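(* Let $(G,\precsim)$ be a C-quasi-ordered group whose associated C-relation $C$ is dense and such that the structure $(G,\cdot,C)$ is C-minimal. Then exactly one of the following three cases (i), (ii), (iii) holds. (i) $\precsim$ comes from a valuation $v:G\to\Gamma\cup\{\infty\}$ (i.e. $g\precsim h\Leftrightarrow v(g)\geq v(h)$). In that case: (1) for any $\gamma\in\Gamma$, $G_{\gamma}$ and $G^{\gamma}$ are normal in $G$; (2) the quotient $G^{\gamma}/G_{\gamma}$ is abelian for all but finitely many $\gamma\in\Gamma$; (3) if $G^{\gamma}/G_{\gamma}$ is infinite, then it is elementary abelian or divisible abelian; if it is divisible, then $G^{\gamma}$ is also abelian; (4) there is a definable abelian subgroup $H$ of $G$ such that $G/H$ has finite exponent. (ii) There exists an o-type element $g\in G$ such that $T_g$ is maximal in the set of type-components of $G$. In that case $G$ is abelian and divisible, $G_g$ is C-minimal and $G^g/G_g$ is o-minimal. (iii) $G$ contains o-type elements different from $1$, but $T_g$ is never maximal in the set of type-components for any o-type $g$. In that case there exists $g\in G$ such that: (1) the final segment $\{h\in G\mid g\precsim h\}$ only contains v-type elements; (2) there is a definable subgroup $H$ of $G$ such that $G/H$ has finite exponent.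
   Context: Quasi-orders. A quasi-order is a reflexive, transitive and total binary relation $\precsim$; $a\sim b$ means $a\precsim b\precsim a$, and $a\precnsim b$ means $a\precsim b$ and $a\nsim b$. For subsets, $S\precsim T$ (resp. $S\precnsim T$) means $s\precsim t$ (resp. $s\precnsim t$) for all $s\in S$, $t\in T$. An element $c$ is between $a$ and $b$ if $a\precsim c\precsim b$ or $b\precsim c\precsim a$. C-relations. A C-relation on a set is a ternary relation $C$ such that for all $x,y,z,w$: $C(x,y,z)\Rightarrow C(x,z,y)$; $C(x,y,z)\Rightarrow\neg C(y,x,z)$; $C(x,y,z)\Rightarrow C(w,y,z)\vee C(x,w,z)$; $x\neq y\Rightarrow C(x,y,y)$. It is dense if in addition $x\neq y\Rightarrow\exists z\,(z\neq y\wedge C(x,y,z))$ and there are at least two elements. On a group it is compatible if $C(x,y,z)$ implies $C(vxu,vyu,vzu)$ for all $x,y,z,u,v$. A C-quasi-order on a group $G$ is a quasi-order of the form $x\precsim y\Leftrightarrow\neg C(x,y,1)$ with $C$ a compatible C-relation; this $C$ is unique, $C(x,y,z)\Leftrightarrow yz^{-1}\precnsim xz^{-1}$, and is the C-relation associated to $\precsim$. A C-quasi-ordered group is a group with a C-quasi-order. A structure $\mathcal M=(M,C,\dots)$ with a C-relation is C-minimal if for every $\mathcal N=(N,C,\dots)\equiv\mathcal M$, every definable subset of $N$ (with parameters) is quantifier-free definable in the language $\{C\}$ (with parameters). The subgroup $G_g$ is considered as a group with the restricted C-relation. "Definable" means definable in $(G,\cdot,C)$. Valuations. With $g^z:=zgz^{-1}$,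 a valuation on a group $G$ is a map $v:G\to\Gamma\cup\{\infty\}$, $\Gamma$ totally ordered and $\gamma<\infty$ for all $\gamma\in\Gamma$, such that $v(g)=\infty\Leftrightarrow g=1$; $v(gh^{-1})\geq\min(v(g),v(h))$; $v(g)\leq v(h)\Leftrightarrow v(g^z)\leq v(h^z)$. Put $G^{\gamma}=\{g\mid v(g)\geq\gamma\}$, $G_{\gamma}=\{g\mid v(g)>\gamma\}$. Types and type-components. $g\in G$ is v-type if $g\sim g^{-1}$; o-type if $g=1$ or $g\nsim g^{-1}$; $o^+$-type if $g^{-1}\precnsim g$; $o^-$-type if $g\precnsim g^{-1}$. For $g\neq1$: if $g$ is v-type, $T_g$ is the set of v-type $h\neq1$ such that there is no $o^+$-type element between $h$ and $g$, and $G_g:=\{h\mid h\precnsim T_g\}$; if $g$ is $o^+$-type, $T_g:=T_g^+\cup T_g^-$, where $T_g^+$ is the set of $o^+$-type $h$ such that every element between $g$ and $h$ is $o^+$-type and $T_g^-:=(T_g^+)^{-1}$, and $G_g:=\{h\mid\{h,h^{-1}\}\precsim g^{-1}\}$; if $g$ is $o^-$-type, $T_g:=T_{g^{-1}}$ and $G_g:=G_{g^{-1}}$. In all cases $G^g:=G_g\cup T_g$. Put $T_1=G_1=G^1=\{1\}$. The sets $T_g$ are the type-components of $G$; they are totally ordered by $T_g\leq T_h\Leftrightarrow(T_g=T_h$ or $T_g\precsim T_h)$. $G_g$ and $G^g$ are subgroups, $G_g$ is normal in $G^g$, and for o-type $g\neq 1$ the quasi-order $fG_g\precsim hG_g\Leftrightarrow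 f\in G_g\vee(h\notin G_g\wedge f\precsim h)$ on $G^g/G_g$ is the C-quasi-order coming from a (unique) group ordering on $G^g/G_g$ via the C-relation $C(x,y,z)\Leftrightarrow(y<x\wedge z<x)\vee(y=z\neq x)$; o-minimality of $G^g/G_g$ refers to this ordered group. *)

theory Defs
  imports "HOL-Algebra.Coset" "HOL-Computational_Algebra.Primes"
begin

section \<open>First-order structures, definability, elementary equivalence\<close>

datatype 'f fo_term = Var nat | Fun 'f "'f fo_term list"

datatype ('f, 'r) fo_formula =
    Eq "'f fo_term" "'f fo_term"
  | Rel 'r "'f fo_term list"
  | Neg "('f, 'r) fo_formula"
  | Conj "('f, 'r) fo_formula" "('f, 'r) fo_formula"
  | Exists nat "('f, 'r) fo_formula"

record ('f, 'r) fo_language =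
  fun_arity :: "'f \<Rightarrow> nat"
  rel_arity :: "'r \<Rightarrow> nat"

record ('u, 'f, 'r) fo_structure =
  universe :: "'u set"
  fun_int :: "'f \<Rightarrow> 'u list \<Rightarrow> 'u"
  rel_int :: "'r \<Rightarrow> 'u list \<Rightarrow> bool"

definition fo_structure_of ::
  "('f, 'r) fo_language \<Rightarrow> ('u, 'f, 'r) fo_structure \<Rightarrow> bool" where
  "fo_structure_of L M \<longleftrightarrow> universe M \<noteq> {} \<and>
     (\<forall>f xs. length xs = fun_arity L f \<and> set xs \<subseteq> universe M
        \<longrightarrow> fun_int M f xs \<in> universe M)"

primrec wf_term :: "('f, 'r) fo_language \<Rightarrow> 'f fo_term \<Rightarrow> bool" where
  "wf_term L (Var n) \<longleftrightarrow> True"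
| "wf_term L (Fun f ts) \<longleftrightarrow> length ts = fun_arity L f \<and> list_all (wf_term L) ts"

primrec wf_formula :: "('f, 'r) fo_language \<Rightarrow> ('f, 'r) fo_formula \<Rightarrow> bool" where
  "wf_formula L (Eq s t) \<longleftrightarrow> wf_term L s \<and> wf_term L t"
| "wf_formula L (Rel r ts) \<longleftrightarrow> length ts = rel_arity L r \<and> list_all (wf_term L) ts"
| "wf_formula L (Neg \<phi>) \<longleftrightarrow> wf_formula L \<phi>"
| "wf_formula L (Conj \<phi> \<psi>) \<longleftrightarrow> wf_formula L \<phi> \<and> wf_formula L \<psi>"
| "wf_formula L (Exists n \<phi>) \<longleftrightarrow> wf_formula L \<phi>"

primrec term_vars :: "'f fo_term \<Rightarrow> nat set" where
  "term_vars (Var n) = {n}"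
| "term_vars (Fun f ts) = \<Union> (set (map term_vars ts))"

primrec free_vars :: "('f, 'r) fo_formula \<Rightarrow> nat set" where
  "free_vars (Eq s t) = term_vars s \<union> term_vars t"
| "free_vars (Rel r ts) = \<Union> (set (map term_vars ts))"
| "free_vars (Neg \<phi>) = free_vars \<phi>"
| "free_vars (Conj \<phi> \<psi>) = free_vars \<phi> \<union> free_vars \<psi>"
| "free_vars (Exists n \<phi>) = free_vars \<phi> - {n}"

primrec term_val :: "('u, 'f, 'r) fo_structure \<Rightarrow> (nat \<Rightarrow> 'u) \<Rightarrow> 'f fo_term \<Rightarrow> 'u" where
  "term_val M e (Var n) = e n"
| "term_val M e (Fun f ts) = fun_int M f (map (term_val M e) ts)"

primrec sat :: "('u, 'f, 'r) fo_structure \<Rightarrow> (nat \<Rightarrow> 'u) \<Rightarrow> ('f, 'r) fo_formula \<Rightarrow> bool" where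
  "sat M e (Eq s t) \<longleftrightarrow> term_val M e s = term_val M e t"
| "sat M e (Rel r ts) \<longleftrightarrow> rel_int M r (map (term_val M e) ts)"
| "sat M e (Neg \<phi>) \<longleftrightarrow> \<not> sat M e \<phi>"
| "sat M e (Conj \<phi> \<psi>) \<longleftrightarrow> sat M e \<phi> \<and> sat M e \<psi>"
| "sat M e (Exists n \<phi>) \<longleftrightarrow> (\<exists>x\<in>universe M. sat M (e(n := x)) \<phi>)"

definition models :: "('u, 'f, 'r) fo_structure \<Rightarrow> ('f, 'r) fo_formula \<Rightarrow> bool" where
  "models M \<phi> \<longleftrightarrow> (\<forall>e. range e \<subseteq> universe M \<longrightarrow> sat M e \<phi>)"

definition elem_equiv ::
  "('f, 'r) fo_language \<Rightarrow> ('u, 'f, 'r) fo_structure \<Rightarrow> ('w, 'f, 'r) fo_structure \<Rightarrow> bool" where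
  "elem_equiv L M N \<longleftrightarrow>
     (\<forall>\<phi>. wf_formula L \<phi> \<and> free_vars \<phi> = {} \<longrightarrow> (models M \<phi> \<longleftrightarrow> models N \<phi>))"

text \<open>The set defined by \<open>\<phi>\<close> in the variable \<open>0\<close>; the assignment \<open>e\<close> supplies the parameters
  for the other free variables.\<close>

definition defined_set ::
  "('u, 'f, 'r) fo_structure \<Rightarrow> (nat \<Rightarrow> 'u) \<Rightarrow> ('f, 'r) fo_formula \<Rightarrow> 'u set" where
  "defined_set M e \<phi> = {x \<in> universe M. sat M (e(0 := x)) \<phi>}"

definition definable_set ::
  "('f, 'r) fo_language \<Rightarrow> ('u, 'f, 'r) fo_structure \<Rightarrow> 'u set \<Rightarrow> bool" where
  "definable_set L M D \<longleftrightarrow>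
     (\<exists>\<phi> e. wf_formula L \<phi> \<and> range e \<subseteq> universe M \<and> D = defined_set M e \<phi>)"

text \<open>Quantifier-free formulas of the language whose only non-logical symbol is the relation
  symbol \<open>c\<close>: all terms are variables.\<close>

primrec qf_formula_in :: "'r \<Rightarrow> ('f, 'r) fo_formula \<Rightarrow> bool" where
  "qf_formula_in c (Eq s t) \<longleftrightarrow> s \<in> range Var \<and> t \<in> range Var"
| "qf_formula_in c (Rel r ts) \<longleftrightarrow> r = c \<and> set ts \<subseteq> range Var"
| "qf_formula_in c (Neg \<phi>) \<longleftrightarrow> qf_formula_in c \<phi>"
| "qf_formula_in c (Conj \<phi> \<psi>) \<longleftrightarrow> qf_formula_in c \<phi> \<and> qf_formula_in c \<psi>"
| "qf_formula_in c (Exists n \<phi>) \<longleftrightarrow> False"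

definition qf_definable_set_in ::
  "'r \<Rightarrow> ('f, 'r) fo_language \<Rightarrow> ('u, 'f, 'r) fo_structure \<Rightarrow> 'u set \<Rightarrow> bool" where
  "qf_definable_set_in c L M D \<longleftrightarrow>
     (\<exists>\<phi> e. wf_formula L \<phi> \<and> qf_formula_in c \<phi> \<and> range e \<subseteq> universe M \<and> D = defined_set M e \<phi>)"


section \<open>C-relations and C-minimality\<close>

definition C_relation_on :: "'a set \<Rightarrow> ('a \<Rightarrow> 'a \<Rightarrow> 'a \<Rightarrow> bool) \<Rightarrow> bool" where
  "C_relation_on A C \<longleftrightarrow>
     (\<forall>x\<in>A. \<forall>y\<in>A. \<forall>z\<in>A. C x y z \<longrightarrow> C x z y) \<and>
     (\<forall>x\<in>A. \<forall>y\<in>A. \<forall>z\<in>A. C x y z \<longrightarrow> \<not> C y x z) \<and>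
     (\<forall>x\<in>A. \<forall>y\<in>A. \<forall>z\<in>A. \<forall>w\<in>A. C x y z \<longrightarrow> C w y z \<or> C x w z) \<and>
     (\<forall>x\<in>A. \<forall>y\<in>A. x \<noteq> y \<longrightarrow> C x y y)"

definition dense_C_relation_on :: "'a set \<Rightarrow> ('a \<Rightarrow> 'a \<Rightarrow> 'a \<Rightarrow> bool) \<Rightarrow> bool" where
  "dense_C_relation_on A C \<longleftrightarrow> C_relation_on A C \<and>
     (\<forall>x\<in>A. \<forall>y\<in>A. x \<noteq> y \<longrightarrow> (\<exists>z\<in>A. z \<noteq> y \<and> C x y z)) \<and>
     (\<exists>x\<in>A. \<exists>y\<in>A. x \<noteq> y)"

text \<open>C-minimality of \<open>M\<close>, where \<open>c\<close> is the symbol for the C-relation. HOL cannot quantify over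
  structures of all types, so the structures \<open>N \<equiv> M\<close> range over those whose universe is a subset
  of the type \<open>'w\<close>, an explicit argument. For a countable language and infinite \<open>'w\<close> this
  is C-minimality in the usual sense: if some \<open>N \<equiv> M\<close> has a definable subset that is not
  quantifier-free definable from \<open>C\<close>, so has every countable elementary substructure of \<open>N\<close>
  containing the parameters of that subset (downward Loewenheim-Skolem), and that substructure has
  an isomorphic copy in \<open>'w\<close>.

  A type carrying a dense C-relation is infinite, so \<open>'w\<close> may be the type of the
  elements of the structure itself when it is a group with dense C-relation.\<close>

definition C_minimal ::
  "'w itself \<Rightarrow> ('f, 'r) fo_language \<Rightarrow> 'r \<Rightarrow> ('u, 'f, 'r) fo_structure \<Rightarrow> bool" where
  "C_minimal W L c M \<longleftrightarrow> fo_structure_of L M \<and> rel_arity L c = 3 \<and>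
     C_relation_on (universe M) (\<lambda>x y z. rel_int M c [x, y, z]) \<and>
     (\<forall>N :: ('w, 'f, 'r) fo_structure. fo_structure_of L N \<and> elem_equiv L N M \<longrightarrow>
        (\<forall>D. definable_set L N D \<longrightarrow> qf_definable_set_in c L N D))"


section \<open>o-minimality\<close>

definition open_intervals_and_points :: "'a set \<Rightarrow> ('a \<Rightarrow> 'a \<Rightarrow> bool) \<Rightarrow> 'a set set" where
  "open_intervals_and_points A lt =
     {A} \<union> {{x \<in> A. lt a x} | a. a \<in> A} \<union> {{x \<in> A. lt x b} | b. b \<in> A}
     \<union> {{x \<in> A. lt a x \<and> lt x b} | a b. a \<in> A \<and> b \<in> A} \<union> {{a} | a. a \<in> A}"

definition strict_total_order :: "'a set \<Rightarrow> ('a \<Rightarrow> 'a \<Rightarrow> bool) \<Rightarrow> bool" where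
  "strict_total_order A lt \<longleftrightarrow> irreflp_on A lt \<and> transp_on A lt \<and> totalp_on A lt"

definition o_minimal ::
  "('f, 'r) fo_language \<Rightarrow> 'r \<Rightarrow> ('u, 'f, 'r) fo_structure \<Rightarrow> bool" where
  "o_minimal L l M \<longleftrightarrow> fo_structure_of L M \<and> rel_arity L l = 2 \<and>
     strict_total_order (universe M) (\<lambda>x y. rel_int M l [x, y]) \<and>
     (\<forall>D. definable_set L M D \<longrightarrow>
        (\<exists>\<I>. finite \<I> \<and>
           \<I> \<subseteq> open_intervals_and_points (universe M) (\<lambda>x y. rel_int M l [x, y]) \<and> D = \<Union>\<I>))"


section \<open>Groups with a C-relation or an ordering as first-order structures\<close>

datatype mult_symbol = Mult
datatype C_symbol = C_sym
datatype less_symbol = Less_sym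

definition C_group_language :: "(mult_symbol, C_symbol) fo_language" where
  "C_group_language = \<lparr>fun_arity = (\<lambda>_. 2), rel_arity = (\<lambda>_. 3)\<rparr>"

definition ordered_group_language :: "(mult_symbol, less_symbol) fo_language" where
  "ordered_group_language = \<lparr>fun_arity = (\<lambda>_. 2), rel_arity = (\<lambda>_. 2)\<rparr>"

definition C_group_structure ::
  "('a, 'm) monoid_scheme \<Rightarrow> ('a \<Rightarrow> 'a \<Rightarrow> 'a \<Rightarrow> bool) \<Rightarrow> ('a, mult_symbol, C_symbol) fo_structure" where
  "C_group_structure G C =
     \<lparr>universe = carrier G,
      fun_int = (\<lambda>_ xs. xs ! 0 \<otimes>\<^bsub>G\<^esub> xs ! 1),
      rel_int = (\<lambda>_ xs. C (xs ! 0) (xs ! 1) (xs ! 2))\<rparr>"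

definition ordered_group_structure ::
  "('a, 'm) monoid_scheme \<Rightarrow> ('a \<Rightarrow> 'a \<Rightarrow> bool) \<Rightarrow> ('a, mult_symbol, less_symbol) fo_structure" where
  "ordered_group_structure G lt =
     \<lparr>universe = carrier G,
      fun_int = (\<lambda>_ xs. xs ! 0 \<otimes>\<^bsub>G\<^esub> xs ! 1),
      rel_int = (\<lambda>_ xs. lt (xs ! 0) (xs ! 1))\<rparr>"

definition C_minimal_group ::
  "'w itself \<Rightarrow> ('a, 'm) monoid_scheme \<Rightarrow> ('a \<Rightarrow> 'a \<Rightarrow> 'a \<Rightarrow> bool) \<Rightarrow> bool" where
  "C_minimal_group W G C \<longleftrightarrow> C_minimal W C_group_language C_sym (C_group_structure G C)"

definition o_minimal_group :: "('a, 'm) monoid_scheme \<Rightarrow> ('a \<Rightarrow> 'a \<Rightarrow> bool) \<Rightarrow> bool" where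
  "o_minimal_group G lt \<longleftrightarrow>
     o_minimal ordered_group_language Less_sym (ordered_group_structure G lt)"

definition definable_in_C_group ::
  "('a, 'm) monoid_scheme \<Rightarrow> ('a \<Rightarrow> 'a \<Rightarrow> 'a \<Rightarrow> bool) \<Rightarrow> 'a set \<Rightarrow> bool" where
  "definable_in_C_group G C D \<longleftrightarrow> definable_set C_group_language (C_group_structure G C) D"


section \<open>C-quasi-ordered groups\<close>

definition quasi_order_on :: "'a set \<Rightarrow> ('a \<Rightarrow> 'a \<Rightarrow> bool) \<Rightarrow> bool" where
  "quasi_order_on A qo \<longleftrightarrow> reflp_on A qo \<and> transp_on A qo \<and> totalp_on A qo"

definition qo_equiv :: "('a \<Rightarrow> 'a \<Rightarrow> bool) \<Rightarrow> 'a \<Rightarrow> 'a \<Rightarrow> bool" where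
  "qo_equiv qo a b \<longleftrightarrow> qo a b \<and> qo b a"

definition qo_less :: "('a \<Rightarrow> 'a \<Rightarrow> bool) \<Rightarrow> 'a \<Rightarrow> 'a \<Rightarrow> bool" where
  "qo_less qo a b \<longleftrightarrow> qo a b \<and> \<not> qo_equiv qo a b"

definition between :: "('a \<Rightarrow> 'a \<Rightarrow> bool) \<Rightarrow> 'a \<Rightarrow> 'a \<Rightarrow> 'a \<Rightarrow> bool" where
  "between qo a b c \<longleftrightarrow> (qo a c \<and> qo c b) \<or> (qo b c \<and> qo c a)"

definition compatible_C_relation ::
  "('a, 'm) monoid_scheme \<Rightarrow> ('a \<Rightarrow> 'a \<Rightarrow> 'a \<Rightarrow> bool) \<Rightarrow> bool" where
  "compatible_C_relation G C \<longleftrightarrow> C_relation_on (carrier G) C \<and>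
     (\<forall>x\<in>carrier G. \<forall>y\<in>carrier G. \<forall>z\<in>carrier G. \<forall>u\<in>carrier G. \<forall>v\<in>carrier G.
        C x y z \<longrightarrow>
        C (v \<otimes>\<^bsub>G\<^esub> x \<otimes>\<^bsub>G\<^esub> u) (v \<otimes>\<^bsub>G\<^esub> y \<otimes>\<^bsub>G\<^esub> u) (v \<otimes>\<^bsub>G\<^esub> z \<otimes>\<^bsub>G\<^esub> u))"

definition associated_C_relation ::
  "('a, 'm) monoid_scheme \<Rightarrow> ('a \<Rightarrow> 'a \<Rightarrow> bool) \<Rightarrow> ('a \<Rightarrow> 'a \<Rightarrow> 'a \<Rightarrow> bool) \<Rightarrow> bool" where
  "associated_C_relation G qo C \<longleftrightarrow> compatible_C_relation G C \<and>
     (\<forall>x\<in>carrier G. \<forall>y\<in>carrier G. qo x y \<longleftrightarrow> \<not> C x y \<one>\<^bsub>G\<^esub>)"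

definition C_quasi_ordered_group ::
  "('a, 'm) monoid_scheme \<Rightarrow> ('a \<Rightarrow> 'a \<Rightarrow> bool) \<Rightarrow> bool" where
  "C_quasi_ordered_group G qo \<longleftrightarrow> group G \<and> quasi_order_on (carrier G) qo \<and>
     (\<exists>C. associated_C_relation G qo C)"


section \<open>Types and type-components\<close>

definition v_type :: "('a, 'm) monoid_scheme \<Rightarrow> ('a \<Rightarrow> 'a \<Rightarrow> bool) \<Rightarrow> 'a \<Rightarrow> bool" where
  "v_type G qo g \<longleftrightarrow> qo_equiv qo g (inv\<^bsub>G\<^esub> g)"

definition o_type :: "('a, 'm) monoid_scheme \<Rightarrow> ('a \<Rightarrow> 'a \<Rightarrow> bool) \<Rightarrow> 'a \<Rightarrow> bool" where
  "o_type G qo g \<longleftrightarrow> g = \<one>\<^bsub>G\<^esub> \<or> \<not> qo_equiv qo g (inv\<^bsub>G\<^esub> g)"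

definition o_plus_type :: "('a, 'm) monoid_scheme \<Rightarrow> ('a \<Rightarrow> 'a \<Rightarrow> bool) \<Rightarrow> 'a \<Rightarrow> bool" where
  "o_plus_type G qo g \<longleftrightarrow> qo_less qo (inv\<^bsub>G\<^esub> g) g"

definition T_plus :: "('a, 'm) monoid_scheme \<Rightarrow> ('a \<Rightarrow> 'a \<Rightarrow> bool) \<Rightarrow> 'a \<Rightarrow> 'a set" where
  "T_plus G qo g = {h \<in> carrier G. o_plus_type G qo h \<and>
     (\<forall>k\<in>carrier G. between qo g h k \<longrightarrow> o_plus_type G qo k)}"

text \<open>In the following two definitions the last branch is the case of an element \<open>g\<close> of
  \<open>o\<^sup>-\<close>-type, where \<open>inv g\<close> is of \<open>o\<^sup>+\<close>-type.\<close>

definition type_component ::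
  "('a, 'm) monoid_scheme \<Rightarrow> ('a \<Rightarrow> 'a \<Rightarrow> bool) \<Rightarrow> 'a \<Rightarrow> 'a set" where
  "type_component G qo g =
     (if g = \<one>\<^bsub>G\<^esub> then {\<one>\<^bsub>G\<^esub>}
      else if v_type G qo g then
        {h \<in> carrier G. h \<noteq> \<one>\<^bsub>G\<^esub> \<and> v_type G qo h \<and>
           \<not> (\<exists>k\<in>carrier G. between qo h g k \<and> o_plus_type G qo k)}
      else if o_plus_type G qo g then
        T_plus G qo g \<union> set_inv\<^bsub>G\<^esub> (T_plus G qo g)
      else
        T_plus G qo (inv\<^bsub>G\<^esub> g) \<union> set_inv\<^bsub>G\<^esub> (T_plus G qo (inv\<^bsub>G\<^esub> g)))"

definition lower_group ::
  "('a, 'm) monoid_scheme \<Rightarrow> ('a \<Rightarrow> 'a \<Rightarrow> bool) \<Rightarrow> 'a \<Rightarrow> 'a set" where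
  "lower_group G qo g =
     (if g = \<one>\<^bsub>G\<^esub> then {\<one>\<^bsub>G\<^esub>}
      else if v_type G qo g then
        {h \<in> carrier G. \<forall>t\<in>type_component G qo g. qo_less qo h t}
      else if o_plus_type G qo g then
        {h \<in> carrier G. qo h (inv\<^bsub>G\<^esub> g) \<and> qo (inv\<^bsub>G\<^esub> h) (inv\<^bsub>G\<^esub> g)}
      else
        {h \<in> carrier G. qo h g \<and> qo (inv\<^bsub>G\<^esub> h) g})"

definition upper_group ::
  "('a, 'm) monoid_scheme \<Rightarrow> ('a \<Rightarrow> 'a \<Rightarrow> bool) \<Rightarrow> 'a \<Rightarrow> 'a set" where
  "upper_group G qo g = lower_group G qo g \<union> type_component G qo g"

definition component_le :: "('a \<Rightarrow> 'a \<Rightarrow> bool) \<Rightarrow> 'a set \<Rightarrow> 'a set \<Rightarrow> bool" where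
  "component_le qo S T \<longleftrightarrow> S = T \<or> (\<forall>s\<in>S. \<forall>t\<in>T. qo s t)"

definition maximal_component ::
  "('a, 'm) monoid_scheme \<Rightarrow> ('a \<Rightarrow> 'a \<Rightarrow> bool) \<Rightarrow> 'a \<Rightarrow> bool" where
  "maximal_component G qo g \<longleftrightarrow>
     (\<forall>T \<in> type_component G qo ` carrier G.
        component_le qo (type_component G qo g) T \<longrightarrow> T = type_component G qo g)"

definition lower_subgroup ::
  "('a, 'm) monoid_scheme \<Rightarrow> ('a \<Rightarrow> 'a \<Rightarrow> bool) \<Rightarrow> 'a \<Rightarrow> ('a, 'm) monoid_scheme" where
  "lower_subgroup G qo g = G\<lparr>carrier := lower_group G qo g\<rparr>"

definition component_quotient ::
  "('a, 'm) monoid_scheme \<Rightarrow> ('a \<Rightarrow> 'a \<Rightarrow> bool) \<Rightarrow> 'a \<Rightarrow> 'a set monoid" where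
  "component_quotient G qo g = (G\<lparr>carrier := upper_group G qo g\<rparr>) Mod (lower_group G qo g)"

definition group_ordering :: "('a, 'm) monoid_scheme \<Rightarrow> ('a \<Rightarrow> 'a \<Rightarrow> bool) \<Rightarrow> bool" where
  "group_ordering G lt \<longleftrightarrow> group G \<and> strict_total_order (carrier G) lt \<and>
     (\<forall>x\<in>carrier G. \<forall>y\<in>carrier G. \<forall>z\<in>carrier G. lt x y \<longrightarrow>
        lt (z \<otimes>\<^bsub>G\<^esub> x) (z \<otimes>\<^bsub>G\<^esub> y) \<and> lt (x \<otimes>\<^bsub>G\<^esub> z) (y \<otimes>\<^bsub>G\<^esub> z))"

definition order_C_relation :: "('a \<Rightarrow> 'a \<Rightarrow> bool) \<Rightarrow> 'a \<Rightarrow> 'a \<Rightarrow> 'a \<Rightarrow> bool" where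
  "order_C_relation lt x y z \<longleftrightarrow> (lt y x \<and> lt z x) \<or> (y = z \<and> z \<noteq> x)"

text \<open>\<open>lt\<close> is the group ordering on \<open>G\<^sup>g/G\<^sub>g\<close> whose C-relation gives the quotient quasi-order.
  The elements of the quotient are written as right cosets, following \<^const>\<open>FactGroup\<close>;
  left and right cosets agree since \<open>G\<^sub>g\<close> is normal in \<open>G\<^sup>g\<close>.\<close>

definition component_ordering ::
  "('a, 'm) monoid_scheme \<Rightarrow> ('a \<Rightarrow> 'a \<Rightarrow> bool) \<Rightarrow> 'a \<Rightarrow> ('a set \<Rightarrow> 'a set \<Rightarrow> bool) \<Rightarrow> bool" where
  "component_ordering G qo g lt \<longleftrightarrow> group_ordering (component_quotient G qo g) lt \<and>
     (\<forall>f\<in>upper_group G qo g. \<forall>h\<in>upper_group G qo g.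
        (f \<in> lower_group G qo g \<or> (h \<notin> lower_group G qo g \<and> qo f h)) \<longleftrightarrow>
        \<not> order_C_relation lt (lower_group G qo g #>\<^bsub>G\<^esub> f) (lower_group G qo g #>\<^bsub>G\<^esub> h)
            \<one>\<^bsub>component_quotient G qo g\<^esub>)"

definition o_minimal_component_quotient ::
  "('a, 'm) monoid_scheme \<Rightarrow> ('a \<Rightarrow> 'a \<Rightarrow> bool) \<Rightarrow> 'a \<Rightarrow> bool" where
  "o_minimal_component_quotient G qo g \<longleftrightarrow>
     (\<exists>lt. component_ordering G qo g lt \<and> o_minimal_group (component_quotient G qo g) lt)"


section \<open>Valuations\<close>

text \<open>The value set \<open>\<Gamma>\<close> is a set totally ordered by \<open>le\<Gamma>\<close>; \<open>\<Gamma> \<union> {\<infinity>}\<close> is encoded in the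
  option type with \<open>\<infinity> = None\<close>, which is the largest element of the order \<open>val_le le\<Gamma>\<close>.\<close>

definition total_order :: "'c set \<Rightarrow> ('c \<Rightarrow> 'c \<Rightarrow> bool) \<Rightarrow> bool" where
  "total_order \<Gamma> le\<Gamma> \<longleftrightarrow>
     reflp_on \<Gamma> le\<Gamma> \<and> antisymp_on \<Gamma> le\<Gamma> \<and> transp_on \<Gamma> le\<Gamma> \<and> totalp_on \<Gamma> le\<Gamma>"

fun val_le :: "('c \<Rightarrow> 'c \<Rightarrow> bool) \<Rightarrow> 'c option \<Rightarrow> 'c option \<Rightarrow> bool" where
  "val_le le\<Gamma> _ None \<longleftrightarrow> True"
| "val_le le\<Gamma> None (Some b) \<longleftrightarrow> False"
| "val_le le\<Gamma> (Some a) (Some b) \<longleftrightarrow> le\<Gamma> a b"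

definition conj_by :: "('a, 'm) monoid_scheme \<Rightarrow> 'a \<Rightarrow> 'a \<Rightarrow> 'a" where
  "conj_by G z g = z \<otimes>\<^bsub>G\<^esub> g \<otimes>\<^bsub>G\<^esub> inv\<^bsub>G\<^esub> z"

definition valuation ::
  "('a, 'm) monoid_scheme \<Rightarrow> 'c set \<Rightarrow> ('c \<Rightarrow> 'c \<Rightarrow> bool) \<Rightarrow> ('a \<Rightarrow> 'c option) \<Rightarrow> bool" where
  "valuation G \<Gamma> le\<Gamma> v \<longleftrightarrow> total_order \<Gamma> le\<Gamma> \<and> v \<in> carrier G \<rightarrow> insert None (Some ` \<Gamma>) \<and>
     (\<forall>g\<in>carrier G. v g = None \<longleftrightarrow> g = \<one>\<^bsub>G\<^esub>) \<and>
     (\<forall>g\<in>carrier G. \<forall>h\<in>carrier G.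
        val_le le\<Gamma> (ord.min (val_le le\<Gamma>) (v g) (v h)) (v (g \<otimes>\<^bsub>G\<^esub> inv\<^bsub>G\<^esub> h))) \<and>
     (\<forall>g\<in>carrier G. \<forall>h\<in>carrier G. \<forall>z\<in>carrier G.
        val_le le\<Gamma> (v g) (v h) \<longleftrightarrow> val_le le\<Gamma> (v (conj_by G z g)) (v (conj_by G z h)))"

definition comes_from ::
  "('a, 'm) monoid_scheme \<Rightarrow> ('a \<Rightarrow> 'a \<Rightarrow> bool) \<Rightarrow>
   'c set \<Rightarrow> ('c \<Rightarrow> 'c \<Rightarrow> bool) \<Rightarrow> ('a \<Rightarrow> 'c option) \<Rightarrow> bool" where
  "comes_from G qo \<Gamma> le\<Gamma> v \<longleftrightarrow> valuation G \<Gamma> le\<Gamma> v \<and>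
     (\<forall>g\<in>carrier G. \<forall>h\<in>carrier G. qo g h \<longleftrightarrow> val_le le\<Gamma> (v h) (v g))"

text \<open>Existence of a valuation inducing \<open>qo\<close>. Taking value sets in \<open>'a set\<close> loses
  nothing: the image of any such valuation, without \<open>\<infinity>\<close>, is order-isomorphic to a set of
  \<open>\<sim>\<close>-classes of \<open>G\<close>.\<close>

definition comes_from_valuation :: "('a, 'm) monoid_scheme \<Rightarrow> ('a \<Rightarrow> 'a \<Rightarrow> bool) \<Rightarrow> bool" where
  "comes_from_valuation G qo \<longleftrightarrow> (\<exists>(\<Gamma> :: 'a set set) le\<Gamma> v. comes_from G qo \<Gamma> le\<Gamma> v)"

definition val_ge_set ::
  "('a, 'm) monoid_scheme \<Rightarrow> ('c \<Rightarrow> 'c \<Rightarrow> bool) \<Rightarrow> ('a \<Rightarrow> 'c option) \<Rightarrow> 'c \<Rightarrow> 'a set" where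
  "val_ge_set G le\<Gamma> v \<gamma> = {g \<in> carrier G. val_le le\<Gamma> (Some \<gamma>) (v g)}"

definition val_gt_set ::
  "('a, 'm) monoid_scheme \<Rightarrow> ('c \<Rightarrow> 'c \<Rightarrow> bool) \<Rightarrow> ('a \<Rightarrow> 'c option) \<Rightarrow> 'c \<Rightarrow> 'a set" where
  "val_gt_set G le\<Gamma> v \<gamma> = {g \<in> carrier G. val_le le\<Gamma> (Some \<gamma>) (v g) \<and> v g \<noteq> Some \<gamma>}"

definition val_quotient ::
  "('a, 'm) monoid_scheme \<Rightarrow> ('c \<Rightarrow> 'c \<Rightarrow> bool) \<Rightarrow> ('a \<Rightarrow> 'c option) \<Rightarrow> 'c \<Rightarrow> 'a set monoid" where
  "val_quotient G le\<Gamma> v \<gamma> =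
     (G\<lparr>carrier := val_ge_set G le\<Gamma> v \<gamma>\<rparr>) Mod (val_gt_set G le\<Gamma> v \<gamma>)"


section \<open>Group-theoretic notions\<close>

definition divisible_group :: "('a, 'm) monoid_scheme \<Rightarrow> bool" where
  "divisible_group G \<longleftrightarrow> group G \<and>
     (\<forall>n::nat. 0 < n \<longrightarrow> (\<forall>x\<in>carrier G. \<exists>y\<in>carrier G. y [^]\<^bsub>G\<^esub> n = x))"

definition elementary_abelian_group :: "('a, 'm) monoid_scheme \<Rightarrow> bool" where
  "elementary_abelian_group G \<longleftrightarrow> comm_group G \<and>
     (\<exists>p::nat. prime p \<and> (\<forall>x\<in>carrier G. x [^]\<^bsub>G\<^esub> p = \<one>\<^bsub>G\<^esub>))"

definition finite_exponent :: "('a, 'm) monoid_scheme \<Rightarrow> bool" where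
  "finite_exponent G \<longleftrightarrow> (\<exists>n::nat. 0 < n \<and> (\<forall>x\<in>carrier G. x [^]\<^bsub>G\<^esub> n = \<one>\<^bsub>G\<^esub>))"


section \<open>The three cases\<close>

definition o_component_maximal :: "('a, 'm) monoid_scheme \<Rightarrow> ('a \<Rightarrow> 'a \<Rightarrow> bool) \<Rightarrow> bool" where
  "o_component_maximal G qo \<longleftrightarrow>
     (\<exists>g\<in>carrier G. o_type G qo g \<and> maximal_component G qo g)"

definition o_component_never_maximal ::
  "('a, 'm) monoid_scheme \<Rightarrow> ('a \<Rightarrow> 'a \<Rightarrow> bool) \<Rightarrow> bool" where
  "o_component_never_maximal G qo \<longleftrightarrow>
     (\<exists>g\<in>carrier G. o_type G qo g \<and> g \<noteq> \<one>\<^bsub>G\<^esub>) \<and>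
     (\<forall>g\<in>carrier G. o_type G qo g \<longrightarrow> \<not> maximal_component G qo g)"

end

theory Submission
  imports Defs "HOL-Library.Countable" "HOL-Library.FuncSet"
begin

text \<open>By compactness, C-minimality bounds the number of parameters uniformly: for every formula there is
  a \<open>k\<close> such that each set it defines is a union of quantifier-free types over at most \<open>k\<close>
  parameters.

  If all elements are of v-type, the quasi-order satisfies the ultrametric inequality. Centralizers
  and sets of powers are then uniformly finite or cofinite in each infinite quotient
  \<open>G\<^sup>\<gamma>/G\<^sub>\<gamma>\<close>, and an argument of Reineke makes these quotients abelian; a chain condition on the
  centralizers of the \<open>G\<^sup>\<gamma>/G\<^sub>\<gamma>\<close> leaves only finitely many nonabelian ones; and a definable subgroup has
  bounded exponent modulo the union of the balls that it contains, which applied to centralizers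
  makes the \<open>m\<close>-th powers commute for a suitable \<open>m\<close>.

  If the component of \<open>g\<close> of \<open>o\<^sup>+\<close>-type is maximal, then \<open>G/G\<^sub>g\<close> is a nontrivial ordered group and
  a definable subgroup that is not contained in \<open>G\<^sub>g\<close> is everything; applied to centralizers and to
  the groups of \<open>n\<close>-th powers, this makes \<open>G\<close> abelian and divisible. Outside of finitely many
  cosets of \<open>G\<^sub>g\<close> the relation \<open>C\<close> is given by the order, hence o-minimality, and parameters outside
  of \<open>G\<^sub>g\<close> can be replaced by elements of \<open>G\<^sub>g\<close>, hence C-minimality. In the remaining case the
  definable set of \<open>o\<^sup>+\<close>-type elements cannot alternate cofinally with its complement.\<close>

section \<open>Compactness\<close>

text \<open>C-minimality is assumed only for structures inside one fixed type, and a full ultrapower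
  may be too large for it; the countable elementary substructure generated by the parameters is used
  instead, with Skolem terms naming its elements. Finiteness of single definable sets would not be
  enough either: the quotients of balls vary with the value, and only a bound \<open>k\<close>
  common to all of them limits the nonabelian ones or yields one exponent for all centralizers. The
  bound is itself expressible by a formula, \<open>fo_determined\<close>; this is why it reaches
  every structure elementarily equivalent to the lower group and gives C-minimality of that group.
  Definability of concrete sets is handled semantically by \<open>Def\<close>, through composition
  rules instead of syntax. A further obstacle lies in the valued case: the axioms make conjugation
  permute the classes of the quasi-order monotonically, while normality of the balls requires that
  every class is fixed. This is extracted from C-minimality in \<open>conj_qo\<close>, before any
  quotient can be formed.\<close>

lemma free_ultrafilter_exists:
  "\<exists>F :: nat filter. F \<noteq> bot \<and> F \<le> sequentially \<and>
     (\<forall>P. eventually P F \<or> eventually (\<lambda>i. \<not> P i) F)"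
proof -
  \<comment> \<open>Requiring finite intersections to be infinite instead of nonempty makes the
    maximal family contain every cofinite set, so the ultrafilter refines
    \<open>sequentially\<close>.\<close>
  define X :: "nat set set set" where "X = {F. \<forall>S. finite S \<and> S \<subseteq> F \<longrightarrow> infinite (\<Inter>S)}"
  have "\<exists>F\<in>X. \<forall>Z\<in>X. F \<subseteq> Z \<longrightarrow> Z = F"
  proof (rule subset_Zorn_nonempty)
    have "{} \<in> X" by (simp add: X_def)
    then show "X \<noteq> {}" by blast
  next
    fix \<C> assume ne: "\<C> \<noteq> {}" and ch: "subset.chain X \<C>"
    show "\<Union>\<C> \<in> X"
      unfolding X_def
    proof (intro CollectI allI impI, elim conjE)
      fix S assume "finite S" "S \<subseteq> \<Union>\<C>"
      then obtain F where "F \<in> \<C>" "S \<subseteq> F"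
        using finite_subset_Union_chain[OF _ _ ne ch] by metis
      then show "infinite (\<Inter>S)"
        using ch \<open>finite S\<close> unfolding subset.chain_def X_def by blast
    qed
  qed
  then obtain F where FX: "F \<in> X" and max: "\<And>Z. Z \<in> X \<Longrightarrow> F \<subseteq> Z \<Longrightarrow> Z = F" by blast
  have inf: "infinite A" if "A \<in> F" for A
    using FX that unfolding X_def by (auto dest: spec[of _ "{A}"])
  have int: "A \<inter> B \<in> F" if "A \<in> F" "B \<in> F" for A B
  proof -
    have "insert (A \<inter> B) F \<in> X"
      unfolding X_def
    proof (intro CollectI allI impI, elim conjE)
      fix S assume S: "finite S" "S \<subseteq> insert (A \<inter> B) F"
      have "finite (insert A (insert B (S - {A \<inter> B}))) \<and> insert A (insert B (S - {A \<inter> B})) \<subseteq> F"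
        using S that by auto
      then have "infinite (\<Inter>(insert A (insert B (S - {A \<inter> B}))))" using FX unfolding X_def by blast
      moreover have "\<Inter>(insert A (insert B (S - {A \<inter> B}))) \<subseteq> \<Inter>S" by auto
      ultimately show "infinite (\<Inter>S)" by (metis finite_subset)
    qed
    then show ?thesis using max by blast
  qed
  \<comment> \<open>If neither \<open>A\<close> nor its complement could be added, finitely many
    members would meet each of the two in a finite set, and so would have a finite intersection
    altogether.\<close>
  have ultra: "A \<in> F \<or> - A \<in> F" for A
  proof (rule ccontr)
    assume neg: "\<not> ?thesis"
    have ext: "\<exists>S. finite S \<and> S \<subseteq> F \<and> finite (B \<inter> \<Inter>S)" if "B \<notin> F" for B
    proof -
      have "insert B F \<notin> X" using max that by blast
      then obtain S where S: "finite S" "S \<subseteq> insert B F" "finite (\<Inter>S)" unfolding X_def by blast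
      have "B \<inter> \<Inter>(S - {B}) \<subseteq> \<Inter>S" by blast
      then show ?thesis using S by (intro exI[of _ "S - {B}"]) (auto intro: finite_subset)
    qed
    obtain S T where S: "finite S" "S \<subseteq> F" "finite (A \<inter> \<Inter>S)"
      and T: "finite T" "T \<subseteq> F" "finite (- A \<inter> \<Inter>T)"
      using ext neg by metis
    have "infinite (\<Inter>(S \<union> T))" using FX S T unfolding X_def by blast
    moreover have "\<Inter>(S \<union> T) \<subseteq> (A \<inter> \<Inter>S) \<union> (- A \<inter> \<Inter>T)" by blast
    ultimately show False using S(3) T(3) by (metis finite_Un finite_subset)
  qed
  have up: "B \<in> F" if "A \<in> F" "A \<subseteq> B" for A B
  proof (rule ccontr)
    assume "B \<notin> F"
    then have "A \<inter> - B \<in> F" using ultra int that by blast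
    then show False using inf that by (metis Diff_eq Diff_eq_empty_iff finite.emptyI)
  qed
  have filt: "is_filter (\<lambda>P. Collect P \<in> F)"
  proof
    show "{x. True} \<in> F" using ultra[of UNIV] inf[of "- UNIV"] by auto
    show "{x. P x \<and> Q x} \<in> F" if "{x. P x} \<in> F" "{x. Q x} \<in> F" for P Q
      using int[OF that] by (simp add: Collect_conj_eq)
    show "{x. Q x} \<in> F" if "\<forall>x. P x \<longrightarrow> Q x" "{x. P x} \<in> F" for P Q
      using up[OF that(2)] that(1) by blast
  qed
  define \<F> where "\<F> = Abs_filter (\<lambda>P. Collect P \<in> F)"
  have ev: "eventually P \<F> \<longleftrightarrow> Collect P \<in> F" for P
    unfolding \<F>_def by (rule eventually_Abs_filter[OF filt])
  have "\<F> \<noteq> bot" using inf by (auto simp: trivial_limit_def ev)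
  moreover have "\<F> \<le> sequentially"
  proof (rule filter_leI)
    fix P :: "nat \<Rightarrow> bool" assume "eventually P sequentially"
    then obtain n where "\<forall>m\<ge>n. P m" by (auto simp: eventually_sequentially)
    then have "- Collect P \<subseteq> {..<n}" by (auto simp: not_le[symmetric])
    then have "- Collect P \<notin> F" using inf finite_subset by blast
    then show "eventually P \<F>" using ultra ev by blast
  qed
  moreover have "eventually P \<F> \<or> eventually (\<lambda>i. \<not> P i) \<F>" for P
    using ultra[of "Collect P"] by (simp add: ev Collect_neg_eq)
  ultimately show ?thesis by blast
qed

lemma term_val_cong:
  "(\<And>n. n \<in> term_vars t \<Longrightarrow> e n = e' n) \<Longrightarrow> term_val M e t = term_val M e' t"
proof (induction t)
  case (Fun f ts)
  then have "map (term_val M e) ts = map (term_val M e') ts" by auto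
  then show ?case by (metis term_val.simps(2))
qed simp

lemma sat_cong:
  "(\<And>n. n \<in> free_vars \<phi> \<Longrightarrow> e n = e' n) \<Longrightarrow> sat M e \<phi> \<longleftrightarrow> sat M e' \<phi>"
proof (induction \<phi> arbitrary: e e')
  case (Eq s t)
  then show ?case using term_val_cong[of s e e' M] term_val_cong[of t e e' M] by simp
next
  case (Rel r ts)
  then have "map (term_val M e) ts = map (term_val M e') ts"
    by (intro map_cong refl term_val_cong) auto
  then show ?case by (metis sat.simps(2))
next
  case (Neg \<phi>)
  have "sat M e \<phi> \<longleftrightarrow> sat M e' \<phi>" by (rule Neg.IH) (simp add: Neg.prems)
  then show ?case by simp
next
  case (Conj \<phi> \<psi>)
  have "sat M e \<phi> \<longleftrightarrow> sat M e' \<phi>" by (rule Conj.IH) (simp add: Conj.prems)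
  moreover have "sat M e \<psi> \<longleftrightarrow> sat M e' \<psi>" by (rule Conj.IH) (simp add: Conj.prems)
  ultimately show ?case by simp
next
  case (Exists n \<phi>)
  have "sat M (e(n := x)) \<phi> \<longleftrightarrow> sat M (e'(n := x)) \<phi>" for x
    using Exists.prems by (intro Exists.IH) auto
  then show ?case by simp
qed

lemma finite_term_vars: "finite (term_vars t)"
  by (induction t) auto

lemma finite_free_vars: "finite (free_vars \<phi>)"
  by (induction \<phi>) (auto simp: finite_term_vars)

section \<open>Skolem terms and their values\<close>

instance fo_term :: (countable) countable by countable_datatype
instance fo_formula :: (countable, countable) countable by countable_datatype

text \<open>Names for the elements of the countable elementary substructure of an ultrapower that is
  generated by a sequence of parameters: \<open>Witness \<phi> n ts\<close> names a witness of \<open>Exists n \<phi>\<close>.\<close>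

datatype ('f, 'r) skolem_term =
    Param nat
  | Witness "('f, 'r) fo_formula" nat "('f, 'r) skolem_term list"

instance skolem_term :: (countable, countable) countable by countable_datatype

definition list_env :: "'u \<Rightarrow> 'u list \<Rightarrow> nat \<Rightarrow> 'u" where
  "list_env d xs n = (if n < length xs then xs ! n else d)"

text \<open>The fallback \<open>e 0\<close> keeps the value in the universe when the formula has no
  solution, so that every name denotes an element in every coordinate.\<close>

definition witness ::
  "('u, 'f, 'r) fo_structure \<Rightarrow> (nat \<Rightarrow> 'u) \<Rightarrow> nat \<Rightarrow> ('f, 'r) fo_formula \<Rightarrow> 'u" where
  "witness M e n \<phi> = (if \<exists>x\<in>universe M. sat M (e(n := x)) \<phi>
     then SOME x. x \<in> universe M \<and> sat M (e(n := x)) \<phi> else e 0)"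

primrec skolem_val ::
  "('u, 'f, 'r) fo_structure \<Rightarrow> (nat \<Rightarrow> 'u) \<Rightarrow> ('f, 'r) skolem_term \<Rightarrow> 'u" where
  "skolem_val M p (Param n) = p n"
| "skolem_val M p (Witness \<phi> n ts) = witness M (list_env (p 0) (map (skolem_val M p) ts)) n \<phi>"

lemma witness_sat:
  assumes "\<exists>x\<in>universe M. sat M (e(n := x)) \<phi>"
  shows "sat M (e(n := witness M e n \<phi>)) \<phi>"
  using someI_ex[of "\<lambda>x. x \<in> universe M \<and> sat M (e(n := x)) \<phi>"] assms
  unfolding witness_def by auto

lemma witness_in_universe:
  assumes "e 0 \<in> universe M"
  shows "witness M e n \<phi> \<in> universe M"
  using someI_ex[of "\<lambda>x. x \<in> universe M \<and> sat M (e(n := x)) \<phi>"] assms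
  unfolding witness_def by auto

lemma skolem_val_in_universe:
  assumes "range p \<subseteq> universe M"
  shows "skolem_val M p t \<in> universe M"
proof (induction t)
  case (Param n)
  then show ?case using assms by auto
next
  case (Witness \<phi> n ts)
  have "list_env (p 0) (map (skolem_val M p) ts) 0 \<in> universe M"
    using Witness assms by (auto simp: list_env_def)
  then show ?case by (simp add: witness_in_universe)
qed

section \<open>The countable ultrapower and the theorem of Los\<close>

locale ultrapower =
  fixes L :: "('f::countable, 'r::countable) fo_language"
    and M :: "('u, 'f, 'r) fo_structure"
    and p :: "nat \<Rightarrow> nat \<Rightarrow> 'u"
    and F :: "nat filter"
    and \<iota> :: "('f, 'r) skolem_term \<Rightarrow> 'w"
  assumes M: "fo_structure_of L M"
    and p: "\<And>i. range (p i) \<subseteq> universe M"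
    and proper: "F \<noteq> bot"
    and ultra: "\<And>P. eventually P F \<or> eventually (\<lambda>i. \<not> P i) F"
    and inj: "inj \<iota>"
begin

abbreviation val :: "nat \<Rightarrow> ('f, 'r) skolem_term \<Rightarrow> 'u" where
  "val i \<equiv> skolem_val M (p i)"

definition eqv :: "('f, 'r) skolem_term \<Rightarrow> ('f, 'r) skolem_term \<Rightarrow> bool" where
  "eqv s t \<longleftrightarrow> eventually (\<lambda>i. val i s = val i t) F"

text \<open>The universe has to lie in the type \<open>'w\<close>, so a class of names is coded by
  the image under \<open>\<iota>\<close> of one chosen member instead of by the class
  itself.\<close>

definition cls :: "('f, 'r) skolem_term \<Rightarrow> 'w" where
  "cls t = \<iota> (SOME s. eqv s t)"

definition rep :: "'w \<Rightarrow> ('f, 'r) skolem_term" where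
  "rep x = (SOME t. cls t = x)"

text \<open>Function values are named without separate function symbols among the names: the
  \<open>Witness\<close> of the formula f(x_0, ..., x_(n-1)) = x_n is its only solution. Relations
  are read off from representatives along \<open>F\<close>.\<close>

definition N :: "('w, 'f, 'r) fo_structure" where
  "N = \<lparr>universe = range cls,
        fun_int = (\<lambda>f xs. cls (Witness (Eq (Fun f (map Var [0..<length xs])) (Var (length xs)))
                                 (length xs) (map rep xs))),
        rel_int = (\<lambda>r xs. eventually (\<lambda>i. rel_int M r (map (\<lambda>x. val i (rep x)) xs)) F)\<rparr>"

lemma eventually_not_iff: "eventually (\<lambda>i. \<not> P i) F \<longleftrightarrow> \<not> eventually P F"
  using ultra[of P] proper eventually_conj[of P F "\<lambda>i. \<not> P i"] by (auto simp: trivial_limit_def)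

lemma eqv_refl: "eqv t t"
  by (simp add: eqv_def)

lemma eqv_sym: "eqv s t \<Longrightarrow> eqv t s"
  by (simp add: eqv_def eq_commute)

lemma eqv_trans:
  assumes "eqv r s" "eqv s t"
  shows "eqv r t"
  using assms unfolding eqv_def by eventually_elim simp

lemma cls_eq_iff: "cls s = cls t \<longleftrightarrow> eqv s t"
proof
  assume "eqv s t"
  then have "(\<lambda>r. eqv r s) = (\<lambda>r. eqv r t)" using eqv_sym eqv_trans by blast
  then show "cls s = cls t" by (simp add: cls_def)
next
  assume "cls s = cls t"
  then have "(SOME r. eqv r s) = (SOME r. eqv r t)" using inj by (simp add: cls_def inj_eq)
  then show "eqv s t" using someI[of "\<lambda>r. eqv r s", OF eqv_refl] someI[of "\<lambda>r. eqv r t", OF eqv_refl]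
      eqv_sym eqv_trans by metis
qed

lemma eqv_rep_cls: "eqv (rep (cls t)) t"
  using someI[of "\<lambda>s. cls s = cls t" t] by (simp add: rep_def cls_eq_iff)

lemma eventually_val_rep: "eventually (\<lambda>i. val i (rep (cls t)) = val i t) F"
  using eqv_rep_cls eqv_def by blast

lemma eventually_map_rep:
  "eventually (\<lambda>i. map (\<lambda>x. val i (rep x)) (map cls ts) = map (val i) ts) F"
  by (induction ts) (auto intro: eventually_conj[OF eventually_val_rep])

lemma val_in_universe: "val i t \<in> universe M"
  using skolem_val_in_universe[OF p] .

lemma fun_int_cls:
  assumes "length ts = fun_arity L f"
  shows "\<exists>t. fun_int N f (map cls ts) = cls t \<and>
    eventually (\<lambda>i. val i t = fun_int M f (map (val i) ts)) F"
proof -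
  let ?n = "length ts"
  let ?t = "Witness (Eq (Fun f (map Var [0..<?n])) (Var ?n)) ?n (map rep (map cls ts))"
  have val_t: "val i ?t = fun_int M f (map (\<lambda>x. val i (rep x)) (map cls ts))" for i
  proof -
    let ?xs = "map (\<lambda>x. val i (rep x)) (map cls ts)"
    let ?e = "list_env (p i 0) ?xs"
    let ?\<phi> = "Eq (Fun f (map Var [0..<?n])) (Var ?n)"
    have "map (term_val M (?e(?n := x))) (map Var [0..<?n]) = ?xs" for x
      by (rule nth_equalityI) (auto simp: list_env_def)
    then have s: "sat M (?e(?n := x)) ?\<phi> \<longleftrightarrow> fun_int M f ?xs = x" for x
      by (simp add: fun_upd_def)
    have "length ?xs = fun_arity L f" "set ?xs \<subseteq> universe M"
      using assms val_in_universe by auto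
    then have "fun_int M f ?xs \<in> universe M"
      using M unfolding fo_structure_of_def by blast
    then have "sat M (?e(?n := witness M ?e ?n ?\<phi>)) ?\<phi>"
      by (intro witness_sat bexI[of _ "fun_int M f ?xs"]) (simp_all only: s)
    then have "witness M ?e ?n ?\<phi> = fun_int M f ?xs" by (simp only: s)
    moreover have "val i ?t = witness M ?e ?n ?\<phi>" by (simp add: comp_def)
    ultimately show ?thesis by simp
  qed
  have "eventually (\<lambda>i. val i ?t = fun_int M f (map (val i) ts)) F"
    using eventually_map_rep[of ts]
  proof eventually_elim
    case (elim i)
    show ?case unfolding val_t elim ..
  qed
  moreover have "fun_int N f (map cls ts) = cls ?t" by (simp add: N_def)
  ultimately show ?thesis by blast
qed

lemma structure_N: "fo_structure_of L N"
proof -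
  have "fun_int N f xs \<in> universe N" if "length xs = fun_arity L f" "set xs \<subseteq> universe N" for f xs
    by (simp add: N_def)
  then show ?thesis by (auto simp: fo_structure_of_def N_def)
qed

lemma term_val_cls:
  "wf_term L \<tau> \<Longrightarrow> \<exists>t. term_val N (cls \<circ> E) \<tau> = cls t \<and>
     eventually (\<lambda>i. val i t = term_val M (\<lambda>n. val i (E n)) \<tau>) F"
proof (induction \<tau>)
  case (Var n)
  then show ?case by (auto intro!: exI[of _ "E n"])
next
  case (Fun f \<tau>s)
  have "\<exists>t. term_val N (cls \<circ> E) \<tau> = cls t \<and>
     eventually (\<lambda>i. val i t = term_val M (\<lambda>n. val i (E n)) \<tau>) F" if "\<tau> \<in> set \<tau>s" for \<tau>
    using Fun.prems that by (intro Fun.IH) (auto simp: list_all_iff)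
  then have "\<forall>\<tau>\<in>set \<tau>s. \<exists>t. term_val N (cls \<circ> E) \<tau> = cls t \<and>
     eventually (\<lambda>i. val i t = term_val M (\<lambda>n. val i (E n)) \<tau>) F" by blast
  from bchoice[OF this] obtain T where T:
    "\<And>\<tau>. \<tau> \<in> set \<tau>s \<Longrightarrow> term_val N (cls \<circ> E) \<tau> = cls (T \<tau>)"
    "\<And>\<tau>. \<tau> \<in> set \<tau>s \<Longrightarrow> eventually (\<lambda>i. val i (T \<tau>) = term_val M (\<lambda>n. val i (E n)) \<tau>) F"
    by blast
  have "length (map T \<tau>s) = fun_arity L f" using Fun by simp
  from fun_int_cls[OF this] obtain t where t: "fun_int N f (map cls (map T \<tau>s)) = cls t"
    "eventually (\<lambda>i. val i t = fun_int M f (map (val i) (map T \<tau>s))) F" by blast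
  have "map cls (map T \<tau>s) = map (term_val N (cls \<circ> E)) \<tau>s" using T by simp
  then have 1: "term_val N (cls \<circ> E) (Fun f \<tau>s) = cls t" using t(1) by (metis term_val.simps(2))
  have "eventually (\<lambda>i. \<forall>\<tau>\<in>set \<tau>s. val i (T \<tau>) = term_val M (\<lambda>n. val i (E n)) \<tau>) F"
    using T(2) by (simp add: eventually_ball_finite)
  then have "eventually (\<lambda>i. map (val i) (map T \<tau>s) = map (term_val M (\<lambda>n. val i (E n))) \<tau>s) F"
    by eventually_elim simp
  then have "eventually (\<lambda>i. val i t = term_val M (\<lambda>n. val i (E n)) (Fun f \<tau>s)) F"
    using t(2) by eventually_elim (metis term_val.simps(2))
  then show ?case using 1 by blast
qed

text \<open>Only the existential quantifier needs an idea: one Skolem term chooses a witness in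
  every coordinate at once, so existence in almost all coordinates already gives an element of
  \<open>N\<close>.\<close>

lemma Los:
  "wf_formula L \<phi> \<Longrightarrow>
     sat N (cls \<circ> E) \<phi> \<longleftrightarrow> eventually (\<lambda>i. sat M (\<lambda>n. val i (E n)) \<phi>) F"
proof (induction \<phi> arbitrary: E)
  case (Eq \<sigma> \<tau>)
  obtain s t where s: "term_val N (cls \<circ> E) \<sigma> = cls s"
    "eventually (\<lambda>i. val i s = term_val M (\<lambda>n. val i (E n)) \<sigma>) F"
    and t: "term_val N (cls \<circ> E) \<tau> = cls t"
    "eventually (\<lambda>i. val i t = term_val M (\<lambda>n. val i (E n)) \<tau>) F"
    using Eq term_val_cls[of \<sigma> E] term_val_cls[of \<tau> E] by auto
  have "eventually (\<lambda>i. (val i s = val i t) = sat M (\<lambda>n. val i (E n)) (Eq \<sigma> \<tau>)) F"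
    using s(2) t(2) by eventually_elim simp
  then show ?case using s(1) t(1) eventually_subst
    by (simp add: cls_eq_iff eqv_def del: comp_apply)
next
  case (Rel r \<tau>s)
  have "\<exists>t. term_val N (cls \<circ> E) \<tau> = cls t \<and>
     eventually (\<lambda>i. val i t = term_val M (\<lambda>n. val i (E n)) \<tau>) F" if "\<tau> \<in> set \<tau>s" for \<tau>
    using Rel that by (intro term_val_cls) (auto simp: list_all_iff)
  then have "\<forall>\<tau>\<in>set \<tau>s. \<exists>t. term_val N (cls \<circ> E) \<tau> = cls t \<and>
     eventually (\<lambda>i. val i t = term_val M (\<lambda>n. val i (E n)) \<tau>) F" by blast
  from bchoice[OF this] obtain T where T:
    "\<And>\<tau>. \<tau> \<in> set \<tau>s \<Longrightarrow> term_val N (cls \<circ> E) \<tau> = cls (T \<tau>)"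
    "\<And>\<tau>. \<tau> \<in> set \<tau>s \<Longrightarrow> eventually (\<lambda>i. val i (T \<tau>) = term_val M (\<lambda>n. val i (E n)) \<tau>) F"
    by blast
  have "eventually (\<lambda>i. \<forall>\<tau>\<in>set \<tau>s. val i (T \<tau>) = term_val M (\<lambda>n. val i (E n)) \<tau>) F"
    using T(2) by (simp add: eventually_ball_finite)
  then have "eventually (\<lambda>i. map (\<lambda>x. val i (rep x)) (map cls (map T \<tau>s))
      = map (term_val M (\<lambda>n. val i (E n))) \<tau>s) F"
    using eventually_map_rep[of "map T \<tau>s"] by eventually_elim simp
  moreover have "map cls (map T \<tau>s) = map (term_val N (cls \<circ> E)) \<tau>s" using T by simp
  ultimately have "eventually (\<lambda>i. map (\<lambda>x. val i (rep x)) (map (term_val N (cls \<circ> E)) \<tau>s)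
      = map (term_val M (\<lambda>n. val i (E n))) \<tau>s) F" by simp
  then have E1: "eventually (\<lambda>i. rel_int M r (map (\<lambda>x. val i (rep x)) (map (term_val N (cls \<circ> E)) \<tau>s))
      = sat M (\<lambda>n. val i (E n)) (Rel r \<tau>s)) F" by eventually_elim (metis sat.simps(2))
  have "sat N (cls \<circ> E) (Rel r \<tau>s) \<longleftrightarrow>
      eventually (\<lambda>i. rel_int M r (map (\<lambda>x. val i (rep x)) (map (term_val N (cls \<circ> E)) \<tau>s))) F"
    by (simp add: N_def)
  then show ?case using eventually_subst[OF E1] by (rule trans)
next
  case (Neg \<phi>)
  then show ?case by (simp add: eventually_not_iff)
next
  case (Conj \<phi> \<psi>)
  then show ?case by (simp add: eventually_conj_iff)
next
  case (Exists n \<phi>)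
  have upd: "(cls \<circ> E)(n := cls t) = cls \<circ> E(n := t)"
    "(\<lambda>k. val i ((E(n := t)) k)) = (\<lambda>k. val i (E k))(n := val i t)" for t i
    by (auto simp: fun_eq_iff)
  have "sat N (cls \<circ> E) (Exists n \<phi>) \<longleftrightarrow> (\<exists>t. sat N (cls \<circ> E(n := t)) \<phi>)"
    by (simp add: upd[symmetric] N_def)
  also have "\<dots> \<longleftrightarrow> (\<exists>t. eventually (\<lambda>i. sat M ((\<lambda>k. val i (E k))(n := val i t)) \<phi>) F)"
    using Exists.IH[of "E(n := t)" for t] Exists.prems by (simp only: upd wf_formula.simps)
  also have "\<dots> \<longleftrightarrow> eventually (\<lambda>i. sat M (\<lambda>k. val i (E k)) (Exists n \<phi>)) F"
  proof
    assume "\<exists>t. eventually (\<lambda>i. sat M ((\<lambda>k. val i (E k))(n := val i t)) \<phi>) F"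
    then show "eventually (\<lambda>i. sat M (\<lambda>k. val i (E k)) (Exists n \<phi>)) F"
      using val_in_universe by (auto elim!: eventually_mono)
  next
    assume ev: "eventually (\<lambda>i. sat M (\<lambda>k. val i (E k)) (Exists n \<phi>)) F"
    define m where "m = Suc (Max (insert 0 (free_vars \<phi>)))"
    have m: "k < m" if "k \<in> free_vars \<phi>" for k
      using that finite_free_vars[of \<phi>] by (simp add: m_def less_Suc_eq_le)
    \<comment> \<open>\<open>m\<close> exceeds every free variable of \<open>\<phi>\<close>, so
      neither the truncated list of arguments nor the default value of \<open>list_env\<close>
      affects satisfaction.\<close>
    define t where "t = Witness \<phi> n (map E [0..<m])"
    have "sat M ((\<lambda>k. val i (E k))(n := val i t)) \<phi>"
      if ex: "sat M (\<lambda>k. val i (E k)) (Exists n \<phi>)" for i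
    proof -
      let ?e = "list_env (p i 0) (map (val i) (map E [0..<m]))"
      have c: "sat M ((\<lambda>k. val i (E k))(n := x)) \<phi> \<longleftrightarrow> sat M (?e(n := x)) \<phi>" for x
        using m by (intro sat_cong) (auto simp: list_env_def)
      have "\<exists>x\<in>universe M. sat M (?e(n := x)) \<phi>" using ex by (simp add: c)
      then have "sat M (?e(n := witness M ?e n \<phi>)) \<phi>" by (rule witness_sat)
      then show ?thesis unfolding t_def c by simp
    qed
    then show "\<exists>t. eventually (\<lambda>i. sat M ((\<lambda>k. val i (E k))(n := val i t)) \<phi>) F"
      by (intro exI[of _ t] eventually_mono[OF ev])
  qed
  finally show ?case .
qed

lemma elem_equiv_N: "elem_equiv L N M"
  unfolding elem_equiv_def
proof (intro allI impI, elim conjE)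
  fix \<phi> assume wf: "wf_formula L \<phi>" and cl: "free_vars \<phi> = {}"
  have M': "sat M e \<phi> \<longleftrightarrow> sat M e' \<phi>" for e e' by (rule sat_cong) (simp add: cl)
  have N': "sat N e \<phi> \<longleftrightarrow> sat N e' \<phi>" for e e' by (rule sat_cong) (simp add: cl)
  have "range (cls \<circ> Param) \<subseteq> universe N" by (auto simp: N_def)
  then have "models N \<phi> \<longleftrightarrow> sat N (cls \<circ> Param) \<phi>" using N' unfolding models_def by blast
  also have "\<dots> \<longleftrightarrow> eventually (\<lambda>i. sat M (p 0) \<phi>) F"
  proof -
    have "sat M (\<lambda>n. val i (Param n)) \<phi> \<longleftrightarrow> sat M (p 0) \<phi>" for i by (rule M')
    then show ?thesis by (simp only: Los[OF wf])
  qed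
  also have "\<dots> \<longleftrightarrow> sat M (p 0) \<phi>" using proper by (simp add: eventually_const)
  also have "\<dots> \<longleftrightarrow> models M \<phi>" using M' p unfolding models_def by blast
  finally show "models N \<phi> \<longleftrightarrow> models M \<phi>" .
qed

end

section \<open>Sets determined by finitely many parameters\<close>

text \<open>Index \<open>k\<close> is the placeholder for the varying element: \<open>x\<close> and \<open>y\<close> have the same
  quantifier-free \<open>R\<close>-type over the parameters \<open>b 0, \<dots>, b (k - 1)\<close>.\<close>

definition same_type ::
  "('u list \<Rightarrow> bool) \<Rightarrow> nat \<Rightarrow> (nat \<Rightarrow> 'u) \<Rightarrow> 'u \<Rightarrow> 'u \<Rightarrow> bool" where
  "same_type R k b x y \<longleftrightarrow>
     (\<forall>i\<le>k. \<forall>j\<le>k. \<forall>l\<le>k. R [(b(k := x)) i, (b(k := x)) j, (b(k := x)) l]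
        \<longleftrightarrow> R [(b(k := y)) i, (b(k := y)) j, (b(k := y)) l]) \<and>
     (\<forall>i\<le>k. \<forall>j\<le>k. (b(k := x)) i = (b(k := x)) j \<longleftrightarrow> (b(k := y)) i = (b(k := y)) j)"

definition determined ::
  "'u set \<Rightarrow> ('u list \<Rightarrow> bool) \<Rightarrow> nat \<Rightarrow> 'u set \<Rightarrow> bool" where
  "determined U R k D \<longleftrightarrow> (\<exists>b. (\<forall>i<k. b i \<in> U) \<and>
     (\<forall>x\<in>U. \<forall>y\<in>U. same_type R k b x y \<longrightarrow> (x \<in> D \<longleftrightarrow> y \<in> D)))"

lemma same_type_reindex:
  assumes "same_type R k b x y" and "\<And>i. i < m \<Longrightarrow> f i < k \<and> c i = b (f i)"
  shows "same_type R m c x y"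
proof -
  \<comment> \<open>Placeholder goes to placeholder: index \<open>m\<close> of the tuple
    \<open>c\<close> corresponds to index \<open>k\<close> of \<open>b\<close>, and all other
    indices are translated by \<open>f\<close>.\<close>
  define g where "g i = (if i < m then f i else k)" for i
  have g: "g i \<le> k" "(c(m := z)) i = (b(k := z)) (g i)" if "i \<le> m" for i z
    using assms(2)[of i] that by (cases "i = m"; simp add: g_def less_imp_le)+
  show ?thesis
    using assms(1) unfolding same_type_def
    by (auto simp only: g)
qed

lemma determined_mono:
  assumes "determined U R k D" "k \<le> m" "U \<noteq> {}"
  shows "determined U R m D"
proof -
  obtain b u where b: "\<forall>i<k. b i \<in> U"
    "\<And>x y. x \<in> U \<Longrightarrow> y \<in> U \<Longrightarrow> same_type R k b x y \<Longrightarrow> x \<in> D \<longleftrightarrow> y \<in> D" and u: "u \<in> U"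
    using assms unfolding determined_def by blast
  define c where "c i = (if i < k then b i else u)" for i
  have "same_type R k b x y" if "same_type R m c x y" for x y
    using that by (rule same_type_reindex[where f = id]) (use assms(2) in \<open>auto simp: c_def\<close>)
  then show ?thesis unfolding determined_def using b u
    by (intro exI[of _ c]) (auto simp: c_def)
qed

section \<open>Determination by k parameters as a formula\<close>

definition fo_True :: "('f, 'r) fo_formula" where
  "fo_True = Eq (Var 0) (Var 0)"

abbreviation fo_Or :: "('f, 'r) fo_formula \<Rightarrow> ('f, 'r) fo_formula \<Rightarrow> ('f, 'r) fo_formula" where
  "fo_Or \<phi> \<psi> \<equiv> Neg (Conj (Neg \<phi>) (Neg \<psi>))"

definition fo_Iff :: "('f, 'r) fo_formula \<Rightarrow> ('f, 'r) fo_formula \<Rightarrow> ('f, 'r) fo_formula" where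
  "fo_Iff \<phi> \<psi> = fo_Or (Conj \<phi> \<psi>) (Conj (Neg \<phi>) (Neg \<psi>))"

definition fo_Conj_list :: "('f, 'r) fo_formula list \<Rightarrow> ('f, 'r) fo_formula" where
  "fo_Conj_list \<phi>s = foldr Conj \<phi>s fo_True"

primrec fo_Exists_from :: "nat \<Rightarrow> nat \<Rightarrow> ('f, 'r) fo_formula \<Rightarrow> ('f, 'r) fo_formula" where
  "fo_Exists_from m 0 \<phi> = \<phi>"
| "fo_Exists_from m (Suc k) \<phi> = fo_Exists_from m k (Exists (m + k) \<phi>)"

lemma sat_fo_Iff: "sat M e (fo_Iff \<phi> \<psi>) \<longleftrightarrow> (sat M e \<phi> \<longleftrightarrow> sat M e \<psi>)"
  by (auto simp: fo_Iff_def)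

lemma wf_fo_Iff: "wf_formula L (fo_Iff \<phi> \<psi>) \<longleftrightarrow> wf_formula L \<phi> \<and> wf_formula L \<psi>"
  by (auto simp: fo_Iff_def)

lemma sat_fo_Conj_list: "sat M e (fo_Conj_list \<phi>s) \<longleftrightarrow> (\<forall>\<phi>\<in>set \<phi>s. sat M e \<phi>)"
  by (induction \<phi>s) (auto simp: fo_Conj_list_def fo_True_def)

lemma wf_fo_Conj_list: "wf_formula L (fo_Conj_list \<phi>s) \<longleftrightarrow> (\<forall>\<phi>\<in>set \<phi>s. wf_formula L \<phi>)"
  by (induction \<phi>s) (auto simp: fo_Conj_list_def fo_True_def)

lemma sat_fo_Exists_from:
  "sat M e (fo_Exists_from m k \<phi>) \<longleftrightarrow> (\<exists>b. (\<forall>i<k. b i \<in> universe M) \<and>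
     sat M (\<lambda>n. if m \<le> n \<and> n < m + k then b (n - m) else e n) \<phi>)"
proof (induction k arbitrary: \<phi>)
  case 0
  have "(\<lambda>n. if m \<le> n \<and> n < m + 0 then b (n - m) else e n) = e" for b
    by (auto simp: fun_eq_iff)
  then show ?case by simp
next
  case (Suc k)
  let ?E = "\<lambda>b k n. if m \<le> n \<and> n < m + k then b (n - m) else e n"
  have E: "(?E b k)(m + k := x) = ?E (b(k := x)) (Suc k)" for b x
    by (auto simp: fun_eq_iff)
  have "sat M e (fo_Exists_from m (Suc k) \<phi>) \<longleftrightarrow>
    (\<exists>b. (\<forall>i<k. b i \<in> universe M) \<and> (\<exists>x\<in>universe M. sat M (?E (b(k := x)) (Suc k)) \<phi>))"
    using Suc[of "Exists (m + k) \<phi>"] by (simp only: fo_Exists_from.simps sat.simps E)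
  also have "\<dots> \<longleftrightarrow> (\<exists>b. (\<forall>i<Suc k. b i \<in> universe M) \<and> sat M (?E b (Suc k)) \<phi>)"
  proof
    assume "\<exists>b. (\<forall>i<k. b i \<in> universe M) \<and> (\<exists>x\<in>universe M. sat M (?E (b(k := x)) (Suc k)) \<phi>)"
    then obtain b x where "\<forall>i<k. b i \<in> universe M" "x \<in> universe M"
      "sat M (?E (b(k := x)) (Suc k)) \<phi>" by blast
    then show "\<exists>b. (\<forall>i<Suc k. b i \<in> universe M) \<and> sat M (?E b (Suc k)) \<phi>"
      by (intro exI[of _ "b(k := x)"]) (simp add: less_Suc_eq)
  next
    assume "\<exists>b. (\<forall>i<Suc k. b i \<in> universe M) \<and> sat M (?E b (Suc k)) \<phi>"
    then obtain b where "\<forall>i<Suc k. b i \<in> universe M" "sat M (?E b (Suc k)) \<phi>" by blast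
    then show "\<exists>b. (\<forall>i<k. b i \<in> universe M) \<and> (\<exists>x\<in>universe M. sat M (?E (b(k := x)) (Suc k)) \<phi>)"
      by (intro exI[of _ b] conjI bexI[of _ "b k"]) (auto simp only: fun_upd_triv less_Suc_eq)
  qed
  finally show ?case .
qed

lemma wf_fo_Exists_from: "wf_formula L (fo_Exists_from m k \<phi>) \<longleftrightarrow> wf_formula L \<phi>"
  by (induction k arbitrary: \<phi>) auto

definition fresh_var :: "('f, 'r) fo_formula \<Rightarrow> nat" where
  "fresh_var \<phi> = Suc (Max (insert 0 (free_vars \<phi>)))"

lemma less_fresh_var: "n \<in> free_vars \<phi> \<Longrightarrow> n < fresh_var \<phi>"
  by (simp add: fresh_var_def less_Suc_eq_le finite_free_vars)

lemma fresh_var_pos: "0 < fresh_var \<phi>"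
  by (simp add: fresh_var_def)

text \<open>Replaces variable 0 by \<open>v\<close> without a substitution operation on formulas.
  The bound variable 0 must differ from \<open>v\<close>, which holds for the variables from
  \<open>fresh_var\<close> on.\<close>

definition fo_at :: "nat \<Rightarrow> ('f, 'r) fo_formula \<Rightarrow> ('f, 'r) fo_formula" where
  "fo_at v \<phi> = Exists 0 (Conj (Eq (Var 0) (Var v)) \<phi>)"

text \<open>The parameters are the variables \<open>m, \<dots>, m + k - 1\<close>, the two elements that are compared are
  the variables \<open>m + k\<close> and \<open>m + k + 1\<close>.\<close>

definition fo_same_type :: "'r \<Rightarrow> nat \<Rightarrow> nat \<Rightarrow> ('f, 'r) fo_formula" where
  "fo_same_type c m k = (let s = (\<lambda>v. if v = m + k then Suc (m + k) else v); V = [m..<Suc (m + k)] in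
     Conj (fo_Conj_list [fo_Iff (Rel c [Var u, Var v, Var w]) (Rel c [Var (s u), Var (s v), Var (s w)]).
             u \<leftarrow> V, v \<leftarrow> V, w \<leftarrow> V])
          (fo_Conj_list [fo_Iff (Eq (Var u) (Var v)) (Eq (Var (s u)) (Var (s v))). u \<leftarrow> V, v \<leftarrow> V]))"

text \<open>For each fixed \<open>k\<close>, being determined by \<open>k\<close> parameters is a
  first-order property of the parameters of \<open>\<phi>\<close>. In this form it passes through
  the theorem of Los and through elementary equivalence.\<close>

definition fo_determined :: "'r \<Rightarrow> nat \<Rightarrow> ('f, 'r) fo_formula \<Rightarrow> ('f, 'r) fo_formula" where
  "fo_determined c k \<phi> = (let m = fresh_var \<phi> in
     fo_Exists_from m k (Neg (Exists (m + k) (Exists (Suc (m + k))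
       (Conj (fo_same_type c m k) (Neg (fo_Iff (fo_at (m + k) \<phi>) (fo_at (Suc (m + k)) \<phi>))))))))"

lemma wf_fo_same_type: "rel_arity L c = 3 \<Longrightarrow> wf_formula L (fo_same_type c m k)"
  by (auto simp: fo_same_type_def wf_fo_Conj_list wf_fo_Iff Let_def)

lemma wf_fo_determined:
  "rel_arity L c = 3 \<Longrightarrow> wf_formula L \<phi> \<Longrightarrow> wf_formula L (fo_determined c k \<phi>)"
  by (simp add: fo_determined_def Let_def wf_fo_Exists_from wf_fo_same_type wf_fo_Iff fo_at_def)

lemma ball_upt_shift: "(\<forall>v\<in>set [m..<Suc (m + k)]. P v) \<longleftrightarrow> (\<forall>i\<le>k. P (m + i))"
proof -
  have "set [m..<Suc (m + k)] = (+) m ` {..k}"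
    by (simp add: image_add_atLeastAtMost atMost_atLeast0 atLeastLessThanSuc_atLeastAtMost
        del: upt_Suc)
  then show ?thesis by (auto simp del: upt_Suc)
qed

lemma sat_fo_same_type:
  assumes e: "\<And>i. i < k \<Longrightarrow> e (m + i) = b i"
  shows "sat M e (fo_same_type c m k) \<longleftrightarrow>
    same_type (rel_int M c) k b (e (m + k)) (e (Suc (m + k)))"
proof -
  let ?s = "\<lambda>v. if v = m + k then Suc (m + k) else v"
  define x where "x = e (m + k)"
  define y where "y = e (Suc (m + k))"
  have x: "e (m + i) = (b(k := x)) i" if "i \<le> k" for i using e that by (auto simp: x_def)
  have y: "e (?s (m + i)) = (b(k := y)) i" if "i \<le> k" for i using e that by (auto simp: y_def)
  have ball3: "(\<forall>\<phi>\<in>set [f u v w. u \<leftarrow> V, v \<leftarrow> V, w \<leftarrow> V]. P \<phi>) \<longleftrightarrow>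
    (\<forall>u\<in>set V. \<forall>v\<in>set V. \<forall>w\<in>set V. P (f u v w))" for f :: "nat \<Rightarrow> nat \<Rightarrow> nat \<Rightarrow> 'z" and V P
    by simp
  have ball2: "(\<forall>\<phi>\<in>set [f u v. u \<leftarrow> V, v \<leftarrow> V]. P \<phi>) \<longleftrightarrow> (\<forall>u\<in>set V. \<forall>v\<in>set V. P (f u v))"
    for f :: "nat \<Rightarrow> nat \<Rightarrow> 'z" and V P
    by simp
  have "sat M e (fo_same_type c m k) \<longleftrightarrow>
    (\<forall>i\<le>k. \<forall>j\<le>k. \<forall>l\<le>k. rel_int M c [e (m + i), e (m + j), e (m + l)] \<longleftrightarrow>
       rel_int M c [e (?s (m + i)), e (?s (m + j)), e (?s (m + l))]) \<and>
    (\<forall>i\<le>k. \<forall>j\<le>k. e (m + i) = e (m + j) \<longleftrightarrow> e (?s (m + i)) = e (?s (m + j)))"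
    unfolding fo_same_type_def Let_def sat.simps sat_fo_Conj_list ball3 ball2 sat_fo_Iff
      ball_upt_shift term_val.simps list.map
    by (rule refl)
  also have "\<dots> \<longleftrightarrow> same_type (rel_int M c) k b x y"
    unfolding same_type_def by (simp only: x y cong: imp_cong)
  finally show ?thesis by (simp only: x_def y_def)
qed

lemma sat_fo_determined:
  assumes "range e \<subseteq> universe M"
  shows "sat M e (fo_determined c k \<phi>) \<longleftrightarrow>
    determined (universe M) (rel_int M c) k (defined_set M e \<phi>)"
proof -
  define m where "m = fresh_var \<phi>"
  define E where "E b n = (if m \<le> n \<and> n < m + k then b (n - m) else e n)" for b n
  have m0: "0 < m" using fresh_var_pos by (simp add: m_def)
  have at: "sat M ((E b)(m + k := x, Suc (m + k) := y)) (fo_at (m + k) \<phi>) \<longleftrightarrow> x \<in> defined_set M e \<phi>"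
    "sat M ((E b)(m + k := x, Suc (m + k) := y)) (fo_at (Suc (m + k)) \<phi>) \<longleftrightarrow> y \<in> defined_set M e \<phi>"
    if "x \<in> universe M" "y \<in> universe M" for b x y
  proof -
    have *: "sat M (((E b)(m + k := x, Suc (m + k) := y))(0 := z)) \<phi> \<longleftrightarrow> sat M (e(0 := z)) \<phi>" for z
      by (intro sat_cong) (auto simp: E_def m_def dest: less_fresh_var)
    show "sat M ((E b)(m + k := x, Suc (m + k) := y)) (fo_at (m + k) \<phi>) \<longleftrightarrow> x \<in> defined_set M e \<phi>"
      "sat M ((E b)(m + k := x, Suc (m + k) := y)) (fo_at (Suc (m + k)) \<phi>) \<longleftrightarrow> y \<in> defined_set M e \<phi>"
      using that m0 * by (auto simp: fo_at_def defined_set_def)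
  qed
  have st: "sat M ((E b)(m + k := x, Suc (m + k) := y)) (fo_same_type c m k) \<longleftrightarrow>
    same_type (rel_int M c) k b x y" for b x y
    by (subst sat_fo_same_type[where b = b]) (auto simp: E_def)
  have "sat M e (fo_determined c k \<phi>) \<longleftrightarrow> (\<exists>b. (\<forall>i<k. b i \<in> universe M) \<and>
     (\<forall>x\<in>universe M. \<forall>y\<in>universe M. same_type (rel_int M c) k b x y \<longrightarrow>
        (x \<in> defined_set M e \<phi> \<longleftrightarrow> y \<in> defined_set M e \<phi>)))"
    unfolding fo_determined_def Let_def sat_fo_Exists_from m_def[symmetric] E_def[symmetric]
    by (simp add: st at sat_fo_Iff)
  then show ?thesis by (simp add: determined_def)
qed

section \<open>Quantifier-free definable sets and determined sets\<close>

lemma qf_definable_imp_determined: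
  assumes "rel_arity L c = 3" "qf_definable_set_in c L M D"
  shows "\<exists>k. determined (universe M) (rel_int M c) k D"
proof -
  obtain \<psi> e where \<psi>: "wf_formula L \<psi>" "qf_formula_in c \<psi>" and e: "range e \<subseteq> universe M"
    and D: "D = defined_set M e \<psi>" using assms unfolding qf_definable_set_in_def by blast
  define k where "k = fresh_var \<psi>"
  have "sat M (e(0 := x)) \<chi> \<longleftrightarrow> sat M (e(0 := y)) \<chi>"
    if st: "same_type (rel_int M c) k e x y"
      and "wf_formula L \<chi>" "qf_formula_in c \<chi>" "free_vars \<chi> \<subseteq> {..<k}" for x y \<chi>
    using that(2-)
  proof (induction \<chi>)
    case (Eq s t)
    then obtain i j where ij: "s = Var i" "t = Var j" "i < k" "j < k" by auto
    \<comment> \<open>The varying element sits at variable 0 in the formula and at index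
      \<open>k\<close> in \<open>same_type\<close>; the other variables keep their index as
      parameters.\<close>
    define i' where "i' = (if i = 0 then k else i)"
    define j' where "j' = (if j = 0 then k else j)"
    have "i' \<le> k" "j' \<le> k" using ij by (auto simp: i'_def j'_def)
    then have "(e(k := x)) i' = (e(k := x)) j' \<longleftrightarrow> (e(k := y)) i' = (e(k := y)) j'"
      using st unfolding same_type_def by blast
    moreover have "(e(k := z)) i' = (e(0 := z)) i" "(e(k := z)) j' = (e(0 := z)) j" for z
      using ij by (auto simp: i'_def j'_def)
    ultimately show ?case using ij by simp
  next
    case (Rel r ts)
    then have "length ts = 3" using assms by simp
    then obtain t1 t2 t3 where ts: "ts = [t1, t2, t3]"
      by (auto simp: numeral_3_eq_3 length_Suc_conv)
    then obtain i j l where ij: "t1 = Var i" "t2 = Var j" "t3 = Var l" "i < k" "j < k" "l < k"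
      using Rel by auto
    define i' where "i' = (if i = 0 then k else i)"
    define j' where "j' = (if j = 0 then k else j)"
    define l' where "l' = (if l = 0 then k else l)"
    have "i' \<le> k" "j' \<le> k" "l' \<le> k" using ij by (auto simp: i'_def j'_def l'_def)
    then have "rel_int M c [(e(k := x)) i', (e(k := x)) j', (e(k := x)) l'] \<longleftrightarrow>
       rel_int M c [(e(k := y)) i', (e(k := y)) j', (e(k := y)) l']"
      using st unfolding same_type_def by blast
    moreover have "(e(k := z)) i' = (e(0 := z)) i" "(e(k := z)) j' = (e(0 := z)) j"
      "(e(k := z)) l' = (e(0 := z)) l" for z
      using ij by (auto simp: i'_def j'_def l'_def)
    ultimately show ?case using ij ts Rel by (simp del: fun_upd_apply)
  qed auto
  moreover have "free_vars \<psi> \<subseteq> {..<k}" by (auto simp: k_def less_fresh_var)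
  ultimately have "\<forall>x\<in>universe M. \<forall>y\<in>universe M. same_type (rel_int M c) k e x y \<longrightarrow> (x \<in> D \<longleftrightarrow> y \<in> D)"
    using \<psi> unfolding D defined_set_def by blast
  then show ?thesis using e unfolding determined_def by blast
qed

text \<open>Induction over the list: the set is split by the truth value of the head, and each half,
  once saturated, is handled by the remaining formulas.\<close>

lemma definable_from_atoms:
  assumes "\<And>\<phi>. \<phi> \<in> set \<phi>s \<Longrightarrow> wf_formula L \<phi> \<and> qf_formula_in c \<phi>"
    and "D \<subseteq> universe M"
    and "\<And>x y. x \<in> D \<Longrightarrow> y \<in> universe M \<Longrightarrow>
      (\<And>\<phi>. \<phi> \<in> set \<phi>s \<Longrightarrow> sat M (e(0 := x)) \<phi> \<longleftrightarrow> sat M (e(0 := y)) \<phi>) \<Longrightarrow> y \<in> D"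
  shows "\<exists>\<psi>. wf_formula L \<psi> \<and> qf_formula_in c \<psi> \<and> D = defined_set M e \<psi>"
  using assms
proof (induction \<phi>s arbitrary: D)
  case Nil
  show ?case
  proof (cases "D = {}")
    case True
    then show ?thesis by (intro exI[of _ "Neg fo_True"]) (auto simp: fo_True_def defined_set_def)
  next
    case False
    then have "D = universe M" using Nil by auto
    then show ?thesis by (intro exI[of _ fo_True]) (auto simp: fo_True_def defined_set_def)
  qed
next
  case (Cons \<phi> \<phi>s)
  let ?s = "\<lambda>x \<psi>. sat M (e(0 := x)) \<psi>"
  \<comment> \<open>The part of \<open>D\<close> on which \<open>\<phi>\<close> has truth value
    \<open>t\<close>, saturated with respect to the remaining formulas; restricting to that truth
    value again gives the part back.\<close>
  define D' where "D' t = {x \<in> universe M. \<exists>y\<in>D. (?s y \<phi> \<longleftrightarrow> t) \<and> (\<forall>\<psi>\<in>set \<phi>s. ?s y \<psi> \<longleftrightarrow> ?s x \<psi>)}" for t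
  have "\<exists>\<psi>. wf_formula L \<psi> \<and> qf_formula_in c \<psi> \<and> D' t = defined_set M e \<psi>" for t
  proof (rule Cons.IH)
    show "wf_formula L \<psi> \<and> qf_formula_in c \<psi>" if "\<psi> \<in> set \<phi>s" for \<psi> using Cons.prems(1) that by simp
    show "D' t \<subseteq> universe M" by (auto simp: D'_def)
    show "y \<in> D' t" if "x \<in> D' t" "y \<in> universe M" "\<And>\<psi>. \<psi> \<in> set \<phi>s \<Longrightarrow> ?s x \<psi> \<longleftrightarrow> ?s y \<psi>" for x y
      using that unfolding D'_def by blast
  qed
  then obtain \<psi> where \<psi>: "\<And>t. wf_formula L (\<psi> t) \<and> qf_formula_in c (\<psi> t) \<and> D' t = defined_set M e (\<psi> t)"
    by metis
  have "D = {x \<in> universe M. (?s x \<phi> \<and> x \<in> D' True) \<or> (\<not> ?s x \<phi> \<and> x \<in> D' False)}"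
  proof (rule equalityI; rule subsetI)
    fix x assume "x \<in> D"
    then show "x \<in> {x \<in> universe M. (?s x \<phi> \<and> x \<in> D' True) \<or> (\<not> ?s x \<phi> \<and> x \<in> D' False)}"
      using Cons.prems(2) unfolding D'_def by blast
  next
    fix x assume x: "x \<in> {x \<in> universe M. (?s x \<phi> \<and> x \<in> D' True) \<or> (\<not> ?s x \<phi> \<and> x \<in> D' False)}"
    then have "x \<in> D' (?s x \<phi>)" by (cases "?s x \<phi>") auto
    then obtain y where y: "y \<in> D" "?s y \<phi> \<longleftrightarrow> ?s x \<phi>" "\<forall>\<psi>\<in>set \<phi>s. ?s y \<psi> \<longleftrightarrow> ?s x \<psi>"
      unfolding D'_def by blast
    show "x \<in> D"
    proof (rule Cons.prems(3)[OF y(1)])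
      show "x \<in> universe M" using x by blast
      show "?s y \<chi> \<longleftrightarrow> ?s x \<chi>" if "\<chi> \<in> set (\<phi> # \<phi>s)" for \<chi>
        using that y by (cases "\<chi> = \<phi>") simp_all
    qed
  qed
  also have "\<dots> = defined_set M e (fo_Or (Conj \<phi> (\<psi> True)) (Conj (Neg \<phi>) (\<psi> False)))"
    using \<psi> by (auto simp: defined_set_def)
  finally show ?case using \<psi> Cons.prems(1)
    by (intro exI[of _ "fo_Or (Conj \<phi> (\<psi> True)) (Conj (Neg \<phi>) (\<psi> False))"]) simp
qed

lemma determined_imp_qf_definable:
  fixes L :: "('f, 'r) fo_language" and M :: "('u, 'f, 'r) fo_structure"
  assumes "rel_arity L c = 3" "universe M \<noteq> {}" "D \<subseteq> universe M"
    and "determined (universe M) (rel_int M c) k D"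
  shows "qf_definable_set_in c L M D"
proof -
  obtain b u where b: "\<forall>i<k. b i \<in> universe M" and u: "u \<in> universe M"
    and D: "\<And>x y. x \<in> universe M \<Longrightarrow> y \<in> universe M \<Longrightarrow> same_type (rel_int M c) k b x y \<Longrightarrow> x \<in> D \<longleftrightarrow> y \<in> D"
    using assms unfolding determined_def by blast
  \<comment> \<open>The parameters move to the variables 1, ..., k because
    \<open>defined_set\<close> reserves variable 0; beyond them any element of the universe
    serves.\<close>
  define e where "e n = (if 0 < n \<and> n \<le> k then b (n - 1) else u)" for n
  define v where "v i = (if i = k then 0 else Suc i)" for i
  have v: "(e(0 := x)) (v i) = (b(k := x)) i" if "i \<le> k" for i x
    using that by (auto simp: v_def e_def)
  define At :: "('f, 'r) fo_formula list" where
    "At = map (\<lambda>(i, j, l). Rel c [Var (v i), Var (v j), Var (v l)])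
        (List.product [0..<Suc k] (List.product [0..<Suc k] [0..<Suc k]))
      @ map (\<lambda>(i, j). Eq (Var (v i)) (Var (v j))) (List.product [0..<Suc k] [0..<Suc k])"
  have At1: "Rel c [Var (v i), Var (v j), Var (v l)] \<in> set At" if "i \<le> k" "j \<le> k" "l \<le> k" for i j l
    using that unfolding At_def set_append set_map
    by (intro UnI1 image_eqI[of _ _ "(i, j, l)"]) (simp_all del: upt_Suc)
  have At2: "Eq (Var (v i)) (Var (v j)) \<in> set At" if "i \<le> k" "j \<le> k" for i j
    using that unfolding At_def set_append set_map
    by (intro UnI2 image_eqI[of _ _ "(i, j)"]) (simp_all del: upt_Suc)
  have "\<exists>\<psi>. wf_formula L \<psi> \<and> qf_formula_in c \<psi> \<and> D = defined_set M e \<psi>"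
  proof (rule definable_from_atoms)
    show "wf_formula L \<phi> \<and> qf_formula_in c \<phi>" if "\<phi> \<in> set At" for \<phi>
      using that assms(1) by (auto simp: At_def)
    show "D \<subseteq> universe M" by fact
    fix x y
    assume x: "x \<in> D" and y: "y \<in> universe M"
      and eq: "\<And>\<phi>. \<phi> \<in> set At \<Longrightarrow> sat M (e(0 := x)) \<phi> \<longleftrightarrow> sat M (e(0 := y)) \<phi>"
    have "same_type (rel_int M c) k b x y"
      unfolding same_type_def
    proof (intro conjI allI impI)
      fix i j l assume "i \<le> k" "j \<le> k" "l \<le> k"
      then show "rel_int M c [(b(k := x)) i, (b(k := x)) j, (b(k := x)) l] \<longleftrightarrow>
          rel_int M c [(b(k := y)) i, (b(k := y)) j, (b(k := y)) l]"
        using eq[OF At1] by (simp add: v del: fun_upd_apply)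
    next
      fix i j assume "i \<le> k" "j \<le> k"
      then show "(b(k := x)) i = (b(k := x)) j \<longleftrightarrow> (b(k := y)) i = (b(k := y)) j"
        using eq[OF At2] by (simp add: v del: fun_upd_apply)
    qed
    then show "y \<in> D" using D x y assms(3) by blast
  qed
  moreover have "range e \<subseteq> universe M" using b u by (auto simp: e_def)
  ultimately show ?thesis unfolding qf_definable_set_in_def by blast
qed

text \<open>A sequence of counterexamples for \<open>k = 0, 1, \<dots>\<close> would give an element of an ultrapower whose
  definable set is not determined by any finite number of parameters.\<close>

theorem uniformly_determined:
  fixes L :: "('f::countable, 'r::countable) fo_language" and M :: "('u, 'f, 'r) fo_structure"
  assumes Cm: "C_minimal TYPE('w) L c M" and inf: "infinite (UNIV :: 'w set)"
    and wf: "wf_formula L \<phi>"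
  shows "\<exists>k. \<forall>e. range e \<subseteq> universe M \<longrightarrow>
    determined (universe M) (rel_int M c) k (defined_set M e \<phi>)"
proof (rule ccontr)
  assume "\<not> ?thesis"
  then have "\<forall>k. \<exists>e. range e \<subseteq> universe M \<and> \<not> determined (universe M) (rel_int M c) k (defined_set M e \<phi>)"
    by blast
  then obtain p where range_p: "\<And>k. range (p k) \<subseteq> universe M"
    and not_det: "\<And>k. \<not> determined (universe M) (rel_int M c) k (defined_set M (p k) \<phi>)" by metis
  have M: "fo_structure_of L M" and c: "rel_arity L c = 3"
    using Cm by (auto simp: C_minimal_def)
  have ne: "universe M \<noteq> {}" using M by (simp add: fo_structure_of_def)
  obtain F :: "nat filter" where F: "F \<noteq> bot" "F \<le> sequentially"
    "\<And>P. eventually P F \<or> eventually (\<lambda>i. \<not> P i) F" using free_ultrafilter_exists by blast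
  obtain h :: "nat \<Rightarrow> 'w" where "inj h" using inf infinite_countable_subset by blast
  then have "inj (h \<circ> (to_nat :: ('f, 'r) skolem_term \<Rightarrow> nat))" by (simp add: inj_compose)
  then interpret ultrapower L M p F "h \<circ> to_nat"
    by (rule ultrapower.intro[OF M range_p F(1) F(3)])
  define e where "e = cls \<circ> Param"
  have e: "range e \<subseteq> universe N" by (auto simp: e_def N_def)
  \<comment> \<open>The \<open>i\<close>-th assignment fails for \<open>i\<close> parameters, hence
    for every \<open>k\<close> up to \<open>i\<close>. A fixed \<open>k\<close> therefore fails in
    almost all coordinates, and \<open>N\<close> inherits the failure.\<close>
  have "\<not> determined (universe N) (rel_int N c) k (defined_set N e \<phi>)" for k
  proof -
    have "eventually (\<lambda>i. \<not> sat M (p i) (fo_determined c k \<phi>)) F"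
    proof (rule eventually_mono)
      show "eventually (\<lambda>i. k \<le> i) F" using F(2) eventually_ge_at_top filter_leD by blast
      show "\<not> sat M (p i) (fo_determined c k \<phi>)" if "k \<le> i" for i
        using not_det[of i] determined_mono[OF _ that ne] sat_fo_determined[OF range_p] by blast
    qed
    then have "\<not> sat N e (fo_determined c k \<phi>)"
      using Los[OF wf_fo_determined[OF c wf], of Param k] by (simp add: e_def eventually_not_iff)
    then show ?thesis using e by (simp add: sat_fo_determined)
  qed
  moreover have "qf_definable_set_in c L N (defined_set N e \<phi>)"
    using Cm structure_N elem_equiv_N wf e unfolding C_minimal_def definable_set_def by blast
  ultimately show False using qf_definable_imp_determined[OF c] by blast
qed

section \<open>C-quasi-ordered groups\<close>

instance mult_symbol :: countable by countable_datatype
instance C_symbol :: countable by countable_datatype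

lemma (in group) inv_mult_cancel [simp]:
  "x \<in> carrier G \<Longrightarrow> y \<in> carrier G \<Longrightarrow> inv x \<otimes> (x \<otimes> y) = y"
  by (simp add: m_assoc[symmetric])

lemma (in group) mult_inv_cancel [simp]:
  "x \<in> carrier G \<Longrightarrow> y \<in> carrier G \<Longrightarrow> x \<otimes> (inv x \<otimes> y) = y"
  by (simp add: m_assoc[symmetric])

section \<open>Calculus of a compatible C-relation\<close>

locale C_quasi_order = group G for G (structure) +
  fixes qo :: "'a \<Rightarrow> 'a \<Rightarrow> bool" and C :: "'a \<Rightarrow> 'a \<Rightarrow> 'a \<Rightarrow> bool"
  assumes quasi_order: "quasi_order_on (carrier G) qo"
    and associated: "associated_C_relation G qo C"
begin

abbreviation lt :: "'a \<Rightarrow> 'a \<Rightarrow> bool" where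
  "lt x y \<equiv> \<not> qo y x"

abbreviation sim :: "'a \<Rightarrow> 'a \<Rightarrow> bool" where
  "sim x y \<equiv> qo x y \<and> qo y x"

lemma qo_refl [simp]: "x \<in> carrier G \<Longrightarrow> qo x x"
  using quasi_order by (auto simp: quasi_order_on_def reflp_on_def)

lemma qo_trans: "qo x y \<Longrightarrow> qo y z \<Longrightarrow> x \<in> carrier G \<Longrightarrow> y \<in> carrier G \<Longrightarrow> z \<in> carrier G \<Longrightarrow> qo x z"
  using quasi_order unfolding quasi_order_on_def by (blast dest: transp_onD)

lemma qo_total: "x \<in> carrier G \<Longrightarrow> y \<in> carrier G \<Longrightarrow> qo x y \<or> qo y x"
  using quasi_order by (cases "x = y") (auto simp: quasi_order_on_def totalp_on_def reflp_on_def)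

lemma qo_less_iff: "x \<in> carrier G \<Longrightarrow> y \<in> carrier G \<Longrightarrow> qo_less qo x y \<longleftrightarrow> lt x y"
  using qo_total by (auto simp: qo_less_def qo_equiv_def)

lemma lt_trans: "lt x y \<Longrightarrow> lt y z \<Longrightarrow> x \<in> carrier G \<Longrightarrow> y \<in> carrier G \<Longrightarrow> z \<in> carrier G \<Longrightarrow> lt x z"
  using qo_total qo_trans by blast

lemma lt_qo_trans: "lt x y \<Longrightarrow> qo y z \<Longrightarrow> x \<in> carrier G \<Longrightarrow> y \<in> carrier G \<Longrightarrow> z \<in> carrier G \<Longrightarrow> lt x z"
  using qo_trans by blast

lemma qo_lt_trans: "qo x y \<Longrightarrow> lt y z \<Longrightarrow> x \<in> carrier G \<Longrightarrow> y \<in> carrier G \<Longrightarrow> z \<in> carrier G \<Longrightarrow> lt x z"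
  using qo_trans by blast

lemma lt_imp_qo: "lt x y \<Longrightarrow> x \<in> carrier G \<Longrightarrow> y \<in> carrier G \<Longrightarrow> qo x y"
  using qo_total by blast

lemma C_rel: "C_relation_on (carrier G) C"
  using associated by (simp add: associated_C_relation_def compatible_C_relation_def)

lemma C_sym: "x \<in> carrier G \<Longrightarrow> y \<in> carrier G \<Longrightarrow> z \<in> carrier G \<Longrightarrow> C x y z \<longleftrightarrow> C x z y"
  using C_rel unfolding C_relation_on_def by blast

lemma C_asym: "C x y z \<Longrightarrow> x \<in> carrier G \<Longrightarrow> y \<in> carrier G \<Longrightarrow> z \<in> carrier G \<Longrightarrow> \<not> C y x z"
  using C_rel unfolding C_relation_on_def by blast

lemma C_third: "C x y z \<Longrightarrow> x \<in> carrier G \<Longrightarrow> y \<in> carrier G \<Longrightarrow> z \<in> carrier G \<Longrightarrow> w \<in> carrier G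
    \<Longrightarrow> C w y z \<or> C x w z"
  using C_rel unfolding C_relation_on_def by blast

lemma C_same: "x \<in> carrier G \<Longrightarrow> y \<in> carrier G \<Longrightarrow> C x y y \<longleftrightarrow> x \<noteq> y"
  using C_rel unfolding C_relation_on_def by metis

text \<open>\<open>C x y z\<close> says that \<open>y\<close> and \<open>z\<close> branch off from
  \<open>x\<close> together; for fixed \<open>x\<close> this is an equivalence relation on the other
  points.\<close>

lemma C_trans:
  assumes "C x y z" "C x z w" "x \<in> carrier G" "y \<in> carrier G" "z \<in> carrier G" "w \<in> carrier G"
  shows "C x y w"
  using C_third[of x y z w] C_third[of x z y w] C_third[of x z w y] C_sym C_asym assms by metis

lemma C_mult:
  "C x y z \<Longrightarrow> x \<in> carrier G \<Longrightarrow> y \<in> carrier G \<Longrightarrow> z \<in> carrier G \<Longrightarrow> u \<in> carrier G \<Longrightarrow> v \<in> carrier G \<Longrightarrow>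
    C (v \<otimes> x \<otimes> u) (v \<otimes> y \<otimes> u) (v \<otimes> z \<otimes> u)"
  using associated unfolding associated_C_relation_def compatible_C_relation_def by blast

lemma C_right:
  assumes "C x y z" "x \<in> carrier G" "y \<in> carrier G" "z \<in> carrier G" "u \<in> carrier G"
  shows "C (x \<otimes> u) (y \<otimes> u) (z \<otimes> u)"
  using C_mult[of x y z u \<one>] assms by simp

lemma C_left:
  assumes "C x y z" "x \<in> carrier G" "y \<in> carrier G" "z \<in> carrier G" "u \<in> carrier G"
  shows "C (u \<otimes> x) (u \<otimes> y) (u \<otimes> z)"
  using C_mult[of x y z \<one> u] assms by simp

lemma lt_iff_C: "x \<in> carrier G \<Longrightarrow> y \<in> carrier G \<Longrightarrow> lt x y \<longleftrightarrow> C y x \<one>"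
  using associated by (auto simp: associated_C_relation_def)

lemma C_iff:
  assumes "x \<in> carrier G" "y \<in> carrier G" "z \<in> carrier G"
  shows "C x y z \<longleftrightarrow> lt (y \<otimes> inv z) (x \<otimes> inv z)"
proof
  assume "C x y z"
  from C_right[OF this assms inv_closed[OF assms(3)]]
  show "lt (y \<otimes> inv z) (x \<otimes> inv z)" using assms by (simp add: lt_iff_C)
next
  assume "lt (y \<otimes> inv z) (x \<otimes> inv z)"
  then have "C (x \<otimes> inv z) (y \<otimes> inv z) \<one>" using assms by (simp add: lt_iff_C)
  from C_right[OF this _ _ _ assms(3)] show "C x y z" using assms by (simp add: m_assoc)
qed

lemma C_iff_left:
  assumes "x \<in> carrier G" "y \<in> carrier G" "z \<in> carrier G"
  shows "C x y z \<longleftrightarrow> lt (inv z \<otimes> y) (inv z \<otimes> x)"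
proof
  assume "C x y z"
  from C_left[OF this assms inv_closed[OF assms(3)]]
  show "lt (inv z \<otimes> y) (inv z \<otimes> x)" using assms by (simp add: lt_iff_C)
next
  assume "lt (inv z \<otimes> y) (inv z \<otimes> x)"
  then have "C (inv z \<otimes> x) (inv z \<otimes> y) \<one>" using assms by (simp add: lt_iff_C)
  from C_left[OF this _ _ _ assms(3)] show "C x y z" using assms by simp
qed

lemma one_least [simp]: "x \<in> carrier G \<Longrightarrow> qo \<one> x"
  using lt_iff_C[of x \<one>] C_asym C_sym by blast

lemma one_lt_iff: "x \<in> carrier G \<Longrightarrow> lt \<one> x \<longleftrightarrow> x \<noteq> \<one>"
  by (simp add: lt_iff_C C_same)

lemma qo_one_iff: "x \<in> carrier G \<Longrightarrow> qo x \<one> \<longleftrightarrow> x = \<one>"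
  using one_lt_iff by blast

text \<open>\<open>lt x y\<close> is \<open>C y x \<one>\<close>, which is symmetric in
  \<open>x\<close> and \<open>\<one>\<close>; translating \<open>x\<close> to \<open>\<one>\<close>
  exchanges their roles. This is the source of the inequalities between products below.\<close>

lemma lt_shift:
  assumes "lt x y" "x \<in> carrier G" "y \<in> carrier G"
  shows "lt (inv x) (y \<otimes> inv x)" "lt (inv x) (inv x \<otimes> y)"
proof -
  have "C y \<one> x" using assms by (simp add: lt_iff_C C_sym)
  then show "lt (inv x) (y \<otimes> inv x)" "lt (inv x) (inv x \<otimes> y)"
    using assms C_iff[of y \<one> x] C_iff_left[of y \<one> x] by simp_all
qed

lemma lt_imp_C_one:
  assumes "lt x y" "x \<in> carrier G" "y \<in> carrier G"
  shows "C \<one> (x \<otimes> inv y) (inv y)" "C \<one> (inv y \<otimes> x) (inv y)"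
proof -
  have "C y x \<one>" using assms by (simp add: lt_iff_C)
  from C_right[OF this, of "inv y"] C_left[OF this, of "inv y"]
  show "C \<one> (x \<otimes> inv y) (inv y)" "C \<one> (inv y \<otimes> x) (inv y)" using assms by simp_all
qed

lemma qo_conj:
  assumes "x \<in> carrier G" "y \<in> carrier G" "z \<in> carrier G"
  shows "qo (z \<otimes> x \<otimes> inv z) (z \<otimes> y \<otimes> inv z) \<longleftrightarrow> qo x y"
proof -
  have "lt (z \<otimes> y \<otimes> inv z) (z \<otimes> x \<otimes> inv z)" if "lt y x" "x \<in> carrier G" "y \<in> carrier G" "z \<in> carrier G" for x y z
    using C_mult[of x y \<one> "inv z" z] that by (simp add: lt_iff_C)
  from this[of x y z] this[of "z \<otimes> x \<otimes> inv z" "z \<otimes> y \<otimes> inv z" "inv z"] assms show ?thesis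
    by (auto simp: m_assoc)
qed

subsection \<open>Uniformly definable families\<close>

abbreviation M :: "('a, mult_symbol, C_symbol) fo_structure" where
  "M \<equiv> C_group_structure G C"

text \<open>\<open>Def P\<close>: the relation \<open>P\<close> on finitely many of the entries of its argument is definable
  without parameters. \<open>Def_fun t\<close>: \<open>t\<close> is a definable function of finitely many entries.\<close>

definition Def :: "((nat \<Rightarrow> 'a) \<Rightarrow> bool) \<Rightarrow> bool" where
  "Def P \<longleftrightarrow> (\<exists>m. \<forall>n\<ge>m. \<forall>e x. P (e(n := x)) = P e) \<and>
     (\<exists>\<phi>. wf_formula C_group_language \<phi> \<and> (\<forall>e. range e \<subseteq> carrier G \<longrightarrow> (sat M e \<phi> \<longleftrightarrow> P e)))"

definition Def_fun :: "((nat \<Rightarrow> 'a) \<Rightarrow> 'a) \<Rightarrow> bool" where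
  "Def_fun t \<longleftrightarrow> (\<exists>m. \<forall>n\<ge>m. \<forall>e x. t (e(n := x)) = t e) \<and>
     (\<forall>e. range e \<subseteq> carrier G \<longrightarrow> t e \<in> carrier G) \<and>
     (\<exists>m. \<forall>n\<ge>m. Def (\<lambda>e. e n = t e))"

lemma universe_M [simp]: "universe M = carrier G"
  by (simp add: C_group_structure_def)

lemma DefI:
  assumes "\<And>e n x. n \<ge> m \<Longrightarrow> P (e(n := x)) = P e"
    and "wf_formula C_group_language \<phi>"
    and "\<And>e. range e \<subseteq> carrier G \<Longrightarrow> sat M e \<phi> \<longleftrightarrow> P e"
  shows "Def P"
  using assms unfolding Def_def by blast

lemma DefE:
  assumes "Def P"
  obtains m \<phi> where "\<And>n e x. n \<ge> m \<Longrightarrow> P (e(n := x)) = P e" "wf_formula C_group_language \<phi>"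
    "\<And>e. range e \<subseteq> carrier G \<Longrightarrow> sat M e \<phi> \<longleftrightarrow> P e"
  using assms unfolding Def_def by blast

lemma Def_fresh: "Def P \<Longrightarrow> \<exists>m. \<forall>n\<ge>m. \<forall>e x. P (e(n := x)) = P e"
  by (simp add: Def_def)

lemma Def_funI:
  assumes "\<And>e n x. n \<ge> m \<Longrightarrow> t (e(n := x)) = t e"
    and "\<And>e. range e \<subseteq> carrier G \<Longrightarrow> t e \<in> carrier G"
    and "\<And>n. n \<ge> m' \<Longrightarrow> Def (\<lambda>e. e n = t e)"
  shows "Def_fun t"
  using assms unfolding Def_fun_def by blast

lemma Def_fun_fresh: "Def_fun t \<Longrightarrow> \<exists>m. \<forall>n\<ge>m. (\<forall>e x. t (e(n := x)) = t e) \<and> Def (\<lambda>e. e n = t e)"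
proof -
  assume "Def_fun t"
  then obtain m m' where "\<forall>n\<ge>m. \<forall>e x. t (e(n := x)) = t e" "\<forall>n\<ge>m'. Def (\<lambda>e. e n = t e)"
    unfolding Def_fun_def by blast
  then show ?thesis by (intro exI[of _ "max m m'"]) auto
qed

lemma Def_fun_closed: "Def_fun t \<Longrightarrow> range e \<subseteq> carrier G \<Longrightarrow> t e \<in> carrier G"
  by (simp add: Def_fun_def)

lemma Def_fun_depends: "Def_fun t \<Longrightarrow> \<exists>m. \<forall>n\<ge>m. \<forall>e x. t (e(n := x)) = t e"
  by (simp add: Def_fun_def)

lemma Def_cong:
  assumes "Def P" "\<exists>m. \<forall>n\<ge>m. \<forall>e x. Q (e(n := x)) = Q e"
    and "\<And>e. range e \<subseteq> carrier G \<Longrightarrow> P e \<longleftrightarrow> Q e"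
  shows "Def Q"
  using assms unfolding Def_def by simp

lemma Def_not: "Def P \<Longrightarrow> Def (\<lambda>e. \<not> P e)"
proof -
  assume P: "Def P"
  obtain m \<phi> where P: "\<And>n e x. n \<ge> m \<Longrightarrow> P (e(n := x)) = P e" "wf_formula C_group_language \<phi>"
    "\<And>e. range e \<subseteq> carrier G \<Longrightarrow> sat M e \<phi> \<longleftrightarrow> P e" using DefE[OF P] by blast
  show ?thesis by (rule DefI[of m _ "Neg \<phi>"]) (simp_all add: P)
qed

lemma Def_conj: "Def P \<Longrightarrow> Def Q \<Longrightarrow> Def (\<lambda>e. P e \<and> Q e)"
proof -
  assume P: "Def P" and Q: "Def Q"
  obtain m \<phi> where P: "\<And>n e x. n \<ge> m \<Longrightarrow> P (e(n := x)) = P e" "wf_formula C_group_language \<phi>"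
    "\<And>e. range e \<subseteq> carrier G \<Longrightarrow> sat M e \<phi> \<longleftrightarrow> P e" using DefE[OF P] by blast
  obtain m' \<psi> where Q: "\<And>n e x. n \<ge> m' \<Longrightarrow> Q (e(n := x)) = Q e" "wf_formula C_group_language \<psi>"
    "\<And>e. range e \<subseteq> carrier G \<Longrightarrow> sat M e \<psi> \<longleftrightarrow> Q e" using DefE[OF Q] by blast
  show ?thesis
    by (rule DefI[of "max m m'" _ "Conj \<phi> \<psi>"]) (simp_all add: P Q)
qed

lemma Def_disj:
  assumes "Def P" "Def Q"
  shows "Def (\<lambda>e. P e \<or> Q e)"
  using Def_not[OF Def_conj[OF Def_not[OF assms(1)] Def_not[OF assms(2)]]] by simp

lemma Def_imp:
  assumes "Def P" "Def Q"
  shows "Def (\<lambda>e. P e \<longrightarrow> Q e)"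
  using Def_disj[OF Def_not[OF assms(1)] assms(2)] by (simp only: imp_conv_disj)

lemma Def_exists:
  assumes "Def P"
  shows "Def (\<lambda>e. \<exists>x\<in>carrier G. P (e(n := x)))"
proof -
  obtain m \<phi> where P: "\<And>n e x. n \<ge> m \<Longrightarrow> P (e(n := x)) = P e" "wf_formula C_group_language \<phi>"
    "\<And>e. range e \<subseteq> carrier G \<Longrightarrow> sat M e \<phi> \<longleftrightarrow> P e" using DefE[OF assms] by blast
  show ?thesis
  proof (rule DefI[of "max m (Suc n)" _ "Exists n \<phi>"])
    fix e x k assume "max m (Suc n) \<le> k"
    then have "P (e(k := x, n := y)) \<longleftrightarrow> P (e(n := y))" for y
      using P(1)[of k "e(n := y)" x] by (subst fun_upd_twist) auto
    then show "(\<exists>y\<in>carrier G. P (e(k := x, n := y))) = (\<exists>y\<in>carrier G. P (e(n := y)))" by simp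
  next
    fix e :: "nat \<Rightarrow> 'a" assume "range e \<subseteq> carrier G"
    then have "range (e(n := x)) \<subseteq> carrier G" if "x \<in> carrier G" for x using that by auto
    then show "sat M e (Exists n \<phi>) \<longleftrightarrow> (\<exists>x\<in>carrier G. P (e(n := x)))" using P(3) by auto
  qed (use P in simp)
qed

lemma Def_bex:
  assumes "Def (\<lambda>e. Q e (e n))" "\<And>e x y. Q (e(n := y)) x = Q e x"
  shows "Def (\<lambda>e. \<exists>x\<in>carrier G. Q e x)"
  using Def_exists[OF assms(1), of n] assms(2) by simp

lemma Def_ball:
  assumes "Def (\<lambda>e. Q e (e n))" "\<And>e x y. Q (e(n := y)) x = Q e x"
  shows "Def (\<lambda>e. \<forall>x\<in>carrier G. Q e x)"
proof -
  have "Def (\<lambda>e. \<not> (\<exists>x\<in>carrier G. \<not> Q e x))"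
    using assms by (intro Def_not Def_bex[where n = n]) auto
  then show ?thesis by simp
qed

text \<open>Substitution of a definable function is an existential quantifier over a variable
  \<open>n\<close> equated with its value; hence \<open>t\<close> must not depend on that
  variable.\<close>

lemma Def_subst:
  assumes "Def P" "Def (\<lambda>e. e n = t e)" "\<And>e x. t (e(n := x)) = t e"
    and "\<And>e. range e \<subseteq> carrier G \<Longrightarrow> t e \<in> carrier G" and "\<exists>m. \<forall>n\<ge>m. \<forall>e x. t (e(n := x)) = t e"
  shows "Def (\<lambda>e. P (e(n := t e)))"
proof (rule Def_cong[OF Def_exists[OF Def_conj[OF assms(2,1)], of n]])
  obtain m where m: "\<And>n e x. n \<ge> m \<Longrightarrow> P (e(n := x)) = P e" using Def_fresh[OF assms(1)] by blast
  obtain m' where m': "\<And>n e x. n \<ge> m' \<Longrightarrow> t (e(n := x)) = t e" using assms(5) by blast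
  show "\<exists>m. \<forall>k\<ge>m. \<forall>e x. P ((e(k := x))(n := t (e(k := x)))) = P (e(n := t e))"
  proof (intro exI[of _ "max (Suc n) (max m m')"] allI impI)
    fix k e x assume "max (Suc n) (max m m') \<le> k"
    then show "P ((e(k := x))(n := t (e(k := x)))) = P (e(n := t e))"
      using m[of k "e(n := t e)" x] m'[of k] by (subst fun_upd_twist) simp_all
  qed
qed (use assms(3,4) in auto)

lemma Def_fun_subst:
  assumes "Def_fun t"
  shows "\<exists>m. \<forall>n\<ge>m. (\<forall>e x. t (e(n := x)) = t e) \<and> (\<forall>P. Def P \<longrightarrow> Def (\<lambda>e. P (e(n := t e))))"
proof -
  obtain m where m: "\<And>n. n \<ge> m \<Longrightarrow> (\<forall>e x. t (e(n := x)) = t e) \<and> Def (\<lambda>e. e n = t e)"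
    using Def_fun_fresh[OF assms] by blast
  have "Def (\<lambda>e. P (e(n := t e)))" if "n \<ge> m" "Def P" for n P
  proof (rule Def_subst[OF that(2)])
    show "Def (\<lambda>e. e n = t e)" "t (e(n := x)) = t e" for e x using m[OF that(1)] by blast+
    show "t e \<in> carrier G" if "range e \<subseteq> carrier G" for e using Def_fun_closed[OF assms that] .
    show "\<exists>m. \<forall>n\<ge>m. \<forall>e x. t (e(n := x)) = t e" using Def_fun_depends[OF assms] .
  qed
  then show ?thesis using m by (intro exI[of _ m]) blast
qed

lemma Def_C:
  assumes "Def_fun s" "Def_fun t" "Def_fun u"
  shows "Def (\<lambda>e. C (s e) (t e) (u e))"
proof -
  obtain ms where ms: "\<And>n. n \<ge> ms \<Longrightarrow> (\<forall>e x. s (e(n := x)) = s e) \<and> (\<forall>P. Def P \<longrightarrow> Def (\<lambda>e. P (e(n := s e))))"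
    using Def_fun_subst[OF assms(1)] by blast
  obtain mt where mt: "\<And>n. n \<ge> mt \<Longrightarrow> (\<forall>e x. t (e(n := x)) = t e) \<and> (\<forall>P. Def P \<longrightarrow> Def (\<lambda>e. P (e(n := t e))))"
    using Def_fun_subst[OF assms(2)] by blast
  obtain mu where mu: "\<And>n. n \<ge> mu \<Longrightarrow> (\<forall>e x. u (e(n := x)) = u e) \<and> (\<forall>P. Def P \<longrightarrow> Def (\<lambda>e. P (e(n := u e))))"
    using Def_fun_subst[OF assms(3)] by blast
  define n where "n = max ms (max mt mu)"
  have n: "n \<ge> ms" "Suc n \<ge> ms" "Suc (Suc n) \<ge> ms" "n \<ge> mt" "Suc n \<ge> mt" "Suc (Suc n) \<ge> mt"
    "n \<ge> mu" "Suc n \<ge> mu" "Suc (Suc n) \<ge> mu" by (auto simp: n_def)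
  have "Def (\<lambda>e. C (e n) (e (Suc n)) (e (Suc (Suc n))))"
    by (rule DefI[of "n + 3" _ "Rel C_sym [Var n, Var (Suc n), Var (Suc (Suc n))]"])
      (auto simp: C_group_language_def C_group_structure_def)
  then have "Def (\<lambda>e. C (s e) (e (Suc n)) (e (Suc (Suc n))))"
    using ms[OF n(1)] by fastforce
  then have "Def (\<lambda>e. C (s (e(Suc n := t e))) (t e) (e (Suc (Suc n))))"
    using mt[OF n(5)] by fastforce
  then have "Def (\<lambda>e. C (s e) (t e) (e (Suc (Suc n))))" using ms[OF n(2)] by simp
  then have "Def (\<lambda>e. C (s (e(Suc (Suc n) := u e))) (t (e(Suc (Suc n) := u e))) (u e))"
    using mu[OF n(9)] by fastforce
  then show ?thesis using ms[OF n(3)] mt[OF n(6)] by simp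
qed

lemma Def_fun_var: "Def_fun (\<lambda>e. e k)"
proof -
  have "Def (\<lambda>e. e n = e k)" for n
    by (rule DefI[of "max (Suc n) (Suc k)" _ "Eq (Var n) (Var k)"]) auto
  then show ?thesis by (intro Def_funI[of "Suc k" _ 0]) auto
qed

lemma Def_fun_mult:
  assumes "Def_fun s" "Def_fun t"
  shows "Def_fun (\<lambda>e. s e \<otimes> t e)"
proof -
  obtain ms where ms: "\<And>n. n \<ge> ms \<Longrightarrow> (\<forall>e x. s (e(n := x)) = s e) \<and> (\<forall>P. Def P \<longrightarrow> Def (\<lambda>e. P (e(n := s e))))"
    using Def_fun_subst[OF assms(1)] by blast
  obtain mt where mt: "\<And>n. n \<ge> mt \<Longrightarrow> (\<forall>e x. t (e(n := x)) = t e) \<and> (\<forall>P. Def P \<longrightarrow> Def (\<lambda>e. P (e(n := t e))))"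
    using Def_fun_subst[OF assms(2)] by blast
  have "Def (\<lambda>e. e k = s e \<otimes> t e)" if k: "k \<ge> max ms mt" for k
  proof -
    define n where "n = Suc (max k (max ms mt))"
    have n: "n \<ge> ms" "Suc n \<ge> ms" "n \<ge> mt" "Suc n \<ge> mt" "k < n" by (auto simp: n_def)
    have "Def (\<lambda>e. e k = e n \<otimes> e (Suc n))"
      by (rule DefI[of "n + 2" _ "Eq (Var k) (Fun Mult [Var n, Var (Suc n)])"])
        (use n in \<open>auto simp: C_group_language_def C_group_structure_def\<close>)
    then have "Def (\<lambda>e. e k = s e \<otimes> e (Suc n))"
      using ms[OF n(1)] n(5) by fastforce
    then have "Def (\<lambda>e. (e(Suc n := t e)) k = s (e(Suc n := t e)) \<otimes> t e)"
      using mt[OF n(4)] by fastforce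
    then show ?thesis using ms[OF n(2)] n(5) by simp
  qed
  moreover have "\<forall>n\<ge>max ms mt. \<forall>e x. s (e(n := x)) \<otimes> t (e(n := x)) = s e \<otimes> t e"
    using ms mt by simp
  ultimately show ?thesis using Def_fun_closed[OF assms(1)] Def_fun_closed[OF assms(2)]
    unfolding Def_fun_def by blast
qed

lemma Def_eq:
  assumes "Def_fun s" "Def_fun t"
  shows "Def (\<lambda>e. s e = t e)"
proof -
  obtain ms where ms: "\<And>n. n \<ge> ms \<Longrightarrow> (\<forall>e x. s (e(n := x)) = s e) \<and> (\<forall>P. Def P \<longrightarrow> Def (\<lambda>e. P (e(n := s e))))"
    using Def_fun_subst[OF assms(1)] by blast
  obtain mt where mt: "\<And>n. n \<ge> mt \<Longrightarrow> (\<forall>e x. t (e(n := x)) = t e) \<and> (\<forall>P. Def P \<longrightarrow> Def (\<lambda>e. P (e(n := t e))))"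
    using Def_fun_subst[OF assms(2)] by blast
  define n where "n = max ms mt"
  have n: "n \<ge> ms" "Suc n \<ge> ms" "n \<ge> mt" "Suc n \<ge> mt" by (auto simp: n_def)
  have "Def (\<lambda>e. e n = e (Suc n))"
    by (rule DefI[of "n + 2" _ "Eq (Var n) (Var (Suc n))"]) auto
  then have "Def (\<lambda>e. s e = e (Suc n))" using ms[OF n(1)] by fastforce
  then have "Def (\<lambda>e. s (e(Suc n := t e)) = t e)" using mt[OF n(4)] by fastforce
  then show ?thesis using ms[OF n(2)] by simp
qed

text \<open>The language has no symbol for the neutral element; it is defined as the only
  idempotent.\<close>

lemma Def_fun_one: "Def_fun (\<lambda>e. \<one>)"
proof -
  have "Def (\<lambda>e. e n = \<one>)" for n
  proof (rule Def_cong[OF Def_eq[OF Def_fun_mult[OF Def_fun_var[of n] Def_fun_var[of n]] Def_fun_var[of n]]])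
    show "\<exists>m. \<forall>k\<ge>m. \<forall>e x. ((e(k := x)) n = \<one>) = (e n = \<one>)"
      by (intro exI[of _ "Suc n"]) auto
    fix e :: "nat \<Rightarrow> 'a" assume "range e \<subseteq> carrier G"
    then have "e n \<in> carrier G" by auto
    then show "e n \<otimes> e n = e n \<longleftrightarrow> e n = \<one>" by simp
  qed
  then show ?thesis by (intro Def_funI[of 0 _ 0]) auto
qed

lemma Def_fun_inv:
  assumes "Def_fun t"
  shows "Def_fun (\<lambda>e. inv (t e))"
proof -
  obtain m where m: "\<And>n e x. n \<ge> m \<Longrightarrow> t (e(n := x)) = t e" using Def_fun_depends[OF assms] by blast
  have "Def (\<lambda>e. e n = inv (t e))" for n
  proof (rule Def_cong[OF Def_eq[OF Def_fun_mult[OF Def_fun_var assms] Def_fun_one]])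
    show "\<exists>k. \<forall>k'\<ge>k. \<forall>e x. ((e(k' := x)) n = inv (t (e(k' := x)))) = (e n = inv (t e))"
      using m by (intro exI[of _ "max m (Suc n)"]) auto
    fix e :: "nat \<Rightarrow> 'a" assume e: "range e \<subseteq> carrier G"
    then have "e n \<in> carrier G" "t e \<in> carrier G" using Def_fun_closed[OF assms] by auto
    then show "e n \<otimes> t e = \<one> \<longleftrightarrow> e n = inv (t e)" by (auto intro: inv_equality[symmetric])
  qed
  then show ?thesis using m Def_fun_closed[OF assms] by (intro Def_funI[of m _ 0]) auto
qed

lemma Def_fun_pow:
  assumes "Def_fun t"
  shows "Def_fun (\<lambda>e. t e [^] (n::nat))"
proof (induction n)
  case 0
  show ?case using Def_fun_one by simp
next
  case (Suc n)
  show ?case using Def_fun_mult[OF Suc assms] by simp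
qed

lemma Def_qo:
  assumes "Def_fun s" "Def_fun t"
  shows "Def (\<lambda>e. qo (s e) (t e))"
proof -
  have C: "Def (\<lambda>e. \<not> C (s e) (t e) \<one>)"
    by (rule Def_not, rule Def_C[OF assms Def_fun_one])
  obtain m where m: "\<And>n e x. n \<ge> m \<Longrightarrow> s (e(n := x)) = s e" using Def_fun_depends[OF assms(1)] by blast
  obtain m' where m': "\<And>n e x. n \<ge> m' \<Longrightarrow> t (e(n := x)) = t e"
    using Def_fun_depends[OF assms(2)] by blast
  show ?thesis
  proof (rule Def_cong[OF C])
    show "\<exists>m. \<forall>n\<ge>m. \<forall>e x. qo (s (e(n := x))) (t (e(n := x))) = qo (s e) (t e)"
      using m m' by (intro exI[of _ "max m m'"]) simp
    show "\<not> C (s e) (t e) \<one> \<longleftrightarrow> qo (s e) (t e)" if "range e \<subseteq> carrier G" for e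
      using lt_iff_C[OF Def_fun_closed[OF assms(2) that] Def_fun_closed[OF assms(1) that]] by blast
  qed
qed

lemmas Def_intros = Def_not Def_conj Def_disj Def_imp Def_C Def_eq Def_qo
  Def_fun_var Def_fun_mult Def_fun_one Def_fun_inv Def_fun_pow

subsection \<open>Types over finitely many parameters\<close>

text \<open>Only atomic formulas with one occurrence of the varying element are listed. Symmetry of
  \<open>C\<close> in its last two arguments covers the third position, and with two or more
  occurrences the axioms decide the formula from the equalities.\<close>

definition agree :: "'a set \<Rightarrow> 'a \<Rightarrow> 'a \<Rightarrow> bool" where
  "agree B x y \<longleftrightarrow> (\<forall>b\<in>B. x = b \<longleftrightarrow> y = b) \<and>
     (\<forall>b\<in>B. \<forall>b'\<in>B. (C x b b' \<longleftrightarrow> C y b b') \<and> (C b x b' \<longleftrightarrow> C b y b'))"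

text \<open>\<open>\<one>\<close> is counted among the parameters, so that comparison with
  parameters under \<open>qo\<close> is part of the type; this accounts for the \<open>Suc\<close>
  in \<open>determined_imp_det\<close>.\<close>

definition det :: "nat \<Rightarrow> 'a set \<Rightarrow> bool" where
  "det k D \<longleftrightarrow> (\<exists>B. B \<subseteq> carrier G \<and> \<one> \<in> B \<and> finite B \<and> card B \<le> k \<and>
     (\<forall>x\<in>carrier G. \<forall>y\<in>carrier G. agree B x y \<longrightarrow> (x \<in> D \<longleftrightarrow> y \<in> D)))"

lemma agree_imp_same_type:
  assumes "agree B x y" "b ` {..<k} \<subseteq> B" "B \<subseteq> carrier G" "x \<in> carrier G" "y \<in> carrier G"
  shows "same_type (rel_int M C_sym) k b x y"
proof -
  have b: "b i \<in> B" "b i \<in> carrier G" if "i \<le> k" "i \<noteq> k" for i using assms(2,3) that by force+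
  have xx: "\<not> C z z w" if "z \<in> carrier G" "w \<in> carrier G" for z w using C_asym that by blast
  have xx': "\<not> C z w z" if "z \<in> carrier G" "w \<in> carrier G" for z w using xx C_sym that by blast
  have 1: "C ((b(k := x)) i) ((b(k := x)) j) ((b(k := x)) l) \<longleftrightarrow>
      C ((b(k := y)) i) ((b(k := y)) j) ((b(k := y)) l)" if "i \<le> k" "j \<le> k" "l \<le> k" for i j l
  proof -
    consider "i = k" "j = k" | "i = k" "l = k" | "i = k" "j \<noteq> k" "l \<noteq> k"
      | "i \<noteq> k" "j = k" "l = k" | "i \<noteq> k" "j = k" "l \<noteq> k" | "i \<noteq> k" "j \<noteq> k" "l = k"
      | "i \<noteq> k" "j \<noteq> k" "l \<noteq> k" by blast
    then show ?thesis
    proof cases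
      case 1
      then show ?thesis using xx b[of l] that assms(4,5) by (cases "l = k") auto
    next
      case 2
      then show ?thesis using xx' b[of j] that assms(4,5) by (cases "j = k") auto
    next
      case 3
      then show ?thesis using b[of j] b[of l] that assms(1) by (auto simp: agree_def)
    next
      case 4
      then show ?thesis using b[of i] that assms(1,4,5) by (auto simp: agree_def C_same)
    next
      case 5
      then show ?thesis using b[of i] b[of l] that assms(1) by (auto simp: agree_def)
    next
      case 6
      then have "C (b i) x (b j) \<longleftrightarrow> C (b i) y (b j)" using b[of i] b[of j] that assms(1) by (auto simp: agree_def)
      then show ?thesis using 6 b[of i] b[of j] that assms(4,5) C_sym by simp
    qed simp
  qed
  have 2: "(b(k := x)) i = (b(k := x)) j \<longleftrightarrow> (b(k := y)) i = (b(k := y)) j" if "i \<le> k" "j \<le> k" for i j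
    using b[of i] b[of j] that assms(1) by (auto simp: agree_def)
  have "rel_int M C_sym [u, v, w] \<longleftrightarrow> C u v w" for u v w
    by (simp add: C_group_structure_def)
  then show ?thesis unfolding same_type_def using 1 2 by simp
qed

lemma determined_imp_det:
  assumes "determined (carrier G) (rel_int M C_sym) k D"
  shows "det (Suc k) D"
proof -
  obtain b where b: "\<forall>i<k. b i \<in> carrier G" and D: "\<And>x y. x \<in> carrier G \<Longrightarrow> y \<in> carrier G \<Longrightarrow>
      same_type (rel_int M C_sym) k b x y \<Longrightarrow> x \<in> D \<longleftrightarrow> y \<in> D"
    using assms unfolding determined_def by blast
  define B where "B = insert \<one> (b ` {..<k})"
  have sub: "B \<subseteq> carrier G" using b by (auto simp: B_def)
  have "card B \<le> Suc k"
    unfolding B_def by (rule order.trans[OF card_insert_le_m1]) (auto intro: order.trans[OF card_image_le])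
  moreover have "x \<in> D \<longleftrightarrow> y \<in> D" if "x \<in> carrier G" "y \<in> carrier G" "agree B x y" for x y
    by (rule D[OF that(1,2) agree_imp_same_type[OF that(3) _ sub that(1,2)]]) (auto simp: B_def)
  ultimately show ?thesis unfolding det_def using sub by (intro exI[of _ B]) (auto simp: B_def)
qed

lemma det_mono: "det k D \<Longrightarrow> k \<le> m \<Longrightarrow> det m D"
  unfolding det_def by (meson order.trans)

end

section \<open>Uniform bounds from C-minimality\<close>

locale C_minimal_quasi_order = C_quasi_order G qo C for G (structure) and qo C +
  assumes dense: "dense_C_relation_on (carrier G) C"
    and C_minimal: "C_minimal_group TYPE('a) G C"
begin

lemma dense_ex:
  assumes "x \<in> carrier G" "y \<in> carrier G" "x \<noteq> y"
  shows "\<exists>z\<in>carrier G. z \<noteq> y \<and> C x y z"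
  using dense assms unfolding dense_C_relation_on_def by blast

lemma no_least: 
  assumes "g \<in> carrier G" "g \<noteq> \<one>"
  shows "\<exists>h\<in>carrier G. h \<noteq> \<one> \<and> lt h g"
  using dense_ex[OF assms(1) one_closed assms(2)] C_sym lt_iff_C assms by (metis one_closed)

text \<open>Density leaves no least class above \<open>\<one>\<close>, which a finite group would
  have. Infinity of the type \<open>'a\<close> gives room for the countable structure of the
  compactness argument.\<close>

lemma infinite_carrier: "infinite (carrier G)"
proof
  assume fin: "finite (carrier G)"
  obtain g where g: "g \<in> carrier G" "g \<noteq> \<one>"
    using dense unfolding dense_C_relation_on_def by (metis one_closed)
  define S where "S h = {x \<in> carrier G. qo x h}" for h
  have "\<exists>h. (h \<in> carrier G \<and> h \<noteq> \<one>) \<and> (\<forall>h'. h' \<in> carrier G \<and> h' \<noteq> \<one> \<longrightarrow> card (S h) \<le> card (S h'))"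
    using g by (intro ex_has_least_nat) blast
  then obtain h where h: "h \<in> carrier G" "h \<noteq> \<one>"
    "\<And>h'. h' \<in> carrier G \<Longrightarrow> h' \<noteq> \<one> \<Longrightarrow> card (S h) \<le> card (S h')" by blast
  obtain h' where h': "h' \<in> carrier G" "h' \<noteq> \<one>" "lt h' h" using no_least h by blast
  have "S h' \<subseteq> S h" using h h' qo_trans[OF _ lt_imp_qo[OF h'(3)]] unfolding S_def by blast
  moreover have "h \<in> S h" "h \<notin> S h'" using h h' by (auto simp: S_def)
  ultimately have "S h' \<subset> S h" by blast
  then have "card (S h') < card (S h)" using fin by (intro psubset_card_mono) (auto simp: S_def)
  then show False using h(3)[OF h'(1,2)] by simp
qed

lemma uniformly_det:
  assumes "Def P"
  shows "\<exists>k. \<forall>e. range e \<subseteq> carrier G \<longrightarrow> det k {x \<in> carrier G. P (e(0 := x))}"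
proof -
  obtain m \<phi> where \<phi>: "\<And>n e x. n \<ge> m \<Longrightarrow> P (e(n := x)) = P e" "wf_formula C_group_language \<phi>"
    "\<And>e. range e \<subseteq> carrier G \<Longrightarrow> sat M e \<phi> \<longleftrightarrow> P e" using DefE[OF assms] by blast
  have inf: "infinite (UNIV :: 'a set)" using infinite_carrier by (metis finite_subset subset_UNIV)
  have "C_minimal TYPE('a) C_group_language C_sym M"
    using C_minimal unfolding C_minimal_group_def .
  from uniformly_determined[OF this inf \<phi>(2)] obtain k where
    k: "\<And>e. range e \<subseteq> carrier G \<Longrightarrow> determined (carrier G) (rel_int M C_sym) k (defined_set M e \<phi>)"
    unfolding universe_M by blast
  have "det (Suc k) {x \<in> carrier G. P (e(0 := x))}" if e: "range e \<subseteq> carrier G" for e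
  proof -
    have "range (e(0 := x)) \<subseteq> carrier G" if "x \<in> carrier G" for x using that e by auto
    then have "defined_set M e \<phi> = {x \<in> carrier G. P (e(0 := x))}"
      using \<phi>(3) unfolding defined_set_def by auto
    then show ?thesis using determined_imp_det[OF k[OF e]] by simp
  qed
  then show ?thesis by blast
qed

lemma uniformly_det2:
  assumes "Def (\<lambda>e. Q (e 0) (e 1) (e 2))"
  shows "\<exists>k. \<forall>a\<in>carrier G. \<forall>c\<in>carrier G. det k {x \<in> carrier G. Q x a c}"
proof -
  obtain k where k: "\<forall>e :: nat \<Rightarrow> 'a. range e \<subseteq> carrier G \<longrightarrow>
      det k {x \<in> carrier G. Q ((e(0 := x)) 0) ((e(0 := x)) 1) ((e(0 := x)) 2)}"
    using uniformly_det[OF assms] by (elim exE) (rule that)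
  have "det k {x \<in> carrier G. Q x a c}" if "a \<in> carrier G" "c \<in> carrier G" for a c
    using spec[OF k, of "(\<lambda>_. \<one>)(1 := a, 2 := c)"] that by (auto simp: image_subset_iff)
  then show ?thesis by blast
qed

lemma uniformly_det1:
  assumes "Def (\<lambda>e. Q (e 0) (e 1))"
  shows "\<exists>k. \<forall>a\<in>carrier G. det k {x \<in> carrier G. Q x a}"
proof -
  obtain k where k: "\<forall>a\<in>carrier G. \<forall>c\<in>carrier G. det k {x \<in> carrier G. Q x a}"
    using uniformly_det2[of "\<lambda>x a c. Q x a", OF assms] by blast
  then show ?thesis using one_closed by blast
qed

lemma definable_Def:
  assumes "Def P" "range e \<subseteq> carrier G"
  shows "definable_in_C_group G C {x \<in> carrier G. P (e(0 := x))}"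
proof -
  obtain m \<phi> where \<phi>: "\<And>n e x. n \<ge> m \<Longrightarrow> P (e(n := x)) = P e" "wf_formula C_group_language \<phi>"
    "\<And>e. range e \<subseteq> carrier G \<Longrightarrow> sat M e \<phi> \<longleftrightarrow> P e" using DefE[OF assms(1)] by blast
  have "range (e(0 := x)) \<subseteq> carrier G" if "x \<in> carrier G" for x using that assms(2) by auto
  then have "{x \<in> carrier G. P (e(0 := x))} = defined_set M e \<phi>" using \<phi>(3) unfolding defined_set_def by auto
  then show ?thesis using \<phi>(2) assms(2) unfolding definable_in_C_group_def definable_set_def by auto
qed

end

section \<open>Minimal groups\<close>

text \<open>Explicit bounds instead of finiteness, because the argument is applied to all quotients
  of balls with the same constant.\<close>

abbreviation at_most :: "nat \<Rightarrow> 'a set \<Rightarrow> bool" where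
  "at_most k S \<equiv> finite S \<and> card S \<le> k"

lemma at_most_Un:
  assumes "at_most k S" "at_most k T"
  shows "at_most (2 * k) (S \<union> T)"
  using assms card_Un_le[of S T] by auto

context group
begin

definition centralizer :: "'a \<Rightarrow> 'a set" where
  "centralizer a = {x \<in> carrier G. x \<otimes> a = a \<otimes> x}"

definition central :: "'a \<Rightarrow> bool" where
  "central z \<longleftrightarrow> (\<forall>x\<in>carrier G. z \<otimes> x = x \<otimes> z)"

definition conjugates :: "'a \<Rightarrow> 'a set" where
  "conjugates a = (\<lambda>y. y \<otimes> a \<otimes> inv y) ` carrier G"

lemma subgroup_centralizer:
  assumes a: "a \<in> carrier G"
  shows "subgroup (centralizer a) G"
proof (rule subgroupI)
  show "centralizer a \<subseteq> carrier G" by (auto simp: centralizer_def)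
  show "centralizer a \<noteq> {}" using a by (auto simp: centralizer_def)
  fix x assume x: "x \<in> centralizer a"
  then have xG: "x \<in> carrier G" and xa: "x \<otimes> a = a \<otimes> x" by (auto simp: centralizer_def)
  have "inv x \<otimes> a = inv x \<otimes> (a \<otimes> x) \<otimes> inv x" using xG a by (simp add: m_assoc)
  also have "\<dots> = a \<otimes> inv x" unfolding xa[symmetric] using xG a by simp
  finally have "inv x \<otimes> a = a \<otimes> inv x" .
  then show "inv x \<in> centralizer a" using xG by (simp add: centralizer_def)
  fix y assume "y \<in> centralizer a"
  then have yG: "y \<in> carrier G" and ya: "y \<otimes> a = a \<otimes> y" by (auto simp: centralizer_def)
  have "x \<otimes> y \<otimes> a = x \<otimes> (a \<otimes> y)" using xG yG a ya by (simp add: m_assoc)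
  also have "\<dots> = a \<otimes> (x \<otimes> y)" using xG yG a xa by (simp add: m_assoc[symmetric])
  finally show "x \<otimes> y \<in> centralizer a" using xG yG by (simp add: centralizer_def)
qed

lemma centralizer_self: "a \<in> carrier G \<Longrightarrow> a \<in> centralizer a"
  by (simp add: centralizer_def)

lemma subgroup_pow_closed: "subgroup H G \<Longrightarrow> x \<in> H \<Longrightarrow> x [^] (n::nat) \<in> H"
  by (induction n) (auto intro: subgroup.one_closed subgroup.m_closed)

lemma central_iff: "z \<in> carrier G \<Longrightarrow> central z \<longleftrightarrow> (\<forall>a\<in>carrier G. z \<in> centralizer a)"
  by (auto simp: central_def centralizer_def)

lemma conj_pow:
  assumes "y \<in> carrier G" "a \<in> carrier G"
  shows "(y \<otimes> a \<otimes> inv y) [^] (n::nat) = y \<otimes> a [^] n \<otimes> inv y"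
proof (induction n)
  case (Suc n)
  have "y \<otimes> a [^] n \<otimes> inv y \<otimes> (y \<otimes> a \<otimes> inv y) = y \<otimes> a [^] n \<otimes> (inv y \<otimes> y) \<otimes> a \<otimes> inv y"
    using assms by (simp add: m_assoc del: l_inv)
  then show ?case using Suc assms by (simp add: m_assoc)
qed (use assms in simp)

lemma central_conj:
  assumes "y \<in> carrier G" "a \<in> carrier G"
  shows "central (y \<otimes> a \<otimes> inv y) \<longleftrightarrow> central a"
proof
  have eq: "inv y \<otimes> (y \<otimes> a \<otimes> inv y) \<otimes> y = a" using assms by (simp add: m_assoc)
  assume c: "central (y \<otimes> a \<otimes> inv y)"
  define w where "w = y \<otimes> a \<otimes> inv y"
  have w: "w \<in> carrier G" "w \<otimes> y = y \<otimes> w" using c assms by (auto simp: w_def central_def)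
  have "inv y \<otimes> w \<otimes> y = w" using w assms by (simp add: m_assoc)
  then show "central a" using eq c by (simp add: w_def)
next
  assume c: "central a"
  have "y \<otimes> a \<otimes> inv y = a \<otimes> y \<otimes> inv y" using c assms unfolding central_def by metis
  also have "\<dots> = a" using assms by (simp add: m_assoc)
  finally show "central (y \<otimes> a \<otimes> inv y)" using c by simp
qed

text \<open>Modulo the centre all elements \<open>a\<close> of such a group have the same order \<open>n\<close>. If \<open>n = 2\<close>, then
  the noncentral elements commute with \<open>a\<close>; otherwise \<open>n\<close> is odd and an element inverting \<open>a\<close>
  commutes with \<open>a\<close>.\<close>

lemma all_central_if_noncentral_conjugate:
  assumes conj: "\<And>a b. a \<in> carrier G \<Longrightarrow> b \<in> carrier G \<Longrightarrow> \<not> central a \<Longrightarrow> \<not> central b \<Longrightarrow> b \<in> conjugates a"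
    and tors: "\<And>a. a \<in> carrier G \<Longrightarrow> \<exists>n>0. central (a [^] (n::nat))"
    and a: "a \<in> carrier G"
  shows "central a"
proof (rule ccontr)
  assume nc: "\<not> central a"
  \<comment> \<open>Noncentral elements are all conjugate to each other, so the same powers of them
    are central.\<close>
  have same: "central (b [^] n) \<longleftrightarrow> central (a [^] n)" if b: "b \<in> carrier G" "\<not> central b" for b and n :: nat
  proof -
    obtain y where "y \<in> carrier G" "b = y \<otimes> a \<otimes> inv y" using conj[OF a b(1) nc b(2)] by (auto simp: conjugates_def)
    then show ?thesis using a by (simp add: conj_pow central_conj)
  qed
  show False
  proof (cases "central (a [^] (2::nat))")
    case True
    have sq: "central (x \<otimes> x)" if "x \<in> carrier G" for x
    proof (cases "central x")
      case True
      then show ?thesis using that subgroup.m_closed[OF subgroup_centralizer] by (simp add: central_iff)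
    next
      case False
      then show ?thesis using same[OF that False, of 2] True \<open>central (a [^] (2::nat))\<close> that by (simp add: numeral_2_eq_2)
    qed
    have "b \<in> centralizer a" if b: "b \<in> carrier G" for b
    proof (cases "central b")
      case True
      then show ?thesis using a b by (simp add: central_iff)
    next
      case False
      then obtain y where y: "y \<in> carrier G" "b = y \<otimes> a \<otimes> inv y"
        using conj[OF a b nc] by (auto simp: conjugates_def)
      \<comment> \<open>The square of \<open>y a\<close> equals \<open>b y^2 a\<close>. Both squares
        are central, so \<open>b\<close> is a product of elements that commute with
        \<open>a\<close>.\<close>
      let ?c = "(y \<otimes> a) \<otimes> (y \<otimes> a)"
      have "?c = b \<otimes> (y \<otimes> y) \<otimes> a" using y a by (simp add: m_assoc)
      then have "b = ?c \<otimes> inv a \<otimes> inv (y \<otimes> y)"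
        using y a by (simp add: m_assoc inv_mult_group)
      moreover have "?c \<in> centralizer a" "y \<otimes> y \<in> centralizer a" using sq y a central_iff by auto
      ultimately show ?thesis using subgroup_centralizer[OF a] centralizer_self[OF a]
        by (metis subgroup.m_closed subgroup.m_inv_closed)
    qed
    then have "central a" unfolding central_def centralizer_def by auto
    then show False using nc by simp
  next
    case False
    define n where "n = (LEAST n. 0 < n \<and> central (a [^] (n::nat)))"
    have n: "0 < n" "central (a [^] n)"
      using LeastI_ex[of "\<lambda>n. 0 < n \<and> central (a [^] (n::nat))"] tors[OF a] by (auto simp: n_def)
    have least: "\<not> central (a [^] m)" if "0 < m" "m < n" for m
      using not_less_Least[of m "\<lambda>n. 0 < n \<and> central (a [^] (n::nat))"] that by (auto simp: n_def)
    \<comment> \<open>If \<open>n = 2 m\<close>, the noncentral element \<open>a^2\<close> would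
      have a central \<open>m\<close>-th power, and so would \<open>a\<close>, against the
      minimality of \<open>n\<close>.\<close>
    have "odd n"
    proof
      assume "even n"
      then obtain m where m: "n = 2 * m" by blast
      have "central ((a [^] (2::nat)) [^] m)" using n(2) m a by (simp add: nat_pow_pow)
      then have "central (a [^] m)" using same[of "a [^] (2::nat)" m] False a by simp
      then show False using least[of m] m n(1) by simp
    qed
    then obtain m where m: "n = 2 * m + 1" by (rule oddE)
    have "\<not> central (inv a)"
    proof
      assume "central (inv a)"
      then have "inv a \<in> centralizer b" if "b \<in> carrier G" for b using that a by (simp add: central_iff)
      then have "inv (inv a) \<in> centralizer b" if "b \<in> carrier G" for b
        using that subgroup_centralizer[OF that] subgroup.m_inv_closed by metis
      then show False using nc a by (simp add: central_iff)
    qed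
    \<comment> \<open>Conjugation by \<open>y\<close> inverts \<open>a\<close>, so
      \<open>y^2\<close> commutes with \<open>a\<close>. As \<open>y\<close> is noncentral,
      \<open>y^n\<close> is central; since \<open>n\<close> is odd, \<open>y\<close> is a product of
      \<open>y^n\<close> and a power of \<open>y^2\<close>.\<close>
    then obtain y where y: "y \<in> carrier G" "inv a = y \<otimes> a \<otimes> inv y"
      using conj[of a "inv a"] a nc by (auto simp: conjugates_def)
    have a2: "a \<otimes> a \<noteq> \<one>" using False a by (auto simp: numeral_2_eq_2 central_def)
    have "y \<notin> centralizer a"
    proof
      assume "y \<in> centralizer a"
      then have "inv a = a" using y a by (simp add: centralizer_def m_assoc)
      then show False using a2 a by (metis l_inv)
    qed
    moreover have "y \<in> centralizer a"
    proof -
      have "\<not> central y" using \<open>y \<notin> centralizer a\<close> y a central_iff by blast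
      then have yn: "y [^] n \<in> centralizer a" using same[OF y(1), of n] n(2) y a central_iff by (metis nat_pow_closed)
      have ya: "y \<otimes> a = inv a \<otimes> y" using y a by (simp add: m_assoc)
      then have "y \<otimes> inv a = a \<otimes> y"
        using y(1) a by (metis inv_closed inv_inv inv_mult_group inv_solve_left m_assoc m_closed)
      then have "(y \<otimes> y) \<otimes> a = a \<otimes> (y \<otimes> y)" using ya y(1) a by (metis inv_closed m_assoc)
      then have "y \<otimes> y \<in> centralizer a" using y by (simp add: centralizer_def)
      then have ym: "(y \<otimes> y) [^] m \<in> centralizer a" using subgroup_pow_closed subgroup_centralizer[OF a] by blast
      have yy: "y \<otimes> y = y [^] (2::nat)" using y by (simp add: numeral_2_eq_2)
      have "y [^] n = y [^] (2 * m) \<otimes> y" using m y by simp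
      also have "y [^] (2 * m) = (y \<otimes> y) [^] m" unfolding yy nat_pow_pow[OF y(1)] ..
      finally have "y = inv ((y \<otimes> y) [^] m) \<otimes> y [^] n" using y by (simp add: m_assoc[symmetric])
      then show ?thesis using yn ym subgroup_centralizer[OF a] by (metis subgroup.m_closed subgroup.m_inv_closed)
    qed
    ultimately show False by contradiction
  qed
qed

text \<open>A coset \<open>u H\<close> of a proper subgroup lies in its complement, so
  \<open>H\<close> would have at most \<open>k\<close> elements and the whole group at most
  \<open>2 * k\<close>.\<close>

lemma subgroup_at_most_or_all:
  assumes H: "subgroup H G" and k: "at_most k (carrier G - H)" and big: "\<not> at_most (2 * k) (carrier G)"
  shows "H = carrier G"
proof (rule ccontr)
  have sub: "H \<subseteq> carrier G" using H subgroup.subset by blast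
  assume "H \<noteq> carrier G"
  then obtain u where u: "u \<in> carrier G" "u \<notin> H" using sub by blast
  have inj: "inj_on ((\<otimes>) u) H" using u sub by (auto simp: inj_on_def subset_iff)
  have "u \<otimes> h \<notin> H" if h: "h \<in> H" for h
  proof
    assume "u \<otimes> h \<in> H"
    then have "u \<otimes> h \<otimes> inv h \<in> H" using H h by (metis subgroup.m_closed subgroup.m_inv_closed)
    then show False using u h sub by (auto simp: m_assoc)
  qed
  then have img: "(\<otimes>) u ` H \<subseteq> carrier G - H" using u sub by auto
  have "finite H" using inj_on_finite[OF inj img] k by simp
  moreover have "card H \<le> k" using card_inj_on_le[OF inj img] k by simp
  moreover have "carrier G = H \<union> (carrier G - H)" using sub by blast
  ultimately have "at_most (2 * k) (carrier G)"
    using k by (metis add_mono card_Un_le finite_UnI mult_2 order.trans)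
  then show False using big by simp
qed

text \<open>Orbit counting: each fibre of the conjugation map is moved into the centralizer by a
  translation.\<close>

lemma carrier_at_most_conjugates:
  assumes a: "a \<in> carrier G" and "at_most k (centralizer a)" "at_most m (conjugates a)"
  shows "at_most (k * m) (carrier G)"
proof -
  let ?f = "\<lambda>y. y \<otimes> a \<otimes> inv y"
  have fib: "at_most k {y \<in> carrier G. ?f y = b}" for b
  proof (cases "{y \<in> carrier G. ?f y = b} = {}")
    case False
    then obtain z where z: "z \<in> carrier G" "?f z = b" by blast
    have "inv z \<otimes> y \<in> centralizer a" if y: "y \<in> carrier G" "?f y = b" for y
    proof -
      have "inv z \<otimes> y \<otimes> a = inv z \<otimes> ?f y \<otimes> y" using y(1) z(1) a by (simp add: m_assoc)
      also have "\<dots> = inv z \<otimes> ?f z \<otimes> y" using y z by simp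
      also have "\<dots> = a \<otimes> (inv z \<otimes> y)" using y(1) z(1) a by (simp add: m_assoc)
      finally have "inv z \<otimes> y \<otimes> a = a \<otimes> (inv z \<otimes> y)" .
      then show ?thesis using y z by (simp add: centralizer_def)
    qed
    then have img: "(\<otimes>) (inv z) ` {y \<in> carrier G. ?f y = b} \<subseteq> centralizer a" by blast
    have inj: "inj_on ((\<otimes>) (inv z)) {y \<in> carrier G. ?f y = b}" using z by (auto simp: inj_on_def)
    show ?thesis using inj_on_finite[OF inj img] card_inj_on_le[OF inj img] assms(2) by auto
  next
    case True
    show ?thesis unfolding True by simp
  qed
  have eq: "carrier G = (\<Union>b\<in>conjugates a. {y \<in> carrier G. ?f y = b})" by (auto simp: conjugates_def)
  have "finite (\<Union>b\<in>conjugates a. {y \<in> carrier G. ?f y = b})" using assms(3) fib by blast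
  then have "finite (carrier G)" using eq by (simp only:)
  moreover have "card (carrier G) \<le> (\<Sum>b\<in>conjugates a. card {y \<in> carrier G. ?f y = b})"
    by (subst eq, rule card_UN_le) (use assms(3) in blast)
  moreover have "\<dots> \<le> card (conjugates a) * k"
    using fib sum_bounded_above[of "conjugates a" "\<lambda>b. card {y \<in> carrier G. ?f y = b}" k] by simp
  moreover have "\<dots> \<le> k * m" using assms(3) by (simp add: mult.commute)
  ultimately show ?thesis by linarith
qed

text \<open>Reineke's theorem on minimal groups, with bounds.\<close>

lemma abelian_if_minimal:
  assumes cen: "\<And>a. a \<in> carrier G \<Longrightarrow> at_most k (centralizer a) \<or> at_most k (carrier G - centralizer a)"
    and con: "\<And>a. a \<in> carrier G \<Longrightarrow> at_most k (conjugates a) \<or> at_most k (carrier G - conjugates a)"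
    and big: "\<not> at_most (k * k + 2 * k) (carrier G)"
  shows "comm_group G"
proof -
  have big2: "\<not> at_most (2 * k) (carrier G)" and big3: "\<not> at_most (k * k) (carrier G)"
    using big by auto
  have cen': "at_most k (centralizer a)" if "a \<in> carrier G" "\<not> central a" for a
  proof -
    have "centralizer a \<noteq> carrier G" using that unfolding central_def centralizer_def by force
    then show ?thesis
      using cen[OF that(1)] subgroup_at_most_or_all[OF subgroup_centralizer[OF that(1)] _ big2] by blast
  qed
  \<comment> \<open>With a small centralizer, a small conjugacy class would bound the group by
    \<open>k * k\<close>, so the class is large.\<close>
  have con': "at_most k (carrier G - conjugates a)" if "a \<in> carrier G" "\<not> central a" for a
    using con[OF that(1)] carrier_at_most_conjugates[OF that(1) cen'[OF that]] big3 by blast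
  have "central a" if "a \<in> carrier G" for a
  proof (rule all_central_if_noncentral_conjugate[OF _ _ that])
    fix a b assume ab: "a \<in> carrier G" "b \<in> carrier G" "\<not> central a" "\<not> central b"
    \<comment> \<open>Two disjoint classes, each missing at most \<open>k\<close> elements, would
      leave at most \<open>2 * k\<close> elements in the group.\<close>
    have "conjugates a \<inter> conjugates b \<noteq> {}"
    proof
      assume "conjugates a \<inter> conjugates b = {}"
      then have "(carrier G - conjugates a) \<union> (carrier G - conjugates b) = carrier G" by blast
      then show False using big2 at_most_Un[OF con'[OF ab(1,3)] con'[OF ab(2,4)]] by (simp only: simp_thms)
    qed
    then obtain y z where yz: "y \<in> carrier G" "z \<in> carrier G" "y \<otimes> a \<otimes> inv y = z \<otimes> b \<otimes> inv z"
      by (auto simp: conjugates_def)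
    have "b = inv z \<otimes> (z \<otimes> b \<otimes> inv z) \<otimes> z" using yz ab by (simp add: m_assoc)
    also have "\<dots> = (inv z \<otimes> y) \<otimes> a \<otimes> inv (inv z \<otimes> y)"
      unfolding yz(3)[symmetric] using yz(1,2) ab by (simp add: m_assoc inv_mult_group)
    finally show "b \<in> conjugates a" unfolding conjugates_def using yz by blast
  next
    fix a assume a: "a \<in> carrier G"
    show "\<exists>n>0. central (a [^] (n::nat))"
    proof (cases "central a")
      case True
      then show ?thesis using a by (intro exI[of _ 1]) simp
    next
      case False
      \<comment> \<open>The powers of a noncentral element lie in its centralizer, which is
        finite.\<close>
      have "range (\<lambda>n::nat. a [^] n) \<subseteq> centralizer a"
        using subgroup_pow_closed[OF subgroup_centralizer[OF a] centralizer_self[OF a]] by blast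
      then have "finite (range (\<lambda>n::nat. a [^] n))" using cen'[OF a False] finite_subset by blast
      then have "\<not> inj (\<lambda>n::nat. a [^] n)" using finite_imageD infinite_UNIV_nat by blast
      then obtain i j :: nat where "i \<noteq> j" and eq: "a [^] i = a [^] j" by (auto simp: inj_def)
      have "\<exists>n>0. a [^] (n::nat) = \<one>" if "i < j" "a [^] i = a [^] j" for i j :: nat
      proof -
        have "a [^] i \<otimes> a [^] (j - i) = a [^] j" using that(1) a by (simp add: nat_pow_mult)
        then have "a [^] (j - i) = \<one>" using that(2) a by (metis l_cancel_one' nat_pow_closed)
        then show ?thesis using that by (intro exI[of _ "j - i"]) simp
      qed
      then obtain n :: nat where "n > 0" "a [^] n = \<one>" using eq \<open>i \<noteq> j\<close> by (metis nat_neq_iff)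
      then show ?thesis by (intro exI[of _ n]) (simp add: central_def)
    qed
  qed
  then show ?thesis by (intro group_comm_groupI) (auto simp: central_def)
qed

end

section \<open>Minimal abelian groups\<close>

lemma (in comm_group) subgroup_powers: "subgroup ((\<lambda>x. x [^] (n::nat)) ` carrier G) G"
proof (rule subgroupI)
  show "(\<lambda>x. x [^] n) ` carrier G \<subseteq> carrier G" "(\<lambda>x. x [^] n) ` carrier G \<noteq> {}" by auto
  fix x assume "x \<in> (\<lambda>x. x [^] n) ` carrier G"
  then obtain y where y: "y \<in> carrier G" "x = y [^] n" by blast
  then show "inv x \<in> (\<lambda>x. x [^] n) ` carrier G" by (intro image_eqI[of _ _ "inv y"]) (auto simp: nat_pow_inv)
  fix x' assume "x' \<in> (\<lambda>x. x [^] n) ` carrier G"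
  then obtain y' where "y' \<in> carrier G" "x' = y' [^] n" by blast
  then show "x \<otimes> x' \<in> (\<lambda>x. x [^] n) ` carrier G"
    using y by (intro image_eqI[of _ _ "y \<otimes> y'"]) (auto simp: nat_pow_distrib)
qed

lemma (in comm_group) subgroup_torsion: "subgroup {x \<in> carrier G. x [^] (n::nat) = \<one>} G"
  by (rule subgroupI) (auto simp: nat_pow_inv nat_pow_distrib intro!: exI[of _ \<one>])

lemma (in comm_group) divisible_if_prime_divisible:
  assumes "\<And>p::nat. prime p \<Longrightarrow> (\<lambda>x. x [^] p) ` carrier G = carrier G"
  shows "divisible_group G"
proof -
  have "\<exists>y\<in>carrier G. y [^] n = x" if "0 < n" "x \<in> carrier G" for n :: nat and x
    using that
  proof (induction n arbitrary: x rule: less_induct)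
    case (less n)
    show ?case
    proof (cases "n = 1")
      case True
      then show ?thesis using less by (intro bexI[of _ x]) auto
    next
      case False
      then obtain p where p: "prime p" "p dvd n" using less by (metis prime_factor_nat)
      then obtain m where m: "n = p * m" by blast
      then have "0 < m" "m < n" using p less prime_gt_1_nat[of p] by auto
      then obtain y where y: "y \<in> carrier G" "y [^] m = x" using less by blast
      then obtain z where "z \<in> carrier G" "y = z [^] p" using assms[OF p(1)] by blast
      then show ?thesis using y m by (intro bexI[of _ z]) (auto simp: nat_pow_pow)
    qed
  qed
  then show ?thesis unfolding divisible_group_def using is_group by blast
qed

text \<open>If the \<open>p\<close>-th powers are not everything, there are only finitely many of
  them. The map to \<open>p\<close>-th powers then has an infinite kernel, which by the dichotomy is
  the whole group.\<close>

lemma (in comm_group) elementary_or_divisible_if_minimal: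
  assumes inf: "infinite (carrier G)"
    and pow: "\<And>n::nat. finite ((\<lambda>x. x [^] n) ` carrier G) \<or> finite (carrier G - (\<lambda>x. x [^] n) ` carrier G)"
    and tor: "\<And>n::nat. finite {x \<in> carrier G. x [^] n = \<one>} \<or> finite (carrier G - {x \<in> carrier G. x [^] n = \<one>})"
  shows "elementary_abelian_group G \<or> divisible_group G"
proof (cases "\<forall>p::nat. prime p \<longrightarrow> (\<lambda>x. x [^] p) ` carrier G = carrier G")
  case True
  then show ?thesis using divisible_if_prime_divisible by blast
next
  case False
  then obtain p :: nat where p: "prime p" "(\<lambda>x. x [^] p) ` carrier G \<noteq> carrier G" by blast
  have all: "H = carrier G" if "subgroup H G" "finite (carrier G - H)" for H
    using subgroup_at_most_or_all[OF that(1), of "card (carrier G - H)"] that(2) inf by blast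
  have fin: "finite ((\<lambda>x. x [^] p) ` carrier G)" using p(2) pow all[OF subgroup_powers] by blast
  define K where "K = {x \<in> carrier G. x [^] p = \<one>}"
  have "infinite K"
  proof
    assume K: "finite K"
    have "finite {x \<in> carrier G. x [^] p = b}" for b
    proof (cases "{x \<in> carrier G. x [^] p = b} = {}")
      case False
      then obtain z where z: "z \<in> carrier G" "z [^] p = b" by blast
      have "(\<lambda>x. x \<otimes> inv z) ` {x \<in> carrier G. x [^] p = b} \<subseteq> K"
        using z by (auto simp: K_def nat_pow_distrib nat_pow_inv)
      moreover have "inj_on (\<lambda>x. x \<otimes> inv z) {x \<in> carrier G. x [^] p = b}" using z by (auto simp: inj_on_def)
      ultimately show ?thesis using K inj_on_finite by blast
    qed (metis finite.emptyI)
    moreover have "carrier G = (\<Union>b\<in>(\<lambda>x. x [^] p) ` carrier G. {x \<in> carrier G. x [^] p = b})" by auto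
    ultimately show False using fin inf by (metis (no_types, lifting) finite_UN)
  qed
  then have "K = carrier G" using tor all[OF subgroup_torsion] unfolding K_def by blast
  then have "\<forall>x\<in>carrier G. x [^] p = \<one>" unfolding K_def by blast
  then show ?thesis using p(1) comm_group_axioms unfolding elementary_abelian_group_def by blast
qed

section \<open>Valued groups\<close>

text \<open>After translation of \<open>b'\<close> to \<open>\<one>\<close>, both
  \<open>C x b b'\<close> and \<open>C b x b'\<close> compare \<open>x b'^-1\<close> with
  \<open>b b'^-1\<close>, so only the class of \<open>x b'^-1\<close> enters.\<close>

lemma (in C_quasi_order) agreeI:
  assumes "B \<subseteq> carrier G" and x: "x \<in> carrier G" and y: "y \<in> carrier G"
    and sim: "\<And>b. b \<in> B \<Longrightarrow> sim (x \<otimes> inv b) (y \<otimes> inv b)"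
  shows "agree B x y"
  unfolding agree_def
proof (intro conjI ballI)
  have one: "u = b \<longleftrightarrow> qo (u \<otimes> inv b) \<one>" if "u \<in> carrier G" "b \<in> carrier G" for u b
    using that by (metis inv_closed inv_equality inv_inv m_closed qo_one_iff r_inv)
  fix b assume b: "b \<in> B"
  then have bG: "b \<in> carrier G" using assms(1) by blast
  show "x = b \<longleftrightarrow> y = b"
    unfolding one[OF x bG] one[OF y bG]
    using sim[OF b] qo_trans x y bG by (meson inv_closed m_closed one_closed)
  fix b' assume b': "b' \<in> B"
  then have b'G: "b' \<in> carrier G" using assms(1) by blast
  show "C x b b' \<longleftrightarrow> C y b b'" "C b x b' \<longleftrightarrow> C b y b'"
    unfolding C_iff[OF x bG b'G] C_iff[OF y bG b'G] C_iff[OF bG x b'G] C_iff[OF bG y b'G]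
    using sim[OF b'] qo_trans x y bG b'G by (meson inv_closed m_closed)+
qed

lemma (in C_quasi_order) finite_least:
  assumes "finite A" "A \<noteq> {}" "A \<subseteq> carrier G"
  shows "\<exists>m\<in>A. \<forall>a\<in>A. qo m a"
  using assms
proof (induction A rule: finite_ne_induct)
  case (singleton x)
  then show ?case by simp
next
  case (insert x F)
  then obtain m where m: "m \<in> F" "\<forall>a\<in>F. qo m a" by auto
  have xG: "x \<in> carrier G" and mG: "m \<in> carrier G" and FG: "F \<subseteq> carrier G" using insert m by auto
  show ?case
  proof (cases "qo x m")
    case True
    have "qo x a" if "a \<in> F" for a using qo_trans[OF True] m(2) that xG mG FG by blast
    then show ?thesis using xG by (intro bexI[of _ x]) auto
  next
    case False
    then have "qo m x" using qo_total xG mG by blast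
    then show ?thesis using m by (intro bexI[of _ m]) auto
  qed
qed

locale C_minimal_valued = C_minimal_quasi_order +
  assumes v_type: "x \<in> carrier G \<Longrightarrow> qo x (inv x)"
begin

lemma qo_inv_left [simp]: "x \<in> carrier G \<Longrightarrow> z \<in> carrier G \<Longrightarrow> qo (inv x) z \<longleftrightarrow> qo x z"
  using v_type[of x] v_type[of "inv x"] qo_trans by (metis inv_closed inv_inv)

lemma qo_inv_right [simp]: "x \<in> carrier G \<Longrightarrow> z \<in> carrier G \<Longrightarrow> qo z (inv x) \<longleftrightarrow> qo z x"
  using v_type[of x] v_type[of "inv x"] qo_trans by (metis inv_closed inv_inv)

text \<open>The ultrametric inequality. If \<open>x\<close> and \<open>y\<close> were both strictly
  below \<open>x y\<close>, \<open>lt_shift\<close> would cancel either factor and give both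
  \<open>lt x y\<close> and \<open>lt y x\<close>.\<close>

lemma mult_qo:
  assumes "qo x z" "qo y z" "x \<in> carrier G" "y \<in> carrier G" "z \<in> carrier G"
  shows "qo (x \<otimes> y) z"
proof (rule ccontr)
  assume z: "lt z (x \<otimes> y)"
  have "lt x (x \<otimes> y)" using qo_lt_trans[OF assms(1) z] assms by simp
  from lt_shift(2)[OF this] have "lt x y" using assms by simp
  have "lt y (x \<otimes> y)" using qo_lt_trans[OF assms(2) z] assms by simp
  from lt_shift(1)[OF this] have "lt y x" using assms by (simp add: m_assoc)
  then show False using \<open>lt x y\<close> qo_total assms by blast
qed

lemma mult_lt:
  assumes "lt x z" "lt y z" "x \<in> carrier G" "y \<in> carrier G" "z \<in> carrier G"
  shows "lt (x \<otimes> y) z"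
proof -
  have "qo (x \<otimes> y) x \<or> qo (x \<otimes> y) y" using mult_qo[of x x y] mult_qo[of x y y] qo_total assms by auto
  then show ?thesis using qo_lt_trans[OF _ assms(1)] qo_lt_trans[OF _ assms(2)] assms by auto
qed

lemma mult_sim:
  assumes "lt x y" "x \<in> carrier G" "y \<in> carrier G"
  shows "sim (x \<otimes> y) y" "sim (y \<otimes> x) y"
proof -
  have q: "qo x y" using lt_imp_qo assms by blast
  have "qo y (x \<otimes> y)" using mult_lt[of y "inv x" "x \<otimes> y"] assms by auto
  then show "sim (x \<otimes> y) y" using mult_qo[of x y y] q assms by simp
  have "qo y (y \<otimes> x)" using mult_lt[of y "y \<otimes> x" "inv x"] assms by (auto simp: m_assoc)
  then show "sim (y \<otimes> x) y" using mult_qo[of y y x] q assms by simp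
qed

lemma pow_qo: "qo x z \<Longrightarrow> x \<in> carrier G \<Longrightarrow> z \<in> carrier G \<Longrightarrow> qo (x [^] (n::nat)) z"
  by (induction n) (auto intro: mult_qo)

lemma pow_lt: "lt x z \<Longrightarrow> x \<in> carrier G \<Longrightarrow> z \<in> carrier G \<Longrightarrow> lt (x [^] (n::nat)) z"
proof (induction n)
  case 0
  then show ?case using qo_one_iff one_lt_iff one_least qo_trans by (metis nat_pow_0 one_closed)
next
  case (Suc n)
  then show ?case using mult_lt[OF Suc.IH[OF Suc.prems] Suc.prems(1)] by simp
qed

lemma diff_lt_trans:
  assumes "lt (x \<otimes> inv b) g" "lt (y \<otimes> inv b) g"
    "x \<in> carrier G" "y \<in> carrier G" "b \<in> carrier G" "g \<in> carrier G"
  shows "lt (x \<otimes> inv y) g"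
proof -
  have "lt (inv (y \<otimes> inv b)) g" using assms by simp
  from mult_lt[OF assms(1) this] have "lt ((x \<otimes> inv b) \<otimes> inv (y \<otimes> inv b)) g" using assms by blast
  then show ?thesis using assms by (simp add: m_assoc inv_mult_group)
qed

text \<open>A far parameter \<open>b\<close> in the ball of \<open>g\<close> has distance of class
  \<open>g\<close> from the element, and a parameter \<open>b\<close> outside of the ball has
  distance of class \<open>b\<close>. Neither depends on the element.\<close>

lemma cell_agree:
  assumes "B \<subseteq> carrier G" "x \<in> carrier G" "y \<in> carrier G" "g \<in> carrier G" "qo x g" "qo y g"
    and far: "\<And>b. b \<in> B \<Longrightarrow> qo g (x \<otimes> inv b) \<and> qo g (y \<otimes> inv b)"
  shows "agree B x y"
proof (rule agreeI[OF assms(1-3)])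
  fix b assume b: "b \<in> B"
  then have bG: "b \<in> carrier G" using assms(1) by blast
  show "sim (x \<otimes> inv b) (y \<otimes> inv b)"
  proof (cases "qo b g")
    case True
    have "qo (x \<otimes> inv b) g" "qo (y \<otimes> inv b) g" using mult_qo assms bG True by simp_all
    then show ?thesis using far[OF b] qo_trans[of _ g] assms bG by blast
  next
    case False
    have "lt x (inv b)" "lt y (inv b)" using qo_lt_trans[OF _ False] assms bG by simp_all
    from mult_sim(1)[OF this(1)] mult_sim(1)[OF this(2)] show ?thesis
      using qo_trans[of _ "inv b"] assms bG by (meson inv_closed m_closed)
  qed
qed

text \<open>The elements lie in different cosets of the open ball of \<open>g\<close>. Distances are
  used because the notion is needed before the quotient by that ball is available.\<close>

definition separated :: "'a \<Rightarrow> 'a set \<Rightarrow> bool" where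
  "separated g Y \<longleftrightarrow> (\<forall>x\<in>Y. \<forall>y\<in>Y. x \<noteq> y \<longrightarrow> qo g (x \<otimes> inv y))"

text \<open>Pigeonhole: a parameter at distance less than \<open>g\<close> from two members would
  bring these closer than \<open>g\<close> to each other, so each parameter excludes at most one
  member.\<close>

lemma far_element_exists:
  assumes B: "finite B" "card B \<le> k" "B \<subseteq> carrier G"
    and Y: "Y \<subseteq> carrier G" "\<not> at_most k Y" "separated g Y" and g: "g \<in> carrier G"
  shows "\<exists>x\<in>Y. \<forall>b\<in>B. qo g (x \<otimes> inv b)"
proof (rule ccontr)
  assume "\<not> ?thesis"
  then have "\<forall>x\<in>Y. \<exists>b\<in>B. lt (x \<otimes> inv b) g" by blast
  then obtain f where f: "\<And>x. x \<in> Y \<Longrightarrow> f x \<in> B \<and> lt (x \<otimes> inv (f x)) g" by metis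
  have "inj_on f Y"
  proof (rule inj_onI, rule ccontr)
    fix x y assume xy: "x \<in> Y" "y \<in> Y" "f x = f y" "x \<noteq> y"
    then have "lt (x \<otimes> inv y) g" using diff_lt_trans[of g x "f x" y] f[of x] f[of y] B(3) Y(1) g by auto
    then show False using Y(3) xy unfolding separated_def by blast
  qed
  moreover have "f ` Y \<subseteq> B" using f by blast
  ultimately have "finite Y" "card Y \<le> card B" using inj_on_finite card_inj_on_le B(1) by blast+
  then show False using Y(2) B(2) by simp
qed

lemma detE:
  assumes "det k D"
  obtains B where "B \<subseteq> carrier G" "finite B" "card B \<le> k"
    "\<And>x y. x \<in> carrier G \<Longrightarrow> y \<in> carrier G \<Longrightarrow> agree B x y \<Longrightarrow> x \<in> D \<longleftrightarrow> y \<in> D"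
  using assms unfolding det_def by blast

text \<open>Used for contradictions, with \<open>X\<close> inside and \<open>Y\<close> outside of
  \<open>D\<close>: elements of the ball that are far from all parameters look alike.\<close>

lemma det_cells:
  assumes D: "det k D" and g: "g \<in> carrier G"
    and X: "X \<subseteq> carrier G" "\<And>x. x \<in> X \<Longrightarrow> qo x g" "\<not> at_most k X" "separated g X"
    and Y: "Y \<subseteq> carrier G" "\<And>x. x \<in> Y \<Longrightarrow> qo x g" "\<not> at_most k Y" "separated g Y"
  shows "\<exists>x\<in>X. \<exists>y\<in>Y. x \<in> D \<longleftrightarrow> y \<in> D"
proof -
  obtain B where B: "B \<subseteq> carrier G" "finite B" "card B \<le> k"
    "\<And>x y. x \<in> carrier G \<Longrightarrow> y \<in> carrier G \<Longrightarrow> agree B x y \<Longrightarrow> x \<in> D \<longleftrightarrow> y \<in> D"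
    using detE[OF D] by blast
  obtain x where x: "x \<in> X" "\<And>b. b \<in> B \<Longrightarrow> qo g (x \<otimes> inv b)"
    using far_element_exists[OF B(2,3,1) X(1,3,4) g] by blast
  obtain y where y: "y \<in> Y" "\<And>b. b \<in> B \<Longrightarrow> qo g (y \<otimes> inv b)"
    using far_element_exists[OF B(2,3,1) Y(1,3,4) g] by blast
  have "agree B x y" using B(1) x y X Y g by (intro cell_agree[of B x y g]) auto
  then have "x \<in> D \<longleftrightarrow> y \<in> D" using B(4)[of x y] x(1) y(1) X(1) Y(1) by blast
  then show ?thesis using x(1) y(1) by blast
qed

text \<open>If \<open>u\<close> were outside of \<open>H\<close>, the translate of \<open>Y\<close>
  by \<open>u\<close> would be a separated family in the same ball but outside of \<open>H\<close>,
  and \<open>k\<close> parameters cannot distinguish the two families.\<close>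

lemma ball_subset_subgroup:
  assumes H: "subgroup H G" "det k H" and g: "g \<in> carrier G"
    and Y: "Y \<subseteq> H" "\<And>x. x \<in> Y \<Longrightarrow> qo x g" "\<not> at_most k Y" "separated g Y"
    and u: "u \<in> carrier G" "qo u g"
  shows "u \<in> H"
proof (rule ccontr)
  assume uH: "u \<notin> H"
  have YG: "Y \<subseteq> carrier G" using Y(1) subgroup.subset[OF H(1)] by blast
  define Z where "Z = (\<lambda>y. y \<otimes> u) ` Y"
  have inj: "inj_on (\<lambda>y. y \<otimes> u) Y" using u YG by (auto simp: inj_on_def subset_iff)
  have "\<exists>x\<in>Y. \<exists>z\<in>Z. x \<in> H \<longleftrightarrow> z \<in> H"
  proof (rule det_cells[OF H(2) g YG Y(2,3,4)])
    show "Z \<subseteq> carrier G" using YG u by (auto simp: Z_def)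
    show "qo z g" if "z \<in> Z" for z using that Y(2) YG u g by (auto simp: Z_def intro!: mult_qo)
    show "\<not> at_most k Z" using Y(3) inj by (simp add: Z_def finite_image_iff card_image)
    show "separated g Z"
      unfolding separated_def
    proof (intro ballI impI)
      fix a b assume "a \<in> Z" "b \<in> Z" "a \<noteq> b"
      then obtain x y where xy: "x \<in> Y" "y \<in> Y" "a = x \<otimes> u" "b = y \<otimes> u" "x \<noteq> y" by (auto simp: Z_def)
      then have "a \<otimes> inv b = x \<otimes> inv y" using YG u by (auto simp: m_assoc inv_mult_group subset_iff)
      then show "qo g (a \<otimes> inv b)" using Y(4) xy unfolding separated_def by simp
    qed
  qed
  then obtain x y where xy: "x \<in> Y" "y \<in> Y" "x \<in> H \<longleftrightarrow> y \<otimes> u \<in> H" by (auto simp: Z_def)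
  then have "y \<otimes> u \<in> H" "inv y \<in> H" using Y(1) subgroup.m_inv_closed[OF H(1)] by auto
  then have "inv y \<otimes> (y \<otimes> u) \<in> H" using subgroup.m_closed[OF H(1)] by blast
  then show False using uH u xy YG by (simp add: subset_iff)
qed

text \<open>Conjugation acts on the classes monotonically and might shift them. The set
  \<open>P\<close> of elements that shift the class of \<open>g\<close> down contains the positive
  powers, but not the inverses, of its members. Finitely many parameters cannot see this
  asymmetry.\<close>

lemma conj_qo:
  assumes g: "g \<in> carrier G" and z: "z \<in> carrier G"
  shows "qo g (z \<otimes> g \<otimes> inv z)"
proof (rule ccontr)
  define P where "P = {z \<in> carrier G. lt (z \<otimes> g \<otimes> inv z) g}"
  assume "\<not> ?thesis"
  then have zP: "z \<in> P" using z by (simp add: P_def)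
  have PG: "P \<subseteq> carrier G" by (auto simp: P_def)
  have "Def (\<lambda>e. \<not> qo (e 1) (e 0 \<otimes> e 1 \<otimes> inv (e 0)))" by (intro Def_intros)
  then obtain k where "\<forall>a\<in>carrier G. det k {x \<in> carrier G. lt (x \<otimes> a \<otimes> inv x) a}"
    using uniformly_det1[of "\<lambda>x a. lt (x \<otimes> a \<otimes> inv x) a"] by blast
  then have detP: "det k P" using g by (simp add: P_def)
  then obtain B where B: "B \<subseteq> carrier G" "finite B" "card B \<le> k"
    "\<And>x y. x \<in> carrier G \<Longrightarrow> y \<in> carrier G \<Longrightarrow> agree B x y \<Longrightarrow> x \<in> P \<longleftrightarrow> y \<in> P"
    using detE by blast
  have inv_notin: "inv x \<notin> P" if x: "x \<in> P" for x
  proof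
    assume "inv x \<in> P"
    then have "lt (inv x \<otimes> g \<otimes> x) g" using x by (simp add: P_def)
    then have "lt (x \<otimes> (inv x \<otimes> g \<otimes> x) \<otimes> inv x) (x \<otimes> g \<otimes> inv x)"
      using qo_conj x g PG by auto
    moreover have "x \<otimes> (inv x \<otimes> g \<otimes> x) \<otimes> inv x = g" using x g PG by (auto simp: m_assoc)
    ultimately have "lt g (x \<otimes> g \<otimes> inv x)" by simp
    then show False using x g qo_total[of g "x \<otimes> g \<otimes> inv x"] by (auto simp: P_def)
  qed
  \<comment> \<open>An element whose class contains no parameter has the same type as its inverse,
    but \<open>P\<close> separates the two.\<close>
  have near: "\<exists>b\<in>B. sim b x" if x: "x \<in> P" for x
  proof (rule ccontr)
    assume no: "\<not> ?thesis"
    have xG: "x \<in> carrier G" using x PG by blast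
    have far: "qo x (w \<otimes> inv b)" if b: "b \<in> B" and w: "w = x \<or> w = inv x" for b w
    proof -
      have bG: "b \<in> carrier G" using b B(1) by blast
      have wG: "w \<in> carrier G" and xw: "qo x w" and wx: "qo w x" using w xG by auto
      have "\<not> sim b x" using no b by blast
      then consider "lt b x" | "lt x b" by blast
      then show ?thesis
      proof cases
        case 1
        then have "lt (inv b) w" using lt_qo_trans[OF 1 xw] bG xG wG by simp
        from mult_sim(2)[OF this] have "qo w (w \<otimes> inv b)" using bG wG by simp
        then show ?thesis using qo_trans[OF xw] xG wG bG by simp
      next
        case 2
        then have "lt w (inv b)" using qo_lt_trans[OF wx 2] bG xG wG by simp
        from mult_sim(1)[OF this] have "qo (inv b) (w \<otimes> inv b)" using bG wG by simp
        moreover have "qo x (inv b)" using lt_imp_qo[OF 2] bG xG by simp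
        ultimately show ?thesis using qo_trans xG wG bG by (meson inv_closed m_closed)
      qed
    qed
    have "agree B x (inv x)"
      using xG far by (intro cell_agree[of B x "inv x" x] B(1)) auto
    then show False using B(4)[of x "inv x"] x xG inv_notin[OF x] by simp
  qed
  \<comment> \<open>\<open>P\<close> meets only classes of parameters, hence finitely many;
    \<open>y\<close> is taken in the least of them.\<close>
  define B' where "B' = {b \<in> B. \<exists>x\<in>P. sim b x}"
  have "B' \<noteq> {}" using near[OF zP] zP by (auto simp: B'_def)
  then obtain b0 where b0: "b0 \<in> B'" "\<And>b. b \<in> B' \<Longrightarrow> qo b0 b"
    using finite_least[of B'] B by (auto simp: B'_def)
  obtain y where y: "y \<in> P" "sim b0 y" using b0(1) by (auto simp: B'_def)
  have yG: "y \<in> carrier G" using y PG by blast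
  have least: "qo y x" if x: "x \<in> P" for x
  proof -
    obtain b where b: "b \<in> B" "sim b x" using near[OF x] by blast
    then have "qo b0 b" using b0(2) x by (auto simp: B'_def)
    have G: "b0 \<in> carrier G" "b \<in> carrier G" "x \<in> carrier G" using b0 b B(1) x PG by (auto simp: B'_def)
    show ?thesis using qo_trans[of y b0 b] qo_trans[of y b x] \<open>qo b0 b\<close> y b G yG by blast
  qed
  have pow: "y [^] n \<in> P" if "0 < n" for n :: nat
    using that
  proof (induction n)
    case (Suc n)
    show ?case
    proof (cases "n = 0")
      case True
      then show ?thesis using y yG by simp
    next
      case False
      then have IH: "y [^] n \<in> P" using Suc by simp
      have "lt (y [^] n \<otimes> (y \<otimes> g \<otimes> inv y) \<otimes> inv (y [^] n)) (y [^] n \<otimes> g \<otimes> inv (y [^] n))"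
        using y(1) yG g qo_conj by (simp add: P_def)
      then have "lt (y [^] n \<otimes> (y \<otimes> g \<otimes> inv y) \<otimes> inv (y [^] n)) g"
        using IH lt_trans g yG by (simp add: P_def)
      moreover have "y [^] n \<otimes> (y \<otimes> g \<otimes> inv y) \<otimes> inv (y [^] n) = y [^] Suc n \<otimes> g \<otimes> inv (y [^] Suc n)"
        using g yG by (simp add: m_assoc inv_mult_group)
      ultimately show ?thesis using yG by (simp add: P_def)
    qed
  qed simp
  have powqo: "qo (y [^] n) y" for n :: nat using yG by (intro pow_qo) auto
  \<comment> \<open>Up to inversion the quotient of two powers of \<open>y\<close> is a positive
    power, which lies in \<open>P\<close> and so is not below the least class. The powers are
    therefore separated at distance \<open>y\<close>.\<close>
  have diff: "qo y (y [^] i \<otimes> inv (y [^] j))" "qo y (inv (y [^] i) \<otimes> y [^] j)" if "i \<noteq> j" for i j :: nat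
  proof -
    have *: "qo y (y [^] i \<otimes> inv (y [^] j)) \<and> qo y (inv (y [^] i) \<otimes> y [^] j)" if "i < j" for i j :: nat
    proof -
      have e: "y [^] j = y [^] i \<otimes> y [^] (j - i)" "y [^] j = y [^] (j - i) \<otimes> y [^] i"
        using that yG by (simp_all add: nat_pow_mult)
      have "y [^] i \<otimes> inv (y [^] j) = inv (y [^] (j - i))" by (subst e(2)) (use yG in \<open>simp add: inv_mult_group\<close>)
      moreover have "inv (y [^] i) \<otimes> y [^] j = y [^] (j - i)" by (subst e(1)) (use yG in simp)
      ultimately show ?thesis using least[OF pow[of "j - i"]] that yG by simp
    qed
    have "inv (y [^] i \<otimes> inv (y [^] j)) = y [^] j \<otimes> inv (y [^] i)"
      "inv (inv (y [^] i) \<otimes> y [^] j) = inv (y [^] j) \<otimes> y [^] i" using yG by (simp_all add: inv_mult_group)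
    then have "qo y (y [^] i \<otimes> inv (y [^] j)) \<longleftrightarrow> qo y (y [^] j \<otimes> inv (y [^] i))"
      "qo y (inv (y [^] i) \<otimes> y [^] j) \<longleftrightarrow> qo y (inv (y [^] j) \<otimes> y [^] i)"
      using qo_inv_right[of "y [^] i \<otimes> inv (y [^] j)" y] qo_inv_right[of "inv (y [^] i) \<otimes> y [^] j" y] yG by auto
    then show "qo y (y [^] i \<otimes> inv (y [^] j))" "qo y (inv (y [^] i) \<otimes> y [^] j)"
      using *[of i j] *[of j i] that by (auto simp: neq_iff)
  qed
  have y1: "\<not> qo y \<one>" using y(1) yG g qo_one_iff by (auto simp: P_def)
  have inj: "inj (\<lambda>n::nat. y [^] n)" using diff(1) y1 yG by (intro injI) (metis nat_pow_closed r_inv)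
  define X where "X = (\<lambda>n::nat. y [^] n) ` {0<..}"
  define Y where "Y = (\<lambda>n::nat. inv (y [^] n)) ` {0<..}"
  have "infinite X" unfolding X_def using inj inj_on_subset infinite_Ioi by (metis finite_imageD subset_UNIV)
  moreover have "Y = (\<lambda>x. inv x) ` X" by (simp add: X_def Y_def image_image)
  moreover have "inj_on (\<lambda>x. inv x) X"
    using yG by (auto simp: X_def inj_on_def) (metis inv_inv nat_pow_closed)
  ultimately have infY: "infinite Y" using finite_imageD by blast
  \<comment> \<open>Positive powers lie in \<open>P\<close>, negative ones do not, and both families
    are infinite and separated in the ball of \<open>y\<close>.\<close>
  have "\<exists>x\<in>X. \<exists>u\<in>Y. x \<in> P \<longleftrightarrow> u \<in> P"
  proof (rule det_cells[OF detP yG])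
    show "X \<subseteq> carrier G" "Y \<subseteq> carrier G" using yG by (auto simp: X_def Y_def)
    show "qo x y" if "x \<in> X" for x using that powqo by (auto simp: X_def)
    show "qo x y" if "x \<in> Y" for x using that powqo yG by (auto simp: Y_def)
    show "\<not> at_most k X" "\<not> at_most k Y" using \<open>infinite X\<close> infY by auto
    show "separated y X" unfolding separated_def X_def by (auto intro!: diff(1))
    show "separated y Y" unfolding separated_def Y_def using yG by (auto intro!: diff(2))
  qed
  then show False using pow inv_notin by (auto simp: X_def Y_def)
qed

lemma conj_sim:
  assumes g: "g \<in> carrier G" and z: "z \<in> carrier G"
  shows "sim (z \<otimes> g \<otimes> inv z) g"
proof -
  have "qo (z \<otimes> g \<otimes> inv z) (inv z \<otimes> (z \<otimes> g \<otimes> inv z) \<otimes> inv (inv z))"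
    using assms by (intro conj_qo) auto
  moreover have "inv z \<otimes> (z \<otimes> g \<otimes> inv z) \<otimes> inv (inv z) = g" using assms by (simp add: m_assoc)
  ultimately show ?thesis using conj_qo[OF assms] by simp
qed

end

section \<open>Quotients of subgroups by normal subgroups of the whole group\<close>

locale subquotient = group G for G (structure) +
  fixes S N :: "'a set"
  assumes subgroup_S: "subgroup S G" and normal_N: "N \<lhd> G" and N_subset: "N \<subseteq> S"
begin

abbreviation Q :: "'a set monoid" where
  "Q \<equiv> (G\<lparr>carrier := S\<rparr>) Mod N"

lemma S_closed: "x \<in> S \<Longrightarrow> x \<in> carrier G"
  using subgroup.subset[OF subgroup_S] by blast

lemma normal_N_S: "N \<lhd> G\<lparr>carrier := S\<rparr>"
  using normal_restrict_supergroup[OF subgroup_S normal_N N_subset] .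

lemma group_Q: "group Q"
  using normal.factorgroup_is_group[OF normal_N_S] .

lemma carrier_Q: "carrier Q = (\<lambda>x. N #> x) ` S"
  by (simp add: carrier_FactGroup r_coset_def)

lemma mult_Q: "x \<in> S \<Longrightarrow> y \<in> S \<Longrightarrow> (N #> x) \<otimes>\<^bsub>Q\<^esub> (N #> y) = N #> (x \<otimes> y)"
  using normal.rcos_sum[OF normal_N_S, of x y] by (simp add: r_coset_def)

lemma pow_Q: "x \<in> S \<Longrightarrow> (N #> x) [^]\<^bsub>Q\<^esub> (n::nat) = N #> (x [^] n)"
  using normal.FactGroup_pow[OF normal_N_S, of x n] by (simp add: r_coset_def nat_pow_consistent[symmetric])

lemma coset_eq_iff:
  assumes "x \<in> carrier G" "y \<in> carrier G"
  shows "N #> x = N #> y \<longleftrightarrow> x \<otimes> inv y \<in> N"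
proof -
  have N: "subgroup N G" using normal_N by (rule normal_imp_subgroup)
  show ?thesis
  proof
    assume "N #> x = N #> y"
    then have "x \<in> N #> y" using rcos_self[OF assms(1) N] by simp
    then obtain n where "n \<in> N" "x = n \<otimes> y" by (auto simp: r_coset_def)
    then show "x \<otimes> inv y \<in> N" using assms subgroup.mem_carrier[OF N] by (simp add: m_assoc)
  next
    assume "x \<otimes> inv y \<in> N"
    then have "x \<otimes> inv y \<otimes> y \<in> N #> y" by (auto simp: r_coset_def)
    then have "x \<in> N #> y" using assms by (simp add: m_assoc)
    then show "N #> x = N #> y" using repr_independence[OF _ assms(2) N] by simp
  qed
qed

lemma inv_Q:
  assumes "x \<in> S"
  shows "inv\<^bsub>Q\<^esub> (N #> x) = N #> inv x"
proof -
  interpret Q: group Q by (rule group_Q)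
  have x: "inv x \<in> S" "x \<in> carrier G" "N #> x \<in> carrier Q" "N #> inv x \<in> carrier Q"
    using assms subgroup.m_inv_closed[OF subgroup_S] S_closed by (auto simp: carrier_Q)
  have "(N #> inv x) \<otimes>\<^bsub>Q\<^esub> (N #> x) = \<one>\<^bsub>Q\<^esub>"
    using mult_Q[OF x(1) assms] x(2) coset_mult_one[OF subgroup.subset[OF normal_imp_subgroup[OF normal_N]]]
    by simp
  then show ?thesis using x by (intro Q.inv_equality) auto
qed

lemma comm_group_Q_iff:
  "comm_group Q \<longleftrightarrow> (\<forall>x\<in>S. \<forall>y\<in>S. x \<otimes> y \<otimes> inv (y \<otimes> x) \<in> N)"
proof -
  interpret Q: group Q by (rule group_Q)
  have "comm_group Q \<longleftrightarrow> (\<forall>a\<in>carrier Q. \<forall>b\<in>carrier Q. a \<otimes>\<^bsub>Q\<^esub> b = b \<otimes>\<^bsub>Q\<^esub> a)"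
    using Q.group_comm_groupI comm_monoid.m_comm comm_group.axioms(1) by metis
  also have "\<dots> \<longleftrightarrow> (\<forall>x\<in>S. \<forall>y\<in>S. N #> (x \<otimes> y) = N #> (y \<otimes> x))"
    by (simp add: carrier_Q mult_Q del: mult_FactGroup)
  also have "\<dots> \<longleftrightarrow> (\<forall>x\<in>S. \<forall>y\<in>S. x \<otimes> y \<otimes> inv (y \<otimes> x) \<in> N)"
    using coset_eq_iff S_closed by simp
  finally show ?thesis .
qed

end

context C_minimal_valued
begin

definition ball :: "'a \<Rightarrow> 'a set" where
  "ball g = {x \<in> carrier G. qo x g}"

definition open_ball :: "'a \<Rightarrow> 'a set" where
  "open_ball g = {x \<in> carrier G. lt x g}"

abbreviation quot :: "'a \<Rightarrow> 'a set monoid" where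
  "quot g \<equiv> (G\<lparr>carrier := ball g\<rparr>) Mod (open_ball g)"

text \<open>The ultrametric inequality gives closure under products, and \<open>conj_sim\<close>
  closure under conjugation.\<close>

lemma normal_down_closed:
  assumes "S \<subseteq> carrier G" "\<one> \<in> S" "\<And>x y. x \<in> S \<Longrightarrow> y \<in> carrier G \<Longrightarrow> qo y x \<Longrightarrow> y \<in> S"
  shows "S \<lhd> G"
proof (rule normal_invI)
  show "subgroup S G"
  proof (rule subgroupI)
    fix x assume x: "x \<in> S"
    then show "inv x \<in> S" using assms(1) assms(3)[OF x, of "inv x"] by auto
    fix y assume y: "y \<in> S"
    have xy: "x \<in> carrier G" "y \<in> carrier G" using x y assms(1) by auto
    then have "qo (x \<otimes> y) x \<or> qo (x \<otimes> y) y" using mult_qo[of x x y] mult_qo[of x y y] qo_total by auto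
    then show "x \<otimes> y \<in> S" using assms(3) x y xy by blast
  qed (use assms in auto)
  show "x \<otimes> h \<otimes> inv x \<in> S" if "x \<in> carrier G" "h \<in> S" for x h
    using assms(1) assms(3)[OF that(2)] conj_sim[of h x] that by auto
qed

lemma normal_ball: "g \<in> carrier G \<Longrightarrow> ball g \<lhd> G"
  by (rule normal_down_closed) (auto simp: ball_def intro: qo_trans)

lemma normal_open_ball: "g \<in> carrier G \<Longrightarrow> g \<noteq> \<one> \<Longrightarrow> open_ball g \<lhd> G"
  by (rule normal_down_closed) (auto simp: open_ball_def one_lt_iff intro: qo_trans)

lemma subquotient_ball:
  assumes "g \<in> carrier G" "g \<noteq> \<one>"
  shows "subquotient G (ball g) (open_ball g)"
proof (intro subquotient.intro subquotient_axioms.intro)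
  show "group G" by (rule is_group)
  show "subgroup (ball g) G" using normal_ball[OF assms(1)] by (rule normal_imp_subgroup)
  show "open_ball g \<lhd> G" using normal_open_ball[OF assms] .
  show "open_ball g \<subseteq> ball g" using qo_total assms by (auto simp: ball_def open_ball_def)
qed

subsection \<open>Definable subgroups and their cores\<close>

lemma centralizers_det: "\<exists>k. \<forall>a\<in>carrier G. det k (centralizer a)"
proof -
  have "Def (\<lambda>e. e 0 \<otimes> e 1 = e 1 \<otimes> e 0)" by (intro Def_intros)
  from uniformly_det1[of "\<lambda>x a. x \<otimes> a = a \<otimes> x", OF this] show ?thesis by (simp add: centralizer_def)
qed

text \<open>The union of the balls contained in \<open>H\<close>.\<close>

definition core :: "'a set \<Rightarrow> 'a set" where
  "core H = {y \<in> carrier G. ball y \<subseteq> H}"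

text \<open>When a shell, that is a class of \<open>sim\<close>, contains no parameter, every
  parameter has distance at least \<open>y\<close> from all of its elements, so
  \<open>cell_agree\<close> applies.\<close>

lemma shell_agree:
  assumes "B \<subseteq> carrier G" "x \<in> carrier G" "y \<in> carrier G" "sim x y" "\<And>b. b \<in> B \<Longrightarrow> \<not> sim b y"
  shows "agree B x y"
proof (rule cell_agree[OF assms(1-3,3)])
  fix b assume b: "b \<in> B"
  then have bG: "b \<in> carrier G" using assms(1) by blast
  have far: "qo y (w \<otimes> inv b)" if w: "w \<in> carrier G" "sim w y" for w
  proof -
    consider "lt b y" | "lt y b" using assms(5)[OF b] by blast
    then show ?thesis
    proof cases
      case 1
      then have "lt (inv b) w" using lt_qo_trans[OF 1, of w] w bG assms(3) by simp
      from mult_sim(2)[OF this] have "qo w (w \<otimes> inv b)" using bG w by simp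
      then show ?thesis using qo_trans[of y w] assms(3) w bG by simp
    next
      case 2
      then have "lt w (inv b)" using qo_lt_trans[of w y b] bG assms(3) w by simp
      from mult_sim(1)[OF this] have "qo (inv b) (w \<otimes> inv b)" using bG w by simp
      moreover have "qo y (inv b)" using lt_imp_qo[OF 2] bG assms(3) by simp
      ultimately show ?thesis using qo_trans[of y "inv b"] assms(3) w bG by simp
    qed
  qed
  show "qo y (x \<otimes> inv b) \<and> qo y (y \<otimes> inv b)" using far[of x] far[of y] assms by simp
qed (use assms in auto)

text \<open>Outside the core of \<open>H\<close>, an element of \<open>H\<close> lies in a shell of one of the parameters, and its
  image modulo the next smaller ball has order at most \<open>k\<close>.\<close>

lemma not_in_core:
  assumes H: "subgroup H G" "det k H"
    and B: "B \<subseteq> carrier G" "\<And>x y. x \<in> carrier G \<Longrightarrow> y \<in> carrier G \<Longrightarrow> agree B x y \<Longrightarrow> x \<in> H \<longleftrightarrow> y \<in> H"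
    and y: "y \<in> H" "y \<notin> core H"
  shows "\<exists>b\<in>B. sim b y" "lt (y [^] (fact k :: nat)) y"
proof -
  have yG: "y \<in> carrier G" using y(1) subgroup.mem_carrier[OF H(1)] by blast
  obtain u where u: "u \<in> carrier G" "qo u y" "u \<notin> H" using y(2) yG by (auto simp: core_def ball_def)
  show "\<exists>b\<in>B. sim b y"
  proof (rule ccontr)
    assume "\<not> ?thesis"
    \<comment> \<open>Without a parameter in the shell of \<open>y\<close>, all of the shell lies in
      \<open>H\<close>; a smaller \<open>u\<close> is then the quotient of the elements
      \<open>u y\<close> and \<open>y\<close> of the shell.\<close>
    then have shell: "x \<in> H" if "x \<in> carrier G" "sim x y" for x
      using shell_agree[OF B(1) that(1) yG that(2)] B(2)[OF that(1) yG] y(1) by blast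
    then have "lt u y" using u by blast
    then have "u \<otimes> y \<in> H" using mult_sim(1)[OF _ u(1) yG] u yG by (intro shell) auto
    then have "u \<otimes> y \<otimes> inv y \<in> H" using y(1) H(1) by (meson subgroup.m_closed subgroup.m_inv_closed)
    then show False using u yG by (simp add: m_assoc)
  qed
  have y1: "y \<noteq> \<one>" using u qo_one_iff subgroup.one_closed[OF H(1)] by metis
  then have one_y: "lt \<one> y" using yG one_lt_iff by simp
  define Y where "Y = (\<lambda>i::nat. y [^] i) ` {1..Suc k}"
  \<comment> \<open>Otherwise \<open>y\<close>, ..., \<open>y^(k+1)\<close> would be
    \<open>k + 1\<close> separated elements of \<open>H\<close>, and the ball of \<open>y\<close>
    would lie in \<open>H\<close>.\<close>
  have "\<exists>i j. 1 \<le> i \<and> i < j \<and> j \<le> Suc k \<and> lt (y [^] i \<otimes> inv (y [^] j)) y"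
  proof (rule ccontr)
    assume neg: "\<not> ?thesis"
    have sep: "qo y (y [^] i \<otimes> inv (y [^] j))" if "i \<in> {1..Suc k}" "j \<in> {1..Suc k}" "i \<noteq> j" for i j :: nat
    proof (cases "i < j")
      case True
      then show ?thesis using neg that by auto
    next
      case False
      then have "qo y (y [^] j \<otimes> inv (y [^] i))" using neg that by auto
      moreover have "y [^] i \<otimes> inv (y [^] j) = inv (y [^] j \<otimes> inv (y [^] i))"
        using yG by (simp add: inv_mult_group)
      ultimately show ?thesis using yG by (simp del: inv_mult_group)
    qed
    have "inj_on (\<lambda>i::nat. y [^] i) {1..Suc k}"
    proof (rule inj_onI, rule ccontr)
      fix i j :: nat assume ij: "i \<in> {1..Suc k}" "j \<in> {1..Suc k}" "y [^] i = y [^] j" "i \<noteq> j"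
      then show False using sep[OF ij(1,2,4)] yG one_y by simp
    qed
    then have "\<not> at_most k Y" by (simp add: Y_def card_image)
    moreover have "Y \<subseteq> H" using y(1) subgroup_pow_closed[OF H(1)] by (auto simp: Y_def)
    moreover have "separated y Y" unfolding separated_def Y_def by (auto intro!: sep)
    moreover have "qo x y" if "x \<in> Y" for x using that yG by (auto simp: Y_def intro: pow_qo)
    ultimately have "u \<in> H" using ball_subset_subgroup[OF H yG, of Y u] u by blast
    then show False using u by simp
  qed
  then obtain i j :: nat where ij: "1 \<le> i" "i < j" "j \<le> Suc k" "lt (y [^] i \<otimes> inv (y [^] j)) y" by blast
  define n where "n = j - i"
  have "y [^] j = y [^] n \<otimes> y [^] i" using ij yG by (simp add: n_def nat_pow_mult)
  then have "y [^] i \<otimes> inv (y [^] j) = inv (y [^] n)" using yG by (simp add: inv_mult_group)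
  then have n: "lt (y [^] n) y" using ij(4) yG by simp
  \<comment> \<open>The exponent \<open>n\<close> is at most \<open>k\<close>; the factorial
    replaces it by one that does not depend on \<open>y\<close>.\<close>
  have "n dvd fact k" using ij by (intro dvd_fact) (auto simp: n_def)
  then obtain q where "fact k = n * q" by blast
  then have "y [^] (fact k :: nat) = (y [^] n) [^] q" using yG by (simp add: nat_pow_pow)
  then show "lt (y [^] (fact k :: nat)) y" using pow_lt[OF n] yG by simp
qed

text \<open>As long as the iterated powers stay outside of the core, they descend strictly through
  shells that contain parameters. There are at most \<open>k\<close> such shells but
  \<open>k + 1\<close> iterates, whence the exponent \<open>fact k ^ k\<close>.\<close>

lemma power_in_core:
  assumes H: "subgroup H G" "det k H" and y: "y \<in> H"
  shows "y [^] ((fact k :: nat) ^ k) \<in> core H"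
proof -
  obtain B where B: "B \<subseteq> carrier G" "finite B" "card B \<le> k"
    "\<And>x y. x \<in> carrier G \<Longrightarrow> y \<in> carrier G \<Longrightarrow> agree B x y \<Longrightarrow> x \<in> H \<longleftrightarrow> y \<in> H"
    using detE[OF H(2)] by blast
  have yG: "y \<in> carrier G" using y subgroup.mem_carrier[OF H(1)] by blast
  define F where "F = (fact k :: nat)"
  define s where "s i = y [^] (F ^ i)" for i :: nat
  have sH: "s i \<in> H" and sG: "s i \<in> carrier G" for i
    using subgroup_pow_closed[OF H(1) y] yG by (auto simp: s_def)
  have s_Suc: "s (Suc i) = s i [^] F" for i
    using yG by (simp add: s_def nat_pow_pow mult.commute)
  have "\<exists>i\<le>k. s i \<in> core H"
  proof (rule ccontr)
    assume "\<not> ?thesis"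
    then have nc: "s i \<notin> core H" if "i \<le> k" for i using that by blast
    have step: "lt (s (Suc i)) (s i)" if "i \<le> k" for i
      using not_in_core(2)[OF H B(1) B(4) sH nc[OF that]] unfolding s_Suc F_def by blast
    have dec: "lt (s j) (s i)" if "i < j" "j \<le> k" for i j
      using that
    proof (induction j)
      case (Suc j)
      then have "lt (s (Suc j)) (s j)" using step by simp
      then show ?case using Suc lt_trans[of "s j" "s (Suc j)" "s i"] sG by (cases "i = j") auto
    qed simp
    have "\<forall>i\<in>{..k}. \<exists>b\<in>B. sim b (s i)"
      using not_in_core(1)[OF H B(1) B(4) sH nc] by blast
    then obtain f where f: "\<And>i. i \<le> k \<Longrightarrow> f i \<in> B \<and> sim (f i) (s i)" by (metis atMost_iff)
    have "inj_on f {..k}"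
    proof (rule inj_onI, rule ccontr)
      fix i j assume ij: "i \<in> {..k}" "j \<in> {..k}" "f i = f j" "i \<noteq> j"
      have "sim (s i) (s j)" using f[of i] f[of j] ij B(1) sG qo_trans[of _ "f i"] by auto
      then show False using dec[of i j] dec[of j i] ij by (auto simp: neq_iff)
    qed
    moreover have "f ` {..k} \<subseteq> B" using f by auto
    ultimately have "card {..k} \<le> card B" using card_inj_on_le B(2) by blast
    then show False using B(3) by simp
  qed
  then obtain i where i: "i \<le> k" "s i \<in> core H" by blast
  have "y [^] (F ^ k) = s i [^] (F ^ (k - i))"
    using i(1) yG by (simp add: s_def nat_pow_pow power_add[symmetric])
  then have "qo (y [^] (F ^ k)) (s i)" using sG[of i] by (simp add: pow_qo)
  then show ?thesis using i(2) sG[of i] yG qo_trans[of _ "y [^] (F ^ k)" "s i"]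
    unfolding core_def ball_def F_def by auto
qed

text \<open>By \<open>power_in_core\<close> for the centralizer of \<open>y\<close>, the whole ball
  of \<open>y^m\<close> commutes with \<open>y\<close>. Of two \<open>m\<close>-th powers, the
  smaller one lies in the ball of the larger one.\<close>

lemma powers_commute: "\<exists>m::nat. 0 < m \<and> (\<forall>x\<in>carrier G. \<forall>y\<in>carrier G. x [^] m \<otimes> y [^] m = y [^] m \<otimes> x [^] m)"
proof -
  obtain k where k: "\<forall>a\<in>carrier G. det k (centralizer a)" using centralizers_det by blast
  define m where "m = (fact k :: nat) ^ k"
  have core: "x [^] m \<in> core (centralizer x)" if "x \<in> carrier G" for x
    unfolding m_def using k that by (intro power_in_core subgroup_centralizer centralizer_self) auto
  have *: "x [^] m \<otimes> y [^] m = y [^] m \<otimes> x [^] m"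
    if "x \<in> carrier G" "y \<in> carrier G" "qo (x [^] m) (y [^] m)" for x y
  proof -
    have "x [^] m \<in> centralizer y" using core[OF that(2)] that unfolding core_def ball_def by auto
    then have "y \<in> centralizer (x [^] m)" using that by (simp add: centralizer_def)
    then have "y [^] m \<in> centralizer (x [^] m)"
      using that subgroup_pow_closed[OF subgroup_centralizer] by simp
    then show ?thesis by (simp add: centralizer_def)
  qed
  have "x [^] m \<otimes> y [^] m = y [^] m \<otimes> x [^] m" if "x \<in> carrier G" "y \<in> carrier G" for x y
    using *[of x y] *[of y x] qo_total[of "x [^] m" "y [^] m"] that by auto
  moreover have "0 < m" by (simp add: m_def)
  ultimately show ?thesis by blast
qed

lemma (in group) centralizer_conj:
  assumes "x \<in> carrier G" "z \<in> carrier G" "w \<in> carrier G"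
  shows "z \<otimes> x \<otimes> inv z \<in> centralizer w \<longleftrightarrow> x \<in> centralizer (inv z \<otimes> w \<otimes> z)"
proof
  assume "z \<otimes> x \<otimes> inv z \<in> centralizer w"
  then have "inv z \<otimes> (z \<otimes> x \<otimes> inv z \<otimes> w) \<otimes> z = inv z \<otimes> (w \<otimes> (z \<otimes> x \<otimes> inv z)) \<otimes> z"
    by (simp add: centralizer_def)
  then show "x \<in> centralizer (inv z \<otimes> w \<otimes> z)" using assms by (simp add: centralizer_def m_assoc)
next
  assume "x \<in> centralizer (inv z \<otimes> w \<otimes> z)"
  then have "z \<otimes> (x \<otimes> (inv z \<otimes> w \<otimes> z)) \<otimes> inv z = z \<otimes> (inv z \<otimes> w \<otimes> z \<otimes> x) \<otimes> inv z"
    by (simp add: centralizer_def)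
  then show "z \<otimes> x \<otimes> inv z \<in> centralizer w" using assms by (simp add: centralizer_def m_assoc)
qed

text \<open>The subgroup is the double centralizer of the commuting set of \<open>m\<close>-th powers.\<close>

lemma abelian_normal_subgroup:
  "\<exists>H. H \<lhd> G \<and> definable_in_C_group G C H \<and> comm_group (G\<lparr>carrier := H\<rparr>) \<and> finite_exponent (G Mod H)"
proof -
  obtain m :: nat where m: "0 < m"
    and comm: "\<And>x y. x \<in> carrier G \<Longrightarrow> y \<in> carrier G \<Longrightarrow> x [^] m \<otimes> y [^] m = y [^] m \<otimes> x [^] m"
    using powers_commute by blast
  define E where "E = {x \<in> carrier G. \<forall>y\<in>carrier G. x \<in> centralizer (y [^] m)}"
  \<comment> \<open>\<open>H\<close> is the centre of \<open>E\<close>. It contains all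
    \<open>m\<close>-th powers, since these commute with each other and, by the choice of
    \<open>E\<close>, with \<open>E\<close>.\<close>
  define H where "H = {x \<in> E. \<forall>y\<in>E. x \<in> centralizer y}"
  have EG: "E \<subseteq> carrier G" and HE: "H \<subseteq> E" by (auto simp: E_def H_def)
  have subE: "subgroup E G"
  proof (rule subgroupI)
    show "E \<noteq> {}" using subgroup.one_closed[OF subgroup_centralizer] by (auto simp: E_def)
  qed (auto simp: E_def subgroup.m_inv_closed[OF subgroup_centralizer] subgroup.m_closed[OF subgroup_centralizer])
  have subH: "subgroup H G"
  proof (rule subgroupI)
    show "H \<noteq> {}" using subgroup.one_closed[OF subgroup_centralizer] subgroup.one_closed[OF subE] EG
      by (auto simp: H_def)
    show "H \<subseteq> carrier G" using EG HE by blast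
    show "inv x \<in> H" if "x \<in> H" for x
      using that EG subgroup.m_inv_closed[OF subE] subgroup.m_inv_closed[OF subgroup_centralizer]
      by (auto simp: H_def)
    show "x \<otimes> y \<in> H" if "x \<in> H" "y \<in> H" for x y
      using that EG subgroup.m_closed[OF subE] subgroup.m_closed[OF subgroup_centralizer]
      by (auto simp: H_def)
  qed
  have conjE: "z \<otimes> x \<otimes> inv z \<in> E" if x: "x \<in> E" and z: "z \<in> carrier G" for x z
  proof -
    have "z \<otimes> x \<otimes> inv z \<in> centralizer (y [^] m)" if y: "y \<in> carrier G" for y
    proof -
      have "inv z \<otimes> y [^] m \<otimes> z = (inv z \<otimes> y \<otimes> z) [^] m"
        using conj_pow[of "inv z" y m] y z by simp
      then have "x \<in> centralizer (inv z \<otimes> y [^] m \<otimes> z)" using x y z by (auto simp: E_def)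
      then show ?thesis using centralizer_conj x y z EG by auto
    qed
    then show ?thesis using x z by (auto simp: E_def)
  qed
  have "H \<lhd> G"
  proof (rule normal_invI[OF subH])
    fix z x assume z: "z \<in> carrier G" and x: "x \<in> H"
    have "z \<otimes> x \<otimes> inv z \<in> centralizer w" if w: "w \<in> E" for w
    proof -
      have "inv z \<otimes> w \<otimes> z \<in> E" using conjE[OF w, of "inv z"] z by simp
      then have "x \<in> centralizer (inv z \<otimes> w \<otimes> z)" using x by (auto simp: H_def)
      then show ?thesis using centralizer_conj[of x z w] x w z EG HE by auto
    qed
    then show "z \<otimes> x \<otimes> inv z \<in> H" using conjE x z HE by (auto simp: H_def)
  qed
  moreover have "comm_group (G\<lparr>carrier := H\<rparr>)"
  proof -
    have "group (G\<lparr>carrier := H\<rparr>)" using subgroup.subgroup_is_group[OF subH is_group] .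
    then show ?thesis
    proof (rule group.group_comm_groupI)
      fix x y assume "x \<in> carrier (G\<lparr>carrier := H\<rparr>)" "y \<in> carrier (G\<lparr>carrier := H\<rparr>)"
      then have "x \<in> centralizer y" by (simp add: H_def)
      then show "x \<otimes>\<^bsub>G\<lparr>carrier := H\<rparr>\<^esub> y = y \<otimes>\<^bsub>G\<lparr>carrier := H\<rparr>\<^esub> x"
        by (simp add: centralizer_def)
    qed
  qed
  moreover have powH: "x [^] m \<in> H" if "x \<in> carrier G" for x
  proof -
    have "x [^] m \<in> E" using comm that by (auto simp: E_def centralizer_def)
    moreover have "x [^] m \<in> centralizer y" if "y \<in> E" for y
      using that \<open>x \<in> carrier G\<close> by (auto simp: E_def centralizer_def)
    ultimately show ?thesis by (simp add: H_def)
  qed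
  moreover have "finite_exponent (G Mod H)"
    unfolding finite_exponent_def
  proof (intro exI[of _ m] conjI ballI m)
    fix X assume "X \<in> carrier (G Mod H)"
    then obtain x where x: "x \<in> carrier G" "X = H #> x" by (auto simp: carrier_FactGroup)
    then have "X [^]\<^bsub>G Mod H\<^esub> m = H #> (x [^] m)" using normal.FactGroup_pow[OF \<open>H \<lhd> G\<close>] by simp
    then show "X [^]\<^bsub>G Mod H\<^esub> m = \<one>\<^bsub>G Mod H\<^esub>"
      using coset_join2[OF _ subH powH[OF x(1)]] x by simp
  qed
  moreover have "definable_in_C_group G C H"
  proof -
    have E: "Def (\<lambda>e. \<forall>y\<in>carrier G. e n \<otimes> y [^] m = y [^] m \<otimes> e n)" if "n \<noteq> 2" for n
      by (rule Def_ball[where n = 2]) (use that in \<open>auto intro!: Def_eq Def_fun_mult Def_fun_pow Def_fun_var\<close>)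
    let ?P = "\<lambda>e :: nat \<Rightarrow> 'a. (\<forall>y\<in>carrier G. e 0 \<otimes> y [^] m = y [^] m \<otimes> e 0) \<and>
      (\<forall>z\<in>carrier G. (\<forall>y\<in>carrier G. z \<otimes> y [^] m = y [^] m \<otimes> z) \<longrightarrow> e 0 \<otimes> z = z \<otimes> e 0)"
    have "Def ?P"
    proof (rule Def_conj)
      show "Def (\<lambda>e. \<forall>y\<in>carrier G. e 0 \<otimes> y [^] m = y [^] m \<otimes> e 0)" by (rule E) simp
      show "Def (\<lambda>e. \<forall>z\<in>carrier G. (\<forall>y\<in>carrier G. z \<otimes> y [^] m = y [^] m \<otimes> z) \<longrightarrow> e 0 \<otimes> z = z \<otimes> e 0)"
        by (rule Def_ball[where n = 1]) (auto intro!: Def_imp E Def_eq Def_fun_mult Def_fun_var)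
    qed
    from definable_Def[OF this, of "\<lambda>_. \<one>"]
    have "definable_in_C_group G C {x \<in> carrier G. ?P ((\<lambda>_. \<one>)(0 := x))}" by auto
    moreover have "{x \<in> carrier G. ?P ((\<lambda>_. \<one>)(0 := x))} = H"
      by (auto simp: H_def E_def centralizer_def)
    ultimately show ?thesis by simp
  qed
  ultimately show ?thesis by blast
qed

end

context C_minimal_valued
begin

section \<open>Quotients of balls as minimal groups\<close>

abbreviation coset :: "'a \<Rightarrow> 'a \<Rightarrow> 'a set" where
  "coset g x \<equiv> open_ball g #> x"

lemma coset_eq:
  assumes "g \<in> carrier G" "g \<noteq> \<one>" "x \<in> carrier G" "y \<in> carrier G"
  shows "coset g x = coset g y \<longleftrightarrow> lt (x \<otimes> inv y) g"
  using subquotient.coset_eq_iff[OF subquotient_ball[OF assms(1,2)] assms(3,4)] assms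
  by (simp add: open_ball_def)

lemma ball_closed: "x \<in> ball g \<Longrightarrow> x \<in> carrier G"
  by (simp add: ball_def)

lemma conj_ball:
  assumes "x \<in> ball g" "z \<in> carrier G" "g \<in> carrier G"
  shows "z \<otimes> x \<otimes> inv z \<in> ball g"
  using normal_invE(2)[OF normal_ball[OF assms(3)] assms(2,1)] .

text \<open>Representatives of different cosets are separated, so \<open>det_cells\<close> does not
  let a determined set distinguish more than \<open>k\<close> cosets from more than \<open>k\<close>
  others.\<close>

lemma quotient_small:
  assumes g: "g \<in> carrier G" "g \<noteq> \<one>" and S: "S \<subseteq> carrier (quot g)"
    and D: "det k D" "\<And>x. x \<in> ball g \<Longrightarrow> x \<in> D \<longleftrightarrow> coset g x \<in> S"
  shows "at_most k S \<or> at_most k (carrier (quot g) - S)"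
proof (rule ccontr)
  assume neg: "\<not> ?thesis"
  interpret subquotient G "ball g" "open_ball g" by (rule subquotient_ball[OF g])
  have "\<forall>q\<in>carrier Q. \<exists>x\<in>ball g. coset g x = q" using carrier_Q by auto
  then obtain r where r: "\<And>q. q \<in> carrier Q \<Longrightarrow> r q \<in> ball g \<and> coset g (r q) = q" by metis
  have many: "\<not> at_most k (r ` T)" and sep: "separated g (r ` T)"
    and sub: "r ` T \<subseteq> carrier G" and le: "\<And>x. x \<in> r ` T \<Longrightarrow> qo x g"
    if T: "T \<subseteq> carrier Q" "\<not> at_most k T" for T
  proof -
    have "inj_on r T" using r T(1) by (metis inj_onI subsetD)
    then show "\<not> at_most k (r ` T)" using T(2) by (simp add: finite_image_iff card_image)
    show "r ` T \<subseteq> carrier G" using r T(1) ball_closed by blast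
    show "qo x g" if "x \<in> r ` T" for x using that r T(1) by (auto simp: ball_def subset_iff)
    show "separated g (r ` T)"
      unfolding separated_def
    proof (intro ballI impI)
      fix x y assume "x \<in> r ` T" "y \<in> r ` T" "x \<noteq> y"
      then obtain p q where pq: "p \<in> T" "q \<in> T" "x = r p" "y = r q" by blast
      then have "coset g x \<noteq> coset g y" using r T(1) \<open>x \<noteq> y\<close> by (metis subsetD)
      moreover have "x \<in> carrier G" "y \<in> carrier G" using pq r T(1) ball_closed by blast+
      ultimately show "qo g (x \<otimes> inv y)" using coset_eq[OF g] by blast
    qed
  qed
  have S': "carrier Q - S \<subseteq> carrier Q" by blast
  have n1: "\<not> at_most k S" and n2: "\<not> at_most k (carrier Q - S)" using neg by blast+
  obtain x y where xy: "x \<in> r ` S" "y \<in> r ` (carrier Q - S)" "x \<in> D \<longleftrightarrow> y \<in> D"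
    using det_cells[OF D(1) g(1) sub[OF S n1] le[OF S n1] many[OF S n1] sep[OF S n1]
        sub[OF S' n2] le[OF S' n2] many[OF S' n2] sep[OF S' n2]] by blast
  obtain p q where pq: "p \<in> S" "q \<in> carrier Q - S" "x = r p" "y = r q" using xy by blast
  have "x \<in> ball g" "coset g x = p" "y \<in> ball g" "coset g y = q" using r pq S by blast+
  then show False using D(2) xy(3) pq by blast
qed

text \<open>Centralizers and conjugacy classes of the quotient pull back to sets defined from
  \<open>g\<close> and \<open>a\<close> by one formula each. Hence \<open>k\<close> does not depend
  on \<open>g\<close>, and the argument of Reineke bounds every nonabelian quotient by
  \<open>k * k + 2 * k\<close>.\<close>

lemma quotient_abelian_or_small:
  "\<exists>m. \<forall>g\<in>carrier G. g \<noteq> \<one> \<longrightarrow> comm_group (quot g) \<or> at_most m (carrier (quot g))"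
proof -
  have "Def (\<lambda>e. \<not> qo (e 1) (e 0 \<otimes> e 2 \<otimes> inv (e 2 \<otimes> e 0)))" by (intro Def_intros)
  from uniformly_det2[of "\<lambda>x g a. lt (x \<otimes> a \<otimes> inv (a \<otimes> x)) g", OF this]
  obtain k1 where k1: "\<And>g a. g \<in> carrier G \<Longrightarrow> a \<in> carrier G \<Longrightarrow>
      det k1 {x \<in> carrier G. lt (x \<otimes> a \<otimes> inv (a \<otimes> x)) g}" by blast
  \<comment> \<open>Conjugation within the quotient: the conjugating element ranges over the ball of
    \<open>g\<close>.\<close>
  have "Def (\<lambda>e. \<exists>y\<in>carrier G. qo y (e 1) \<and> \<not> qo (e 1) (e 0 \<otimes> inv (y \<otimes> e 2 \<otimes> inv y)))"
    by (rule Def_bex[where n = 3]) (auto intro!: Def_conj Def_not Def_qo Def_fun_mult Def_fun_inv Def_fun_var)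
  from uniformly_det2[of "\<lambda>x g a. \<exists>y\<in>carrier G. qo y g \<and> lt (x \<otimes> inv (y \<otimes> a \<otimes> inv y)) g", OF this]
  obtain k2 where k2: "\<And>g a. g \<in> carrier G \<Longrightarrow> a \<in> carrier G \<Longrightarrow>
      det k2 {x \<in> carrier G. \<exists>y\<in>carrier G. qo y g \<and> lt (x \<otimes> inv (y \<otimes> a \<otimes> inv y)) g}" by blast
  define k where "k = max k1 k2"
  have "comm_group (quot g)" if g: "g \<in> carrier G" "g \<noteq> \<one>"
    and big: "\<not> at_most (k * k + 2 * k) (carrier (quot g))" for g
  proof -
    interpret subquotient G "ball g" "open_ball g" by (rule subquotient_ball[OF g])
    interpret Q: group Q by (rule group_Q)
    have sb: "subgroup (ball g) G" by (rule subgroup_S)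
    show ?thesis
    proof (rule Q.abelian_if_minimal[OF _ _ big])
      fix q assume "q \<in> carrier Q"
      then obtain a where a: "a \<in> ball g" "q = coset g a" using carrier_Q by auto
      have aG: "a \<in> carrier G" using a ball_closed by blast
      have "x \<in> {x \<in> carrier G. lt (x \<otimes> a \<otimes> inv (a \<otimes> x)) g} \<longleftrightarrow> coset g x \<in> Q.centralizer q"
        if x: "x \<in> ball g" for x
      proof -
        have "coset g x \<in> Q.centralizer q \<longleftrightarrow> coset g (x \<otimes> a) = coset g (a \<otimes> x)"
          using x a mult_Q by (auto simp: Q.centralizer_def carrier_Q simp del: mult_FactGroup)
        also have "\<dots> \<longleftrightarrow> lt (x \<otimes> a \<otimes> inv (a \<otimes> x)) g"
          using coset_eq[OF g] x aG ball_closed by simp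
        finally show ?thesis using x ball_closed by simp
      qed
      then show "at_most k (Q.centralizer q) \<or> at_most k (carrier Q - Q.centralizer q)"
        by (intro quotient_small[OF g _ det_mono[OF k1[OF g(1) aG]]]) (auto simp: Q.centralizer_def k_def)
      have "x \<in> {x \<in> carrier G. \<exists>y\<in>carrier G. qo y g \<and> lt (x \<otimes> inv (y \<otimes> a \<otimes> inv y)) g} \<longleftrightarrow>
          coset g x \<in> Q.conjugates q" if x: "x \<in> ball g" for x
      proof -
        have "coset g x \<in> Q.conjugates q \<longleftrightarrow>
            (\<exists>y\<in>ball g. coset g x = coset g y \<otimes>\<^bsub>Q\<^esub> coset g a \<otimes>\<^bsub>Q\<^esub> inv\<^bsub>Q\<^esub> coset g y)"
          unfolding Q.conjugates_def carrier_Q a(2) by blast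
        also have "\<dots> \<longleftrightarrow> (\<exists>y\<in>ball g. coset g x = coset g (y \<otimes> a \<otimes> inv y))"
          using a(1) subgroup.m_closed[OF sb] subgroup.m_inv_closed[OF sb]
          by (simp add: mult_Q inv_Q del: mult_FactGroup)
        also have "\<dots> \<longleftrightarrow> (\<exists>y\<in>ball g. lt (x \<otimes> inv (y \<otimes> a \<otimes> inv y)) g)"
          using coset_eq[OF g] x aG ball_closed by (intro bex_cong) auto
        finally show ?thesis using x by (auto simp: ball_def)
      qed
      moreover have "Q.conjugates q \<subseteq> carrier Q" using \<open>q \<in> carrier Q\<close>
        by (auto simp: Q.conjugates_def simp del: mult_FactGroup)
      ultimately show "at_most k (Q.conjugates q) \<or> at_most k (carrier Q - Q.conjugates q)"
        by (intro quotient_small[OF g _ det_mono[OF k2[OF g(1) aG]]]) (auto simp: k_def)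
    qed
  qed
  then show ?thesis by blast
qed

text \<open>The sets of \<open>n\<close>-th powers and of \<open>n\<close>-torsion elements pull
  back to definable sets, so each of them is finite or cofinite.\<close>

lemma infinite_quotient:
  assumes g: "g \<in> carrier G" "g \<noteq> \<one>" and inf: "infinite (carrier (quot g))"
  shows "comm_group (quot g)" "elementary_abelian_group (quot g) \<or> divisible_group (quot g)"
proof -
  show comm: "comm_group (quot g)" using quotient_abelian_or_small g inf by blast
  interpret subquotient G "ball g" "open_ball g" by (rule subquotient_ball[OF g])
  interpret Q: comm_group Q by (rule comm)
  show "elementary_abelian_group Q \<or> divisible_group Q"
  proof (rule Q.elementary_or_divisible_if_minimal[OF inf])
    fix n :: nat
    have "Def (\<lambda>e. \<exists>y\<in>carrier G. qo y (e 1) \<and> \<not> qo (e 1) (e 0 \<otimes> inv (y [^] n)))"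
      by (rule Def_bex[where n = 3]) (auto intro!: Def_conj Def_not Def_qo Def_fun_mult Def_fun_inv Def_fun_var Def_fun_pow)
    from uniformly_det1[of "\<lambda>x g. \<exists>y\<in>carrier G. qo y g \<and> lt (x \<otimes> inv (y [^] n)) g", OF this] g(1)
    obtain k where k: "det k {x \<in> carrier G. \<exists>y\<in>carrier G. qo y g \<and> lt (x \<otimes> inv (y [^] n)) g}" by blast
    have "x \<in> {x \<in> carrier G. \<exists>y\<in>carrier G. qo y g \<and> lt (x \<otimes> inv (y [^] n)) g} \<longleftrightarrow>
        coset g x \<in> (\<lambda>q. q [^]\<^bsub>Q\<^esub> n) ` carrier Q" if x: "x \<in> ball g" for x
    proof -
      have "coset g x \<in> (\<lambda>q. q [^]\<^bsub>Q\<^esub> n) ` carrier Q \<longleftrightarrow> (\<exists>y\<in>ball g. coset g x = coset g y [^]\<^bsub>Q\<^esub> n)"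
        unfolding carrier_Q by blast
      also have "\<dots> \<longleftrightarrow> (\<exists>y\<in>ball g. coset g x = coset g (y [^] n))" using pow_Q by simp
      also have "\<dots> \<longleftrightarrow> (\<exists>y\<in>ball g. lt (x \<otimes> inv (y [^] n)) g)"
        using coset_eq[OF g] x ball_closed by (intro bex_cong) auto
      finally show ?thesis using x by (auto simp: ball_def)
    qed
    then have "at_most k ((\<lambda>q. q [^]\<^bsub>Q\<^esub> n) ` carrier Q) \<or> at_most k (carrier Q - (\<lambda>q. q [^]\<^bsub>Q\<^esub> n) ` carrier Q)"
      by (intro quotient_small[OF g _ k]) auto
    then show "finite ((\<lambda>q. q [^]\<^bsub>Q\<^esub> n) ` carrier Q) \<or> finite (carrier Q - (\<lambda>q. q [^]\<^bsub>Q\<^esub> n) ` carrier Q)" by blast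
  next
    fix n :: nat
    have "Def (\<lambda>e. \<not> qo (e 1) (e 0 [^] n))" by (intro Def_intros)
    from uniformly_det1[of "\<lambda>x g. lt (x [^] n) g", OF this] g(1)
    obtain k where k: "det k {x \<in> carrier G. lt (x [^] n) g}" by blast
    have "x \<in> {x \<in> carrier G. lt (x [^] n) g} \<longleftrightarrow> coset g x \<in> {q \<in> carrier Q. q [^]\<^bsub>Q\<^esub> n = \<one>\<^bsub>Q\<^esub>}"
      if x: "x \<in> ball g" for x
    proof -
      have 1: "coset g \<one> = open_ball g"
        using subgroup.subset[OF normal_imp_subgroup[OF normal_N]] by (simp add: coset_mult_one)
      have "coset g x [^]\<^bsub>Q\<^esub> n = \<one>\<^bsub>Q\<^esub> \<longleftrightarrow> coset g (x [^] n) = coset g \<one>"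
        using x by (simp add: pow_Q 1)
      also have "\<dots> \<longleftrightarrow> lt (x [^] n) g" using coset_eq[OF g, of "x [^] n" \<one>] x ball_closed by simp
      finally show ?thesis using x ball_closed by (auto simp: carrier_Q)
    qed
    then have "at_most k {q \<in> carrier Q. q [^]\<^bsub>Q\<^esub> n = \<one>\<^bsub>Q\<^esub>} \<or>
        at_most k (carrier Q - {q \<in> carrier Q. q [^]\<^bsub>Q\<^esub> n = \<one>\<^bsub>Q\<^esub>})"
      by (intro quotient_small[OF g _ k]) auto
    then show "finite {q \<in> carrier Q. q [^]\<^bsub>Q\<^esub> n = \<one>\<^bsub>Q\<^esub>} \<or>
        finite (carrier Q - {q \<in> carrier Q. q [^]\<^bsub>Q\<^esub> n = \<one>\<^bsub>Q\<^esub>})" by blast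
  qed
qed

lemma separated_reps:
  assumes g: "g \<in> carrier G" "g \<noteq> \<one>" and Y: "Y \<subseteq> ball g" "inj_on (coset g) Y"
  shows "separated g Y"
  unfolding separated_def
proof (intro ballI impI)
  fix x y assume "x \<in> Y" "y \<in> Y" "x \<noteq> y"
  then have "coset g x \<noteq> coset g y" "x \<in> carrier G" "y \<in> carrier G"
    using Y ball_closed by (auto dest: inj_onD)
  then show "qo g (x \<otimes> inv y)" using coset_eq[OF g] by blast
qed

text \<open>The centralizer of an element of large order modulo the open ball contains the ball, and all
  but finitely many elements of a divisible minimal group have large order.\<close>

lemma ball_abelian_if_divisible:
  assumes g: "g \<in> carrier G" "g \<noteq> \<one>" and inf: "infinite (carrier (quot g))" and div: "divisible_group (quot g)"
    and xy: "x \<in> ball g" "y \<in> ball g"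
  shows "x \<otimes> y = y \<otimes> x"
proof -
  interpret subquotient G "ball g" "open_ball g" by (rule subquotient_ball[OF g])
  interpret Q: comm_group Q by (rule infinite_quotient(1)[OF g inf])
  obtain k where k: "\<forall>a\<in>carrier G. det k (centralizer a)" using centralizers_det by blast
  \<comment> \<open>If \<open>a\<close> has order larger than \<open>k\<close> modulo the open ball,
    the powers \<open>a^0\<close>, ..., \<open>a^k\<close> are \<open>k + 1\<close> separated
    elements of its centralizer.\<close>
  have cen: "u \<otimes> a = a \<otimes> u"
    if a: "a \<in> ball g" and ord: "\<And>i. 1 \<le> i \<Longrightarrow> i \<le> k \<Longrightarrow> coset g a [^]\<^bsub>Q\<^esub> i \<noteq> \<one>\<^bsub>Q\<^esub>" and u: "u \<in> ball g"
    for a u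
  proof -
    have aG: "a \<in> carrier G" and qa: "coset g a \<in> carrier Q" using a ball_closed carrier_Q by auto
    define Y where "Y = (\<lambda>i::nat. a [^] i) ` {..k}"
    have ne: "coset g (a [^] i) \<noteq> coset g (a [^] j)" if "i < j" "j \<le> k" for i j
    proof
      assume "coset g (a [^] i) = coset g (a [^] j)"
      then have "coset g a [^]\<^bsub>Q\<^esub> j = coset g a [^]\<^bsub>Q\<^esub> i" using a by (simp add: pow_Q)
      then have "coset g a [^]\<^bsub>Q\<^esub> i \<otimes>\<^bsub>Q\<^esub> coset g a [^]\<^bsub>Q\<^esub> (j - i) = coset g a [^]\<^bsub>Q\<^esub> i"
        using that qa Q.nat_pow_mult[of "coset g a" i "j - i"] by simp
      then have "coset g a [^]\<^bsub>Q\<^esub> (j - i) = \<one>\<^bsub>Q\<^esub>" using qa Q.l_cancel_one' Q.nat_pow_closed by metis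
      moreover have "1 \<le> j - i" "j - i \<le> k" using that by auto
      ultimately show False using ord by blast
    qed
    have inj: "inj_on (\<lambda>i. coset g (a [^] i)) {..k}"
    proof (rule inj_onI, rule ccontr)
      fix i j assume ij: "i \<in> {..k}" "j \<in> {..k}" "coset g (a [^] i) = coset g (a [^] j)" "i \<noteq> j"
      then show False using ne[of i j] ne[of j i] by (auto simp: neq_iff)
    qed
    then have inj1: "inj_on (\<lambda>i::nat. a [^] i) {..k}" by (auto simp: inj_on_def)
    have inj2: "inj_on (coset g) Y" using inj by (auto simp: inj_on_def Y_def)
    have Yb: "Y \<subseteq> ball g" using aG a g by (auto simp: Y_def ball_def intro: pow_qo)
    have "u \<in> centralizer a"
    proof (rule ball_subset_subgroup[OF subgroup_centralizer[OF aG] _ g(1), of k Y])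
      show "det k (centralizer a)" using k aG by blast
      show "Y \<subseteq> centralizer a"
        using subgroup_pow_closed[OF subgroup_centralizer[OF aG] centralizer_self[OF aG]] by (auto simp: Y_def)
      show "\<not> at_most k Y" using inj1 by (simp add: Y_def card_image)
      show "separated g Y" by (rule separated_reps[OF g Yb inj2])
    qed (use Yb u in \<open>auto simp: ball_def\<close>)
    then show ?thesis by (simp add: centralizer_def)
  qed
  \<comment> \<open>The centralizer of the whole ball, defined from \<open>g\<close> alone, is again
    a determined subgroup to which \<open>ball_subset_subgroup\<close> applies.\<close>
  define Z where "Z = {z \<in> carrier G. \<forall>u\<in>carrier G. qo u g \<longrightarrow> z \<otimes> u = u \<otimes> z}"
  have subZ: "subgroup Z G"
  proof (rule subgroupI)
    have Z: "Z = {z \<in> carrier G. \<forall>u\<in>ball g. z \<in> centralizer u}"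
      by (auto simp: Z_def ball_def centralizer_def)
    show "Z \<subseteq> carrier G" by (auto simp: Z_def)
    show "Z \<noteq> {}" by (auto simp: Z_def)
    show "inv x \<in> Z" if "x \<in> Z" for x
      using that subgroup.m_inv_closed[OF subgroup_centralizer] ball_closed by (auto simp: Z)
    show "x \<otimes> y \<in> Z" if "x \<in> Z" "y \<in> Z" for x y
      using that subgroup.m_closed[OF subgroup_centralizer] ball_closed by (auto simp: Z)
  qed
  have "Def (\<lambda>e. \<forall>u\<in>carrier G. qo u (e 1) \<longrightarrow> e 0 \<otimes> u = u \<otimes> e 0)"
    by (rule Def_ball[where n = 2]) (auto intro!: Def_imp Def_qo Def_eq Def_fun_mult Def_fun_var)
  from uniformly_det1[of "\<lambda>z g. \<forall>u\<in>carrier G. qo u g \<longrightarrow> z \<otimes> u = u \<otimes> z", OF this]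
  obtain m where m: "det m Z" using g(1) unfolding Z_def by blast
  \<comment> \<open>Elements of order at most \<open>k\<close>. For each exponent the torsion is
    finite: if it were cofinite it would be everything, and divisibility would make the quotient
    trivial.\<close>
  define E where "E = (\<Union>i\<in>{1..k}. {q \<in> carrier Q. q [^]\<^bsub>Q\<^esub> i = \<one>\<^bsub>Q\<^esub>})"
  have "finite E"
    unfolding E_def
  proof (intro finite_UN_I finite_atLeastAtMost)
    fix i assume i: "i \<in> {1..k}"
    let ?T = "{q \<in> carrier Q. q [^]\<^bsub>Q\<^esub> i = \<one>\<^bsub>Q\<^esub>}"
    show "finite ?T"
    proof (rule ccontr)
      assume infT: "infinite ?T"
      have "Def (\<lambda>e. \<not> qo (e 1) (e 0 [^] i))" by (intro Def_intros)
      from uniformly_det1[of "\<lambda>x g. lt (x [^] i) g", OF this] g(1)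
      obtain n where n: "det n {x \<in> carrier G. lt (x [^] i) g}" by blast
      have 1: "coset g \<one> = open_ball g"
        using subgroup.subset[OF normal_imp_subgroup[OF normal_N]] by (simp add: coset_mult_one)
      have "x \<in> {x \<in> carrier G. lt (x [^] i) g} \<longleftrightarrow> coset g x \<in> ?T" if x: "x \<in> ball g" for x
      proof -
        have "coset g x [^]\<^bsub>Q\<^esub> i = \<one>\<^bsub>Q\<^esub> \<longleftrightarrow> coset g (x [^] i) = coset g \<one>"
          using x by (simp add: pow_Q 1)
        also have "\<dots> \<longleftrightarrow> lt (x [^] i) g" using coset_eq[OF g, of "x [^] i" \<one>] x ball_closed by simp
        finally show ?thesis using x ball_closed by (auto simp: carrier_Q)
      qed
      then have "finite (carrier Q - ?T)" using quotient_small[OF g _ n, of ?T] infT by auto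
      then have "?T = carrier Q"
        using Q.subgroup_at_most_or_all[OF Q.subgroup_torsion[of i], of "card (carrier Q - ?T)"] inf by blast
      have "carrier Q \<subseteq> {\<one>\<^bsub>Q\<^esub>}"
      proof
        fix q assume "q \<in> carrier Q"
        moreover have "0 < i" using i by simp
        ultimately obtain p where "p \<in> carrier Q" "p [^]\<^bsub>Q\<^esub> i = q"
          using div unfolding divisible_group_def by blast
        then show "q \<in> {\<one>\<^bsub>Q\<^esub>}" using \<open>?T = carrier Q\<close> by blast
      qed
      then show False using inf finite_subset by blast
    qed
  qed
  then have infD: "infinite (carrier Q - E)" using inf by simp
  have "\<forall>q\<in>carrier Q. \<exists>x\<in>ball g. coset g x = q" using carrier_Q by auto
  then obtain r where r: "\<And>q. q \<in> carrier Q \<Longrightarrow> r q \<in> ball g \<and> coset g (r q) = q" by metis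
  define Y where "Y = r ` (carrier Q - E)"
  have Yb: "Y \<subseteq> ball g" using r by (auto simp: Y_def)
  have inj: "inj_on (coset g) Y"
    unfolding Y_def by (rule inj_on_imageI, rule inj_on_inverseI[where g = "\<lambda>q. q"]) (use r in simp)
  have "inj_on r (carrier Q - E)"
    by (rule inj_on_inverseI[where g = "coset g"]) (use r in blast)
  then have "infinite Y" using infD finite_imageD unfolding Y_def by blast
  have YZ: "Y \<subseteq> Z"
  proof
    fix a assume "a \<in> Y"
    then obtain q where q: "q \<in> carrier Q" "q \<notin> E" "a = r q" by (auto simp: Y_def)
    then have a: "a \<in> ball g" "coset g a = q" using r by auto
    have "coset g a [^]\<^bsub>Q\<^esub> i \<noteq> \<one>\<^bsub>Q\<^esub>" if "1 \<le> i" "i \<le> k" for i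
      using q a(2) that unfolding E_def by auto
    from cen[OF a(1) this] show "a \<in> Z" using a(1) by (auto simp: Z_def ball_def)
  qed
  have "x \<in> Z"
    using ball_subset_subgroup[OF subZ m g(1) YZ _ _ separated_reps[OF g Yb inj], of x] \<open>infinite Y\<close> Yb xy(1)
    by (auto simp: ball_def)
  then show ?thesis using xy(2) by (simp add: Z_def ball_def)
qed

end

section \<open>Only finitely many quotients are nonabelian\<close>

context C_minimal_valued
begin

text \<open>The kernel of the action of \<open>G\<close> by conjugation on the quotient of the ball
  of \<open>g\<close> by the open ball.\<close>

definition level_kernel :: "'a \<Rightarrow> 'a set" where
  "level_kernel g = {z \<in> carrier G. \<forall>h\<in>carrier G. qo h g \<longrightarrow> lt (z \<otimes> h \<otimes> inv z \<otimes> inv h) g}"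

lemma level_kernel_iff:
  assumes g: "g \<in> carrier G" "g \<noteq> \<one>" and z: "z \<in> carrier G"
  shows "z \<in> level_kernel g \<longleftrightarrow> (\<forall>h\<in>ball g. coset g (z \<otimes> h \<otimes> inv z) = coset g h)"
  using z coset_eq[OF g] by (auto simp: level_kernel_def ball_def)

lemma coset_conj_cong:
  assumes g: "g \<in> carrier G" "g \<noteq> \<one>" and "x \<in> carrier G" "y \<in> carrier G" "z \<in> carrier G"
    and "coset g x = coset g y"
  shows "coset g (z \<otimes> x \<otimes> inv z) = coset g (z \<otimes> y \<otimes> inv z)"
proof -
  have "lt (x \<otimes> inv y) g" using assms coset_eq[OF g] by simp
  moreover have "(z \<otimes> x \<otimes> inv z) \<otimes> inv (z \<otimes> y \<otimes> inv z) = z \<otimes> (x \<otimes> inv y) \<otimes> inv z"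
    using assms by (simp add: m_assoc inv_mult_group)
  moreover have "sim (z \<otimes> (x \<otimes> inv y) \<otimes> inv z) (x \<otimes> inv y)" using assms by (intro conj_sim) auto
  ultimately have "lt ((z \<otimes> x \<otimes> inv z) \<otimes> inv (z \<otimes> y \<otimes> inv z)) g"
    using qo_lt_trans[of "z \<otimes> (x \<otimes> inv y) \<otimes> inv z" "x \<otimes> inv y" g] assms by simp
  then show ?thesis using coset_eq[OF g] assms by simp
qed

lemma subgroup_level_kernel:
  assumes g: "g \<in> carrier G" "g \<noteq> \<one>"
  shows "subgroup (level_kernel g) G"
proof (rule subgroupI)
  show "level_kernel g \<subseteq> carrier G" by (auto simp: level_kernel_def)
  have "\<one> \<in> level_kernel g" using level_kernel_iff[OF g, of \<one>] ball_closed by simp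
  then show "level_kernel g \<noteq> {}" by blast
  fix z assume z: "z \<in> level_kernel g"
  then have zG: "z \<in> carrier G" by (auto simp: level_kernel_def)
  have zk: "coset g (z \<otimes> h \<otimes> inv z) = coset g h" if "h \<in> ball g" for h
    using z that level_kernel_iff[OF g zG] by blast
  show "inv z \<in> level_kernel g"
    unfolding level_kernel_iff[OF g inv_closed[OF zG]]
  proof
    fix h assume h: "h \<in> ball g"
    have "coset g (z \<otimes> (inv z \<otimes> h \<otimes> inv (inv z)) \<otimes> inv z) = coset g (inv z \<otimes> h \<otimes> inv (inv z))"
      using zG g h by (intro zk conj_ball) auto
    moreover have "z \<otimes> (inv z \<otimes> h \<otimes> inv (inv z)) \<otimes> inv z = h" using zG ball_closed[OF h] by (simp add: m_assoc)
    ultimately show "coset g (inv z \<otimes> h \<otimes> inv (inv z)) = coset g h" by simp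
  qed
  fix w assume w: "w \<in> level_kernel g"
  then have wG: "w \<in> carrier G" by (auto simp: level_kernel_def)
  show "z \<otimes> w \<in> level_kernel g"
    unfolding level_kernel_iff[OF g m_closed[OF zG wG]]
  proof
    fix h assume h: "h \<in> ball g"
    have "coset g (z \<otimes> (w \<otimes> h \<otimes> inv w) \<otimes> inv z) = coset g (w \<otimes> h \<otimes> inv w)"
      using wG g h by (intro zk conj_ball) auto
    also have "\<dots> = coset g h" using w h level_kernel_iff[OF g wG] by blast
    finally show "coset g (z \<otimes> w \<otimes> h \<otimes> inv (z \<otimes> w)) = coset g h"
      using zG wG ball_closed[OF h] by (simp add: m_assoc inv_mult_group)
  qed
qed

text \<open>The commutator is the product of \<open>z\<close> and a conjugate of
  \<open>z^-1\<close>, and both factors are below \<open>g\<close>.\<close>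

lemma open_ball_subset_level_kernel:
  assumes g: "g \<in> carrier G" "g \<noteq> \<one>" and z: "z \<in> carrier G" "lt z g"
  shows "z \<in> level_kernel g"
proof -
  have "lt (z \<otimes> h \<otimes> inv z \<otimes> inv h) g" if h: "h \<in> carrier G" for h
  proof -
    have "qo (h \<otimes> inv z \<otimes> inv h) (inv z)" using conj_sim[of "inv z" h] z h by blast
    then have "lt (h \<otimes> inv z \<otimes> inv h) g"
      using qo_lt_trans[of "h \<otimes> inv z \<otimes> inv h" "inv z" g] z h g by simp
    from mult_lt[OF z(2) this] have "lt (z \<otimes> (h \<otimes> inv z \<otimes> inv h)) g" using z h g by blast
    then show ?thesis using z h by (simp add: m_assoc)
  qed
  then show ?thesis using z by (simp add: level_kernel_def)
qed

lemma decreasing_enumeration: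
  assumes "finite F" "F \<subseteq> carrier G" "\<And>g h. g \<in> F \<Longrightarrow> h \<in> F \<Longrightarrow> g \<noteq> h \<Longrightarrow> \<not> sim g h"
  shows "\<exists>s :: nat \<Rightarrow> 'a. s ` {..<card F} = F \<and> (\<forall>i j. i < j \<and> j < card F \<longrightarrow> lt (s j) (s i))"
  using assms
proof (induction "card F" arbitrary: F)
  case 0
  then show ?case by auto
next
  case (Suc n)
  have "F \<noteq> {}" using Suc(2) by auto
  then obtain m where m: "m \<in> F" "\<And>a. a \<in> F \<Longrightarrow> qo m a" 
    using finite_least[OF Suc.prems(1) _ Suc.prems(2)] by blast
  have n: "n = card (F - {m})" using Suc(2) m(1) Suc.prems(1) by simp
  have "\<exists>s :: nat \<Rightarrow> 'a. s ` {..<card (F - {m})} = F - {m} \<and> (\<forall>i j. i < j \<and> j < card (F - {m}) \<longrightarrow> lt (s j) (s i))"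
    by (rule Suc(1)[OF n]) (use Suc.prems in auto)
  then obtain s :: "nat \<Rightarrow> 'a" where
    s0: "s ` {..<card (F - {m})} = F - {m} \<and> (\<forall>i j. i < j \<and> j < card (F - {m}) \<longrightarrow> lt (s j) (s i))"
    by (elim exE) (rule that)
  have s: "s ` {..<n} = F - {m}" "\<And>i j. i < j \<Longrightarrow> j < n \<Longrightarrow> lt (s j) (s i)"
    using s0 unfolding n by simp_all
  define t where "t = s(n := m)"
  have "{..<Suc n} = insert n {..<n}" by auto
  then have "t ` {..<Suc n} = insert m (s ` {..<n})" by (auto simp: t_def)
  then have "t ` {..<card F} = F" using s(1) m(1) Suc(2) by auto
  moreover have "lt (t j) (t i)" if "i < j" "j < card F" for i j
  proof (cases "j = n")
    case True
    have "s i \<in> F - {m}" using s(1) that Suc(2) True by blast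
    then have "\<not> sim m (s i)" "qo m (s i)" using Suc.prems(3)[of m "s i"] m by auto
    then show ?thesis using True that by (simp add: t_def)
  next
    case False
    then have "j < n" using that Suc(2) by simp
    then show ?thesis using s(2)[OF that(1)] that by (simp add: t_def)
  qed
  ultimately show ?case by blast
qed

text \<open>The members of a set determined by \<open>B\<close> that lie strictly between two consecutive levels of \<open>B\<close>
  behave alike, so a decreasing sequence alternates at most \<open>card B\<close> times.\<close>

lemma no_alternation:
  assumes D: "det k D" and x: "\<And>j. j \<le> k \<Longrightarrow> x j \<in> carrier G" and y: "\<And>j. j \<le> k \<Longrightarrow> y j \<in> carrier G"
    and yx: "\<And>j. j \<le> k \<Longrightarrow> lt (y j) (x j)" and xy: "\<And>i j. i < j \<Longrightarrow> j \<le> k \<Longrightarrow> lt (x j) (y i)"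
    and alt: "\<And>j. j \<le> k \<Longrightarrow> x j \<notin> D \<and> y j \<in> D"
  shows False
proof -
  obtain B where B: "B \<subseteq> carrier G" "finite B" "card B \<le> k"
    "\<And>x y. x \<in> carrier G \<Longrightarrow> y \<in> carrier G \<Longrightarrow> agree B x y \<Longrightarrow> x \<in> D \<longleftrightarrow> y \<in> D"
    using detE[OF D] by blast
  \<comment> \<open>If no parameter has its class between those of \<open>y j\<close> and
    \<open>x j\<close>, both elements lie on the same side of every parameter, and all comparisons
    in the type come out equal.\<close>
  have "\<exists>b\<in>B. qo (y j) b \<and> qo b (x j)" if j: "j \<le> k" for j
  proof (rule ccontr)
    assume no: "\<not> ?thesis"
    note xG = x[OF j] and yG = y[OF j]
    have cmp: "(lt (x j) b \<and> sim (x j \<otimes> inv b) b \<and> sim (y j \<otimes> inv b) b) \<or>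
      (lt b (y j) \<and> lt b (x j) \<and> sim (x j \<otimes> inv b) (x j) \<and> sim (y j \<otimes> inv b) (y j))" if b: "b \<in> B" for b
    proof -
      have bG: "b \<in> carrier G" using b B(1) by blast
      consider "lt (x j) b" | "lt b (y j)" using no b by blast
      then show ?thesis
      proof cases
        case 1
        then have "lt (y j) b" using lt_trans[OF yx[OF j] 1] bG xG yG by blast
        have "sim (x j \<otimes> inv b) b"
          using mult_sim(1)[of "inv b" "x j"] 1 bG xG qo_inv_left[of b] qo_inv_right[of b] by simp
        moreover have "sim (y j \<otimes> inv b) b"
          using mult_sim(1)[of "inv b" "y j"] \<open>lt (y j) b\<close> bG yG qo_inv_left[of b] qo_inv_right[of b] by simp
        ultimately show ?thesis using 1 by blast
      next
        case 2
        then have "lt b (x j)" using lt_trans[OF 2 yx[OF j]] bG xG yG by blast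
        then show ?thesis using 2 mult_sim(2)[of "x j" "inv b"] mult_sim(2)[of "y j" "inv b"] bG xG yG by simp
      qed
    qed
    have main: "(qo (b \<otimes> inv b') (x j \<otimes> inv b') \<longleftrightarrow> qo (b \<otimes> inv b') (y j \<otimes> inv b')) \<and>
      (qo (x j \<otimes> inv b') (b \<otimes> inv b') \<longleftrightarrow> qo (y j \<otimes> inv b') (b \<otimes> inv b'))" if b: "b \<in> B" and b': "b' \<in> B" for b b'
    proof -
      have G: "b \<in> carrier G" "b' \<in> carrier G" "x j \<in> carrier G" "y j \<in> carrier G" using b b' B(1) xG yG by auto
      let ?c = "b \<otimes> inv b'"
      have cG: "?c \<in> carrier G" using G by simp
      show ?thesis
      proof (cases "lt (x j) b'")
        case True
        then have "\<not> lt b' (x j)" using lt_imp_qo G by blast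
        then have "sim (x j \<otimes> inv b') b'" "sim (y j \<otimes> inv b') b'" using cmp[OF b'] by blast+
        then have "sim (x j \<otimes> inv b') (y j \<otimes> inv b')" using qo_trans[of _ b'] G by (meson inv_closed m_closed)
        then show ?thesis using qo_trans G cG by (meson inv_closed m_closed)
      next
        case False
        then have b'1: "lt b' (y j)" "lt b' (x j)" and b'2: "sim (x j \<otimes> inv b') (x j)" "sim (y j \<otimes> inv b') (y j)"
          using cmp[OF b'] by blast+
        have "(lt ?c (x j) \<and> lt ?c (y j)) \<or> (lt (x j) ?c \<and> lt (y j) ?c)"
        proof (cases "lt (x j) b")
          case True
          then have "lt b' b" using lt_trans[OF b'1(2) True] G by blast
          then have "sim ?c b" using mult_sim(2)[of b "inv b'"] G by simp
          then have "lt (x j) ?c" using lt_qo_trans[OF True] G cG by blast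
          then show ?thesis using lt_trans[OF yx[OF j]] G cG by blast
        next
          case False
          then have "lt b (y j)" "lt b (x j)" using cmp[OF b] by blast+
          then show ?thesis using mult_lt[of "x j" b "inv b'"] mult_lt[of "y j" b "inv b'"] b'1 G by simp
        qed
        then show ?thesis
        proof
          assume c: "lt ?c (x j) \<and> lt ?c (y j)"
          then have "lt ?c (x j \<otimes> inv b')" "lt ?c (y j \<otimes> inv b')"
            using lt_qo_trans[OF conjunct1[OF c] conjunct2[OF b'2(1)]]
              lt_qo_trans[OF conjunct2[OF c] conjunct2[OF b'2(2)]] G cG by simp_all
          then show ?thesis using lt_imp_qo G cG by auto
        next
          assume c: "lt (x j) ?c \<and> lt (y j) ?c"
          then have "lt (x j \<otimes> inv b') ?c" "lt (y j \<otimes> inv b') ?c"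
            using qo_lt_trans[OF conjunct1[OF b'2(1)] conjunct1[OF c]]
              qo_lt_trans[OF conjunct1[OF b'2(2)] conjunct2[OF c]] G cG by simp_all
          then show ?thesis using lt_imp_qo G cG by auto
        qed
      qed
    qed
    have "agree B (x j) (y j)"
      unfolding agree_def
    proof (intro conjI ballI)
      fix b assume b: "b \<in> B"
      have bG: "b \<in> carrier G" using b B(1) by blast
      have "x j \<noteq> b \<and> y j \<noteq> b"
        using cmp[OF b]
      proof (elim disjE conjE)
        assume l: "lt (x j) b"
        then have "lt (y j) b" using lt_trans[OF yx[OF j] l] bG xG yG by blast
        then show ?thesis using l bG by auto
      qed (use bG in auto)
      then show "x j = b \<longleftrightarrow> y j = b" by simp
      fix b' assume b': "b' \<in> B"
      have G: "b \<in> carrier G" "b' \<in> carrier G" using b b' B(1) by auto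
      show "C (x j) b b' \<longleftrightarrow> C (y j) b b'" "C b (x j) b' \<longleftrightarrow> C b (y j) b'"
        using main[OF b b'] C_iff[OF xG G] C_iff[OF yG G] C_iff[OF G(1) xG G(2)] C_iff[OF G(1) yG G(2)] by blast+
    qed
    then show False using B(4)[OF xG yG] alt[OF j] by blast
  qed
  \<comment> \<open>The \<open>k + 1\<close> intervals from \<open>y j\<close> to \<open>x j\<close>
    are disjoint, so they would contain as many different parameters.\<close>
  then obtain f where f: "\<And>j. j \<le> k \<Longrightarrow> f j \<in> B \<and> qo (y j) (f j) \<and> qo (f j) (x j)" by metis
  have ne: "f i \<noteq> f j" if ij: "i < j" "j \<le> k" for i j
  proof
    assume eq: "f i = f j"
    have "i \<le> k" using ij by simp
    then have fG: "f j \<in> carrier G" and fi: "qo (y i) (f j)" and fj: "qo (f j) (x j)"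
      using f[of i] f[of j] B(1) eq ij by auto
    show False using qo_trans[OF fi fj] xy[OF ij] x[OF ij(2)] y[OF \<open>i \<le> k\<close>] fG by blast
  qed
  have "inj_on f {..k}" using ne by (auto simp: inj_on_def) (metis nat_neq_iff)
  moreover have "f ` {..k} \<subseteq> B" using f by auto
  ultimately have "card {..k} \<le> card B" using card_inj_on_le B(2) by blast
  then show False using B(3) by simp
qed

text \<open>Here the level varies and \<open>z\<close> is the parameter; this makes
  \<open>no_alternation\<close> applicable to the levels on which a given element acts
  trivially.\<close>

lemma levels_det: "\<exists>k. \<forall>z\<in>carrier G. det k {g \<in> carrier G. z \<in> level_kernel g}"
proof -
  have "Def (\<lambda>e. \<forall>h\<in>carrier G. qo h (e 0) \<longrightarrow> \<not> qo (e 0) (e 1 \<otimes> h \<otimes> inv (e 1) \<otimes> inv h))"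
    by (rule Def_ball[where n = 2]) (auto intro!: Def_imp Def_not Def_qo Def_fun_mult Def_fun_inv Def_fun_var)
  from uniformly_det1[of "\<lambda>g z. \<forall>h\<in>carrier G. qo h g \<longrightarrow> lt (z \<otimes> h \<otimes> inv z \<otimes> inv h) g", OF this]
  show ?thesis by (simp add: level_kernel_def cong: conj_cong)
qed

definition kernels :: "'a set \<Rightarrow> 'a set" where
  "kernels F = {z \<in> carrier G. \<forall>g\<in>F. z \<in> level_kernel g}"

text \<open>The elements of \<open>F\<close> stand for values; at most one is taken from each class
  of \<open>sim\<close>, so that the cardinality counts values.\<close>

definition levels :: "'a set \<Rightarrow> bool" where
  "levels F \<longleftrightarrow> finite F \<and> F \<subseteq> carrier G - {\<one>} \<and> (\<forall>g\<in>F. \<forall>h\<in>F. g \<noteq> h \<longrightarrow> \<not> sim g h)"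

lemma levels_subset: "levels F \<Longrightarrow> F' \<subseteq> F \<Longrightarrow> levels F'"
  unfolding levels_def by (meson finite_subset order.trans subsetD)

lemma subgroup_mult_iff:
  assumes H: "subgroup H G" and "a \<in> carrier G" "b \<in> carrier G" "a \<in> H \<or> b \<in> H"
  shows "a \<otimes> b \<in> H \<longleftrightarrow> a \<in> H \<and> b \<in> H"
proof
  assume ab: "a \<otimes> b \<in> H"
  show "a \<in> H \<and> b \<in> H"
    using assms(4)
  proof
    assume a: "a \<in> H"
    then have "inv a \<otimes> (a \<otimes> b) \<in> H" using ab H by (meson subgroup.m_closed subgroup.m_inv_closed)
    then show ?thesis using a assms(2,3) by simp
  next
    assume b: "b \<in> H"
    then have "(a \<otimes> b) \<otimes> inv b \<in> H" using ab H by (meson subgroup.m_closed subgroup.m_inv_closed)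
    then show ?thesis using b assms(2,3) by (simp add: m_assoc)
  qed
qed (simp add: subgroup.m_closed[OF H])

text \<open>The Baldwin-Saxl argument: if no kernel contained the intersection of the others, there would
  be elements lying in any prescribed subfamily of the kernels.\<close>

lemma redundant_level_kernel:
  assumes k: "\<forall>z\<in>carrier G. det k {g \<in> carrier G. z \<in> level_kernel g}"
    and F: "levels F" "card F = 2 * Suc k"
  shows "\<exists>g\<in>F. kernels (F - {g}) \<subseteq> level_kernel g"
proof (rule ccontr)
  assume "\<not> ?thesis"
  then have "\<forall>g\<in>F. \<exists>a. a \<in> kernels (F - {g}) \<and> a \<notin> level_kernel g" by blast
  then obtain a where a: "\<And>g. g \<in> F \<Longrightarrow> a g \<in> kernels (F - {g}) \<and> a g \<notin> level_kernel g" by metis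
  have aG: "a g \<in> carrier G" if "g \<in> F" for g using a[OF that] by (auto simp: kernels_def)
  have FG: "g \<in> carrier G" "g \<noteq> \<one>" if "g \<in> F" for g using F(1) that by (auto simp: levels_def)
  \<comment> \<open>The product of the elements \<open>a g\<close> with \<open>g \<in> S\<close>
    escapes precisely the kernels at the levels in \<open>S\<close>.\<close>
  have select: "\<exists>z\<in>carrier G. \<forall>h\<in>F. z \<in> level_kernel h \<longleftrightarrow> h \<notin> S" if "finite S" "S \<subseteq> F" for S
    using that
  proof (induction S rule: finite_induct)
    case empty
    then show ?case using FG subgroup.one_closed[OF subgroup_level_kernel] by (intro bexI[of _ \<one>]) auto
  next
    case (insert g S)
    then obtain z where z: "z \<in> carrier G" "\<And>h. h \<in> F \<Longrightarrow> z \<in> level_kernel h \<longleftrightarrow> h \<notin> S" by auto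
    have gF: "g \<in> F" using insert by simp
    have "a g \<otimes> z \<in> level_kernel h \<longleftrightarrow> h \<notin> insert g S" if h: "h \<in> F" for h
    proof -
      have "a g \<in> level_kernel h \<longleftrightarrow> h \<noteq> g" using a[OF gF] h by (auto simp: kernels_def)
      moreover have "a g \<in> level_kernel h \<or> z \<in> level_kernel h" using calculation z(2)[OF h] insert.hyps by blast
      ultimately show ?thesis
        using subgroup_mult_iff[OF subgroup_level_kernel[OF FG[OF h]] aG[OF gF] z(1)] z(2)[OF h] by blast
    qed
    then show ?case using aG[OF gF] z(1) by (intro bexI[of _ "a g \<otimes> z"]) auto
  qed
  have "\<exists>s :: nat \<Rightarrow> 'a. s ` {..<card F} = F \<and> (\<forall>i j. i < j \<and> j < card F \<longrightarrow> lt (s j) (s i))"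
    by (rule decreasing_enumeration) (use F(1) in \<open>auto simp: levels_def\<close>)
  then obtain s :: "nat \<Rightarrow> 'a" where
    s0: "s ` {..<card F} = F \<and> (\<forall>i j. i < j \<and> j < card F \<longrightarrow> lt (s j) (s i))"
    by (elim exE) (rule that)
  then have s: "s ` {..<card F} = F" "\<And>i j. i < j \<Longrightarrow> j < card F \<Longrightarrow> lt (s j) (s i)" by simp_all
  have sF: "s i \<in> F" if "i < 2 * Suc k" for i using s(1) F(2) that by auto
  have s_inj: "s i \<noteq> s j" if "i < j" "j < 2 * Suc k" for i j
    using s(2)[OF that(1)] that F(2) FG(1)[OF sF[of j]] by auto
  \<comment> \<open>With every second level chosen, trivial and nontrivial action of
    \<open>z\<close> alternate through \<open>k + 1\<close> pairs; hence the family size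
    \<open>2 * Suc k\<close>.\<close>
  define S where "S = (\<lambda>j. s (2 * j)) ` {..k}"
  have "S \<subseteq> F" using sF by (auto simp: S_def)
  then obtain z where z: "z \<in> carrier G" "\<And>h. h \<in> F \<Longrightarrow> z \<in> level_kernel h \<longleftrightarrow> h \<notin> S"
    using select[of S] by (auto simp: S_def)
  have odd: "s (2 * j + 1) \<notin> S" if "j \<le> k" for j
  proof
    assume "s (2 * j + 1) \<in> S"
    then obtain i where i: "i \<le> k" "s (2 * j + 1) = s (2 * i)" by (auto simp: S_def)
    have "2 * j + 1 \<noteq> 2 * i" by presburger
    then show False using s_inj[of "2 * j + 1" "2 * i"] s_inj[of "2 * i" "2 * j + 1"] i that
      by (auto simp: neq_iff)
  qed
  show False
  proof (rule no_alternation[where k = k and D = "{g \<in> carrier G. z \<in> level_kernel g}"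
        and x = "\<lambda>j. s (2 * j)" and y = "\<lambda>j. s (2 * j + 1)"])
    show "det k {g \<in> carrier G. z \<in> level_kernel g}" using k z(1) by blast
    show "s (2 * j) \<in> carrier G" "s (2 * j + 1) \<in> carrier G" if "j \<le> k" for j
      using FG(1)[OF sF] that by auto
    show "lt (s (2 * j + 1)) (s (2 * j))" if "j \<le> k" for j using s(2) F(2) that by simp
    show "lt (s (2 * j)) (s (2 * i + 1))" if "i < j" "j \<le> k" for i j using s(2) F(2) that by simp
    show "s (2 * j) \<notin> {g \<in> carrier G. z \<in> level_kernel g} \<and> s (2 * j + 1) \<in> {g \<in> carrier G. z \<in> level_kernel g}"
      if j: "j \<le> k" for j
    proof -
      have "s (2 * j) \<in> F" "s (2 * j + 1) \<in> F" "s (2 * j) \<in> S" using sF j by (auto simp: S_def)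
      then show ?thesis using z(2) odd[OF j] FG(1) by blast
    qed
  qed
qed

text \<open>While there are more than \<open>2 * k + 2\<close> levels, a subfamily of that size has
  a redundant member, whose removal does not change the intersection.\<close>

lemma few_kernels:
  assumes k: "\<forall>z\<in>carrier G. det k {g \<in> carrier G. z \<in> level_kernel g}"
  shows "levels F \<Longrightarrow> \<exists>F'\<subseteq>F. card F' \<le> 2 * k + 2 \<and> kernels F' = kernels F"
proof (induction "card F" arbitrary: F rule: less_induct)
  case less
  have fin: "finite F" using less(2) by (simp add: levels_def)
  show ?case
  proof (cases "card F \<le> 2 * k + 2")
    case True
    then show ?thesis by blast
  next
    case False
    then obtain F0 where F0: "F0 \<subseteq> F" "card F0 = 2 * Suc k"
      using obtain_subset_with_card_n[of "2 * Suc k" F] by auto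
    obtain g where g: "g \<in> F0" "kernels (F0 - {g}) \<subseteq> level_kernel g"
      using redundant_level_kernel[OF k levels_subset[OF less(2) F0(1)] F0(2)] by blast
    have "kernels (F - {g}) \<subseteq> kernels (F0 - {g})" using F0(1) by (auto simp: kernels_def)
    then have sub: "kernels (F - {g}) \<subseteq> level_kernel g" using g(2) by blast
    have "z \<in> level_kernel h" if "z \<in> kernels (F - {g})" "h \<in> F" for z h
      using that sub by (cases "h = g") (auto simp: kernels_def)
    then have eq: "kernels (F - {g}) = kernels F" by (auto simp: kernels_def)
    have "card (F - {g}) < card F" using g F0(1) fin by (intro card_Diff1_less) auto
    then obtain F' where "F' \<subseteq> F - {g}" "card F' \<le> 2 * k + 2" "kernels F' = kernels (F - {g})"
      using less(1)[of "F - {g}"] levels_subset[OF less(2)] by blast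
    then show ?thesis using eq by blast
  qed
qed

text \<open>The index of an intersection of kernels is bounded, while elements acting nontrivially on
  different levels lie in different cosets.\<close>

lemma nonabelian_levels_bounded:
  "\<exists>n. \<forall>F. levels F \<and> (\<forall>g\<in>F. \<not> comm_group (quot g)) \<longrightarrow> card F \<le> n"
proof -
  obtain k where k: "\<forall>z\<in>carrier G. det k {g \<in> carrier G. z \<in> level_kernel g}" using levels_det by blast
  obtain m where m: "\<And>g. g \<in> carrier G \<Longrightarrow> g \<noteq> \<one> \<Longrightarrow> comm_group (quot g) \<or> at_most m (carrier (quot g))"
    using quotient_abelian_or_small by blast
  \<comment> \<open>Bounds the number of self-maps of a quotient with at most \<open>m\<close>
    elements; the base \<open>Suc m\<close> is positive, as monotonicity in the exponent
    requires.\<close>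
  define M0 where "M0 = Suc m ^ Suc m"
  have "card F \<le> M0 ^ (2 * k + 2)" if F: "levels F" and nc: "\<And>g. g \<in> F \<Longrightarrow> \<not> comm_group (quot g)" for F
  proof -
    have FG: "g \<in> carrier G" "g \<noteq> \<one>" if "g \<in> F" for g using F that by (auto simp: levels_def)
    have finF: "finite F" using F by (simp add: levels_def)
    obtain F' where F': "F' \<subseteq> F" "card F' \<le> 2 * k + 2" "kernels F' = kernels F" using few_kernels[OF k F] by blast
    have "\<exists>x\<in>ball g. x \<notin> level_kernel g" if g: "g \<in> F" for g
    proof -
      interpret subquotient G "ball g" "open_ball g" by (rule subquotient_ball[OF FG[OF g]])
      obtain x y where xy: "x \<in> ball g" "y \<in> ball g" "x \<otimes> y \<otimes> inv (y \<otimes> x) \<notin> open_ball g"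
        using nc[OF g] unfolding comm_group_Q_iff by blast
      have G: "x \<in> carrier G" "y \<in> carrier G" using xy ball_closed by auto
      have "x \<otimes> y \<otimes> inv (y \<otimes> x) = x \<otimes> y \<otimes> inv x \<otimes> inv y" using G by (simp add: m_assoc inv_mult_group)
      then have "x \<notin> level_kernel g" using xy G by (auto simp: level_kernel_def open_ball_def ball_def)
      then show ?thesis using xy(1) by blast
    qed
    then obtain a where a: "\<And>g. g \<in> F \<Longrightarrow> a g \<in> ball g \<and> a g \<notin> level_kernel g" by metis
    have aG: "a g \<in> carrier G" if "g \<in> F" for g using a[OF that] ball_closed by blast
    \<comment> \<open>For \<open>lt h g\<close>, the element \<open>a h\<close> lies below
      \<open>g\<close> and acts trivially at the level \<open>g\<close>, where \<open>a g\<close>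
      does not; so the two differ modulo the intersection of the kernels.\<close>
    have dist: "a g \<otimes> inv (a h) \<notin> kernels F" if g: "g \<in> F" and h: "h \<in> F" and ne: "g \<noteq> h" for g h
    proof -
      have *: "a g \<otimes> inv (a h) \<notin> kernels F \<and> a h \<otimes> inv (a g) \<notin> kernels F"
        if g: "g \<in> F" and h: "h \<in> F" and lt: "lt h g" for g h
      proof -
        have "lt (a h) g" using qo_lt_trans[of "a h" h g] a[OF h] lt aG[OF h] FG g h by (auto simp: ball_def)
        then have hk: "a h \<in> level_kernel g" using open_ball_subset_level_kernel[OF FG[OF g] aG[OF h]] by blast
        have sub: "subgroup (level_kernel g) G" using subgroup_level_kernel[OF FG[OF g]] .
        have hk': "inv (a h) \<in> level_kernel g" using subgroup.m_inv_closed[OF sub hk] .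
        have gk: "a g \<notin> level_kernel g" using a[OF g] by blast
        have gk': "inv (a g) \<notin> level_kernel g" using subgroup.m_inv_closed[OF sub, of "inv (a g)"] gk aG[OF g] by auto
        have "a g \<otimes> inv (a h) \<notin> level_kernel g"
          using subgroup_mult_iff[OF sub aG[OF g] inv_closed[OF aG[OF h]]] hk' gk by blast
        moreover have "a h \<otimes> inv (a g) \<notin> level_kernel g"
          using subgroup_mult_iff[OF sub aG[OF h] inv_closed[OF aG[OF g]]] hk gk' by blast
        ultimately show ?thesis using g by (auto simp: kernels_def)
      qed
      have "\<not> sim g h" using F g h ne by (auto simp: levels_def)
      then show ?thesis using *[OF g h] *[OF h g] by blast
    qed
    define r where "r h q = (SOME x. x \<in> ball h \<and> coset h x = q)" for h q
    have r: "r h q \<in> ball h \<and> coset h (r h q) = q" if "h \<in> F" "q \<in> carrier (quot h)" for h q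
    proof -
      interpret subquotient G "ball h" "open_ball h" by (rule subquotient_ball[OF FG[OF that(1)]])
      have "\<exists>x. x \<in> ball h \<and> coset h x = q" using that(2) carrier_Q by auto
      then show ?thesis unfolding r_def by (rule someI_ex)
    qed
    have carr: "coset h x \<in> carrier (quot h)" if "h \<in> F" "x \<in> ball h" for h x
      using subquotient.carrier_Q[OF subquotient_ball[OF FG[OF that(1)]]] that(2) by blast
    \<comment> \<open>\<open>\<Phi> z\<close> records the action of \<open>z\<close> on the
      quotients at the levels of \<open>F'\<close>. Elements with equal records agree modulo the
      kernels, so the elements \<open>a g\<close> have different records.\<close>
    define \<Phi> where "\<Phi> z = (\<lambda>h\<in>F'. \<lambda>q\<in>carrier (quot h). coset h (z \<otimes> r h q \<otimes> inv z))" for z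
    have \<Phi>: "z \<otimes> inv w \<in> kernels F'" if zw: "z \<in> carrier G" "w \<in> carrier G" "\<Phi> z = \<Phi> w" for z w
    proof -
      have "z \<otimes> inv w \<in> level_kernel h" if h: "h \<in> F'" for h
      proof -
        have hF: "h \<in> F" using h F'(1) by blast
        have "coset h (z \<otimes> inv w \<otimes> x \<otimes> inv (z \<otimes> inv w)) = coset h x" if x: "x \<in> ball h" for x
        proof -
          define y where "y = inv w \<otimes> x \<otimes> inv (inv w)"
          have y: "y \<in> ball h" unfolding y_def using x zw FG[OF hF] by (intro conj_ball) auto
          define q where "q = coset h y"
          have q: "q \<in> carrier (quot h)" unfolding q_def using carr[OF hF y] .
          have ry: "coset h (r h q) = coset h y" "r h q \<in> carrier G" "y \<in> carrier G" "x \<in> carrier G"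
            using r[OF hF q] y x ball_closed by (auto simp: q_def)
          have "coset h (z \<otimes> y \<otimes> inv z) = coset h (z \<otimes> r h q \<otimes> inv z)"
            using coset_conj_cong[OF FG[OF hF] ry(3,2) zw(1)] ry by simp
          also have "\<dots> = coset h (w \<otimes> r h q \<otimes> inv w)"
            using fun_cong[OF fun_cong[OF zw(3), of h], of q] h q by (simp add: \<Phi>_def)
          also have "\<dots> = coset h (w \<otimes> y \<otimes> inv w)"
            using coset_conj_cong[OF FG[OF hF] ry(2,3) zw(2)] ry by simp
          also have "w \<otimes> y \<otimes> inv w = x" using zw ry by (simp add: y_def m_assoc)
          also have "z \<otimes> y \<otimes> inv z = z \<otimes> inv w \<otimes> x \<otimes> inv (z \<otimes> inv w)"
            using zw ry by (simp add: y_def m_assoc inv_mult_group)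
          finally show ?thesis .
        qed
        then show ?thesis using level_kernel_iff[OF FG[OF hF]] zw by simp
      qed
      then show ?thesis using zw by (simp add: kernels_def)
    qed
    have fin: "finite (carrier (quot h))" and card: "card (carrier (quot h)) \<le> m" if "h \<in> F" for h
      using m[OF FG[OF that]] nc[OF that] by blast+
    define P where "P = (\<Pi>\<^sub>E h\<in>F'. carrier (quot h) \<rightarrow>\<^sub>E carrier (quot h))"
    have finF': "finite F'" using F'(1) finF finite_subset by blast
    have finP: "finite P" unfolding P_def using fin F'(1) by (intro finite_PiE finF') blast+
    have "card P = (\<Prod>h\<in>F'. card (carrier (quot h) \<rightarrow>\<^sub>E carrier (quot h)))"
      unfolding P_def by (rule card_PiE[OF finF'])
    also have "\<dots> \<le> M0 ^ (2 * k + 2)"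
    proof (rule prod_le_power[OF _ F'(2)])
      fix h assume "h \<in> F'"
      then have h: "h \<in> F" using F'(1) by blast
      have "card (carrier (quot h) \<rightarrow>\<^sub>E carrier (quot h)) = card (carrier (quot h)) ^ card (carrier (quot h))"
        by (simp add: card_PiE fin[OF h])
      also have "\<dots> \<le> Suc m ^ card (carrier (quot h))" using card[OF h] by (intro power_mono) auto
      also have "\<dots> \<le> M0" unfolding M0_def using card[OF h] by (intro power_increasing) auto
      finally show "0 \<le> card (carrier (quot h) \<rightarrow>\<^sub>E carrier (quot h)) \<and>
        card (carrier (quot h) \<rightarrow>\<^sub>E carrier (quot h)) \<le> M0" by simp
    qed (simp add: M0_def del: power_Suc)
    finally have cardP: "card P \<le> M0 ^ (2 * k + 2)" .
    have "(\<lambda>g. \<Phi> (a g)) ` F \<subseteq> P"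
    proof clarify
      fix g assume g: "g \<in> F"
      show "\<Phi> (a g) \<in> P"
        unfolding P_def \<Phi>_def
      proof (intro restrict_PiE_iff[THEN iffD2] ballI)
        fix h q assume h: "h \<in> F'" and q: "q \<in> carrier (quot h)"
        then have hF: "h \<in> F" using F'(1) by blast
        show "coset h (a g \<otimes> r h q \<otimes> inv (a g)) \<in> carrier (quot h)"
          using r[OF hF q] aG[OF g] FG[OF hF] by (intro carr hF conj_ball) auto
      qed
    qed
    moreover have "inj_on (\<lambda>g. \<Phi> (a g)) F"
    proof (rule inj_onI, rule ccontr)
      fix g h assume gh: "g \<in> F" "h \<in> F" "\<Phi> (a g) = \<Phi> (a h)" "g \<noteq> h"
      then show False using \<Phi>[OF aG[OF gh(1)] aG[OF gh(2)] gh(3)] dist[OF gh(1,2,4)] F'(3) by simp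
    qed
    ultimately have "card F \<le> card P" using card_inj_on_le finP by blast
    then show ?thesis using cardP by simp
  qed
  then show ?thesis by blast
qed

end

section \<open>Elements of o-type\<close>

context C_quasi_order
begin

lemma o_plus_iff: "g \<in> carrier G \<Longrightarrow> o_plus_type G qo g \<longleftrightarrow> lt (inv g) g"
  by (simp add: o_plus_type_def qo_less_iff)

lemma v_type_iff: "v_type G qo g \<longleftrightarrow> sim g (inv g)"
  by (simp add: v_type_def qo_equiv_def)

lemma o_type_iff: "o_type G qo g \<longleftrightarrow> g = \<one> \<or> \<not> sim g (inv g)"
  by (simp add: o_type_def qo_equiv_def)

text \<open>If \<open>g^-1\<close> were below \<open>x^-1\<close> as well as below \<open>x\<close>,
  \<open>lt_shift\<close> would give \<open>lt g (x g)\<close>, and translating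
  \<open>lt g (x^-1 g)\<close> by \<open>x\<close> would give \<open>C g (x g) x\<close>. Neither
  \<open>lt x g\<close> nor \<open>sim x g\<close> is consistent with both.\<close>

lemma o_plus_interval_aux:
  assumes g: "g \<in> carrier G" "lt (inv g) g" and x: "x \<in> carrier G" "lt (inv g) x" "qo x g"
  shows "qo (inv x) (inv g)"
proof (rule ccontr)
  assume b: "\<not> ?thesis"
  have xg: "x \<otimes> g \<in> carrier G" using g x by simp
  have a: "lt g (x \<otimes> g)" using lt_shift(1)[OF x(2)] g x by simp
  then have a': "C (x \<otimes> g) g \<one>" using lt_iff_C g x by simp
  have "lt g (inv x \<otimes> g)" using lt_shift(1)[OF b] g x by simp
  then have "C (inv x \<otimes> g) g \<one>" using lt_iff_C g x by simp
  from C_left[OF this _ _ _ x(1)] have c: "C g (x \<otimes> g) x" using g x by simp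
  have n: "\<not> C g (x \<otimes> g) \<one>"
    using a lt_iff_C[of "x \<otimes> g" g] g xg qo_total[of g "x \<otimes> g"] by blast
  show False
  proof (cases "lt x g")
    case True
    then have "C g x \<one>" using lt_iff_C g x by simp
    then show False using C_trans[OF c] n g x xg by blast
  next
    case False
    have "\<not> C x g \<one>" using x(3) lt_iff_C[of g x] g x(1) by blast
    then have d: "C (x \<otimes> g) x \<one>" using C_third[OF a' xg g(1) one_closed x(1)] by blast
    have "C g x (x \<otimes> g)" using c C_sym g(1) x(1) xg by blast
    then have "C \<one> x (x \<otimes> g) \<or> C g \<one> (x \<otimes> g)" using C_third[of g x "x \<otimes> g" \<one>] g x xg by blast
    then show False
    proof
      assume "C \<one> x (x \<otimes> g)"
      then show False using d C_sym C_asym x(1) xg by (meson one_closed)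
    next
      assume "C g \<one> (x \<otimes> g)"
      then show False using n C_sym g(1) xg by (meson one_closed)
    qed
  qed
qed

text \<open>The opposite inequality between the inverses comes from the auxiliary lemma with
  \<open>x\<close> in the role of \<open>g\<close> and \<open>g^-1\<close> in the role of
  \<open>x\<close>. Components can therefore be described by the class of the inverse.\<close>

lemma o_plus_interval:
  assumes g: "g \<in> carrier G" "lt (inv g) g" and x: "x \<in> carrier G" "lt (inv g) x" "qo x g"
  shows "lt (inv x) x" "sim (inv x) (inv g)"
proof -
  have a: "qo (inv x) (inv g)" using o_plus_interval_aux[OF assms] .
  then show l: "lt (inv x) x" using qo_lt_trans[OF a x(2)] g x by simp
  have "\<not> lt (inv x) (inv g)"
  proof
    assume b: "lt (inv x) (inv g)"
    have "qo (inv g) x" using lt_imp_qo[OF x(2)] g x by simp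
    from o_plus_interval_aux[OF x(1) l _ b this] have "qo g (inv x)" using g by simp
    then show False using g(2) qo_trans[OF _ a] g(1) x(1) by auto
  qed
  then show "sim (inv x) (inv g)" using a by blast
qed

definition lower :: "'a \<Rightarrow> 'a set" where
  "lower g = {h \<in> carrier G. qo h (inv g) \<and> qo (inv h) (inv g)}"

text \<open>The set \<open>T_plus\<close> without betweenness, for \<open>g\<close> of
  \<open>o\<^sup>+\<close>-type: the inverses of its elements form part of a single class.\<close>

definition positive :: "'a \<Rightarrow> 'a set" where
  "positive g = {h \<in> carrier G. lt (inv g) h \<and> sim (inv h) (inv g)}"

text \<open>If \<open>h k\<close> exceeded \<open>g^-1\<close>, left translation by
  \<open>h^-1\<close> would give \<open>C k (h^-1 g^-1) h^-1\<close>. Inserting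
  \<open>\<one>\<close> as a fourth point leaves two configurations, and each contradicts that
  \<open>h\<close>, \<open>k\<close> and their inverses do not exceed \<open>g^-1\<close>.\<close>

lemma subgroup_lower:
  assumes g: "g \<in> carrier G" "lt (inv g) g"
  shows "subgroup (lower g) G"
proof (rule subgroupI)
  show "lower g \<subseteq> carrier G" by (auto simp: lower_def)
  show "lower g \<noteq> {}" using g by (auto simp: lower_def intro!: exI[of _ \<one>])
  show "inv h \<in> lower g" if "h \<in> lower g" for h using that by (auto simp: lower_def)
  fix h k assume h: "h \<in> lower g" and k: "k \<in> lower g"
  have *: "qo (h \<otimes> k) (inv g)" if h: "h \<in> lower g" and k: "k \<in> lower g" for h k
  proof (rule ccontr)
    assume neg: "\<not> ?thesis"
    have hG: "h \<in> carrier G" and kG: "k \<in> carrier G" using h k by (auto simp: lower_def)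
    let ?a = "inv g" and ?u = "inv h \<otimes> inv g"
    have aG: "?a \<in> carrier G" "?u \<in> carrier G" using g hG by auto
    have hg: "lt h g" "lt (inv h) g"
      using h g hG qo_lt_trans[of h ?a g] qo_lt_trans[of "inv h" ?a g] by (auto simp: lower_def)
    have C1: "C \<one> ?u ?a" using lt_imp_C_one(1)[OF hg(2)] g hG by simp
    have C2: "C \<one> (h \<otimes> ?a) ?a" using lt_imp_C_one(1)[OF hg(1)] g hG by simp
    have "C (h \<otimes> k) ?a \<one>" using neg lt_iff_C[of ?a "h \<otimes> k"] g hG kG by simp
    from C_left[OF this _ _ _ inv_closed[OF hG]] have C3: "C k ?u (inv h)" using g hG kG by simp
    have ka: "\<not> C k ?a \<one>" using k lt_iff_C[of ?a k] g kG by (auto simp: lower_def)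
    have "C \<one> ?u (inv h) \<or> C k \<one> (inv h)"
      using C_third[OF C3 kG aG(2) inv_closed[OF hG] one_closed] C3 by blast
    have C3': "C k (inv h) ?u" using C3 C_sym kG aG hG by (meson inv_closed)
    have "C \<one> (inv h) ?u \<or> C k \<one> ?u"
      using C_third[OF C3' kG inv_closed[OF hG] aG(2) one_closed] by blast
    then show False
    proof
      assume "C \<one> (inv h) ?u"
      from C_trans[OF this C1] have "C \<one> (inv h) ?a" using aG hG by simp
      from C_left[OF this _ _ _ hG] have "C h \<one> (h \<otimes> ?a)" using aG hG by simp
      from C_third[OF this, of ?a] have "C ?a \<one> (h \<otimes> ?a) \<or> C h ?a (h \<otimes> ?a)" using aG hG by blast
      moreover have "\<not> C ?a \<one> (h \<otimes> ?a)" using C2 C_asym C_sym aG hG by (meson m_closed one_closed)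
      moreover have "C h \<one> ?a"
        if "C h ?a (h \<otimes> ?a)" using C_trans[OF \<open>C h \<one> (h \<otimes> ?a)\<close>, of ?a] that C_sym aG hG by (meson m_closed one_closed)
      ultimately have "C h ?a \<one>" using C_sym aG hG by (meson one_closed)
      then show False using h lt_iff_C[of ?a h] hG aG by (auto simp: lower_def)
    next
      assume c: "C k \<one> ?u"
      from C_third[OF c, of ?a] have "C ?a \<one> ?u \<or> C k ?a ?u" using aG kG by blast
      then show False
      proof
        assume "C ?a \<one> ?u"
        then show False using C1 C_asym C_sym aG by (meson one_closed)
      next
        assume "C k ?a ?u"
        then have "C k ?u ?a" using C_sym kG aG by blast
        from C_trans[OF c this] have "C k \<one> ?a" using kG aG by blast
        then show False using ka C_sym kG aG by (meson one_closed)
      qed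
    qed
  qed
  have G: "h \<in> carrier G" "k \<in> carrier G" using h k by (auto simp: lower_def)
  have "inv (h \<otimes> k) = inv k \<otimes> inv h" using G by (simp add: inv_mult_group)
  moreover have "inv h \<in> lower g" "inv k \<in> lower g" using h k by (auto simp: lower_def)
  ultimately show "h \<otimes> k \<in> lower g" using *[OF h k] *[of "inv k" "inv h"] G by (simp add: lower_def)
qed

lemma positive_imp_o_plus:
  assumes "g \<in> carrier G" "h \<in> positive g"
  shows "h \<in> carrier G" "lt (inv h) h"
  using assms qo_lt_trans[of "inv h" "inv g" h] by (auto simp: positive_def)

lemma positive_self: "g \<in> carrier G \<Longrightarrow> lt (inv g) g \<Longrightarrow> g \<in> positive g"
  by (simp add: positive_def)

lemma positive_cong:
  assumes "g \<in> carrier G" "h \<in> carrier G" "sim (inv h) (inv g)"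
  shows "positive h = positive g"
proof -
  have "positive h \<subseteq> positive g"
    if "g \<in> carrier G" "h \<in> carrier G" "sim (inv h) (inv g)" for g h
  proof
    fix x assume x: "x \<in> positive h"
    then have xG: "x \<in> carrier G" and x': "lt (inv h) x" "sim (inv x) (inv h)" by (auto simp: positive_def)
    have "qo (inv x) (inv g)" "qo (inv g) (inv x)"
      using qo_trans[of "inv x" "inv h" "inv g"] qo_trans[of "inv g" "inv h" "inv x"] x' that xG by simp_all
    moreover have "lt (inv g) x" using qo_lt_trans[of "inv g" "inv h" x] x' that xG by simp
    ultimately show "x \<in> positive g" using xG by (simp add: positive_def)
  qed
  then show ?thesis using assms by blast
qed

text \<open>If the inverses of \<open>g\<close> and \<open>h\<close> were inequivalent, the larger
  one would be of \<open>o\<^sup>+\<close>-type, by \<open>o_plus_interval\<close> or by the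
  condition on the elements between \<open>g\<close> and \<open>h\<close>.\<close>

lemma T_plus_eq:
  assumes g: "g \<in> carrier G" "lt (inv g) g"
  shows "T_plus G qo g = positive g"
proof (rule equalityI; rule subsetI)
  have aux: "sim (inv h) (inv g)"
    if g: "g \<in> carrier G" "lt (inv g) g" and h: "h \<in> carrier G" "lt (inv h) h" and gh: "qo g h"
      and btw: "\<And>k. k \<in> carrier G \<Longrightarrow> qo g k \<Longrightarrow> qo k h \<Longrightarrow> lt (inv k) k" for g h
  proof -
    have "\<not> lt (inv h) (inv g)"
    proof
      assume l: "lt (inv h) (inv g)"
      have "qo (inv g) h" using qo_trans[OF lt_imp_qo[OF g(2)] gh] g h by simp
      from o_plus_interval(1)[OF h _ l this] g show False using lt_imp_qo[OF g(2)] by simp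
    qed
    moreover have "\<not> lt (inv g) (inv h)"
    proof
      assume l: "lt (inv g) (inv h)"
      have hh: "qo (inv h) h" using lt_imp_qo[OF h(2)] h by simp
      have "lt (inv (inv h)) (inv h)"
      proof (cases "qo (inv h) g")
        case True
        then show ?thesis using o_plus_interval(1)[OF g _ l] h by simp
      next
        case False
        then have "qo g (inv h)" using qo_total[of "inv h" g] g h by auto
        then show ?thesis using btw[of "inv h"] hh h by simp
      qed
      then show False using hh h by simp
    qed
    ultimately show ?thesis by blast
  qed
  fix h
  assume "h \<in> T_plus G qo g"
  then have h: "h \<in> carrier G" "lt (inv h) h"
    and btw: "\<And>k. k \<in> carrier G \<Longrightarrow> between qo g h k \<Longrightarrow> lt (inv k) k"
    by (auto simp: T_plus_def o_plus_iff)
  have "sim (inv h) (inv g)"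
  proof (cases "qo g h")
    case True
    then show ?thesis using aux[OF g h True] btw by (simp add: between_def)
  next
    case False
    then have "qo h g" using qo_total g h by blast
    then have "sim (inv g) (inv h)" using aux[OF h g] btw by (simp add: between_def)
    then show ?thesis by blast
  qed
  then show "h \<in> positive g" using h qo_lt_trans[of "inv g" "inv h" h] g by (simp add: positive_def)
next
  fix h
  assume hp: "h \<in> positive g"
  then have h: "h \<in> carrier G" "lt (inv h) h" "lt (inv g) h" "sim (inv h) (inv g)"
    using positive_imp_o_plus[OF g(1) hp] by (simp_all add: positive_def)
  have "lt (inv k) k" if k: "k \<in> carrier G" "between qo g h k" for k
    using k(2) unfolding between_def
  proof
    assume b: "qo g k \<and> qo k h"
    have "lt (inv h) g" using qo_lt_trans[of "inv h" "inv g" g] h g by simp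
    then have "lt (inv h) k" using lt_qo_trans[of g "inv h" k] b h g k by simp
    then show ?thesis using o_plus_interval(1)[OF h(1,2) k(1)] b by blast
  next
    assume b: "qo h k \<and> qo k g"
    then have "lt (inv g) k" using lt_qo_trans[OF h(3)] g h k by simp
    then show ?thesis using o_plus_interval(1)[OF g k(1)] b by blast
  qed
  then show "h \<in> T_plus G qo g" using h by (simp add: T_plus_def o_plus_iff)
qed

lemma set_inv_positive: "h \<in> carrier G \<Longrightarrow> h \<in> set_inv (positive g) \<longleftrightarrow> inv h \<in> positive g"
  by (auto simp: SET_INV_def positive_def intro!: exI[of _ "inv h"])

lemma component_o_plus:
  assumes g: "g \<in> carrier G" "lt (inv g) g"
  shows "type_component G qo g = positive g \<union> set_inv (positive g)"
proof -
  have "g \<noteq> \<one>" using g by auto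
  moreover have "\<not> v_type G qo g" using g by (simp add: v_type_iff)
  ultimately show ?thesis using g by (simp add: type_component_def o_plus_iff T_plus_eq)
qed

lemma component_o_minus:
  assumes g: "g \<in> carrier G" "lt g (inv g)"
  shows "type_component G qo g = positive (inv g) \<union> set_inv (positive (inv g))"
proof -
  have "g \<noteq> \<one>" using g by auto
  moreover have "\<not> v_type G qo g" using g by (simp add: v_type_iff)
  moreover have "\<not> o_plus_type G qo g" using g qo_total[of g "inv g"] by (simp add: o_plus_iff)
  ultimately show ?thesis using g by (simp add: type_component_def T_plus_eq)
qed

text \<open>\<open>h\<close> and \<open>h^-1\<close> are compared with \<open>g^-1\<close>. If both
  are above it, \<open>o_plus_interval\<close> forces both above \<open>g\<close>.\<close>

lemma o_trichotomy:
  assumes g: "g \<in> carrier G" "lt (inv g) g" and h: "h \<in> carrier G"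
  shows "h \<in> lower g \<or> h \<in> positive g \<or> inv h \<in> positive g \<or> (lt g h \<and> lt g (inv h))"
proof -
  have one: "h \<in> positive g" if h: "h \<in> carrier G" "lt (inv g) h" "qo (inv h) (inv g)" for h
  proof (cases "qo h g")
    case True
    then show ?thesis using o_plus_interval(2)[OF g h(1,2)] h by (simp add: positive_def)
  next
    case False
    have "\<not> lt (inv h) (inv g)"
    proof
      assume l: "lt (inv h) (inv g)"
      have "lt (inv h) h" using qo_lt_trans[OF h(3,2)] g h by simp
      moreover have "qo (inv g) h" using lt_imp_qo[OF h(2)] g h by simp
      ultimately have "lt (inv (inv g)) (inv g)" using o_plus_interval(1)[OF h(1) _ _ l] g by simp
      then show False using lt_imp_qo[OF g(2)] g by simp
    qed
    then show ?thesis using h by (simp add: positive_def)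
  qed
  have two: "lt g h" if h: "h \<in> carrier G" "lt (inv g) h" "lt (inv g) (inv h)" for h
    using o_plus_interval(2)[OF g h(1,2)] h(3) by blast
  show ?thesis
    using one[OF h] one[of "inv h"] two[OF h] two[of "inv h"] h by (auto simp: lower_def)
qed

lemma above_component:
  assumes g: "g \<in> carrier G" "lt (inv g) g" and h: "h \<in> carrier G" "lt g h" "lt g (inv h)"
    and s: "s \<in> type_component G qo g"
  shows "s \<in> carrier G" "lt s h"
proof -
  have ih: "lt (inv g) h" "lt (inv g) (inv h)" using lt_trans[OF g(2)] g h by simp_all
  have pos: "lt s h" if s: "s \<in> positive g" for s
  proof (rule ccontr)
    assume "\<not> lt s h"
    then have hs: "qo h s" by blast
    have sG: "s \<in> carrier G" "lt (inv s) s" "sim (inv s) (inv g)"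
      using positive_imp_o_plus[OF g(1) s] s by (auto simp: positive_def)
    have "lt (inv s) h" using qo_lt_trans[of "inv s" "inv g" h] ih sG g h by simp
    then have "sim (inv h) (inv s)" using o_plus_interval(2)[OF sG(1,2) h(1) _ hs] by blast
    then show False using qo_trans[of "inv h" "inv s" "inv g"] ih(2) sG g h by simp
  qed
  have "s \<in> carrier G \<and> lt s h"
    using s unfolding component_o_plus[OF g]
  proof
    assume "s \<in> positive g"
    then show ?thesis using pos by (simp add: positive_def)
  next
    assume s: "s \<in> set_inv (positive g)"
    then have sG: "s \<in> carrier G" by (auto simp: SET_INV_def positive_def)
    then have "inv s \<in> positive g" using s set_inv_positive by blast
    then have "qo s (inv g)" using sG by (simp add: positive_def)
    then show ?thesis using qo_lt_trans[of s "inv g" h] ih g h sG by simp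
  qed
  then show "s \<in> carrier G" "lt s h" by blast+
qed

lemma self_in_component:
  assumes h: "h \<in> carrier G"
  shows "h \<in> type_component G qo h"
proof -
  consider "h = \<one>" | "h \<noteq> \<one>" "sim h (inv h)" | "lt (inv h) h" | "lt h (inv h)" by blast
  then show ?thesis
  proof cases
    case 1
    then show ?thesis by (simp add: type_component_def)
  next
    case 2
    have "\<not> (\<exists>k\<in>carrier G. between qo h h k \<and> o_plus_type G qo k)"
    proof
      assume "\<exists>k\<in>carrier G. between qo h h k \<and> o_plus_type G qo k"
      then obtain k where k: "k \<in> carrier G" "sim h k" "lt (inv k) k" by (auto simp: between_def o_plus_iff)
      then have "lt (inv k) h" using lt_qo_trans[OF k(3)] h by simp
      then have "lt (inv h) h" using o_plus_interval(1)[OF k(1,3) h] k(2) by blast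
      then show False using 2 by blast
    qed
    then show ?thesis using 2 h by (simp add: type_component_def v_type_iff)
  next
    case 3
    then show ?thesis using component_o_plus h positive_self by blast
  next
    case 4
    then show ?thesis using component_o_minus[OF h 4] positive_self[of "inv h"] set_inv_positive[of h] h by simp
  qed
qed

text \<open>Turns maximality among components into a condition on elements: if \<open>h\<close> and
  \<open>h^-1\<close> were above \<open>g\<close>, the component of \<open>h\<close> or of its
  inverse would lie above that of \<open>g\<close>, whichever the type of \<open>h\<close>.\<close>

lemma maximal_imp_not_above:
  assumes g: "g \<in> carrier G" "lt (inv g) g" and max: "maximal_component G qo g"
    and h: "h \<in> carrier G"
  shows "\<not> (lt g h \<and> lt g (inv h))"
proof
  assume "lt g h \<and> lt g (inv h)"
  then have gh: "lt g h" "lt g (inv h)" by blast+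
  have above: "lt s h" "lt s (inv h)" "s \<in> carrier G" if "s \<in> type_component G qo g" for s
    using above_component[OF g h gh that] above_component[OF g _ gh(2) _ that] h gh by auto
  have gT: "g \<in> type_component G qo g" using self_in_component g by blast
  have *: "False" if h: "h \<in> carrier G" and le: "\<And>s t. s \<in> type_component G qo g \<Longrightarrow> t \<in> type_component G qo h \<Longrightarrow> qo s t"
      and ne: "g \<notin> type_component G qo h" for h
  proof -
    have "component_le qo (type_component G qo g) (type_component G qo h)" using le by (auto simp: component_le_def)
    then have "type_component G qo h = type_component G qo g"
      using max h unfolding maximal_component_def by blast
    then show False using ne gT by blast
  qed
  have o_plus: "False" if h: "h \<in> carrier G" "lt (inv h) h"
    and above: "\<And>s. s \<in> type_component G qo g \<Longrightarrow> lt s (inv h) \<and> s \<in> carrier G" for h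
  proof -
    have ge: "qo (inv h) t \<and> t \<in> carrier G" if t: "t \<in> type_component G qo h" for t
    proof -
      consider "t \<in> positive h" | "t \<in> set_inv (positive h)" using t component_o_plus[OF h] by blast
      then show ?thesis
      proof cases
        case 1
        then show ?thesis using lt_imp_qo[of "inv h" t] h by (auto simp: positive_def)
      next
        case 2
        then have tG: "t \<in> carrier G" by (auto simp: SET_INV_def positive_def)
        then have "inv t \<in> positive h" using 2 set_inv_positive by blast
        then show ?thesis using tG by (simp add: positive_def)
      qed
    qed
    show False
    proof (rule *[OF h(1)])
      show "qo s t" if "s \<in> type_component G qo g" "t \<in> type_component G qo h" for s t
      proof -
        have "qo s (inv h)" using qo_total[of s "inv h"] above[OF that(1)] h by auto
        then show ?thesis using qo_trans[of s "inv h" t] above[OF that(1)] ge[OF that(2)] h by simp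
      qed
      show "g \<notin> type_component G qo h" using ge[of g] above[OF gT] by blast
    qed
  qed
  consider "sim h (inv h)" | "lt (inv h) h" | "lt h (inv h)" by blast
  then show False
  proof cases
    case 1
    have h1: "h \<noteq> \<one>" using gh(1) g by auto
    then have T: "type_component G qo h = {t \<in> carrier G. t \<noteq> \<one> \<and> v_type G qo t \<and>
           \<not> (\<exists>k\<in>carrier G. between qo t h k \<and> o_plus_type G qo k)}"
      using 1 by (simp add: type_component_def v_type_iff)
    show False
    proof (rule *[OF h])
      show "g \<notin> type_component G qo h" using g unfolding T by (simp add: v_type_iff)
      fix s t assume s: "s \<in> type_component G qo g" and t: "t \<in> type_component G qo h"
      show "qo s t"
      proof (rule ccontr)
        assume ts: "\<not> qo s t"
        have tG: "t \<in> carrier G" using t T by blast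
        have sG: "s \<in> carrier G" "lt s h" using above[OF s] by blast+
        have qts: "qo t s" using lt_imp_qo[OF ts] tG sG by blast
        have "\<exists>k\<in>carrier G. qo t k \<and> qo k h \<and> lt (inv k) k"
          using s unfolding component_o_plus[OF g]
        proof
          assume "s \<in> positive g"
          then show ?thesis using positive_imp_o_plus[OF g(1)] qts lt_imp_qo[OF sG(2) sG(1) h] by blast
        next
          assume "s \<in> set_inv (positive g)"
          then have "inv s \<in> positive g" using set_inv_positive sG by blast
          then have "qo s (inv g)" using sG by (simp add: positive_def)
          then have "qo t (inv g)" using qo_trans[OF qts] tG sG g by simp
          then have "qo t g" using qo_trans[OF _ lt_imp_qo[OF g(2)]] tG g by simp
          then show ?thesis using g lt_imp_qo[OF gh(1) g(1) h] by blast
        qed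
        then show False using t unfolding T by (auto simp: between_def o_plus_iff)
      qed
    qed
  next
    case 2
    then show False using o_plus[OF h 2] above by blast
  next
    case 3
    then show False using o_plus[of "inv h"] above h by simp
  qed
qed

lemma not_maximal_imp_above:
  assumes g: "g \<in> carrier G" "lt (inv g) g" and nmax: "\<not> maximal_component G qo g"
  shows "\<exists>h\<in>carrier G. lt g h \<and> lt g (inv h)"
proof -
  obtain h where h: "h \<in> carrier G" and le: "component_le qo (type_component G qo g) (type_component G qo h)"
    and ne: "type_component G qo h \<noteq> type_component G qo g"
    using nmax unfolding maximal_component_def by blast
  have "qo g h"
    using le ne self_in_component[OF g(1)] self_in_component[OF h] by (auto simp: component_le_def)
  have "h \<notin> lower g"
  proof
    assume "h \<in> lower g"
    then have "qo h (inv g)" by (simp add: lower_def)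
    then show False using qo_trans[OF \<open>qo g h\<close>] g h by simp
  qed
  moreover have "h \<notin> positive g"
  proof
    assume p: "h \<in> positive g"
    have "type_component G qo h = positive h \<union> set_inv (positive h)"
      using component_o_plus positive_imp_o_plus[OF g(1) p] by blast
    moreover have "positive h = positive g" using p g h by (intro positive_cong) (auto simp: positive_def)
    ultimately show False using ne component_o_plus[OF g] by simp
  qed
  moreover have "inv h \<notin> positive g"
  proof
    assume p: "inv h \<in> positive g"
    have "type_component G qo h = positive (inv h) \<union> set_inv (positive (inv h))"
      using component_o_minus[OF h] positive_imp_o_plus[OF g(1) p] h by simp
    moreover have "positive (inv h) = positive g" using p g h by (intro positive_cong) (auto simp: positive_def)
    ultimately show False using ne component_o_plus[OF g] by simp
  qed
  ultimately show ?thesis using o_trichotomy[OF g h] h by blast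
qed

end

context C_minimal_quasi_order
begin

text \<open>All elements above all parameters have the same type over the parameters, so the definable
  set of \<open>o\<^sup>+\<close>-type elements contains all or none of them.\<close>

lemma v_types_cofinal:
  assumes never: "\<And>g. g \<in> carrier G \<Longrightarrow> o_type G qo g \<Longrightarrow> \<not> maximal_component G qo g"
  shows "\<exists>g\<in>carrier G. \<forall>h\<in>carrier G. qo g h \<longrightarrow> v_type G qo h"
proof (rule ccontr)
  assume "\<not> ?thesis"
  then have cof: "\<exists>h\<in>carrier G. qo g h \<and> \<not> sim h (inv h)" if "g \<in> carrier G" for g
    using that by (auto simp: v_type_iff)
  have cof': "\<exists>h\<in>carrier G. qo g h \<and> lt (inv h) h" if g: "g \<in> carrier G" for g
  proof -
    obtain h where h: "h \<in> carrier G" "qo g h" "\<not> sim h (inv h)" using cof[OF g] by blast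
    show ?thesis
    proof (cases "lt (inv h) h")
      case True
      then show ?thesis using h by blast
    next
      case False
      then have "lt h (inv h)" using h(3) by blast
      then show ?thesis using qo_trans[OF h(2) lt_imp_qo] g h by (intro bexI[of _ "inv h"]) auto
    qed
  qed
  have "Def (\<lambda>e. \<not> qo (e 0) (inv (e 0)))" by (intro Def_intros)
  from uniformly_det1[of "\<lambda>x a. lt (inv x) x", OF this]
  obtain k where k: "det k {x \<in> carrier G. lt (inv x) x}" using one_closed by blast
  obtain B where B: "B \<subseteq> carrier G" "\<one> \<in> B" "finite B"
    "\<And>x y. x \<in> carrier G \<Longrightarrow> y \<in> carrier G \<Longrightarrow> agree B x y \<Longrightarrow> lt (inv x) x \<longleftrightarrow> lt (inv y) y"
    using k unfolding det_def by blast
  have agree: "agree B x y"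
    if x: "x \<in> carrier G" "\<And>b. b \<in> B \<Longrightarrow> lt b x" and y: "y \<in> carrier G" "\<And>b. b \<in> B \<Longrightarrow> lt b y" for x y
  proof -
    have *: "x \<noteq> b \<and> C x b b' \<and> \<not> C b x b'"
      if x: "x \<in> carrier G" "\<And>b. b \<in> B \<Longrightarrow> lt b x" and b: "b \<in> B" "b' \<in> B" for x b b'
    proof -
      have G: "b \<in> carrier G" "b' \<in> carrier G" using b B(1) by auto
      have "C x b \<one>" "C x b' \<one>" using lt_iff_C x b G by blast+
      then have "C x b b'" using C_trans[of x b \<one> b'] C_sym x(1) G by (meson one_closed)
      moreover have "\<not> C b x b'" using C_asym[OF calculation] x(1) G by blast
      moreover have "x \<noteq> b" using x(2)[OF b(1)] G by auto
      ultimately show ?thesis by blast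
    qed
    show ?thesis unfolding agree_def using *[OF x] *[OF y] by blast
  qed
  have bound: "\<exists>m\<in>carrier G. \<forall>b\<in>B'. qo b m" if "finite B'" "B' \<subseteq> carrier G" for B'
    using that
  proof (induction B' rule: finite_induct)
    case (insert b B')
    then obtain m where m: "m \<in> carrier G" "\<forall>b\<in>B'. qo b m" by auto
    have bG: "b \<in> carrier G" using insert by simp
    show ?case
    proof (cases "qo b m")
      case True
      then show ?thesis using m by auto
    next
      case False
      then have mb: "qo m b" using qo_total m bG by blast
      have "\<forall>c\<in>insert b B'. qo c b" using qo_trans[OF _ mb] m bG insert.prems by auto
      then show ?thesis using bG by blast
    qed
  qed auto
  obtain m where m: "m \<in> carrier G" "\<forall>b\<in>B. qo b m" using bound[OF B(3,1)] by blast
  \<comment> \<open>An \<open>o\<^sup>+\<close>-type element not below any parameter. As its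
    component is not maximal, some \<open>h\<close> and \<open>h^-1\<close> are both above
    it.\<close>
  obtain g0 where g0: "g0 \<in> carrier G" "qo m g0" "lt (inv g0) g0" using cof'[OF m(1)] by blast
  have "o_type G qo g0" using g0 by (simp add: o_type_iff)
  then obtain h where h: "h \<in> carrier G" "lt g0 h" "lt g0 (inv h)"
    using not_maximal_imp_above[OF g0(1,3)] never g0(1) by blast
  obtain g1 where g1: "g1 \<in> carrier G" "qo h g1" "lt (inv g1) g1" using cof'[OF h(1)] by blast
  have above: "lt b x" if b: "b \<in> B" and x: "x \<in> carrier G" "lt g0 x" for b x
  proof -
    have bG: "b \<in> carrier G" using b B(1) by blast
    have "qo b g0" using qo_trans[OF bspec[OF m(2) b] g0(2)] bG m g0 by blast
    then show ?thesis using qo_lt_trans[OF _ x(2)] bG g0 x by blast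
  qed
  have "lt g0 g1" using lt_qo_trans[OF h(2) g1(2)] g0 h g1 by blast
  \<comment> \<open>At least one of \<open>h\<close> and \<open>h^-1\<close> is not of
    \<open>o\<^sup>+\<close>-type; it is above all parameters, just like the
    \<open>o\<^sup>+\<close>-type element \<open>g1\<close>.\<close>
  define w where "w = (if lt (inv h) h then inv h else h)"
  have w: "w \<in> carrier G" "lt g0 w" "\<not> lt (inv w) w"
    using h lt_imp_qo[of h "inv h"] by (auto simp: w_def)
  have "agree B g1 w" using agree[of g1 w] above \<open>lt g0 g1\<close> g1(1) w by blast
  then show False using B(4)[OF g1(1) w(1)] g1(3) w(3) by blast
qed

end

section \<open>A maximal type-component of o-type\<close>

text \<open>By \<open>not_above\<close> and \<open>o_trichotomy\<close> the group is the union of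
  \<open>lower g\<close> and the component of \<open>g\<close>. An \<open>o\<^sup>-\<close>-type
  element is replaced by its inverse to fit the locale.\<close>

locale C_minimal_top = C_minimal_quasi_order +
  fixes g
  assumes g_closed [simp]: "g \<in> carrier G" and g_o_plus: "lt (inv g) g"
    and not_above: "h \<in> carrier G \<Longrightarrow> \<not> (lt g h \<and> lt g (inv h))"
begin

abbreviation N :: "'a set" where
  "N \<equiv> lower g"

abbreviation Pos :: "'a set" where
  "Pos \<equiv> positive g"

lemma N_closed: "x \<in> N \<Longrightarrow> x \<in> carrier G"
  by (simp add: lower_def)

lemma Pos_closed: "x \<in> Pos \<Longrightarrow> x \<in> carrier G"
  by (simp add: positive_def)

lemma N_cases:
  assumes "h \<in> carrier G"
  obtains "h \<in> N" | "h \<in> Pos" | "inv h \<in> Pos"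
  using o_trichotomy[OF g_closed g_o_plus assms] not_above[OF assms] by blast

lemma N_not_Pos: "h \<in> N \<Longrightarrow> h \<notin> Pos" "h \<in> N \<Longrightarrow> inv h \<notin> Pos"
  by (auto simp: lower_def positive_def)

lemma Pos_asym: "h \<in> Pos \<Longrightarrow> inv h \<notin> Pos"
  by (auto simp: positive_def)

lemma Pos_iff:
  assumes "h \<in> carrier G"
  shows "h \<in> Pos \<longleftrightarrow> lt (inv g) h"
  by (rule N_cases[OF assms]) (use assms in \<open>auto simp: lower_def positive_def\<close>)

lemma N_iff: "h \<in> carrier G \<Longrightarrow> h \<in> N \<longleftrightarrow> h \<notin> Pos \<and> inv h \<notin> Pos"
  using N_cases N_not_Pos by blast

lemma subgroup_N: "subgroup N G"
  using subgroup_lower[OF g_closed g_o_plus] .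

lemma g_Pos: "g \<in> Pos"
  using positive_self[OF g_closed g_o_plus] .

lemma Pos_mult:
  assumes "h \<in> Pos" "k \<in> Pos"
  shows "h \<otimes> k \<in> Pos"
proof -
  have G: "h \<in> carrier G" "k \<in> carrier G" using assms Pos_closed by auto
  have "lt (inv k) h" using qo_lt_trans[of "inv k" "inv g" h] assms G by (simp add: positive_def)
  from lt_shift(1)[OF this] have "lt k (h \<otimes> k)" using G by simp
  then have "lt (inv g) (h \<otimes> k)" 
    using lt_trans[of k "inv g" "h \<otimes> k"] assms G by (simp add: positive_def)
  then show ?thesis using Pos_iff G by simp
qed

lemma N_Pos_mult:
  assumes n: "n \<in> N" and p: "p \<in> Pos"
  shows "n \<otimes> p \<in> Pos" "p \<otimes> n \<in> Pos"
proof -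
  have G: "n \<in> carrier G" "p \<in> carrier G" using n p N_closed Pos_closed by auto
  have in_N: "inv n \<in> N" using subgroup.m_inv_closed[OF subgroup_N n] .
  show "n \<otimes> p \<in> Pos"
  proof (rule N_cases[of "n \<otimes> p"])
    assume "n \<otimes> p \<in> N"
    then have "inv n \<otimes> (n \<otimes> p) \<in> N" using subgroup.m_closed[OF subgroup_N in_N] by blast
    then show ?thesis using p N_not_Pos G by simp
  next
    assume "inv (n \<otimes> p) \<in> Pos"
    from Pos_mult[OF p this] have "inv n \<in> Pos" using G by (simp add: inv_mult_group)
    then show ?thesis using N_not_Pos in_N by blast
  qed (use G in auto)
  show "p \<otimes> n \<in> Pos"
  proof (rule N_cases[of "p \<otimes> n"])
    assume "p \<otimes> n \<in> N"
    then have "(p \<otimes> n) \<otimes> inv n \<in> N" using subgroup.m_closed[OF subgroup_N _ in_N] by blast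
    then show ?thesis using p N_not_Pos G by (simp add: m_assoc)
  next
    assume "inv (p \<otimes> n) \<in> Pos"
    from Pos_mult[OF this p] have "inv n \<in> Pos" using G by (simp add: inv_mult_group m_assoc)
    then show ?thesis using N_not_Pos in_N by blast
  qed (use G in auto)
qed

text \<open>The conjugate of \<open>h\<close> is again of \<open>o\<^sup>+\<close>-type. If it fell
  into \<open>N\<close>, the conjugate of \<open>g^-1\<close> by \<open>z^-1\<close> and its inverse
  would both be above \<open>g^-1\<close>, hence both positive.\<close>

lemma Pos_conj:
  assumes h: "h \<in> Pos" and z: "z \<in> carrier G"
  shows "z \<otimes> h \<otimes> inv z \<in> Pos"
proof -
  let ?w = "z \<otimes> h \<otimes> inv z"
  have G: "h \<in> carrier G" "?w \<in> carrier G" using h z Pos_closed by auto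
  have iw: "inv ?w = z \<otimes> inv h \<otimes> inv z" using z G(1) by (simp add: inv_mult_group m_assoc)
  have ow: "lt (inv ?w) ?w" unfolding iw using qo_conj positive_imp_o_plus[OF g_closed h] z by simp
  show ?thesis
  proof (rule N_cases[OF G(2)])
    assume w: "?w \<in> N"
    define u where "u = inv z \<otimes> inv g \<otimes> inv (inv z)"
    have uG: "u \<in> carrier G" using z by (simp add: u_def)
    have "qo (inv z \<otimes> ?w \<otimes> inv (inv z)) u"
      unfolding u_def using qo_conj[of ?w "inv g" "inv z"] w z G by (simp add: lower_def)
    then have "qo h u" using z G(1) by (simp add: m_assoc)
    then have "lt (inv g) u" using lt_qo_trans[of h "inv g" u] h uG by (simp add: positive_def)
    moreover have "inv u = inv z \<otimes> g \<otimes> inv (inv z)" using z by (simp add: u_def inv_mult_group m_assoc)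
    then have "lt u (inv u)" unfolding u_def using qo_conj[of g "inv g" "inv z"] z g_o_plus by simp
    then have "lt (inv g) (inv u)" using lt_trans[OF calculation] uG by simp
    ultimately have "u \<in> Pos" "inv u \<in> Pos" using Pos_iff uG by auto
    then show ?thesis using Pos_asym by blast
  next
    assume "inv ?w \<in> Pos"
    then have "lt ?w (inv ?w)" using positive_imp_o_plus(2)[OF g_closed, of "inv ?w"] G(2) inv_inv by simp
    then show ?thesis using ow qo_total[of ?w "inv ?w"] G(2) by blast
  qed
qed

lemma normal_N: "N \<lhd> G"
proof (rule normal_invI[OF subgroup_N])
  fix z h assume z: "z \<in> carrier G" and h: "h \<in> N"
  let ?w = "z \<otimes> h \<otimes> inv z"
  have G: "h \<in> carrier G" "?w \<in> carrier G" using h z N_closed by auto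
  have conj_back: "inv z \<otimes> ?w \<otimes> inv (inv z) = h" "inv z \<otimes> inv ?w \<otimes> inv (inv z) = inv h"
    using z G(1) by (simp_all add: inv_mult_group m_assoc)
  show "?w \<in> N"
    using Pos_conj[of ?w "inv z"] Pos_conj[of "inv ?w" "inv z"] conj_back N_not_Pos[OF h] z
    by (auto simp: N_iff[OF G(2)])
qed

text \<open>The strict ordering of \<open>G/N\<close> pulled back to \<open>G\<close>; elements of
  the same coset of \<open>N\<close> are incomparable.\<close>

definition gt :: "'a \<Rightarrow> 'a \<Rightarrow> bool" where
  "gt x y \<longleftrightarrow> x \<otimes> inv y \<in> Pos"

lemma gt_asym: "gt x y \<Longrightarrow> x \<in> carrier G \<Longrightarrow> y \<in> carrier G \<Longrightarrow> \<not> gt y x"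
  using Pos_asym[of "x \<otimes> inv y"] by (simp add: gt_def inv_mult_group)

lemma N_iff_gt: "x \<in> carrier G \<Longrightarrow> y \<in> carrier G \<Longrightarrow> x \<otimes> inv y \<in> N \<longleftrightarrow> \<not> gt x y \<and> \<not> gt y x"
  using N_iff[of "x \<otimes> inv y"] by (simp add: gt_def inv_mult_group)

lemma gt_not_gt_trans:
  assumes "gt x y" "\<not> gt z y" "x \<in> carrier G" "y \<in> carrier G" "z \<in> carrier G"
  shows "gt x z"
proof -
  have "y \<otimes> inv z \<in> N \<or> y \<otimes> inv z \<in> Pos" using N_iff_gt[of y z] assms by (auto simp: gt_def)
  then have "(x \<otimes> inv y) \<otimes> (y \<otimes> inv z) \<in> Pos"
    using assms(1) Pos_mult N_Pos_mult(2) unfolding gt_def by blast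
  then show ?thesis using assms by (simp add: gt_def m_assoc)
qed

lemma not_gt_gt_trans:
  assumes "\<not> gt y x" "gt y z" "x \<in> carrier G" "y \<in> carrier G" "z \<in> carrier G"
  shows "gt x z"
proof -
  have "x \<otimes> inv y \<in> N \<or> x \<otimes> inv y \<in> Pos" using N_iff_gt[of x y] assms by (auto simp: gt_def)
  then have "(x \<otimes> inv y) \<otimes> (y \<otimes> inv z) \<in> Pos"
    using assms(2) Pos_mult N_Pos_mult(1) unfolding gt_def by blast
  then show ?thesis using assms by (simp add: gt_def m_assoc)
qed

lemma gt_trans: "gt x y \<Longrightarrow> gt y z \<Longrightarrow> x \<in> carrier G \<Longrightarrow> y \<in> carrier G \<Longrightarrow> z \<in> carrier G \<Longrightarrow> gt x z"
  using gt_not_gt_trans[of x y z] gt_asym[of y z] by blast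

lemma gt_mult_Pos: "h \<in> Pos \<Longrightarrow> x \<in> carrier G \<Longrightarrow> gt (h \<otimes> x) x"
  using Pos_closed by (simp add: gt_def m_assoc)

lemma gt_right: "x \<in> carrier G \<Longrightarrow> y \<in> carrier G \<Longrightarrow> u \<in> carrier G \<Longrightarrow> gt (x \<otimes> u) (y \<otimes> u) \<longleftrightarrow> gt x y"
  by (simp add: gt_def m_assoc inv_mult_group)

lemma gt_left_imp:
  assumes "gt x y" "x \<in> carrier G" "y \<in> carrier G" "u \<in> carrier G"
  shows "gt (u \<otimes> x) (u \<otimes> y)"
  using Pos_conj[of "x \<otimes> inv y" u] assms by (simp add: gt_def m_assoc inv_mult_group)

lemma gt_left:
  assumes "x \<in> carrier G" "y \<in> carrier G" "u \<in> carrier G"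
  shows "gt (u \<otimes> x) (u \<otimes> y) \<longleftrightarrow> gt x y"
  using gt_left_imp[of x y u] gt_left_imp[of "u \<otimes> x" "u \<otimes> y" "inv u"] assms by auto

text \<open>For positive \<open>b\<close> both directions are shifts by \<open>b^-1\<close>, which
  is equivalent to \<open>g^-1\<close>; for the remaining \<open>b\<close> both sides hold.\<close>

lemma lt_Pos_iff:
  assumes a: "a \<in> Pos" and b: "b \<in> carrier G"
  shows "lt b a \<longleftrightarrow> a \<otimes> inv b \<in> Pos"
proof
  have aG: "a \<in> carrier G" using a Pos_closed by blast
  assume l: "lt b a"
  show "a \<otimes> inv b \<in> Pos"
  proof (rule N_cases[OF b])
    assume "b \<in> N"
    then show ?thesis using N_Pos_mult(2)[OF subgroup.m_inv_closed[OF subgroup_N] a] by blast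
  next
    assume bP: "b \<in> Pos"
    have "lt (inv b) (a \<otimes> inv b)" using lt_shift(1)[OF l b aG] .
    then have "lt (inv g) (a \<otimes> inv b)" using qo_lt_trans[of "inv g" "inv b"] bP aG b by (simp add: positive_def)
    then show ?thesis using Pos_iff aG b by simp
  next
    assume "inv b \<in> Pos"
    then show ?thesis using Pos_mult a by blast
  qed
next
  have aG: "a \<in> carrier G" using a Pos_closed by blast
  assume ab: "a \<otimes> inv b \<in> Pos"
  show "lt b a"
  proof (cases "b \<in> Pos")
    case True
    then have "lt (inv b) (a \<otimes> inv b)"
      using qo_lt_trans[of "inv b" "inv g" "a \<otimes> inv b"] ab Pos_iff aG b by (simp add: positive_def)
    from lt_shift(1)[OF this] show ?thesis using aG b by (simp add: m_assoc)
  next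
    case False
    then have "qo b (inv g)" using Pos_iff b by blast
    then show ?thesis using qo_lt_trans[of b "inv g" a] a aG b Pos_iff by simp
  qed
qed

lemma C_gt:
  assumes "gt x z" "x \<in> carrier G" "y \<in> carrier G" "z \<in> carrier G"
  shows "C x y z \<longleftrightarrow> gt x y"
  using lt_Pos_iff[of "x \<otimes> inv z" "y \<otimes> inv z"] assms C_iff[of x y z]
  by (simp add: gt_def m_assoc inv_mult_group)

text \<open>For all \<open>x\<close> below \<open>z\<close> modulo \<open>N\<close>, the quotient
  \<open>x z^-1\<close> is equivalent to \<open>g^-1\<close>; so the formula does not depend on
  \<open>x\<close> any more.\<close>

lemma C_gt_reverse:
  assumes "gt z x" "x \<in> carrier G" "y \<in> carrier G" "z \<in> carrier G"
  shows "C x y z \<longleftrightarrow> lt (y \<otimes> inv z) (inv g)"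
proof -
  have "inv (x \<otimes> inv z) \<in> Pos" using assms by (simp add: gt_def inv_mult_group)
  then have s: "sim (x \<otimes> inv z) (inv g)" using assms by (simp add: positive_def)
  have G: "x \<otimes> inv z \<in> carrier G" "y \<otimes> inv z \<in> carrier G" using assms by auto
  have "qo (x \<otimes> inv z) (y \<otimes> inv z) \<longleftrightarrow> qo (inv g) (y \<otimes> inv z)"
    using qo_trans[of "inv g" "x \<otimes> inv z" "y \<otimes> inv z"] qo_trans[of "x \<otimes> inv z" "inv g" "y \<otimes> inv z"]
      s G inv_closed[OF g_closed] by blast
  then show ?thesis unfolding C_iff[OF assms(2-4)] by blast
qed

lemma C_not_gt:
  assumes "\<not> gt x z" "C x y z" "x \<in> carrier G" "y \<in> carrier G" "z \<in> carrier G"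
  shows "lt (y \<otimes> inv z) (inv g)" "y \<otimes> inv z \<in> N"
proof -
  have G: "x \<otimes> inv z \<in> carrier G" "y \<otimes> inv z \<in> carrier G" using assms by auto
  have "qo (x \<otimes> inv z) (inv g)" using assms(1) Pos_iff[OF G(1)] by (simp add: gt_def)
  moreover have "lt (y \<otimes> inv z) (x \<otimes> inv z)" using assms C_iff by blast
  ultimately show l: "lt (y \<otimes> inv z) (inv g)" using lt_qo_trans[of "x \<otimes> inv z" "y \<otimes> inv z" "inv g"] G by simp
  have "y \<otimes> inv z \<notin> Pos" using Pos_iff[OF G(2)] lt_imp_qo[OF l] G by simp
  moreover have "inv (y \<otimes> inv z) \<notin> Pos"
  proof
    assume "inv (y \<otimes> inv z) \<in> Pos"
    then have "sim (inv (inv (y \<otimes> inv z))) (inv g)" by (simp only: positive_def mem_Collect_eq)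
    then show False using l G by simp
  qed
  ultimately show "y \<otimes> inv z \<in> N" using N_iff[OF G(2)] by blast
qed

text \<open>Off the cosets of the parameters, \<open>C_gt\<close> and \<open>C_gt_reverse\<close>
  evaluate every atomic formula from the cut of the element in the ordering modulo
  \<open>N\<close>.\<close>

lemma cut_agree:
  assumes B: "B \<subseteq> carrier G" and x: "x \<in> carrier G" and y: "y \<in> carrier G"
    and cut: "\<And>b. b \<in> B \<Longrightarrow> (gt x b \<and> gt y b) \<or> (gt b x \<and> gt b y)"
  shows "agree B x y"
proof -
  have irr: "\<not> gt b b" if "b \<in> carrier G" for b using gt_asym[of b b] that by blast
  have C1: "C u b b' \<longleftrightarrow> (if gt u b' then gt u b else lt (b \<otimes> inv b') (inv g))"
    if "u \<in> carrier G" "b \<in> B" "b' \<in> B" "gt u b' \<or> gt b' u" for u b b'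
    using that B C_gt[of u b' b] C_gt_reverse[of b' u b] by auto
  have C2: "C b u b' \<longleftrightarrow> gt b b' \<and> gt b u"
    if "u \<in> carrier G" "b \<in> B" "b' \<in> B" "gt u b' \<or> gt b' u" for u b b'
  proof (cases "gt b b'")
    case True
    then show ?thesis using C_gt[of b b' u] that B by auto
  next
    case False
    have G: "b \<in> carrier G" "b' \<in> carrier G" using that B by auto
    have "\<not> C b u b'" using C_not_gt(2)[OF False] N_iff_gt[of u b'] that G by blast
    then show ?thesis using False by blast
  qed
  have asym: "\<not> (gt b x \<and> gt x b)" "\<not> (gt b y \<and> gt y b)" if "b \<in> B" for b
    using gt_asym that B x y by blast+
  show ?thesis
    unfolding agree_def
  proof (intro conjI ballI)
    fix b assume b: "b \<in> B"
    show "x = b \<longleftrightarrow> y = b" using cut[OF b] irr x y by auto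
    fix b' assume b': "b' \<in> B"
    have cx: "gt x b' \<or> gt b' x" and cy: "gt y b' \<or> gt b' y" using cut[OF b'] by auto
    show "C x b b' \<longleftrightarrow> C y b b'"
      unfolding C1[OF x b b' cx] C1[OF y b b' cy] using cut[OF b] cut[OF b'] asym[OF b] asym[OF b'] by auto
    show "C b x b' \<longleftrightarrow> C b y b'"
      unfolding C2[OF x b b' cx] C2[OF y b b' cy] using cut[OF b] asym[OF b] by auto
  qed
qed

lemma exists_above:
  assumes "finite E" "E \<subseteq> carrier G"
  shows "\<exists>x\<in>carrier G. \<forall>b\<in>E. gt x b"
  using assms
proof (induction E rule: finite_induct)
  case empty
  then show ?case using g_closed by blast
next
  case (insert b E)
  then obtain x where x: "x \<in> carrier G" "\<forall>c\<in>E. gt x c" by auto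
  have bG: "b \<in> carrier G" and EG: "E \<subseteq> carrier G" using insert by auto
  show ?case
  proof (cases "gt x b")
    case True
    then show ?thesis using x by auto
  next
    case False
    have gb: "gt (g \<otimes> b) b" using gt_mult_Pos[OF g_Pos bG] .
    have "gt (g \<otimes> b) c" if c: "c \<in> E" for c
    proof -
      have cG: "c \<in> carrier G" using c EG by blast
      have "gt b c" using not_gt_gt_trans[OF False _ bG x(1) cG] x(2) c by blast
      then show ?thesis using gt_trans[OF gb] bG cG by simp
    qed
    then show ?thesis using gb bG by (intro bexI[of _ "g \<otimes> b"]) auto
  qed
qed

lemma exists_above_in:
  assumes "finite E" "E \<subseteq> carrier G" "H \<subseteq> carrier G" "H \<noteq> {}" "\<And>b. b \<in> E \<Longrightarrow> \<exists>y\<in>H. gt y b"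
  shows "\<exists>x\<in>H. \<forall>b\<in>E. gt x b"
  using assms(1,2,5)
proof (induction E rule: finite_induct)
  case empty
  then show ?case using assms(4) by blast
next
  case (insert b E)
  then obtain x where x: "x \<in> H" "\<forall>c\<in>E. gt x c" by auto
  have bG: "b \<in> carrier G" and EG: "E \<subseteq> carrier G" and xG: "x \<in> carrier G" using insert x assms(3) by auto
  show ?case
  proof (cases "gt x b")
    case True
    then show ?thesis using x by auto
  next
    case False
    obtain y where y: "y \<in> H" "gt y b" using insert.prems by blast
    have yG: "y \<in> carrier G" using y assms(3) by blast
    have "gt y c" if c: "c \<in> E" for c
    proof -
      have cG: "c \<in> carrier G" using c EG by blast
      have "gt b c" using not_gt_gt_trans[OF False _ bG xG cG] x(2) c by blast
      then show ?thesis using gt_trans[OF y(2)] bG cG yG by blast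
    qed
    then show ?thesis using y by (intro bexI[of _ y]) auto
  qed
qed

lemma exists_least:
  assumes "finite E" "E \<noteq> {}" "E \<subseteq> carrier G"
  shows "\<exists>m\<in>E. \<forall>b\<in>E. \<not> gt m b"
  using assms
proof (induction E rule: finite_ne_induct)
  case (singleton x)
  then show ?case using gt_asym[of x x] by auto
next
  case (insert b E)
  then obtain m where m: "m \<in> E" "\<forall>c\<in>E. \<not> gt m c" by auto
  have bG: "b \<in> carrier G" and EG: "E \<subseteq> carrier G" and mG: "m \<in> carrier G" using insert m by auto
  show ?case
  proof (cases "gt m b")
    case False
    then show ?thesis using m by auto
  next
    case True
    have "\<not> gt b c" if c: "c \<in> E" for c
      using gt_trans[OF True, of c] m(2) c mG bG EG by blast
    then show ?thesis using gt_asym[of b b] bG by (intro bexI[of _ b]) auto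
  qed
qed

text \<open>Such a subgroup has elements above every parameter, since the least parameter above it could be
  shifted down by an element of the subgroup without leaving its cell.\<close>

lemma definable_subgroup_eq_carrier:
  assumes H: "subgroup H G" "det k H" and hH: "h0 \<in> H" "h0 \<notin> N"
  shows "H = carrier G"
proof -
  have HG: "H \<subseteq> carrier G" using subgroup.subset[OF H(1)] .
  obtain h where h: "h \<in> H" "h \<in> Pos"
    using N_cases[of h0] hH HG subgroup.m_inv_closed[OF H(1) hH(1)] by blast
  have hG: "h \<in> carrier G" using h HG by blast
  obtain B where B: "B \<subseteq> carrier G" "finite B"
    "\<And>x y. x \<in> carrier G \<Longrightarrow> y \<in> carrier G \<Longrightarrow> agree B x y \<Longrightarrow> x \<in> H \<longleftrightarrow> y \<in> H"
    using H(2) unfolding det_def by blast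
  \<comment> \<open>The parameters that are not exceeded by any element of \<open>H\<close>; there
    turn out to be none.\<close>
  define U where "U = {b \<in> B. \<forall>y\<in>H. \<not> gt y b}"
  have UB: "U \<subseteq> B" by (auto simp: U_def)
  have "\<exists>y\<in>H. \<forall>b\<in>B - U. gt y b"
    using B(1,2) HG h by (intro exists_above_in) (auto simp: U_def)
  then obtain y where y: "y \<in> H" "\<And>b. b \<in> B - U \<Longrightarrow> gt y b" by blast
  have yG: "y \<in> carrier G" using y HG by blast
  have "U = {}"
  proof (rule ccontr)
    assume "U \<noteq> {}"
    then obtain b0 where b0: "b0 \<in> U" "\<And>b. b \<in> U \<Longrightarrow> \<not> gt b0 b"
      using exists_least[of U] finite_subset[OF UB B(2)] UB B(1) by blast
    have b0G: "b0 \<in> carrier G" using b0 UB B(1) by blast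
    have hy: "\<not> gt (h \<otimes> y) b0" using b0(1) subgroup.m_closed[OF H(1) h(1) y(1)] by (auto simp: U_def)
    have b0y: "gt b0 y" using not_gt_gt_trans[OF hy gt_mult_Pos[OF h(2) yG]] b0G hG yG by simp
    \<comment> \<open>\<open>z\<close> lies one step \<open>h\<close> below the least bound
      \<open>b0\<close> and not below \<open>y\<close>, so no parameter separates it from
      \<open>y \<in> H\<close>. Then \<open>h h z = h b0\<close> would be an element of
      \<open>H\<close> above \<open>b0\<close>.\<close>
    define z where "z = inv h \<otimes> b0"
    have zG: "z \<in> carrier G" using hG b0G by (simp add: z_def)
    have hz: "h \<otimes> z = b0" using hG b0G by (simp add: z_def)
    have bz: "gt b0 z" using gt_mult_Pos[OF h(2) zG] hz by simp
    have "\<not> gt y z" using hy gt_left[OF yG zG hG] hz by simp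
    have "agree B y z"
    proof (rule cut_agree[OF B(1) yG zG])
      fix b assume b: "b \<in> B"
      then have bG: "b \<in> carrier G" using B(1) by blast
      show "(gt y b \<and> gt z b) \<or> (gt b y \<and> gt b z)"
      proof (cases "b \<in> U")
        case True
        then show ?thesis using not_gt_gt_trans[OF b0(2)[OF True]] b0y bz bG b0G yG zG by blast
      next
        case False
        then have "gt y b" using y(2) b by blast
        then show ?thesis using not_gt_gt_trans[OF \<open>\<not> gt y z\<close>] bG yG zG by blast
      qed
    qed
    then have "z \<in> H" using B(3)[OF yG zG] y(1) by blast
    then have "h \<otimes> (h \<otimes> z) \<in> H" using subgroup.m_closed[OF H(1)] h(1) by blast
    then have "\<not> gt (h \<otimes> b0) b0" using b0(1) hz by (auto simp: U_def)
    then show False using gt_mult_Pos[OF h(2) b0G] by blast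
  qed
  have above: "x \<in> H" if x: "x \<in> carrier G" "\<And>b. b \<in> B \<Longrightarrow> gt x b" for x
  proof -
    have "agree B y x" by (rule cut_agree[OF B(1) yG x(1)]) (use x y \<open>U = {}\<close> in auto)
    then show ?thesis using B(3)[OF yG x(1)] y(1) by blast
  qed
  have "u \<in> H" if u: "u \<in> carrier G" for u
  proof -
    \<comment> \<open>Every \<open>u\<close> is the quotient of two elements \<open>u x\<close> and
      \<open>x\<close> that are both above all parameters.\<close>
    have "\<exists>x\<in>carrier G. \<forall>b\<in>B \<union> (\<lambda>b. inv u \<otimes> b) ` B. gt x b"
      using B(1,2) u by (intro exists_above) auto
    then obtain x where x: "x \<in> carrier G" "\<And>b. b \<in> B \<Longrightarrow> gt x b" "\<And>b. b \<in> B \<Longrightarrow> gt x (inv u \<otimes> b)" by blast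
    have "x \<in> H" using above x(1,2) .
    moreover have "u \<otimes> x \<in> H"
    proof (rule above)
      fix b assume b: "b \<in> B"
      then have bG: "b \<in> carrier G" using B(1) by blast
      show "gt (u \<otimes> x) b" using gt_left[of x "inv u \<otimes> b" u] x(1) x(3)[OF b] u bG by simp
    qed (use u x in simp)
    ultimately have "(u \<otimes> x) \<otimes> inv x \<in> H" using H(1) by (meson subgroup.m_closed subgroup.m_inv_closed)
    then show ?thesis using u x(1) by (simp add: m_assoc)
  qed
  then show ?thesis using HG by blast
qed

lemma g_not_N: "g \<notin> N"
  using g_Pos N_not_Pos by blast

text \<open>The centralizer of an element outside of \<open>N\<close> contains that element and is
  therefore everything; elements of \<open>N\<close> are quotients of elements outside of
  \<open>N\<close>.\<close>

lemma comm_group_G: "comm_group G"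
proof -
  have "Def (\<lambda>e. e 0 \<otimes> e 1 = e 1 \<otimes> e 0)" by (intro Def_intros)
  from uniformly_det1[of "\<lambda>x a. x \<otimes> a = a \<otimes> x", OF this] obtain k where
    k: "\<forall>a\<in>carrier G. det k (centralizer a)" unfolding centralizer_def by blast
  have c: "centralizer x = carrier G" if "x \<in> carrier G" "x \<notin> N" for x
    using definable_subgroup_eq_carrier[OF subgroup_centralizer _ centralizer_self] k that by blast
  have "x \<in> centralizer a" if x: "x \<in> carrier G" and a: "a \<in> carrier G" for x a
  proof -
    have *: "y \<in> centralizer a" if "y \<in> carrier G" "y \<notin> N" for y
    proof -
      have "a \<in> centralizer y" using c[OF that] a by blast
      then show ?thesis using that by (simp add: centralizer_def)
    qed
    show ?thesis
    proof (cases "x \<in> N")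
      case True
      have "x \<otimes> g \<notin> N" using N_Pos_mult(1)[OF True g_Pos] N_not_Pos by blast
      then have "x \<otimes> g \<in> centralizer a" "g \<in> centralizer a" using * g_not_N x by auto
      then have "(x \<otimes> g) \<otimes> inv g \<in> centralizer a"
        using subgroup_centralizer[OF a] by (meson subgroup.m_closed subgroup.m_inv_closed)
      then show ?thesis using x by (simp add: m_assoc)
    next
      case False
      then show ?thesis using * x by blast
    qed
  qed
  then show ?thesis by (intro group_comm_groupI) (auto simp: centralizer_def)
qed

text \<open>The subgroup of \<open>n\<close>-th powers contains the \<open>n\<close>-th power of
  \<open>g\<close>, which is again positive.\<close>

lemma divisible_G: "divisible_group G"
proof -
  interpret comm_group G by (rule comm_group_G)
  have "(\<lambda>x. x [^] n) ` carrier G = carrier G" if n: "0 < n" for n :: nat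
  proof -
    have "Def (\<lambda>e. \<exists>y\<in>carrier G. e 0 = y [^] n)"
      by (rule Def_bex[where n = 3]) (auto intro!: Def_eq Def_fun_pow Def_fun_var)
    from uniformly_det1[of "\<lambda>x a. \<exists>y\<in>carrier G. x = y [^] n", OF this]
    obtain k where k: "det k {x \<in> carrier G. \<exists>y\<in>carrier G. x = y [^] n}" using one_closed by blast
    have eq: "{x \<in> carrier G. \<exists>y\<in>carrier G. x = y [^] n} = (\<lambda>x. x [^] n) ` carrier G" by auto
    have "g [^] n \<in> Pos"
      using n
    proof (induction n)
      case (Suc n)
      then show ?case using g_Pos Pos_mult by (cases n) auto
    qed simp
    then have "g [^] n \<notin> N" using N_not_Pos by blast
    then show ?thesis
      using definable_subgroup_eq_carrier[OF subgroup_powers[of n], of k "g [^] n"] k eq by auto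
  qed
  then show ?thesis unfolding divisible_group_def using is_group by (metis imageE)
qed

end

section \<open>O-minimality of the quotient\<close>

lemma finite_strict_max:
  assumes "strict_total_order A lt" "finite S" "S \<noteq> {}" "S \<subseteq> A"
  shows "\<exists>m\<in>S. \<forall>s\<in>S. s = m \<or> lt s m"
  using assms(2-4)
proof (induction S rule: finite_ne_induct)
  case (insert x F)
  then obtain m where m: "m \<in> F" "\<forall>s\<in>F. s = m \<or> lt s m" by auto
  have A: "x \<in> A" "m \<in> A" "F \<subseteq> A" and ne: "x \<noteq> m" using insert m by auto
  have "lt x m \<or> lt m x"
    using assms(1) A ne unfolding strict_total_order_def totalp_on_def by blast
  then show ?case
  proof
    assume "lt x m"
    then show ?thesis using m by auto
  next
    assume mx: "lt m x"
    have "lt s x" if "s \<in> F" for s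
    proof (cases "s = m")
      case False
      then have "lt s m" using m(2) that by blast
      moreover have "s \<in> A" using that A by blast
      ultimately show ?thesis
        using assms(1) mx A unfolding strict_total_order_def by (meson transp_onD)
    qed (use mx in simp)
    then show ?thesis by blast
  qed
qed simp

lemma strict_total_order_converse:
  "strict_total_order A lt \<Longrightarrow> strict_total_order A (\<lambda>x y. lt y x)"
  unfolding strict_total_order_def irreflp_on_def transp_on_def totalp_on_def by metis

lemma finite_union_of_intervals:
  assumes ord: "strict_total_order A lt" and B: "finite B" "B \<subseteq> A" and D: "D \<subseteq> A"
    and hom: "\<And>x y. x \<in> A - B \<Longrightarrow> y \<in> A - B \<Longrightarrow> (\<And>b. b \<in> B \<Longrightarrow> lt b x \<longleftrightarrow> lt b y) \<Longrightarrow> x \<in> D \<longleftrightarrow> y \<in> D"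
  shows "\<exists>\<I>. finite \<I> \<and> \<I> \<subseteq> open_intervals_and_points A lt \<and> D = \<Union>\<I>"
proof -
  have irr: "\<not> lt x x" if "x \<in> A" for x
    using ord that unfolding strict_total_order_def irreflp_on_def by blast
  have tr: "lt x z" if "lt x y" "lt y z" "x \<in> A" "y \<in> A" "z \<in> A" for x y z
    using ord that unfolding strict_total_order_def transp_on_def by blast
  have tot: "lt x y \<or> lt y x" if "x \<noteq> y" "x \<in> A" "y \<in> A" for x y
    using ord that unfolding strict_total_order_def totalp_on_def by blast
  \<comment> \<open>The points of \<open>A - B\<close> whose lower parameters are exactly those in
    \<open>L\<close>. If \<open>L\<close> is the cut of a point, this is the interval between the
    largest element of \<open>L\<close> and the least element of \<open>B - L\<close>.\<close>
  define cell where "cell L = {y \<in> A - B. \<forall>b\<in>B. lt b y \<longleftrightarrow> b \<in> L}" for L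
  define cut where "cut x = {b \<in> B. lt b x}" for x
  have cell_interval: "cell (cut x) \<in> open_intervals_and_points A lt" if x: "x \<in> A - B" for x
  proof -
    define L where "L = cut x"
    define U where "U = B - L"
    have LB: "L \<subseteq> B" "finite L" "L \<subseteq> A" and UB: "U \<subseteq> B" "finite U" "U \<subseteq> A"
      using B finite_subset[of _ B] by (auto simp: L_def U_def cut_def)
    have lx: "lt b x" if "b \<in> L" for b using that by (auto simp: L_def cut_def)
    have xu: "lt x b" if b: "b \<in> U" for b
    proof -
      have "\<not> lt b x" "b \<in> A" "b \<noteq> x" using b UB x by (auto simp: U_def L_def cut_def)
      then show ?thesis using tot x by blast
    qed
    have mem: "y \<in> cell L \<longleftrightarrow> y \<in> A \<and> (\<forall>b\<in>L. lt b y) \<and> (\<forall>b\<in>U. lt y b)" for y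
    proof
      assume y: "y \<in> cell L"
      then have yA: "y \<in> A" "y \<notin> B" by (auto simp: cell_def)
      have "lt y b" if b: "b \<in> U" for b
      proof -
        have "\<not> lt b y" "b \<noteq> y" "b \<in> A" using b y yA UB by (auto simp: cell_def U_def)
        then show ?thesis using tot yA by blast
      qed
      then show "y \<in> A \<and> (\<forall>b\<in>L. lt b y) \<and> (\<forall>b\<in>U. lt y b)" using y yA LB by (auto simp: cell_def)
    next
      assume y: "y \<in> A \<and> (\<forall>b\<in>L. lt b y) \<and> (\<forall>b\<in>U. lt y b)"
      have "lt b y \<longleftrightarrow> b \<in> L" if b: "b \<in> B" for b
      proof (cases "b \<in> L")
        case False
        then have "lt y b" "b \<in> A" using b y UB by (auto simp: U_def)
        then show ?thesis using False tr[of b y b] irr y by blast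
      qed (use y in blast)
      moreover have "y \<notin> B"
      proof
        assume "y \<in> B"
        then have "y \<in> L \<or> y \<in> U" by (auto simp: U_def)
        then show False using y irr by blast
      qed
      ultimately show "y \<in> cell L" using y by (auto simp: cell_def)
    qed
    have max: "\<exists>l\<in>L. \<forall>y\<in>A. (\<forall>b\<in>L. lt b y) \<longleftrightarrow> lt l y" if ne: "L \<noteq> {}"
    proof -
      obtain l where l: "l \<in> L" "\<forall>s\<in>L. s = l \<or> lt s l" using finite_strict_max[OF ord LB(2) ne LB(3)] by blast
      have "(\<forall>b\<in>L. lt b y) \<longleftrightarrow> lt l y" if "y \<in> A" for y
        using l tr[OF _ _ subsetD[OF LB(3)] subsetD[OF LB(3)] that] by (metis (no_types, lifting))
      then show ?thesis using l(1) by blast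
    qed
    have min: "\<exists>u\<in>U. \<forall>y\<in>A. (\<forall>b\<in>U. lt y b) \<longleftrightarrow> lt y u" if ne: "U \<noteq> {}"
    proof -
      obtain u where u: "u \<in> U" "\<forall>s\<in>U. s = u \<or> lt u s"
        using finite_strict_max[OF strict_total_order_converse[OF ord] UB(2) ne UB(3)] by blast
      have "(\<forall>b\<in>U. lt y b) \<longleftrightarrow> lt y u" if "y \<in> A" for y
        using u tr[OF _ _ that subsetD[OF UB(3)] subsetD[OF UB(3)]] by (metis (no_types, lifting))
      then show ?thesis using u(1) by blast
    qed
    show ?thesis
    proof (cases "L = {}")
      case True
      show ?thesis
      proof (cases "U = {}")
        case True
        then have "cell L = A" using \<open>L = {}\<close> mem by blast
        then show ?thesis by (simp add: L_def open_intervals_and_points_def)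
      next
        case False
        then obtain u where "u \<in> U" "\<forall>y\<in>A. (\<forall>b\<in>U. lt y b) \<longleftrightarrow> lt y u" using min by blast
        then have "cell L = {y \<in> A. lt y u}" "u \<in> A" using \<open>L = {}\<close> mem UB(3) by blast+
        then show ?thesis unfolding L_def[symmetric] open_intervals_and_points_def by blast
      qed
    next
      case False
      then obtain l where l: "l \<in> L" "\<forall>y\<in>A. (\<forall>b\<in>L. lt b y) \<longleftrightarrow> lt l y" using max by blast
      show ?thesis
      proof (cases "U = {}")
        case True
        then have "cell L = {y \<in> A. lt l y}" "l \<in> A" using l mem LB(3) by blast+
        then show ?thesis unfolding L_def[symmetric] open_intervals_and_points_def by blast
      next
        case False
        then obtain u where u: "u \<in> U" "\<forall>y\<in>A. (\<forall>b\<in>U. lt y b) \<longleftrightarrow> lt y u" using min by blast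
        moreover have "cell L = {y \<in> A. lt l y \<and> lt y u}"
        proof (rule Set.set_eqI)
          fix y
          show "y \<in> cell L \<longleftrightarrow> y \<in> {y \<in> A. lt l y \<and> lt y u}" using mem[of y] l(2) u(2) by auto
        qed
        moreover have "l \<in> A" "u \<in> A" using l(1) u(1) LB(3) UB(3) by blast+
        ultimately show ?thesis unfolding L_def[symmetric] open_intervals_and_points_def by blast
      qed
    qed
  qed
  define \<I> where "\<I> = (\<lambda>b. {b}) ` (B \<inter> D) \<union> (\<lambda>x. cell (cut x)) ` (D - B)"
  have "(\<lambda>x. cell (cut x)) ` (D - B) \<subseteq> cell ` Pow B" by (auto simp: cut_def)
  then have "finite \<I>" 
    using B(1) finite_subset[of "(\<lambda>x. cell (cut x)) ` (D - B)" "cell ` Pow B"] unfolding \<I>_def by simp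
  moreover have "\<I> \<subseteq> open_intervals_and_points A lt"
  proof -
    have "(\<lambda>b. {b}) ` (B \<inter> D) \<subseteq> open_intervals_and_points A lt"
      using B(2) unfolding open_intervals_and_points_def by blast
    moreover have "(\<lambda>x. cell (cut x)) ` (D - B) \<subseteq> open_intervals_and_points A lt"
      using cell_interval D by blast
    ultimately show ?thesis unfolding \<I>_def by blast
  qed
  moreover have "D = \<Union>\<I>"
  proof (rule equalityI; rule subsetI)
    fix x assume x: "x \<in> D"
    show "x \<in> \<Union>\<I>"
    proof (cases "x \<in> B")
      case False
      then have "x \<in> cell (cut x)" using x D by (auto simp: cell_def cut_def)
      then show ?thesis using x False unfolding \<I>_def by blast
    qed (use x in \<open>auto simp: \<I>_def\<close>)
  next
    fix x assume "x \<in> \<Union>\<I>"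
    then consider "x \<in> B \<inter> D" | y where "y \<in> D - B" "x \<in> cell (cut y)" unfolding \<I>_def by blast
    then show "x \<in> D"
    proof cases
      case 2
      have "lt b y \<longleftrightarrow> lt b x" if "b \<in> B" for b using 2(2) that by (auto simp: cell_def cut_def)
      then show ?thesis using hom[of y x] 2 D by (auto simp: cell_def)
    qed simp
  qed
  ultimately show ?thesis by blast
qed

text \<open>Renumbers the variables to free index 1 for the parameter \<open>g\<close>; index 0
  stays with the element of the defined set.\<close>

definition skip_one :: "nat \<Rightarrow> nat" where
  "skip_one n = (if n = 0 then 0 else Suc n)"

lemma skip_one [simp]: "skip_one 0 = 0" "skip_one n \<noteq> 1" "skip_one n \<noteq> Suc 0"
  "skip_one n = skip_one m \<longleftrightarrow> n = m"
  by (auto simp: skip_one_def)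

sublocale C_minimal_top \<subseteq> subquotient G "carrier G" N
  by (intro subquotient.intro subquotient_axioms.intro is_group subgroup_self normal_N)
    (auto dest: N_closed)

context C_minimal_top
begin

lemma carrier_quotient: "carrier (G Mod N) = (\<lambda>x. N #> x) ` carrier G"
  using carrier_Q by simp

lemma mult_quotient:
  "x \<in> carrier G \<Longrightarrow> y \<in> carrier G \<Longrightarrow> (N #> x) \<otimes>\<^bsub>G Mod N\<^esub> (N #> y) = N #> (x \<otimes> y)"
  using mult_Q[of x y] by simp

definition quot_less :: "'a set \<Rightarrow> 'a set \<Rightarrow> bool" where
  "quot_less X Y \<longleftrightarrow> (\<exists>x\<in>carrier G. \<exists>y\<in>carrier G. X = N #> x \<and> Y = N #> y \<and> gt y x)"

lemma coset_N_eq_iff: "x \<in> carrier G \<Longrightarrow> y \<in> carrier G \<Longrightarrow> N #> x = N #> y \<longleftrightarrow> \<not> gt x y \<and> \<not> gt y x"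
  by (simp add: coset_eq_iff N_iff_gt)

lemma quot_less_iff:
  assumes "x \<in> carrier G" "y \<in> carrier G"
  shows "quot_less (N #> x) (N #> y) \<longleftrightarrow> gt y x"
proof
  assume "quot_less (N #> x) (N #> y)"
  then obtain x' y' where xy: "x' \<in> carrier G" "y' \<in> carrier G" "N #> x = N #> x'" "N #> y = N #> y'" "gt y' x'"
    unfolding quot_less_def by blast
  have "\<not> gt y' y" "\<not> gt x x'" using xy assms coset_N_eq_iff by auto
  then have "gt y x'" using not_gt_gt_trans[OF _ xy(5)] xy assms by blast
  then show "gt y x" using gt_not_gt_trans \<open>\<not> gt x x'\<close> xy assms by blast
qed (use assms in \<open>auto simp: quot_less_def\<close>)

lemma group_ordering_quot_less: "group_ordering Q quot_less"
  unfolding group_ordering_def strict_total_order_def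
proof (intro conjI group_Q)
  show "irreflp_on (carrier Q) quot_less"
    using gt_asym by (auto simp: irreflp_on_def carrier_quotient quot_less_iff)
  show "transp_on (carrier Q) quot_less"
    using gt_trans by (auto simp: transp_on_def carrier_quotient quot_less_iff)
  show "totalp_on (carrier Q) quot_less"
    by (auto simp: totalp_on_def carrier_quotient quot_less_iff coset_N_eq_iff)
  show "\<forall>x\<in>carrier Q. \<forall>y\<in>carrier Q. \<forall>z\<in>carrier Q. quot_less x y \<longrightarrow>
    quot_less (z \<otimes>\<^bsub>Q\<^esub> x) (z \<otimes>\<^bsub>Q\<^esub> y) \<and> quot_less (x \<otimes>\<^bsub>Q\<^esub> z) (y \<otimes>\<^bsub>Q\<^esub> z)"
    by (simp add: carrier_quotient mult_quotient quot_less_iff gt_left gt_right del: mult_FactGroup)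
qed

text \<open>Three ranges of \<open>f\<close>: elements of \<open>N\<close> are least, those with
  positive inverse form the next class, and on positive elements the quasi-order is the ordering
  modulo \<open>N\<close>, by \<open>lt_Pos_iff\<close>.\<close>

lemma quotient_C_relation:
  assumes f: "f \<in> carrier G" and h: "h \<in> carrier G"
  shows "(f \<in> N \<or> (h \<notin> N \<and> qo f h)) \<longleftrightarrow> \<not> order_C_relation quot_less (N #> f) (N #> h) \<one>\<^bsub>Q\<^esub>"
proof -
  have one: "\<one>\<^bsub>Q\<^esub> = N #> \<one>" using subgroup.subset[OF subgroup_N] by (simp add: coset_mult_one)
  have gt1: "gt x \<one> \<longleftrightarrow> x \<in> Pos" if "x \<in> carrier G" for x using that by (simp add: gt_def)
  have eq1: "N #> x = N #> \<one> \<longleftrightarrow> x \<in> N" if "x \<in> carrier G" for x using that by (simp add: coset_eq_iff)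
  have "order_C_relation quot_less (N #> f) (N #> h) \<one>\<^bsub>Q\<^esub> \<longleftrightarrow> (gt f h \<and> f \<in> Pos) \<or> (h \<in> N \<and> f \<notin> N)"
    unfolding order_C_relation_def one using f h
    by (auto simp: quot_less_iff gt1 eq1 eq_commute[of "N #> \<one>"])
  moreover have "(f \<in> N \<or> (h \<notin> N \<and> qo f h)) \<longleftrightarrow> \<not> ((gt f h \<and> f \<in> Pos) \<or> (h \<in> N \<and> f \<notin> N))"
  proof (rule N_cases[OF f])
    assume "f \<in> N"
    then show ?thesis using N_not_Pos by blast
  next
    assume p: "f \<in> Pos"
    then have "f \<notin> N" using N_not_Pos by blast
    moreover have "qo f h \<longleftrightarrow> \<not> gt f h" using lt_Pos_iff[OF p h] by (auto simp: gt_def)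
    ultimately show ?thesis using p by blast
  next
    assume p: "inv f \<in> Pos"
    then have fN: "f \<notin> N" "f \<notin> Pos" using N_not_Pos Pos_asym by blast+
    have fg: "qo f (inv g)" using p f by (simp add: positive_def)
    have "qo f h" if hN: "h \<notin> N"
    proof (rule N_cases[OF h])
      assume "h \<in> Pos"
      then have "qo (inv g) h" using lt_imp_qo[of h "inv g"] h by (simp add: positive_def)
      then show ?thesis using qo_trans[OF fg] f h by simp
    next
      assume "inv h \<in> Pos"
      then have "qo (inv g) h" using h by (simp add: positive_def)
      then show ?thesis using qo_trans[OF fg] f h by simp
    qed (use hN in blast)
    then show ?thesis using fN by blast
  qed
  ultimately show ?thesis by blast
qed

section \<open>Interpretation of the ordered quotient in the C-group\<close>

abbreviation QS :: "('a set, mult_symbol, less_symbol) fo_structure" where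
  "QS \<equiv> ordered_group_structure Q quot_less"

lemma quotient_term:
  "wf_term ordered_group_language t \<Longrightarrow> \<exists>\<tau>. Def_fun \<tau> \<and>
     (\<forall>e. range e \<subseteq> carrier G \<longrightarrow> term_val QS (\<lambda>n. N #> e (skip_one n)) t = N #> \<tau> e)"
proof (induction t)
  case (Var n)
  then show ?case by (intro exI[of _ "\<lambda>e. e (skip_one n)"]) (auto intro: Def_fun_var)
next
  case (Fun m ts)
  then obtain s t where ts: "ts = [s, t]"
    by (auto simp: ordered_group_language_def numeral_2_eq_2 length_Suc_conv)
  then have wf: "wf_term ordered_group_language s" "wf_term ordered_group_language t" using Fun.prems by auto
  obtain \<sigma> where \<sigma>: "Def_fun \<sigma>"
    "\<And>e. range e \<subseteq> carrier G \<Longrightarrow> term_val QS (\<lambda>n. N #> e (skip_one n)) s = N #> \<sigma> e"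
    using Fun.IH[of s] wf ts by auto
  obtain \<tau> where \<tau>: "Def_fun \<tau>"
    "\<And>e. range e \<subseteq> carrier G \<Longrightarrow> term_val QS (\<lambda>n. N #> e (skip_one n)) t = N #> \<tau> e"
    using Fun.IH[of t] wf ts by auto
  have "term_val QS (\<lambda>n. N #> e (skip_one n)) (Fun m ts) = N #> (\<sigma> e \<otimes> \<tau> e)" if e: "range e \<subseteq> carrier G" for e
  proof -
    have "term_val QS (\<lambda>n. N #> e (skip_one n)) (Fun m ts) = (N #> \<sigma> e) \<otimes>\<^bsub>Q\<^esub> (N #> \<tau> e)"
      using \<sigma>(2)[OF e] \<tau>(2)[OF e] by (simp add: ts ordered_group_structure_def del: mult_FactGroup)
    also have "\<dots> = N #> (\<sigma> e \<otimes> \<tau> e)" by (rule mult_Q[OF Def_fun_closed[OF \<sigma>(1) e] Def_fun_closed[OF \<tau>(1) e]])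
    finally show ?thesis .
  qed
  then show ?case using Def_fun_mult[OF \<sigma>(1) \<tau>(1)] by (intro exI[of _ "\<lambda>e. \<sigma> e \<otimes> \<tau> e"]) blast
qed

text \<open>The entry \<open>1\<close> of the assignment is reserved for \<open>g\<close>, from which \<open>N\<close> is defined.\<close>

lemma quotient_formula:
  "wf_formula ordered_group_language \<phi> \<Longrightarrow> \<exists>P. Def P \<and>
     (\<forall>e. range e \<subseteq> carrier G \<longrightarrow> e 1 = g \<longrightarrow> (sat QS (\<lambda>n. N #> e (skip_one n)) \<phi> \<longleftrightarrow> P e))"
proof (induction \<phi>)
  case (Eq s t)
  obtain \<sigma> where \<sigma>: "Def_fun \<sigma>"
    "\<And>e. range e \<subseteq> carrier G \<Longrightarrow> term_val QS (\<lambda>n. N #> e (skip_one n)) s = N #> \<sigma> e"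
    using quotient_term[of s] Eq by auto
  obtain \<tau> where \<tau>: "Def_fun \<tau>"
    "\<And>e. range e \<subseteq> carrier G \<Longrightarrow> term_val QS (\<lambda>n. N #> e (skip_one n)) t = N #> \<tau> e"
    using quotient_term[of t] Eq by auto
  let ?P = "\<lambda>e. qo (\<sigma> e \<otimes> inv (\<tau> e)) (inv (e 1)) \<and> qo (inv (\<sigma> e \<otimes> inv (\<tau> e))) (inv (e 1))"
  have "Def ?P"
    by (rule Def_conj; rule Def_qo) (rule Def_fun_inv Def_fun_mult Def_fun_var \<sigma>(1) \<tau>(1))+
  moreover have "sat QS (\<lambda>n. N #> e (skip_one n)) (Eq s t) \<longleftrightarrow> ?P e" if e: "range e \<subseteq> carrier G" "e 1 = g" for e
  proof -
    have G: "\<sigma> e \<in> carrier G" "\<tau> e \<in> carrier G" using Def_fun_closed \<sigma>(1) \<tau>(1) e(1) by blast+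
    have "sat QS (\<lambda>n. N #> e (skip_one n)) (Eq s t) \<longleftrightarrow> \<sigma> e \<otimes> inv (\<tau> e) \<in> N"
      using \<sigma>(2)[OF e(1)] \<tau>(2)[OF e(1)] G by (simp add: coset_eq_iff)
    also have "\<dots> \<longleftrightarrow> ?P e" unfolding lower_def using G e(2) by simp
    finally show ?thesis .
  qed
  ultimately show ?case by (intro exI[of _ ?P]) blast
next
  case (Rel r ts)
  then obtain s t where ts: "ts = [s, t]"
    by (auto simp: ordered_group_language_def numeral_2_eq_2 length_Suc_conv)
  then have wf: "wf_term ordered_group_language s" "wf_term ordered_group_language t" using Rel by auto
  obtain \<sigma> where \<sigma>: "Def_fun \<sigma>"
    "\<And>e. range e \<subseteq> carrier G \<Longrightarrow> term_val QS (\<lambda>n. N #> e (skip_one n)) s = N #> \<sigma> e"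
    using quotient_term[OF wf(1)] by auto
  obtain \<tau> where \<tau>: "Def_fun \<tau>"
    "\<And>e. range e \<subseteq> carrier G \<Longrightarrow> term_val QS (\<lambda>n. N #> e (skip_one n)) t = N #> \<tau> e"
    using quotient_term[OF wf(2)] by auto
  let ?P = "\<lambda>e. \<not> qo (\<tau> e \<otimes> inv (\<sigma> e)) (inv (e 1))"
  have "Def ?P"
    by (rule Def_not; rule Def_qo) (rule Def_fun_inv Def_fun_mult Def_fun_var \<sigma>(1) \<tau>(1))+
  moreover have "sat QS (\<lambda>n. N #> e (skip_one n)) (Rel r ts) \<longleftrightarrow> ?P e" if e: "range e \<subseteq> carrier G" "e 1 = g" for e
  proof -
    have G: "\<sigma> e \<in> carrier G" "\<tau> e \<in> carrier G" using Def_fun_closed \<sigma>(1) \<tau>(1) e(1) by blast+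
    have "sat QS (\<lambda>n. N #> e (skip_one n)) (Rel r ts) \<longleftrightarrow> quot_less (N #> \<sigma> e) (N #> \<tau> e)"
      using \<sigma>(2)[OF e(1)] \<tau>(2)[OF e(1)] by (simp add: ts ordered_group_structure_def)
    also have "\<dots> \<longleftrightarrow> \<tau> e \<otimes> inv (\<sigma> e) \<in> Pos" using G by (simp add: quot_less_iff gt_def)
    also have "\<dots> \<longleftrightarrow> ?P e" using Pos_iff[of "\<tau> e \<otimes> inv (\<sigma> e)"] G e(2) by simp
    finally show ?thesis .
  qed
  ultimately show ?case by (intro exI[of _ ?P]) blast
next
  case (Neg \<phi>)
  then obtain P where P: "Def P"
    "\<And>e. range e \<subseteq> carrier G \<Longrightarrow> e 1 = g \<Longrightarrow> sat QS (\<lambda>n. N #> e (skip_one n)) \<phi> \<longleftrightarrow> P e" by auto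
  then show ?case using Def_not[OF P(1)] by (intro exI[of _ "\<lambda>e. \<not> P e"]) simp
next
  case (Conj \<phi> \<psi>)
  obtain P where P: "Def P"
    "\<And>e. range e \<subseteq> carrier G \<Longrightarrow> e 1 = g \<Longrightarrow> sat QS (\<lambda>n. N #> e (skip_one n)) \<phi> \<longleftrightarrow> P e"
    using Conj.IH(1) Conj.prems by auto
  obtain P' where P': "Def P'"
    "\<And>e. range e \<subseteq> carrier G \<Longrightarrow> e 1 = g \<Longrightarrow> sat QS (\<lambda>n. N #> e (skip_one n)) \<psi> \<longleftrightarrow> P' e"
    using Conj.IH(2) Conj.prems by auto
  show ?case using Def_conj[OF P(1) P'(1)] P(2) P'(2) by (intro exI[of _ "\<lambda>e. P e \<and> P' e"]) simp
next
  case (Exists n \<phi>)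
  then obtain P where P: "Def P"
    "\<And>e. range e \<subseteq> carrier G \<Longrightarrow> e 1 = g \<Longrightarrow> sat QS (\<lambda>n. N #> e (skip_one n)) \<phi> \<longleftrightarrow> P e" by auto
  let ?P = "\<lambda>e. \<exists>x\<in>carrier G. P (e(skip_one n := x))"
  have "sat QS (\<lambda>k. N #> e (skip_one k)) (Exists n \<phi>) \<longleftrightarrow> ?P e" if e: "range e \<subseteq> carrier G" "e 1 = g" for e
  proof -
    have upd: "(\<lambda>k. N #> e (skip_one k))(n := N #> x) = (\<lambda>k. N #> (e(skip_one n := x)) (skip_one k))" for x
      by (auto simp: fun_eq_iff)
    have "sat QS (\<lambda>k. N #> e (skip_one k)) (Exists n \<phi>) \<longleftrightarrow>
      (\<exists>x\<in>carrier G. sat QS ((\<lambda>k. N #> e (skip_one k))(n := N #> x)) \<phi>)"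
      by (simp add: ordered_group_structure_def carrier_quotient)
    also have "\<dots> \<longleftrightarrow> ?P e"
    proof (rule bex_cong[OF refl])
      fix x assume x: "x \<in> carrier G"
      have "range (e(skip_one n := x)) \<subseteq> carrier G" using e(1) x by auto
      moreover have "(e(skip_one n := x)) 1 = g"
        using e(2) skip_one(2)[of n] by (simp add: eq_commute)
      ultimately show "sat QS ((\<lambda>k. N #> e (skip_one k))(n := N #> x)) \<phi> \<longleftrightarrow> P (e(skip_one n := x))"
        unfolding upd by (rule P(2))
    qed
    finally show ?thesis .
  qed
  then show ?case using Def_exists[OF P(1), of "skip_one n"] by (intro exI[of _ ?P]) blast
qed

lemma o_minimal_quotient: "o_minimal_group Q quot_less"
proof -
  have ord: "strict_total_order (carrier Q) quot_less"
    using group_ordering_quot_less by (simp add: group_ordering_def)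
  interpret Q: group Q by (rule group_Q)
  have univ: "universe QS = carrier Q" by (simp add: ordered_group_structure_def)
  have "fo_structure_of ordered_group_language QS"
  proof -
    have "xs ! 0 \<otimes>\<^bsub>Q\<^esub> xs ! 1 \<in> carrier Q" if "length xs = 2" "set xs \<subseteq> carrier Q" for xs
    proof -
      have "xs ! 0 \<in> carrier Q" "xs ! 1 \<in> carrier Q" using that nth_mem[of 0 xs] nth_mem[of 1 xs] by auto
      then show ?thesis by (rule Q.m_closed)
    qed
    moreover have "carrier Q \<noteq> {}" using Q.one_closed by blast
    ultimately show ?thesis
      unfolding fo_structure_of_def ordered_group_structure_def ordered_group_language_def by simp
  qed
  moreover have "\<exists>\<I>. finite \<I> \<and> \<I> \<subseteq> open_intervals_and_points (carrier Q) quot_less \<and> D = \<Union>\<I>"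
    if "definable_set ordered_group_language QS D" for D
  proof -
    obtain \<phi> \<epsilon> where \<phi>: "wf_formula ordered_group_language \<phi>" and \<epsilon>: "range \<epsilon> \<subseteq> carrier Q"
      and D: "D = defined_set QS \<epsilon> \<phi>" using \<open>definable_set ordered_group_language QS D\<close>
      unfolding definable_set_def univ by blast
    have DQ: "D \<subseteq> carrier Q" unfolding D defined_set_def univ by blast
    obtain P where P: "Def P"
      "\<And>e. range e \<subseteq> carrier G \<Longrightarrow> e 1 = g \<Longrightarrow> sat QS (\<lambda>n. N #> e (skip_one n)) \<phi> \<longleftrightarrow> P e"
      using quotient_formula[OF \<phi>] by auto
    have "\<forall>n. \<exists>x\<in>carrier G. N #> x = \<epsilon> n" using \<epsilon> unfolding carrier_Q by fastforce
    then obtain r where r: "\<And>n. r n \<in> carrier G" "\<And>n. N #> r n = \<epsilon> n" by metis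
    \<comment> \<open>Undoes \<open>skip_one\<close>: index 0 keeps its entry, and the indices from
      2 on hold representatives of the entries from 1 on.\<close>
    define e where "e n = (if n = 1 then g else r (if n = 0 then 0 else n - 1))" for n
    have e: "range e \<subseteq> carrier G" "e 1 = g" using r(1) by (auto simp: e_def)
    have mem: "N #> x \<in> D \<longleftrightarrow> P (e(0 := x))" if x: "x \<in> carrier G" for x
    proof -
      have "\<epsilon>(0 := N #> x) = (\<lambda>n. N #> (e(0 := x)) (skip_one n))"
        using r(2) by (auto simp: fun_eq_iff e_def skip_one_def)
      moreover have "range (e(0 := x)) \<subseteq> carrier G" "(e(0 := x)) 1 = g" using e x by auto
      ultimately have "sat QS (\<epsilon>(0 := N #> x)) \<phi> \<longleftrightarrow> P (e(0 := x))" by (metis P(2))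
      moreover have "N #> x \<in> carrier Q" using x unfolding carrier_Q by blast
      ultimately show ?thesis unfolding D defined_set_def univ by blast
    qed
    obtain k where k: "\<forall>e. range e \<subseteq> carrier G \<longrightarrow> det k {x \<in> carrier G. P (e(0 := x))}"
      using uniformly_det[OF P(1)] by (elim exE) (rule that)
    have "det k {x \<in> carrier G. P (e(0 := x))}" using k e(1) by blast
    then obtain B where B: "B \<subseteq> carrier G" "finite B"
      "\<And>x y. x \<in> carrier G \<Longrightarrow> y \<in> carrier G \<Longrightarrow> agree B x y \<Longrightarrow> P (e(0 := x)) \<longleftrightarrow> P (e(0 := y))"
      unfolding det_def by auto
    show ?thesis
    proof (rule finite_union_of_intervals[OF ord _ _ DQ, of "(\<lambda>b. N #> b) ` B"])
      show "finite ((\<lambda>b. N #> b) ` B)" using B(2) by simp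
      show "(\<lambda>b. N #> b) ` B \<subseteq> carrier Q" using B(1) unfolding carrier_Q by blast
      fix X Y assume X: "X \<in> carrier Q - (\<lambda>b. N #> b) ` B" and Y: "Y \<in> carrier Q - (\<lambda>b. N #> b) ` B"
        and cut: "\<And>b. b \<in> (\<lambda>b. N #> b) ` B \<Longrightarrow> quot_less b X \<longleftrightarrow> quot_less b Y"
      obtain x y where xy: "x \<in> carrier G" "X = N #> x" "y \<in> carrier G" "Y = N #> y"
        using X Y unfolding carrier_Q by blast
      \<comment> \<open>The cosets of the parameters serve as end points; any other coset is
        comparable with all of them, so its cut determines the type.\<close>
      have "agree B x y"
      proof (rule cut_agree[OF B(1) xy(1,3)])
        fix b assume b: "b \<in> B"
        then have bG: "b \<in> carrier G" using B(1) by blast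
        have "N #> x \<noteq> N #> b" "N #> y \<noteq> N #> b" using X Y xy b by blast+
        then have "gt x b \<or> gt b x" "gt y b \<or> gt b y" using coset_N_eq_iff xy bG by blast+
        moreover have "gt x b \<longleftrightarrow> gt y b" using cut[of "N #> b"] b xy bG by (simp add: quot_less_iff)
        ultimately show "(gt x b \<and> gt y b) \<or> (gt b x \<and> gt b y)" by blast
      qed
      then show "X \<in> D \<longleftrightarrow> Y \<in> D" using mem xy B(3) by simp
    qed
  qed
  ultimately show ?thesis
    unfolding o_minimal_group_def o_minimal_def univ using ord
    by (simp add: ordered_group_language_def ordered_group_structure_def)
qed

end

section \<open>C-minimality of the lower group\<close>

lemma free_vars_fo_Exists_from: "free_vars (fo_Exists_from m k \<phi>) = free_vars \<phi> - {m..<m + k}"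
  by (induction k arbitrary: \<phi>) auto

lemma models_universal_closure:
  fixes M :: "('u, 'f, 'r) fo_structure"
  shows "models M (Neg (fo_Exists_from 0 (fresh_var \<psi>) (Neg \<psi>))) \<longleftrightarrow>
     (\<forall>e. range e \<subseteq> universe M \<longrightarrow> sat M e \<psi>)"
proof
  assume M: "models M (Neg (fo_Exists_from 0 (fresh_var \<psi>) (Neg \<psi>)))"
  show "\<forall>e. range e \<subseteq> universe M \<longrightarrow> sat M e \<psi>"
  proof (intro allI impI)
    fix e :: "nat \<Rightarrow> 'u" assume e: "range e \<subseteq> universe M"
    have eq: "(\<lambda>n. if 0 \<le> n \<and> n < 0 + fresh_var \<psi> then e (n - 0) else e n) = e" by auto
    show "sat M e \<psi>"
    proof (rule ccontr)
      assume "\<not> sat M e \<psi>"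
      then have "sat M e (fo_Exists_from 0 (fresh_var \<psi>) (Neg \<psi>))"
        unfolding sat_fo_Exists_from using e by (intro exI[of _ e]) (auto simp only: eq sat.simps)
      then show False using M e by (simp add: models_def)
    qed
  qed
next
  assume M: "\<forall>e. range e \<subseteq> universe M \<longrightarrow> sat M e \<psi>"
  show "models M (Neg (fo_Exists_from 0 (fresh_var \<psi>) (Neg \<psi>)))"
    unfolding models_def sat.simps sat_fo_Exists_from
  proof (intro allI impI notI, elim exE conjE)
    fix e b :: "nat \<Rightarrow> 'u" assume e: "range e \<subseteq> universe M" and b: "\<forall>i<fresh_var \<psi>. b i \<in> universe M"
      and "\<not> sat M (\<lambda>n. if 0 \<le> n \<and> n < 0 + fresh_var \<psi> then b (n - 0) else e n) \<psi>"
    moreover have "range (\<lambda>n. if 0 \<le> n \<and> n < 0 + fresh_var \<psi> then b (n - 0) else e n) \<subseteq> universe M"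
      using e b by auto
    ultimately show False using M by blast
  qed
qed

text \<open>The converse of the compactness theorem. For a fixed bound \<open>k\<close>,
  determination for all parameters is one sentence; it holds in every elementarily equivalent
  structure, whatever type \<open>'w\<close> carries it.\<close>

lemma C_minimal_if_uniformly_determined:
  fixes L :: "('f, 'r) fo_language" and M :: "('u, 'f, 'r) fo_structure"
  assumes "fo_structure_of L M" and c: "rel_arity L c = 3"
    and "C_relation_on (universe M) (\<lambda>x y z. rel_int M c [x, y, z])"
    and det: "\<And>\<phi>. wf_formula L \<phi> \<Longrightarrow> \<exists>k. \<forall>e. range e \<subseteq> universe M \<longrightarrow>
      determined (universe M) (rel_int M c) k (defined_set M e \<phi>)"
  shows "C_minimal TYPE('w) L c M"
  unfolding C_minimal_def
proof (intro conjI allI impI)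
  fix N :: "('w, 'f, 'r) fo_structure" and D
  assume N: "fo_structure_of L N \<and> elem_equiv L N M" and "definable_set L N D"
  then obtain \<phi> e where \<phi>: "wf_formula L \<phi>" and e: "range e \<subseteq> universe N"
    and D: "D = defined_set N e \<phi>" unfolding definable_set_def by blast
  obtain k where k: "\<forall>e. range e \<subseteq> universe M \<longrightarrow>
      determined (universe M) (rel_int M c) k (defined_set M e \<phi>)"
    using det[OF \<phi>] by (elim exE) (rule that)
  let ?\<psi> = "fo_determined c k \<phi>"
  let ?\<chi> = "Neg (fo_Exists_from 0 (fresh_var ?\<psi>) (Neg ?\<psi>))"
  have "wf_formula L ?\<chi>" using wf_fo_determined[OF c \<phi>] by (simp add: wf_fo_Exists_from)
  moreover have "free_vars ?\<chi> = {}" using less_fresh_var by (force simp: free_vars_fo_Exists_from)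
  moreover have "models M ?\<chi>"
    unfolding models_universal_closure
  proof (intro allI impI)
    show "sat M e ?\<psi>" if "range e \<subseteq> universe M" for e
      using k that by (simp only: sat_fo_determined[OF that])
  qed
  ultimately have "models N ?\<chi>" using N unfolding elem_equiv_def by blast
  then have "sat N e ?\<psi>" unfolding models_universal_closure using e by (elim allE[of _ e] impE)
  then have "determined (universe N) (rel_int N c) k (defined_set N e \<phi>)"
    by (simp only: sat_fo_determined[OF e])
  moreover have "universe N \<noteq> {}" using N by (simp add: fo_structure_of_def)
  ultimately show "qf_definable_set_in c L N D"
    unfolding D using c by (intro determined_imp_qf_definable) (auto simp: defined_set_def)
qed (fact assms)+

context C_minimal_top
begin

abbreviation MN :: "('a, mult_symbol, C_symbol) fo_structure" where
  "MN \<equiv> C_group_structure (G\<lparr>carrier := N\<rparr>) C"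

lemma lower_term:
  "wf_term C_group_language t \<Longrightarrow> \<exists>\<tau>. Def_fun \<tau> \<and> (\<forall>e. term_val MN (\<lambda>n. e (skip_one n)) t = \<tau> e)"
proof (induction t)
  case (Var n)
  then show ?case by (intro exI[of _ "\<lambda>e. e (skip_one n)"]) (auto intro: Def_fun_var)
next
  case (Fun m ts)
  then obtain s t where ts: "ts = [s, t]"
    by (auto simp: C_group_language_def numeral_2_eq_2 length_Suc_conv)
  then have wf: "wf_term C_group_language s" "wf_term C_group_language t" using Fun.prems by auto
  obtain \<sigma> where \<sigma>: "Def_fun \<sigma>" "\<And>e. term_val MN (\<lambda>n. e (skip_one n)) s = \<sigma> e"
    using Fun.IH[of s] wf ts by auto
  obtain \<tau> where \<tau>: "Def_fun \<tau>" "\<And>e. term_val MN (\<lambda>n. e (skip_one n)) t = \<tau> e"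
    using Fun.IH[of t] wf ts by auto
  show ?case using Def_fun_mult[OF \<sigma>(1) \<tau>(1)] \<sigma>(2) \<tau>(2)
    by (intro exI[of _ "\<lambda>e. \<sigma> e \<otimes> \<tau> e"]) (simp add: ts C_group_structure_def)
qed

text \<open>Quantifiers are relativised to \<open>N\<close>, which is definable from
  \<open>g\<close>, the entry 1 of the assignment.\<close>

lemma lower_formula:
  "wf_formula C_group_language \<phi> \<Longrightarrow>
     \<exists>P. Def P \<and> (\<forall>e :: nat \<Rightarrow> 'a. e 1 = g \<longrightarrow> (sat MN (\<lambda>n. e (skip_one n)) \<phi> \<longleftrightarrow> P e))"
proof (induction \<phi>)
  case (Eq s t)
  obtain \<sigma> where \<sigma>: "Def_fun \<sigma>" "\<And>e. term_val MN (\<lambda>n. e (skip_one n)) s = \<sigma> e"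
    using lower_term[of s] Eq by auto
  obtain \<tau> where \<tau>: "Def_fun \<tau>" "\<And>e. term_val MN (\<lambda>n. e (skip_one n)) t = \<tau> e"
    using lower_term[of t] Eq by auto
  show ?case using Def_eq[OF \<sigma>(1) \<tau>(1)] \<sigma>(2) \<tau>(2) by (intro exI[of _ "\<lambda>e. \<sigma> e = \<tau> e"]) simp
next
  case (Rel r ts)
  then obtain s t u where ts: "ts = [s, t, u]"
    by (auto simp: C_group_language_def numeral_3_eq_3 length_Suc_conv)
  then have wf: "wf_term C_group_language s" "wf_term C_group_language t" "wf_term C_group_language u"
    using Rel by auto
  obtain \<sigma> where \<sigma>: "Def_fun \<sigma>" "\<And>e. term_val MN (\<lambda>n. e (skip_one n)) s = \<sigma> e"
    using lower_term[OF wf(1)] by auto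
  obtain \<tau> where \<tau>: "Def_fun \<tau>" "\<And>e. term_val MN (\<lambda>n. e (skip_one n)) t = \<tau> e"
    using lower_term[OF wf(2)] by auto
  obtain \<upsilon> where \<upsilon>: "Def_fun \<upsilon>" "\<And>e. term_val MN (\<lambda>n. e (skip_one n)) u = \<upsilon> e"
    using lower_term[OF wf(3)] by auto
  show ?case using Def_C[OF \<sigma>(1) \<tau>(1) \<upsilon>(1)] \<sigma>(2) \<tau>(2) \<upsilon>(2)
    by (intro exI[of _ "\<lambda>e. C (\<sigma> e) (\<tau> e) (\<upsilon> e)"]) (simp add: ts C_group_structure_def)
next
  case (Neg \<phi>)
  then obtain P where P: "Def P" "\<And>e :: nat \<Rightarrow> 'a. e 1 = g \<Longrightarrow> sat MN (\<lambda>n. e (skip_one n)) \<phi> \<longleftrightarrow> P e" by auto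
  then show ?case using Def_not[OF P(1)] by (intro exI[of _ "\<lambda>e. \<not> P e"]) simp
next
  case (Conj \<phi> \<psi>)
  obtain P where P: "Def P" "\<And>e :: nat \<Rightarrow> 'a. e 1 = g \<Longrightarrow> sat MN (\<lambda>n. e (skip_one n)) \<phi> \<longleftrightarrow> P e"
    using Conj.IH(1) Conj.prems by auto
  obtain P' where P': "Def P'" "\<And>e :: nat \<Rightarrow> 'a. e 1 = g \<Longrightarrow> sat MN (\<lambda>n. e (skip_one n)) \<psi> \<longleftrightarrow> P' e"
    using Conj.IH(2) Conj.prems by auto
  show ?case using Def_conj[OF P(1) P'(1)] P(2) P'(2) by (intro exI[of _ "\<lambda>e. P e \<and> P' e"]) simp
next
  case (Exists n \<phi>)
  then obtain P where P: "Def P" "\<And>e :: nat \<Rightarrow> 'a. e 1 = g \<Longrightarrow> sat MN (\<lambda>n. e (skip_one n)) \<phi> \<longleftrightarrow> P e" by auto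
  let ?R = "\<lambda>e :: nat \<Rightarrow> 'a. (qo (e (skip_one n)) (inv (e 1)) \<and> qo (inv (e (skip_one n))) (inv (e 1))) \<and> P e"
  let ?P = "\<lambda>e :: nat \<Rightarrow> 'a. \<exists>x\<in>carrier G. ?R (e(skip_one n := x))"
  have "Def (\<lambda>e. qo (e (skip_one n)) (inv (e 1)) \<and> qo (inv (e (skip_one n))) (inv (e 1)))"
    by (rule Def_conj; rule Def_qo) (rule Def_fun_inv Def_fun_var)+
  then have "Def ?R" using P(1) by (rule Def_conj)
  then have "Def ?P" by (rule Def_exists)
  moreover have "sat MN (\<lambda>k. e (skip_one k)) (Exists n \<phi>) \<longleftrightarrow> ?P e" if e: "e 1 = g" for e :: "nat \<Rightarrow> 'a"
  proof -
    have upd: "(\<lambda>k. e (skip_one k))(n := x) = (\<lambda>k. (e(skip_one n := x)) (skip_one k))" for x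
      by (auto simp: fun_eq_iff)
    have upd1: "(e(skip_one n := x)) 1 = g" for x using e skip_one(2)[of n] by (simp add: eq_commute)
    have "sat MN (\<lambda>k. e (skip_one k)) (Exists n \<phi>) \<longleftrightarrow>
      (\<exists>x\<in>N. sat MN (\<lambda>k. (e(skip_one n := x)) (skip_one k)) \<phi>)"
      unfolding sat.simps upd by (simp add: C_group_structure_def)
    also have "\<dots> \<longleftrightarrow> (\<exists>x\<in>N. P (e(skip_one n := x)))"
      by (rule bex_cong[OF refl], rule P(2)) (rule upd1)
    also have "\<dots> \<longleftrightarrow> ?P e"
      unfolding lower_def upd1 by auto
    finally show ?thesis .
  qed
  ultimately show ?case by (intro exI[of _ ?P]) blast
qed

lemma gt_N_cong:
  assumes "x \<in> N" "y \<in> N" "b \<in> carrier G"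
  shows "gt x b \<longleftrightarrow> gt y b" "gt b x \<longleftrightarrow> gt b y"
proof -
  have G: "x \<in> carrier G" "y \<in> carrier G" using assms N_closed by auto
  have "x \<otimes> inv y \<in> N" using assms subgroup_N subgroup.m_inv_closed subgroup.m_closed by metis
  then have xy: "\<not> gt x y" "\<not> gt y x" using N_iff_gt G by auto
  show "gt x b \<longleftrightarrow> gt y b" using not_gt_gt_trans[of x y b] not_gt_gt_trans[of y x b] xy G assms(3) by blast
  show "gt b x \<longleftrightarrow> gt b y" using gt_not_gt_trans[of b x y] gt_not_gt_trans[of b y x] xy G assms(3) by blast
qed

lemma gt_outside_N:
  assumes "x \<in> N" "b \<in> carrier G" "b \<notin> N"
  shows "gt x b \<or> gt b x"
proof (rule ccontr)
  assume "\<not> ?thesis"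
  then have "x \<otimes> inv b \<in> N" using N_iff_gt[of x b] assms N_closed by blast
  then have "inv x \<otimes> (x \<otimes> inv b) \<in> N"
    using assms(1) subgroup_N subgroup.m_inv_closed subgroup.m_closed by metis
  then have "inv b \<in> N" using assms N_closed by simp
  then have "inv (inv b) \<in> N" using subgroup_N subgroup.m_inv_closed by metis
  then show False using assms by simp
qed

text \<open>A parameter \<open>b\<close> outside of \<open>N\<close> matters on \<open>N\<close> only through the formula \<open>C b x b'\<close> with
  \<open>b < b' \<in> N\<close>, which says that \<open>x b'\<^sup>-\<^sup>1\<close> is smaller than \<open>g\<^sup>-\<^sup>1\<close> and is therefore equivalent
  to \<open>C (h0 b') x b'\<close> if \<open>h0 \<in> N\<close> is equivalent to \<open>g\<^sup>-\<^sup>1\<close>.\<close>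

lemma agree_on_N:
  assumes B: "B \<subseteq> carrier G" and h0: "h0 \<in> N"
    and top: "\<And>h. h \<in> N \<Longrightarrow> sim h (inv g) \<Longrightarrow> sim h0 (inv g)"
    and xN: "x \<in> N" and yN: "y \<in> N"
    and agree: "agree ((B \<inter> N) \<union> (\<lambda>b. h0 \<otimes> b) ` (B \<inter> N)) x y"
  shows "agree B x y"
proof -
  let ?B = "(B \<inter> N) \<union> (\<lambda>b. h0 \<otimes> b) ` (B \<inter> N)"
  have G: "x \<in> carrier G" "y \<in> carrier G" "h0 \<in> carrier G" using xN yN h0 N_closed by auto
  have quotN: "u \<otimes> inv b \<in> N" if "u \<in> N" "b \<in> N" for u b
    using that subgroup_N subgroup.m_inv_closed subgroup.m_closed by metis
  have eq: "x = b \<longleftrightarrow> y = b" if "b \<in> B" for b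
    using agree that xN yN unfolding agree_def by blast
  have left_out: "C x b b' \<longleftrightarrow> C y b b'" if b: "b \<in> B" "b \<notin> N" and b': "b' \<in> B" for b b'
  proof -
    have bG: "b \<in> carrier G" "b' \<in> carrier G" using b b' B by auto
    have one: "C z b b' \<longleftrightarrow> (if gt z b then gt z b' else lt (b' \<otimes> inv b) (inv g))" if z: "z \<in> N" for z
    proof -
      have zG: "z \<in> carrier G" using z N_closed by blast
      have "C z b b' \<longleftrightarrow> C z b' b" using C_sym zG bG by blast
      then show ?thesis
        using gt_outside_N[OF z bG(1) b(2)] C_gt[of z b b'] C_gt_reverse[of b z b'] zG bG by auto
    qed
    show ?thesis using one[OF xN] one[OF yN] gt_N_cong[OF xN yN] bG by simp
  qed
  have left: "C x b b' \<longleftrightarrow> C y b b'" if b: "b \<in> B" "b' \<in> B" for b b'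
  proof -
    have bG: "b \<in> carrier G" "b' \<in> carrier G" using b B by auto
    consider "b \<notin> N" | "b' \<notin> N" | "b \<in> ?B" "b' \<in> ?B" using b by blast
    then show ?thesis
    proof cases
      case 2
      then have "C x b' b \<longleftrightarrow> C y b' b" using left_out b by blast
      then show ?thesis using C_sym G bG by blast
    next
      case 3
      then show ?thesis using agree unfolding agree_def by blast
    qed (use left_out b in blast)
  qed
  have middle: "C b x b' \<longleftrightarrow> C b y b'" if b: "b \<in> B" "b' \<in> B" for b b'
  proof -
    have bG: "b \<in> carrier G" "b' \<in> carrier G" using b B by auto
    show ?thesis
    proof (cases "gt b b'")
      case True
      then show ?thesis using C_gt[of b b'] gt_N_cong[OF xN yN bG(1)] bG G by blast
    next
      case ngt: False
      show ?thesis
      proof (cases "b' \<in> N")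
        case False
        have "\<not> C b z b'" if z: "z \<in> N" for z
        proof
          assume "C b z b'"
          then have "z \<otimes> inv b' \<in> N" using C_not_gt(2)[OF ngt] bG z N_closed by blast
          then show False
            using gt_outside_N[OF z bG(2) False] N_iff_gt[of z b'] z N_closed bG by blast
        qed
        then show ?thesis using xN yN by blast
      next
        case b'N: True
        show ?thesis
        proof (cases "b \<in> N")
          case True
          then have "b \<in> ?B" "b' \<in> ?B" using b b'N by auto
          then show ?thesis using agree unfolding agree_def by blast
        next
          case False
          then have gt': "gt b' b" using gt_outside_N[OF b'N bG(1)] ngt by blast
          have low: "C b z b' \<longleftrightarrow> lt (z \<otimes> inv b') (inv g)" if "z \<in> N" for z
            using C_gt_reverse[OF gt' bG(1) N_closed[OF that] bG(2)] .
          show ?thesis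
          proof (cases "sim h0 (inv g)")
            case True
            have "C b z b' \<longleftrightarrow> C (h0 \<otimes> b') z b'" if z: "z \<in> N" for z
            proof -
              have zG: "z \<in> carrier G" "z \<otimes> inv b' \<in> carrier G" using z N_closed bG by auto
              have "C (h0 \<otimes> b') z b' \<longleftrightarrow> lt (z \<otimes> inv b') h0"
                using C_iff[of "h0 \<otimes> b'" z b'] zG bG G by (simp add: m_assoc)
              also have "\<dots> \<longleftrightarrow> lt (z \<otimes> inv b') (inv g)"
                using True qo_trans[of h0 "inv g" "z \<otimes> inv b'"] qo_trans[of "inv g" h0 "z \<otimes> inv b'"]
                  zG G inv_closed[OF g_closed] by blast
              finally show ?thesis using low[OF z] by blast
            qed
            moreover have "C (h0 \<otimes> b') x b' \<longleftrightarrow> C (h0 \<otimes> b') y b'"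
            proof -
              have "h0 \<otimes> b' \<in> ?B" "b' \<in> ?B" using b b'N by auto
              then show ?thesis using agree unfolding agree_def by blast
            qed
            ultimately show ?thesis using xN yN by blast
          next
            \<comment> \<open>\<open>N\<close> has no element equivalent to \<open>g^-1\<close>, so
              \<open>x b'^-1\<close> and \<open>y b'^-1\<close> are strictly smaller and the formula
              holds for both.\<close>
            case False
            have "C b z b'" if z: "z \<in> N" for z
            proof -
              have zb: "z \<otimes> inv b' \<in> N" using quotN[OF z b'N] .
              then have "qo (z \<otimes> inv b') (inv g)" by (simp only: lower_def mem_Collect_eq)
              then have "lt (z \<otimes> inv b') (inv g)" using top[OF zb] False by blast
              then show ?thesis using low[OF z] by blast
            qed
            then show ?thesis using xN yN by blast
          qed
        qed
      qed
    qed
  qed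
  show ?thesis unfolding agree_def using eq left middle by blast
qed

lemma det_restrict_N:
  assumes "det k D"
  shows "determined N (rel_int MN C_sym) (2 * k) (D \<inter> N)"
proof -
  obtain B where B: "B \<subseteq> carrier G" "\<one> \<in> B" "finite B" "card B \<le> k"
    and D: "\<And>x y. x \<in> carrier G \<Longrightarrow> y \<in> carrier G \<Longrightarrow> agree B x y \<Longrightarrow> x \<in> D \<longleftrightarrow> y \<in> D"
    using assms unfolding det_def by auto
  have oneN: "\<one> \<in> N" using subgroup_N subgroup.one_closed by metis
  \<comment> \<open>An element equivalent to \<open>g^-1\<close> if \<open>N\<close> has one, and
    any element of \<open>N\<close> otherwise.\<close>
  obtain h0 where h0: "h0 \<in> N" "\<And>h. h \<in> N \<Longrightarrow> sim h (inv g) \<Longrightarrow> sim h0 (inv g)"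
    using oneN by blast
  \<comment> \<open>The translates by \<open>h0\<close> stand in for the parameters outside of
    \<open>N\<close> and account for the factor 2 in the bound.\<close>
  define B' where "B' = (B \<inter> N) \<union> (\<lambda>b. h0 \<otimes> b) ` (B \<inter> N)"
  have B'N: "B' \<subseteq> N" using h0(1) subgroup_N subgroup.m_closed unfolding B'_def by fastforce
  have B'f: "finite B'" "B' \<noteq> {}" using B(2,3) oneN by (auto simp: B'_def)
  have "card B' \<le> 2 * k"
  proof -
    have "card (B \<inter> N) \<le> k" using B card_mono[of B "B \<inter> N"] by auto
    moreover have "card ((\<lambda>b. h0 \<otimes> b) ` (B \<inter> N)) \<le> card (B \<inter> N)" using B(3) by (simp add: card_image_le)
    moreover have "card B' \<le> card (B \<inter> N) + card ((\<lambda>b. h0 \<otimes> b) ` (B \<inter> N))"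
      unfolding B'_def by (rule card_Un_le)
    ultimately show ?thesis by linarith
  qed
  obtain b where b: "b ` {..<card B'} = B'"
    using B'f(1) ex_bij_betw_nat_finite[of B'] unfolding atLeast0LessThan bij_betw_def by blast
  have "determined N (rel_int MN C_sym) (card B') (D \<inter> N)"
    unfolding determined_def
  proof (intro exI[of _ b] conjI ballI impI)
    show "\<forall>i<card B'. b i \<in> N" using b B'N by blast
    fix x y assume xy: "x \<in> N" "y \<in> N" and st: "same_type (rel_int MN C_sym) (card B') b x y"
    let ?k = "card B'"
    let ?e = "\<lambda>z. b(?k := z)"
    have rel: "C (?e x i) (?e x j) (?e x l) \<longleftrightarrow> C (?e y i) (?e y j) (?e y l)"
      if "i \<le> ?k" "j \<le> ?k" "l \<le> ?k" for i j l
      using st that unfolding same_type_def by (simp add: C_group_structure_def del: fun_upd_apply)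
    have eq: "?e x i = ?e x j \<longleftrightarrow> ?e y i = ?e y j" if "i \<le> ?k" "j \<le> ?k" for i j
      using st that unfolding same_type_def by blast
    have agB': "agree B' x y"
      unfolding agree_def
    proof (intro conjI ballI)
      fix u assume "u \<in> B'"
      then obtain i where i: "i < ?k" "u = b i" using b by blast
      show "x = u \<longleftrightarrow> y = u" using eq[of ?k i] i by simp
    next
      fix u w assume "u \<in> B'" "w \<in> B'"
      then obtain i j where i: "i < ?k" "u = b i" "j < ?k" "w = b j" using b by blast
      show "C x u w \<longleftrightarrow> C y u w" using rel[of ?k i j] i by simp
      show "C u x w \<longleftrightarrow> C u y w" using rel[of i ?k j] i by simp
    qed
    have "agree B x y"
    proof (rule agree_on_N[OF B(1) h0(1) _ xy])
      show "sim h0 (inv g)" if "h \<in> N" "sim h (inv g)" for h using h0(2)[OF that(1)] that(2) by blast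
      show "agree ((B \<inter> N) \<union> (\<lambda>b. h0 \<otimes> b) ` (B \<inter> N)) x y" using agB' unfolding B'_def .
    qed
    then show "x \<in> D \<inter> N \<longleftrightarrow> y \<in> D \<inter> N" using D xy N_closed by blast
  qed
  moreover have "N \<noteq> {}" using oneN by blast
  ultimately show ?thesis using determined_mono \<open>card B' \<le> 2 * k\<close> by metis
qed

theorem C_minimal_N: "C_minimal_group TYPE('w) (G\<lparr>carrier := N\<rparr>) C"
  unfolding C_minimal_group_def
proof (rule C_minimal_if_uniformly_determined)
  have univ: "universe MN = N" by (simp add: C_group_structure_def)
  have NG: "N \<subseteq> carrier G" using N_closed by blast
  have oneN: "\<one> \<in> N" using subgroup_N subgroup.one_closed by metis
  show "rel_arity C_group_language C_sym = 3" by (simp add: C_group_language_def)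
  show "fo_structure_of C_group_language MN"
  proof -
    have "xs ! 0 \<otimes> xs ! 1 \<in> N" if "length xs = 2" "set xs \<subseteq> N" for xs
    proof -
      have "xs ! 0 \<in> N" "xs ! 1 \<in> N" using that nth_mem[of 0 xs] nth_mem[of 1 xs] by auto
      then show ?thesis using subgroup_N subgroup.m_closed by metis
    qed
    moreover have "N \<noteq> {}" using oneN by blast
    ultimately show ?thesis
      unfolding fo_structure_of_def C_group_structure_def C_group_language_def by simp
  qed
  have "C_relation_on N C" using C_rel NG unfolding C_relation_on_def by (meson subsetD)
  then show "C_relation_on (universe MN) (\<lambda>x y z. rel_int MN C_sym [x, y, z])"
    by (simp add: C_group_structure_def numeral_2_eq_2)
  fix \<phi> :: "(mult_symbol, C_symbol) fo_formula" assume "wf_formula C_group_language \<phi>"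
  then obtain P where P: "Def P" "\<And>e :: nat \<Rightarrow> 'a. e 1 = g \<Longrightarrow> sat MN (\<lambda>n. e (skip_one n)) \<phi> \<longleftrightarrow> P e"
    using lower_formula by blast
  obtain k where k: "\<forall>e. range e \<subseteq> carrier G \<longrightarrow> det k {x \<in> carrier G. P (e(0 := x))}"
    using uniformly_det[OF P(1)] by (elim exE) (rule that)
  have "determined N (rel_int MN C_sym) (2 * k) (defined_set MN \<epsilon> \<phi>)" if \<epsilon>: "range \<epsilon> \<subseteq> N" for \<epsilon>
  proof -
    define e where "e n = (if n = 1 then g else \<epsilon> (if n = 0 then 0 else n - 1))" for n
    have "range e \<subseteq> carrier G" using \<epsilon> NG by (auto simp: e_def)
    then have d: "det k {x \<in> carrier G. P (e(0 := x))}" using k by blast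
    have "sat MN (\<epsilon>(0 := x)) \<phi> \<longleftrightarrow> P (e(0 := x))" for x
    proof -
      have "\<epsilon>(0 := x) = (\<lambda>n. (e(0 := x)) (skip_one n))" by (auto simp: fun_eq_iff e_def skip_one_def)
      moreover have "(e(0 := x)) 1 = g" by (simp add: e_def)
      ultimately show ?thesis by (metis P(2))
    qed
    then have "defined_set MN \<epsilon> \<phi> = {x \<in> carrier G. P (e(0 := x))} \<inter> N"
      unfolding defined_set_def univ using NG by blast
    then show ?thesis using det_restrict_N[OF d] by simp
  qed
  then show "\<exists>k. \<forall>e. range e \<subseteq> universe MN \<longrightarrow>
      determined (universe MN) (rel_int MN C_sym) k (defined_set MN e \<phi>)"
    unfolding univ by blast
qed

end

section \<open>The three cases\<close>

text \<open>Since \<open>\<one>\<close> has the value \<open>None\<close>, the inequality for the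
  quotient of \<open>\<one>\<close> by \<open>h\<close> bounds the value of \<open>h^-1\<close>
  below by that of \<open>h\<close>.\<close>

lemma (in C_quasi_order) v_type_if_valuation:
  assumes v: "comes_from G qo \<Gamma> le\<Gamma> v" and h: "h \<in> carrier G"
  shows "qo h (inv h)"
proof -
  have *: "qo (inv h) h" if h: "h \<in> carrier G" for h
  proof -
    have "val_le le\<Gamma> (ord.min (val_le le\<Gamma>) (v \<one>) (v h)) (v (\<one> \<otimes> inv h))" "v \<one> = None"
      "qo (inv h) h \<longleftrightarrow> val_le le\<Gamma> (v h) (v (inv h))"
      using v h one_closed inv_closed unfolding comes_from_def valuation_def by blast+
    then show ?thesis using h by (cases "v h") (auto simp: ord.min_def)
  qed
  show ?thesis using *[of "inv h"] h by simp
qed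

lemma (in C_minimal_valued) comes_from_valuation: "comes_from_valuation G qo"
proof -
  define cls where "cls g = {h \<in> carrier G. sim h g}" for g
  \<comment> \<open>The values are the classes of the elements other than \<open>\<one>\<close>, in
    the reversed order.\<close>
  define \<Gamma> where "\<Gamma> = cls ` (carrier G - {\<one>})"
  define le\<Gamma> where "le\<Gamma> S T \<longleftrightarrow> (\<exists>x\<in>S. \<exists>y\<in>T. qo y x)" for S T
  define v where "v g = (if g = \<one> then None else Some (cls g))" for g
  have le\<Gamma>: "le\<Gamma> (cls g) (cls h) \<longleftrightarrow> qo h g" if gh: "g \<in> carrier G" "h \<in> carrier G" for g h
  proof
    assume "le\<Gamma> (cls g) (cls h)"
    then obtain x y where xy: "x \<in> carrier G" "sim x g" "y \<in> carrier G" "sim y h" "qo y x"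
      unfolding le\<Gamma>_def cls_def by blast
    have "qo h x" using qo_trans[of h y x] xy gh by blast
    then show "qo h g" using qo_trans[of h x g] xy gh by blast
  next
    assume "qo h g"
    then show "le\<Gamma> (cls g) (cls h)" unfolding le\<Gamma>_def cls_def using gh qo_refl by blast
  qed
  have cls_eq: "cls g = cls h" if "qo h g" "qo g h" "g \<in> carrier G" "h \<in> carrier G" for g h
    using that qo_trans[of _ g h] qo_trans[of _ h g] qo_trans[of g h] qo_trans[of h g]
    unfolding cls_def by blast
  have val: "val_le le\<Gamma> (v g) (v h) \<longleftrightarrow> qo h g" if gh: "g \<in> carrier G" "h \<in> carrier G" for g h
    using le\<Gamma>[OF gh] gh qo_one_iff by (auto simp: v_def)
  have "total_order \<Gamma> le\<Gamma>"
    unfolding total_order_def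
  proof (intro conjI)
    show "reflp_on \<Gamma> le\<Gamma>" unfolding reflp_on_def \<Gamma>_def by (auto simp: le\<Gamma>)
    show "antisymp_on \<Gamma> le\<Gamma>"
    proof (rule antisymp_onI)
      fix S T assume "S \<in> \<Gamma>" "T \<in> \<Gamma>" and ST: "le\<Gamma> S T" "le\<Gamma> T S"
      then obtain x y where xy: "x \<in> carrier G" "S = cls x" "y \<in> carrier G" "T = cls y"
        unfolding \<Gamma>_def by blast
      then show "S = T" using ST le\<Gamma> cls_eq[of y x] by simp
    qed
    show "transp_on \<Gamma> le\<Gamma>"
    proof (rule transp_onI)
      fix R S T assume "R \<in> \<Gamma>" "S \<in> \<Gamma>" "T \<in> \<Gamma>" and RST: "le\<Gamma> R S" "le\<Gamma> S T"
      then obtain x y z where "x \<in> carrier G" "R = cls x" "y \<in> carrier G" "S = cls y" "z \<in> carrier G" "T = cls z"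
        unfolding \<Gamma>_def by blast
      then show "le\<Gamma> R T" using RST le\<Gamma> qo_trans[of z y x] by simp
    qed
    show "totalp_on \<Gamma> le\<Gamma>" unfolding totalp_on_def \<Gamma>_def using qo_total by (auto simp: le\<Gamma>)
  qed
  moreover have "v \<in> carrier G \<rightarrow> insert None (Some ` \<Gamma>)" by (auto simp: v_def \<Gamma>_def)
  moreover have "val_le le\<Gamma> (ord.min (val_le le\<Gamma>) (v g) (v h)) (v (g \<otimes> inv h))"
    if gh: "g \<in> carrier G" "h \<in> carrier G" for g h
  proof (cases "qo h g")
    case True
    then have "qo (g \<otimes> inv h) g" using mult_qo[of g g "inv h"] gh by simp
    then show ?thesis using val gh True by (simp add: ord.min_def)
  next
    case False
    then have "qo g h" using qo_total gh by blast
    then have "qo (g \<otimes> inv h) h" using mult_qo[of g h "inv h"] gh by simp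
    then show ?thesis using val gh False by (simp add: ord.min_def)
  qed
  moreover have "val_le le\<Gamma> (v g) (v h) \<longleftrightarrow> val_le le\<Gamma> (v (conj_by G z g)) (v (conj_by G z h))"
    if "g \<in> carrier G" "h \<in> carrier G" "z \<in> carrier G" for g h z
    using that qo_conj by (simp add: val conj_by_def)
  ultimately have "comes_from G qo \<Gamma> le\<Gamma> v"
    unfolding comes_from_def valuation_def using val by (auto simp: v_def)
  then show ?thesis unfolding comes_from_valuation_def by blast
qed

section \<open>Arbitrary valuations that induce the quasi-order\<close>

locale C_minimal_valuation = C_minimal_valued +
  fixes \<Gamma> :: "'c set" and le\<Gamma> v
  assumes comes_from: "comes_from G qo \<Gamma> le\<Gamma> v"
begin

abbreviation "ge_set \<equiv> val_ge_set G le\<Gamma> v"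
abbreviation "gt_set \<equiv> val_gt_set G le\<Gamma> v"

lemma order: "total_order \<Gamma> le\<Gamma>"
  using comes_from by (simp add: comes_from_def valuation_def)

lemma v_None_iff: "x \<in> carrier G \<Longrightarrow> v x = None \<longleftrightarrow> x = \<one>"
  using comes_from by (simp add: comes_from_def valuation_def)

lemma v_iff: "x \<in> carrier G \<Longrightarrow> y \<in> carrier G \<Longrightarrow> val_le le\<Gamma> (v x) (v y) \<longleftrightarrow> qo y x"
  using comes_from by (simp add: comes_from_def)

lemma val_le_antisym:
  assumes "val_le le\<Gamma> \<alpha> \<beta>" "val_le le\<Gamma> \<beta> \<alpha>" "\<alpha> \<in> insert None (Some ` \<Gamma>)" "\<beta> \<in> insert None (Some ` \<Gamma>)"
  shows "\<alpha> = \<beta>"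
  using assms order by (auto simp: total_order_def dest: antisymp_onD)

lemma val_le_trans:
  assumes "val_le le\<Gamma> \<alpha> \<beta>" "val_le le\<Gamma> \<beta> \<gamma>" "\<alpha> \<in> insert None (Some ` \<Gamma>)" "\<beta> \<in> insert None (Some ` \<Gamma>)"
    "\<gamma> \<in> insert None (Some ` \<Gamma>)"
  shows "val_le le\<Gamma> \<alpha> \<gamma>"
  using assms order by (cases \<gamma>) (auto simp: total_order_def dest: transp_onD)

lemma v_in: "x \<in> carrier G \<Longrightarrow> v x \<in> insert None (Some ` \<Gamma>)"
  using comes_from funcset_mem[of v "carrier G"] unfolding comes_from_def valuation_def by blast

lemma v_eq_iff: "x \<in> carrier G \<Longrightarrow> y \<in> carrier G \<Longrightarrow> v x = v y \<longleftrightarrow> sim x y"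
  using v_iff[of x y] v_iff[of y x] val_le_antisym[OF _ _ v_in v_in, of x y] v_iff[of x x] qo_refl by metis

lemma normal_ge_gt:
  assumes \<gamma>: "\<gamma> \<in> \<Gamma>"
  shows "ge_set \<gamma> \<lhd> G" "gt_set \<gamma> \<lhd> G"
proof -
  have one: "v \<one> = None" using v_None_iff by simp
  have \<gamma>': "Some \<gamma> \<in> insert None (Some ` \<Gamma>)" using \<gamma> by blast
  have ge: "val_le le\<Gamma> (Some \<gamma>) (v y)"
    if "val_le le\<Gamma> (Some \<gamma>) (v x)" "x \<in> carrier G" "y \<in> carrier G" "qo y x" for x y
    using val_le_trans[OF that(1) _ \<gamma>' v_in v_in] v_iff that by blast
  show "ge_set \<gamma> \<lhd> G"
    by (rule normal_down_closed) (auto simp: val_ge_set_def one intro: ge)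
  have "v y \<noteq> Some \<gamma>"
    if "val_le le\<Gamma> (Some \<gamma>) (v x)" "v x \<noteq> Some \<gamma>" "x \<in> carrier G" "y \<in> carrier G" "qo y x" for x y
  proof
    assume "v y = Some \<gamma>"
    then have "val_le le\<Gamma> (v x) (Some \<gamma>)" using v_iff[of x y] that by simp
    then show False using val_le_antisym[OF _ that(1) v_in \<gamma>'] that by blast
  qed
  then show "gt_set \<gamma> \<lhd> G"
    by (intro normal_down_closed) (auto simp: val_gt_set_def one intro: ge)
qed

lemma sets_of_value:
  assumes "g \<in> carrier G" "v g = Some \<gamma>"
  shows "ge_set \<gamma> = ball g" "gt_set \<gamma> = open_ball g"
  using assms v_iff[of g] v_eq_iff[of _ g] qo_total[of _ g]
  unfolding val_ge_set_def val_gt_set_def ball_def open_ball_def by (auto simp flip: assms(2))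

text \<open>An element of \<open>\<Gamma>\<close> need not be a value of \<open>v\<close>. If it is
  not, the two subgroups coincide and the quotient is trivial; otherwise they are the balls of an
  element with that value.\<close>

lemma val_quotient_cases:
  assumes \<gamma>: "\<gamma> \<in> \<Gamma>"
  obtains (attained) g where "g \<in> carrier G" "g \<noteq> \<one>" "v g = Some \<gamma>" "val_quotient G le\<Gamma> v \<gamma> = quot g" "ge_set \<gamma> = ball g"
  | (trivial) "comm_group (val_quotient G le\<Gamma> v \<gamma>)" "finite (carrier (val_quotient G le\<Gamma> v \<gamma>))"
proof (cases "\<exists>g\<in>carrier G. v g = Some \<gamma>")
  case True
  then obtain g where g: "g \<in> carrier G" "v g = Some \<gamma>" by blast
  then have "g \<noteq> \<one>" using v_None_iff[of g] by auto
  then show ?thesis using attained[OF g(1) _ g(2)] sets_of_value[OF g] by (simp add: val_quotient_def)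
next
  case False
  then have eq: "gt_set \<gamma> = ge_set \<gamma>" by (auto simp: val_ge_set_def val_gt_set_def)
  interpret subquotient G "ge_set \<gamma>" "ge_set \<gamma>"
    using normal_ge_gt(1)[OF \<gamma>]
    by (intro subquotient.intro subquotient_axioms.intro is_group normal_imp_subgroup) auto
  have "subgroup (ge_set \<gamma>) G" using normal_ge_gt(1)[OF \<gamma>] by (rule normal_imp_subgroup)
  then have "ge_set \<gamma> #> x = ge_set \<gamma>" if "x \<in> ge_set \<gamma>" for x
    using coset_join2[of x "ge_set \<gamma>"] that S_closed by blast
  then have Q: "carrier Q \<subseteq> {ge_set \<gamma>}" unfolding carrier_Q by auto
  interpret Q: group Q by (rule group_Q)
  have "comm_group Q"
  proof (rule Q.group_comm_groupI)
    fix X Y assume "X \<in> carrier Q" "Y \<in> carrier Q"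
    then have "X = Y" using Q by blast
    then show "X \<otimes>\<^bsub>Q\<^esub> Y = Y \<otimes>\<^bsub>Q\<^esub> X" by simp
  qed
  moreover have "finite (carrier Q)" using Q finite_subset by blast
  ultimately show ?thesis using trivial by (simp add: val_quotient_def eq)
qed

lemma finite_nonabelian: "finite {\<gamma> \<in> \<Gamma>. \<not> comm_group (val_quotient G le\<Gamma> v \<gamma>)}" (is "finite ?A")
proof (rule ccontr)
  assume inf: "infinite ?A"
  obtain n where n: "\<And>F. levels F \<Longrightarrow> (\<And>g. g \<in> F \<Longrightarrow> \<not> comm_group (quot g)) \<Longrightarrow> card F \<le> n"
    using nonabelian_levels_bounded by (elim exE) (rule that, blast)
  obtain A where A: "finite A" "card A = Suc n" "A \<subseteq> ?A"
    using infinite_arbitrarily_large[OF inf] by blast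
  have "\<exists>g. g \<in> carrier G \<and> g \<noteq> \<one> \<and> v g = Some \<gamma> \<and> \<not> comm_group (quot g)" if "\<gamma> \<in> A" for \<gamma>
  proof -
    have \<gamma>: "\<gamma> \<in> \<Gamma>" "\<not> comm_group (val_quotient G le\<Gamma> v \<gamma>)" using A(3) that by auto
    from \<gamma>(1) show ?thesis by (cases rule: val_quotient_cases) (use \<gamma>(2) in auto)
  qed
  then obtain r where r: "\<And>\<gamma>. \<gamma> \<in> A \<Longrightarrow> r \<gamma> \<in> carrier G \<and> r \<gamma> \<noteq> \<one> \<and> v (r \<gamma>) = Some \<gamma> \<and> \<not> comm_group (quot (r \<gamma>))"
    by metis
  have "levels (r ` A)"
    unfolding levels_def
  proof (intro conjI ballI impI)
    show "finite (r ` A)" using A(1) by simp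
    show "r ` A \<subseteq> carrier G - {\<one>}" using r by auto
    fix x y assume "x \<in> r ` A" "y \<in> r ` A" and ne: "x \<noteq> y"
    then obtain a b where ab: "a \<in> A" "x = r a" "b \<in> A" "y = r b" by blast
    show "\<not> sim x y"
    proof
      assume "sim x y"
      moreover have "x \<in> carrier G" "y \<in> carrier G" using ab r by auto
      ultimately have "v x = v y" using v_eq_iff by blast
      then have "a = b" using r[OF ab(1)] r[OF ab(3)] ab(2,4) by simp
      then show False using ne ab(2,4) by simp
    qed
  qed
  moreover have "card (r ` A) = card A"
  proof (rule card_image, rule inj_onI)
    fix a b assume "a \<in> A" "b \<in> A" "r a = r b"
    then show "a = b" using r by (metis option.inject)
  qed
  ultimately show False using n[of "r ` A"] r A(2) by auto
qed

lemma infinite_val_quotient: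
  assumes \<gamma>: "\<gamma> \<in> \<Gamma>" and inf: "infinite (carrier (val_quotient G le\<Gamma> v \<gamma>))"
  shows "(elementary_abelian_group (val_quotient G le\<Gamma> v \<gamma>) \<or>
      comm_group (val_quotient G le\<Gamma> v \<gamma>) \<and> divisible_group (val_quotient G le\<Gamma> v \<gamma>)) \<and>
    (divisible_group (val_quotient G le\<Gamma> v \<gamma>) \<longrightarrow> comm_group (G\<lparr>carrier := ge_set \<gamma>\<rparr>))"
  using \<gamma>
proof (cases rule: val_quotient_cases)
  case (attained g)
  have inf': "infinite (carrier (quot g))" using inf attained by simp
  have "comm_group (G\<lparr>carrier := ball g\<rparr>)" if "divisible_group (quot g)"
  proof -
    have "group (G\<lparr>carrier := ball g\<rparr>)"
      using normal_imp_subgroup[OF normal_ball[OF attained(1)]] subgroup.subgroup_is_group[OF _ is_group] by blast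
    then show ?thesis
      using ball_abelian_if_divisible[OF attained(1,2) inf' that] by (intro group.group_comm_groupI) auto
  qed
  then show ?thesis using infinite_quotient[OF attained(1,2) inf'] attained by auto
qed (use inf in blast)

end

text \<open>The neutral element counts as o-type, so it has to be ruled out as a witness of a
  maximal component; its component lies below every other one.\<close>

lemma (in C_minimal_quasi_order) one_not_maximal: "\<not> maximal_component G qo \<one>"
proof
  assume max: "maximal_component G qo \<one>"
  obtain h where h: "h \<in> carrier G" "h \<noteq> \<one>"
    using dense one_closed unfolding dense_C_relation_on_def by metis
  have "type_component G qo h \<subseteq> carrier G"
    using h by (auto simp: type_component_def T_plus_def SET_INV_def)
  then have "component_le qo (type_component G qo \<one>) (type_component G qo h)"
    by (auto simp: component_le_def type_component_def[of G qo \<one>])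
  then have "type_component G qo h = type_component G qo \<one>"
    using max h unfolding maximal_component_def by blast
  then show False using self_in_component[OF h(1)] h(2) by (simp add: type_component_def[of G qo \<one>])
qed

lemma (in C_minimal_top) case_ii:
  assumes "lower_group G qo g0 = N" "upper_group G qo g0 = carrier G"
  shows "C_minimal_group TYPE('w) (lower_subgroup G qo g0) C"
    and "o_minimal_component_quotient G qo g0"
proof -
  show "C_minimal_group TYPE('w) (lower_subgroup G qo g0) C"
    using C_minimal_N by (simp add: lower_subgroup_def assms)
  have Q: "component_quotient G qo g0 = Q" by (simp add: component_quotient_def assms)
  have "component_ordering G qo g0 quot_less"
    unfolding component_ordering_def Q assms using group_ordering_quot_less quotient_C_relation by blast
  then show "o_minimal_component_quotient G qo g0"
    unfolding o_minimal_component_quotient_def Q using o_minimal_quotient by blast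
qed

lemma (in C_minimal_quasi_order) maximal_o_component:
  assumes g0: "g0 \<in> carrier G" "o_type G qo g0" and max: "maximal_component G qo g0"
  shows "comm_group G" "divisible_group G"
    "C_minimal_group TYPE('w) (lower_subgroup G qo g0) C" "o_minimal_component_quotient G qo g0"
proof -
  have ne: "g0 \<noteq> \<one>" using max one_not_maximal by blast
  then have "\<not> sim g0 (inv g0)" using g0(2) by (simp add: o_type_iff)
  \<comment> \<open>Passing from an \<open>o\<^sup>-\<close>-type element to its inverse changes
    neither the type-component nor the lower group.\<close>
  define g where "g = (if lt (inv g0) g0 then g0 else inv g0)"
  have gG: "g \<in> carrier G" and gp: "lt (inv g) g" using g0 \<open>\<not> sim g0 (inv g0)\<close> by (auto simp: g_def)
  have T: "type_component G qo g0 = type_component G qo g"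
    using component_o_plus[OF gG gp] component_o_minus[OF g0(1)] g0(1) gp by (auto simp: g_def)
  have "maximal_component G qo g" using max unfolding maximal_component_def T .
  then interpret C_minimal_top G qo C g
    using maximal_imp_not_above[OF gG gp] gG gp by unfold_locales auto
  have low: "lower_group G qo g0 = N"
    using ne gp \<open>\<not> sim g0 (inv g0)\<close> g0(1)
    by (auto simp: lower_group_def v_type_iff o_plus_iff lower_def g_def)
  have up: "upper_group G qo g0 = carrier G"
  proof -
    have "upper_group G qo g0 = N \<union> (Pos \<union> set_inv Pos)"
      unfolding upper_group_def low T component_o_plus[OF gG gp] ..
    moreover have "N \<union> (Pos \<union> set_inv Pos) \<subseteq> carrier G"
      using N_closed Pos_closed by (auto simp: SET_INV_def)
    moreover have "h \<in> N \<union> (Pos \<union> set_inv Pos)" if "h \<in> carrier G" for h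
      using N_cases[OF that] set_inv_positive[OF that] by blast
    ultimately show ?thesis by blast
  qed
  show "comm_group G" "divisible_group G" by (fact comm_group_G divisible_G)+
  show "C_minimal_group TYPE('w) (lower_subgroup G qo g0) C" by (rule case_ii(1)[OF low up])
  show "o_minimal_component_quotient G qo g0" by (rule case_ii(2)[OF low up])
qed

text \<open>The whole group is taken for \<open>H\<close>: it is definable, and its quotient is
  trivial, of exponent 1.\<close>

lemma (in C_minimal_quasi_order) definable_finite_index:
  "\<exists>H. H \<lhd> G \<and> definable_in_C_group G C H \<and> finite_exponent (G Mod H)"
proof (intro exI conjI)
  show n: "carrier G \<lhd> G" by (rule normal_invI[OF subgroup_self]) simp
  have "Def (\<lambda>e. e 0 = e 0)" by (intro Def_intros)
  from definable_Def[OF this, of "\<lambda>_. \<one>"] show "definable_in_C_group G C (carrier G)" by auto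
  have "X [^]\<^bsub>G Mod carrier G\<^esub> (1::nat) = \<one>\<^bsub>G Mod carrier G\<^esub>" if "X \<in> carrier (G Mod carrier G)" for X
  proof -
    interpret Q: group "G Mod carrier G" using n by (rule normal.factorgroup_is_group)
    have "X = carrier G" using that one_closed
      by (auto simp: FactGroup_def RCOSETS_def subgroup_self coset_join2 split: if_splits)
    then show ?thesis using that Q.l_one[of X] by simp
  qed
  then show "finite_exponent (G Mod carrier G)" unfolding finite_exponent_def by blast
qed

theorem theorem4p5:
  fixes G :: "('a, 'm) monoid_scheme"
    and qo :: "'a \<Rightarrow> 'a \<Rightarrow> bool"
    and C :: "'a \<Rightarrow> 'a \<Rightarrow> 'a \<Rightarrow> bool"
  assumes "C_quasi_ordered_group G qo"
    and "associated_C_relation G qo C"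
    and "dense_C_relation_on (carrier G) C"
    and "C_minimal_group TYPE('a) G C"
  shows
    "\<comment> \<open>exactly one of the three cases holds\<close>
     (comes_from_valuation G qo \<or> o_component_maximal G qo \<or> o_component_never_maximal G qo) \<and>
     \<not> (comes_from_valuation G qo \<and> o_component_maximal G qo) \<and>
     \<not> (comes_from_valuation G qo \<and> o_component_never_maximal G qo) \<and>
     \<not> (o_component_maximal G qo \<and> o_component_never_maximal G qo) \<and>
     \<comment> \<open>case (i)\<close>
     (\<forall>(\<Gamma> :: 'c set) le\<Gamma> v. comes_from G qo \<Gamma> le\<Gamma> v \<longrightarrow>
        (\<forall>\<gamma>\<in>\<Gamma>. val_gt_set G le\<Gamma> v \<gamma> \<lhd> G \<and> val_ge_set G le\<Gamma> v \<gamma> \<lhd> G) \<and>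
        finite {\<gamma> \<in> \<Gamma>. \<not> comm_group (val_quotient G le\<Gamma> v \<gamma>)} \<and>
        (\<forall>\<gamma>\<in>\<Gamma>. infinite (carrier (val_quotient G le\<Gamma> v \<gamma>)) \<longrightarrow>
           (elementary_abelian_group (val_quotient G le\<Gamma> v \<gamma>) \<or>
            comm_group (val_quotient G le\<Gamma> v \<gamma>) \<and> divisible_group (val_quotient G le\<Gamma> v \<gamma>)) \<and>
           (divisible_group (val_quotient G le\<Gamma> v \<gamma>) \<longrightarrow>
            comm_group (G\<lparr>carrier := val_ge_set G le\<Gamma> v \<gamma>\<rparr>))) \<and>
        (\<exists>H. H \<lhd> G \<and> definable_in_C_group G C H \<and> comm_group (G\<lparr>carrier := H\<rparr>) \<and>
           finite_exponent (G Mod H))) \<and>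
     \<comment> \<open>case (ii)\<close>
     (\<forall>g\<in>carrier G. o_type G qo g \<and> maximal_component G qo g \<longrightarrow>
        comm_group G \<and> divisible_group G \<and>
        C_minimal_group TYPE('w) (lower_subgroup G qo g) C \<and>
        o_minimal_component_quotient G qo g) \<and>
     \<comment> \<open>case (iii)\<close>
     (o_component_never_maximal G qo \<longrightarrow>
        (\<exists>g\<in>carrier G.
           (\<forall>h\<in>carrier G. qo g h \<longrightarrow> v_type G qo h) \<and>
           (\<exists>H. H \<lhd> G \<and> definable_in_C_group G C H \<and> finite_exponent (G Mod H))))"
proof -
  interpret C_minimal_quasi_order G qo C
    using assms unfolding C_quasi_ordered_group_def
    by (intro C_minimal_quasi_order.intro C_quasi_order.intro C_quasi_order_axioms.intro
        C_minimal_quasi_order_axioms.intro) auto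
  have valued: "C_minimal_valued G qo C" if "\<And>x. x \<in> carrier G \<Longrightarrow> qo x (inv\<^bsub>G\<^esub> x)"
    by (intro C_minimal_valued.intro C_minimal_valued_axioms.intro C_minimal_quasi_order_axioms that)
  have v_type: "qo x (inv\<^bsub>G\<^esub> x)" if "comes_from_valuation G qo" "x \<in> carrier G" for x
    using that v_type_if_valuation unfolding comes_from_valuation_def by blast
  \<comment> \<open>Under a valuation only \<open>\<one>\<close> is of o-type, and its component is
    not maximal; hence case (i) excludes the other two.\<close>
  have o_type: "g = \<one>\<^bsub>G\<^esub>" if "comes_from_valuation G qo" "g \<in> carrier G" "o_type G qo g" for g
    using v_type[OF that(1), of g] v_type[OF that(1), of "inv\<^bsub>G\<^esub> g"] that by (simp add: o_type_iff)
  have cases: "comes_from_valuation G qo \<or> o_component_maximal G qo \<or> o_component_never_maximal G qo"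
  proof (cases "\<forall>x\<in>carrier G. qo x (inv\<^bsub>G\<^esub> x)")
    case True
    then show ?thesis using C_minimal_valued.comes_from_valuation[OF valued] by blast
  next
    case False
    then obtain x where x: "x \<in> carrier G" "\<not> qo x (inv\<^bsub>G\<^esub> x)" by blast
    then have "o_type G qo x" "x \<noteq> \<one>\<^bsub>G\<^esub>" by (auto simp: o_type_iff)
    then show ?thesis using x(1) unfolding o_component_maximal_def o_component_never_maximal_def by blast
  qed
  have excl: "\<not> (comes_from_valuation G qo \<and> o_component_maximal G qo)"
    "\<not> (comes_from_valuation G qo \<and> o_component_never_maximal G qo)"
    "\<not> (o_component_maximal G qo \<and> o_component_never_maximal G qo)"
    using o_type one_not_maximal unfolding o_component_maximal_def o_component_never_maximal_def by blast+
  have i: "(\<forall>\<gamma>\<in>\<Gamma>. val_gt_set G le\<Gamma> v \<gamma> \<lhd> G \<and> val_ge_set G le\<Gamma> v \<gamma> \<lhd> G) \<and>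
        finite {\<gamma> \<in> \<Gamma>. \<not> comm_group (val_quotient G le\<Gamma> v \<gamma>)} \<and>
        (\<forall>\<gamma>\<in>\<Gamma>. infinite (carrier (val_quotient G le\<Gamma> v \<gamma>)) \<longrightarrow>
           (elementary_abelian_group (val_quotient G le\<Gamma> v \<gamma>) \<or>
            comm_group (val_quotient G le\<Gamma> v \<gamma>) \<and> divisible_group (val_quotient G le\<Gamma> v \<gamma>)) \<and>
           (divisible_group (val_quotient G le\<Gamma> v \<gamma>) \<longrightarrow>
            comm_group (G\<lparr>carrier := val_ge_set G le\<Gamma> v \<gamma>\<rparr>))) \<and>
        (\<exists>H. H \<lhd> G \<and> definable_in_C_group G C H \<and> comm_group (G\<lparr>carrier := H\<rparr>) \<and>
           finite_exponent (G Mod H))"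
    if v: "comes_from G qo \<Gamma> le\<Gamma> v" for \<Gamma> :: "'c set" and le\<Gamma> v
  proof -
    interpret V: C_minimal_valuation G qo C \<Gamma> le\<Gamma> v
      using v valued[OF v_type_if_valuation[OF v]]
      by (intro C_minimal_valuation.intro C_minimal_valuation_axioms.intro)
    show ?thesis
      using V.normal_ge_gt V.finite_nonabelian V.infinite_val_quotient V.abelian_normal_subgroup by blast
  qed
  have ii: "comm_group G \<and> divisible_group G \<and>
        C_minimal_group TYPE('w) (lower_subgroup G qo g) C \<and> o_minimal_component_quotient G qo g"
    if "g \<in> carrier G" "o_type G qo g \<and> maximal_component G qo g" for g
    using maximal_o_component that by blast
  have iii: "\<exists>g\<in>carrier G. (\<forall>h\<in>carrier G. qo g h \<longrightarrow> v_type G qo h) \<and>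
           (\<exists>H. H \<lhd> G \<and> definable_in_C_group G C H \<and> finite_exponent (G Mod H))"
    if "o_component_never_maximal G qo"
  proof -
    have "\<exists>g\<in>carrier G. \<forall>h\<in>carrier G. qo g h \<longrightarrow> v_type G qo h"
      using v_types_cofinal that unfolding o_component_never_maximal_def by blast
    then show ?thesis using definable_finite_index by blast
  qed
  show ?thesis
    apply (rule conjI[OF cases conjI[OF excl(1) conjI[OF excl(2) conjI[OF excl(3) conjI]]]])
     apply (intro allI impI)
     apply (rule i, assumption)
    apply (rule conjI)
     apply (intro ballI impI)
     apply (rule ii, assumption, assumption)
    apply (rule impI)
    apply (rule iii, assumption)
    done
qed

end
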